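(* Let $(R,\mathfrak{m})$ be a Noetherian local ring and let $M$ be a finitely generated $R$-module. Suppose that $\operatorname{ann}(x)\,\mathfrak{m}=\mathfrak{m}^{2}$ for all $x\in\mathfrak{m}\setminus\mathfrak{m}^{2}$. Then the following hold. (i) $M$ is a Koszul $R$-module if there exists $x\in\mathfrak{m}\setminus\mathfrak{m}^{2}$ such that $\operatorname{ann}(x)M=0$. In particular, $R$ is a Koszul ring. (ii) If $x_{1},\dots,x_{s}$ are in $\mathfrak{m}\setminus\mathfrak{m}^{2}$, then $(x_{1},\dots,x_{s})M$ is a Koszul $R$-module. (iii) $\operatorname{reg}_{R}(M)\leq 1$. (iv) For every ideal $I\subseteq\mathfrak{m}$ the quotient ring $R/I$ is a Koszul ring.
   Context: All rings are commutative Noetherian and all modules are finitely generated. Here $\operatorname{ann}(x)=\{r\in R: rx=0\}$, and $k=R/\mathfrak{m}$. Associated graded objects: for a local ring $(R,\mathfrak{m},k)$ and an $R$-module $M$, $R^{g}=\bigoplus_{i\ge 0}\mathfrak{m}^{i}/\mathfrak{m}^{i+1}$, a standard graded $k$-algebra, and $M^{g}=\bigoplus_{i\ge 0}\mathfrak{m}^{i}M/\mathfrak{m}^{i+1}M$, a graded $R^{g}$-module. Linear part: a complex of $R$-modules $\mathbf{C}$ with differential $\partial$ is minimal if $\partial_n(C_n)\subseteq\mathfrak{m}C_{n-1}$ for all $n$. For a minimal complex $\mathbf{C}$, define subcomplexes $\mathcal{F}^{i}\mathbf{C}$ ($i\geq 0$) by $(\mathcal{F}^{i}\mathbf{C})_{n}=\mathfrak{m}^{i-n}C_{n}$,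 where $\mathfrak{m}^{j}=R$ for $j\le 0$. The associated graded complex of this filtration is denoted $\operatorname{lin}^{R}(\mathbf{C})$; it is a complex of graded $R^{g}$-modules with $\operatorname{lin}^{R}(\mathbf{C})_n=C_n^{g}(-n)$. Koszul: an $R$-module $M$ with minimal free resolution $\mathbf{F}$ is Koszul if $H_i(\operatorname{lin}^{R}(\mathbf{F}))=0$ for all $i>0$. The local ring $R$ is a Koszul ring if its residue field $k$ is a Koszul $R$-module. Regularity: for a standard graded $k$-algebra $A$ and a finitely generated graded $A$-module $N$, $\operatorname{reg}_A(N)=\sup\{j-i : i\ge 0,\ j\in\mathbb{Z},\ \operatorname{Tor}^{A}_i(N,k)_j\neq 0\}$ (with $\sup\emptyset=-\infty$). For a local ring $R$ and an $R$-module $M$, $\operatorname{reg}_R(M):=\operatorname{reg}_{R^{g}}(M^{g})$. *)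

theory Defs
  imports "HOL-Library.Extended_Real" "HOL-Algebra.Free_Abelian_Groups" "HOL-Algebra.Module"
    "HOL-Algebra.Ideal_Product" "HOL-Algebra.QuotRing" "HOL-Algebra.Ring_Divisibility"
begin

section \<open>Local rings, ideals and modules\<close>

locale noetherian_local_ring = cring R + noetherian_ring R + maximalideal \<mm> R
  for \<mm> and R (structure) +
  assumes maximal_unique: "maximalideal J R \<Longrightarrow> J = \<mm>"

definition annihilator :: "('a, 'r) ring_scheme \<Rightarrow> 'a \<Rightarrow> 'a set" where
  "annihilator R x = {r \<in> carrier R. r \<otimes>\<^bsub>R\<^esub> x = \<zero>\<^bsub>R\<^esub>}"

primrec ideal_pow :: "('a, 'r) ring_scheme \<Rightarrow> 'a set \<Rightarrow> nat \<Rightarrow> 'a set" where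
  "ideal_pow R I 0 = carrier R"
| "ideal_pow R I (Suc n) = ideal_prod R (ideal_pow R I n) I"

text \<open>\<open>ideal_smult M I N\<close> is the submodule \<open>I N\<close> of all finite sums of products \<open>a x\<close>
  (compare \<^const>\<open>ideal_prod\<close>); \<open>I\<close> is meant to be an ideal and \<open>N\<close> a submodule of \<open>M\<close>.\<close>

inductive_set ideal_smult :: "('a, 'b, 's) module_scheme \<Rightarrow> 'a set \<Rightarrow> 'b set \<Rightarrow> 'b set"
  for M and I and N where
  smult: "\<lbrakk>a \<in> I; x \<in> N\<rbrakk> \<Longrightarrow> a \<odot>\<^bsub>M\<^esub> x \<in> ideal_smult M I N"
| sum: "\<lbrakk>x \<in> ideal_smult M I N; y \<in> ideal_smult M I N\<rbrakk> \<Longrightarrow> x \<oplus>\<^bsub>M\<^esub> y \<in> ideal_smult M I N"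

definition fg_module :: "('a, 'r) ring_scheme \<Rightarrow> ('a, 'b, 's) module_scheme \<Rightarrow> bool" where
  "fg_module R M \<longleftrightarrow> module R M \<and>
     (\<exists>X. finite X \<and> X \<subseteq> carrier M \<and> (\<forall>N. submodule N R M \<and> X \<subseteq> N \<longrightarrow> N = carrier M))"

definition module_homs ::
  "('a, 'r) ring_scheme \<Rightarrow> ('a, 'b, 's) module_scheme \<Rightarrow> ('a, 'c, 't) module_scheme \<Rightarrow> ('b \<Rightarrow> 'c) set"
where
  "module_homs R M N = {h \<in> carrier M \<rightarrow> carrier N.
     (\<forall>x\<in>carrier M. \<forall>y\<in>carrier M. h (x \<oplus>\<^bsub>M\<^esub> y) = h x \<oplus>\<^bsub>N\<^esub> h y) \<and>
     (\<forall>a\<in>carrier R. \<forall>x\<in>carrier M. h (a \<odot>\<^bsub>M\<^esub> x) = a \<odot>\<^bsub>N\<^esub> h x)}"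

text \<open>The type \<^typ>\<open>('a, 'b) module\<close> extends that of rings, so a module also has the fields
  \<^const>\<open>monoid.mult\<close> and \<^const>\<open>monoid.one\<close>. They play no role for modules and are left \<open>undefined\<close> in
  the constructions below.\<close>

definition self_module :: "('a, 'r) ring_scheme \<Rightarrow> ('a, 'a) module" where
  "self_module R = \<lparr>carrier = carrier R, monoid.mult = monoid.mult R, monoid.one = monoid.one R,
     ring.zero = ring.zero R, ring.add = ring.add R, smult = monoid.mult R\<rparr>"

definition module_quot :: "('a, 'b, 's) module_scheme \<Rightarrow> 'b set \<Rightarrow> ('a, 'b set) module" where
  "module_quot M N = \<lparr>carrier = a_rcosets\<^bsub>M\<^esub> N, monoid.mult = undefined, monoid.one = undefined,
     ring.zero = N, ring.add = set_add M, smult = (\<lambda>a X. \<Union>x\<in>X. N +>\<^bsub>M\<^esub> (a \<odot>\<^bsub>M\<^esub> x))\<rparr>"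

text \<open>The free module \<open>R\<^sup>b\<close> of rank \<open>b\<close>, with coordinate vectors as elements.\<close>

definition free_module :: "('a, 'r) ring_scheme \<Rightarrow> nat \<Rightarrow> ('a, nat \<Rightarrow> 'a) module" where
  "free_module R b = \<lparr>carrier = {..<b} \<rightarrow>\<^sub>E carrier R, monoid.mult = undefined, monoid.one = undefined,
     ring.zero = (\<lambda>l\<in>{..<b}. \<zero>\<^bsub>R\<^esub>), ring.add = (\<lambda>u v. \<lambda>l\<in>{..<b}. u l \<oplus>\<^bsub>R\<^esub> v l),
     smult = (\<lambda>a u. \<lambda>l\<in>{..<b}. a \<otimes>\<^bsub>R\<^esub> u l)\<rparr>"

definition residue_field_module :: "('a, 'r) ring_scheme \<Rightarrow> 'a set \<Rightarrow> ('a, 'a set) module" where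
  "residue_field_module R \<mm> = module_quot (self_module R) \<mm>"


section \<open>Complexes and free resolutions\<close>

text \<open>Complexes \<open>\<dots> \<rightarrow> C 2 \<rightarrow> C 1 \<rightarrow> C 0 \<rightarrow> 0\<close>, where \<open>d n\<close> is the
  differential \<open>C (n + 1) \<rightarrow> C n\<close>, which is usually denoted \<open>\<partial>\<^sub>n\<^sub>+\<^sub>1\<close>.\<close>

definition chain_complex ::
  "('a, 'r) ring_scheme \<Rightarrow> (nat \<Rightarrow> ('a, 'c, 's) module_scheme) \<Rightarrow> (nat \<Rightarrow> 'c \<Rightarrow> 'c) \<Rightarrow> bool" where
  "chain_complex R C d \<longleftrightarrow>
     (\<forall>n. module R (C n)) \<and> (\<forall>n. d n \<in> module_homs R (C (Suc n)) (C n)) \<and>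
     (\<forall>n. \<forall>x\<in>carrier (C (Suc (Suc n))). d n (d (Suc n) x) = \<zero>\<^bsub>C n\<^esub>)"

definition cycles ::
  "(nat \<Rightarrow> ('a, 'c, 's) module_scheme) \<Rightarrow> (nat \<Rightarrow> 'c \<Rightarrow> 'c) \<Rightarrow> nat \<Rightarrow> 'c set" where
  "cycles C d n = (case n of 0 \<Rightarrow> carrier (C 0)
     | Suc k \<Rightarrow> {x \<in> carrier (C (Suc k)). d k x = \<zero>\<^bsub>C k\<^esub>})"

definition boundaries ::
  "(nat \<Rightarrow> ('a, 'c, 's) module_scheme) \<Rightarrow> (nat \<Rightarrow> 'c \<Rightarrow> 'c) \<Rightarrow> nat \<Rightarrow> 'c set" where
  "boundaries C d n = d n ` carrier (C (Suc n))"

definition homology ::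
  "(nat \<Rightarrow> ('a, 'c, 's) module_scheme) \<Rightarrow> (nat \<Rightarrow> 'c \<Rightarrow> 'c) \<Rightarrow> nat \<Rightarrow> ('a, 'c set) module" where
  "homology C d n = module_quot ((C n)\<lparr>carrier := cycles C d n\<rparr>) (boundaries C d n)"

definition homology_zero ::
  "(nat \<Rightarrow> ('a, 'c, 's) module_scheme) \<Rightarrow> (nat \<Rightarrow> 'c \<Rightarrow> 'c) \<Rightarrow> nat \<Rightarrow> bool" where
  "homology_zero C d n \<longleftrightarrow> carrier (homology C d n) = {\<zero>\<^bsub>homology C d n\<^esub>}"

text \<open>A resolution of \<open>M\<close> by finitely generated free modules \<open>R\<^sup>b\<^sup>(\<^sup>n\<^sup>)\<close> with augmentation
  \<open>\<epsilon>\<close>. Every finitely generated free module is isomorphic to some \<open>R\<^sup>b\<close>, so only these are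
  used.\<close>

definition free_resolution ::
  "('a, 'r) ring_scheme \<Rightarrow> ('a, 'b, 's) module_scheme \<Rightarrow> (nat \<Rightarrow> nat) \<Rightarrow>
   (nat \<Rightarrow> (nat \<Rightarrow> 'a) \<Rightarrow> nat \<Rightarrow> 'a) \<Rightarrow> ((nat \<Rightarrow> 'a) \<Rightarrow> 'b) \<Rightarrow> bool" where
  "free_resolution R M b d \<epsilon> \<longleftrightarrow>
     chain_complex R (\<lambda>n. free_module R (b n)) d \<and>
     (\<forall>n>0. homology_zero (\<lambda>n. free_module R (b n)) d n) \<and>
     \<epsilon> \<in> module_homs R (free_module R (b 0)) M \<and>
     \<epsilon> ` carrier (free_module R (b 0)) = carrier M \<and>
     {x \<in> carrier (free_module R (b 0)). \<epsilon> x = \<zero>\<^bsub>M\<^esub>} = boundaries (\<lambda>n. free_module R (b n)) d 0"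

definition minimal_complex ::
  "'a set \<Rightarrow> (nat \<Rightarrow> ('a, 'c, 's) module_scheme) \<Rightarrow> (nat \<Rightarrow> 'c \<Rightarrow> 'c) \<Rightarrow> bool" where
  "minimal_complex \<mm> C d \<longleftrightarrow>
     (\<forall>n. d n ` carrier (C (Suc n)) \<subseteq> ideal_smult (C n) \<mm> (carrier (C n)))"

definition minimal_free_resolution where
  "minimal_free_resolution R \<mm> M b d \<epsilon> \<longleftrightarrow>
     free_resolution R M b d \<epsilon> \<and> minimal_complex \<mm> (\<lambda>n. free_module R (b n)) d"


section \<open>Associated graded objects\<close>

text \<open>For a descending filtration \<open>\<Phi>\<close> of \<open>M\<close> by submodules, an element \<open>f\<close> of
  \<open>\<Oplus>\<^sub>i \<Phi> i / \<Phi> (i + 1)\<close> is the finitely supported family of its components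
  \<open>f i \<in> \<Phi> i / \<Phi> (i + 1)\<close>. If \<open>\<mm>\<^sup>i \<Phi> j \<subseteq> \<Phi> (i + j)\<close>, the ring \<open>R\<^sup>g\<close>, whose
  elements are such families for \<open>M = R\<close> and \<open>\<Phi> i = \<mm>\<^sup>i\<close>, acts by convolution; the union
  below is the single coset of \<open>a x\<close>, for any representatives \<open>a\<close> of \<open>r i\<close> and \<open>x\<close> of
  \<open>f (n - i)\<close>.\<close>

definition assoc_graded ::
  "('a, 'b, 's) module_scheme \<Rightarrow> (nat \<Rightarrow> 'b set) \<Rightarrow> (nat \<Rightarrow> 'a set, nat \<Rightarrow> 'b set) module" where
  "assoc_graded M \<Phi> =
     \<lparr>carrier = {f. (\<forall>i. f i \<in> (\<lambda>x. \<Phi> (Suc i) +>\<^bsub>M\<^esub> x) ` \<Phi> i) \<and> finite {i. f i \<noteq> \<Phi> (Suc i)}},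
      monoid.mult = undefined, monoid.one = undefined,
      ring.zero = (\<lambda>i. \<Phi> (Suc i)),
      ring.add = (\<lambda>f g i. f i <+>\<^bsub>M\<^esub> g i),
      smult = (\<lambda>r f n. finsum (module_quot M (\<Phi> (Suc n)))
        (\<lambda>i. \<Union>a\<in>r i. \<Union>x\<in>f (n - i). \<Phi> (Suc n) +>\<^bsub>M\<^esub> (a \<odot>\<^bsub>M\<^esub> x)) {..n})\<rparr>"

definition gr_ring :: "('a, 'r) ring_scheme \<Rightarrow> 'a set \<Rightarrow> (nat \<Rightarrow> 'a set) ring" where
  "gr_ring R \<mm> = (let G = assoc_graded (self_module R) (ideal_pow R \<mm>) in
     \<lparr>carrier = carrier G, monoid.mult = smult G,
      monoid.one = (\<lambda>i. if i = 0 then ideal_pow R \<mm> 1 +>\<^bsub>R\<^esub> \<one>\<^bsub>R\<^esub> else ideal_pow R \<mm> (Suc i)),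
      ring.zero = ring.zero G, ring.add = ring.add G\<rparr>)"

definition gr_module ::
  "('a, 'r) ring_scheme \<Rightarrow> 'a set \<Rightarrow> ('a, 'b, 's) module_scheme \<Rightarrow>
   (nat \<Rightarrow> 'a set, nat \<Rightarrow> 'b set) module" where
  "gr_module R \<mm> M = assoc_graded M (\<lambda>i. ideal_smult M (ideal_pow R \<mm> i) (carrier M))"

definition gr_piece :: "(nat \<Rightarrow> 'b set, 's) ring_scheme \<Rightarrow> int \<Rightarrow> (nat \<Rightarrow> 'b set) set" where
  "gr_piece G j = {f \<in> carrier G. \<forall>i. int i \<noteq> j \<longrightarrow> f i = \<zero>\<^bsub>G\<^esub> i}"

text \<open>The filtration \<open>\<F>\<^sup>i\<close> of a minimal complex in homological degree \<open>n\<close>. Truncated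
  subtraction implements the convention \<open>\<mm>\<^sup>j = R\<close> for \<open>j \<le> 0\<close>.\<close>

definition lin_filtration ::
  "('a, 'r) ring_scheme \<Rightarrow> 'a set \<Rightarrow> (nat \<Rightarrow> ('a, 'c, 's) module_scheme) \<Rightarrow> nat \<Rightarrow> nat \<Rightarrow> 'c set" where
  "lin_filtration R \<mm> C n i = ideal_smult (C n) (ideal_pow R \<mm> (i - n)) (carrier (C n))"

definition lin_complex ::
  "('a, 'r) ring_scheme \<Rightarrow> 'a set \<Rightarrow> (nat \<Rightarrow> ('a, 'c, 's) module_scheme) \<Rightarrow>
   nat \<Rightarrow> (nat \<Rightarrow> 'a set, nat \<Rightarrow> 'c set) module" where
  "lin_complex R \<mm> C n = assoc_graded (C n) (lin_filtration R \<mm> C n)"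

definition lin_diff ::
  "('a, 'r) ring_scheme \<Rightarrow> 'a set \<Rightarrow> (nat \<Rightarrow> ('a, 'c, 's) module_scheme) \<Rightarrow> (nat \<Rightarrow> 'c \<Rightarrow> 'c) \<Rightarrow>
   nat \<Rightarrow> (nat \<Rightarrow> 'c set) \<Rightarrow> nat \<Rightarrow> 'c set" where
  "lin_diff R \<mm> C d n f = (\<lambda>i. \<Union>x\<in>f i. lin_filtration R \<mm> C n (Suc i) +>\<^bsub>C n\<^esub> d n x)"


section \<open>Koszul modules and Koszul rings\<close>

text \<open>Minimal free resolutions of finitely generated modules over a Noetherian local ring exist
  and are unique up to isomorphism of complexes, so the choice of resolution is immaterial.\<close>

definition koszul_module ::
  "('a, 'r) ring_scheme \<Rightarrow> 'a set \<Rightarrow> ('a, 'b, 's) module_scheme \<Rightarrow> bool" where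
  "koszul_module R \<mm> M \<longleftrightarrow> (\<exists>b d \<epsilon>. minimal_free_resolution R \<mm> M b d \<epsilon> \<and>
     (\<forall>i>0. homology_zero (lin_complex R \<mm> (\<lambda>n. free_module R (b n)))
              (lin_diff R \<mm> (\<lambda>n. free_module R (b n)) d) i))"

definition koszul_ring :: "('a, 'r) ring_scheme \<Rightarrow> bool" where
  "koszul_ring R \<longleftrightarrow>
     (\<exists>\<mm>. noetherian_local_ring \<mm> R \<and> koszul_module R \<mm> (residue_field_module R \<mm>))"


section \<open>Tensor products\<close>

definition tensor_rel ::
  "('a, 'r) ring_scheme \<Rightarrow> ('a, 'b, 's) module_scheme \<Rightarrow> ('a, 'c, 't) module_scheme \<Rightarrow>
   ('b \<times> 'c \<Rightarrow>\<^sub>0 int) set" where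
  "tensor_rel A M N = generate (free_Abelian_group (carrier M \<times> carrier N))
     ({frag_of (x \<oplus>\<^bsub>M\<^esub> x', y) - frag_of (x, y) - frag_of (x', y) | x x' y.
         x \<in> carrier M \<and> x' \<in> carrier M \<and> y \<in> carrier N}
    \<union> {frag_of (x, y \<oplus>\<^bsub>N\<^esub> y') - frag_of (x, y) - frag_of (x, y') | x y y'.
         x \<in> carrier M \<and> y \<in> carrier N \<and> y' \<in> carrier N}
    \<union> {frag_of (a \<odot>\<^bsub>M\<^esub> x, y) - frag_of (x, a \<odot>\<^bsub>N\<^esub> y) | a x y.
         a \<in> carrier A \<and> x \<in> carrier M \<and> y \<in> carrier N})"

definition tensor_class ::
  "('a, 'r) ring_scheme \<Rightarrow> ('a, 'b, 's) module_scheme \<Rightarrow> ('a, 'c, 't) module_scheme \<Rightarrow>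
   ('b \<times> 'c \<Rightarrow>\<^sub>0 int) \<Rightarrow> ('b \<times> 'c \<Rightarrow>\<^sub>0 int) set" where
  "tensor_class A M N c = tensor_rel A M N #>\<^bsub>free_Abelian_group (carrier M \<times> carrier N)\<^esub> c"

text \<open>The unions are single cosets: the maps \<open>x \<otimes> y \<mapsto> a x \<otimes> y\<close> and
  \<open>x \<otimes> y \<mapsto> h x \<otimes> y\<close> are well-defined.\<close>

definition tensor_product ::
  "('a, 'r) ring_scheme \<Rightarrow> ('a, 'b, 's) module_scheme \<Rightarrow> ('a, 'c, 't) module_scheme \<Rightarrow>
   ('a, ('b \<times> 'c \<Rightarrow>\<^sub>0 int) set) module" where
  "tensor_product A M N =
     (let G = free_Abelian_group (carrier M \<times> carrier N) Mod tensor_rel A M N in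
      \<lparr>carrier = carrier G, monoid.mult = undefined, monoid.one = undefined,
       ring.zero = monoid.one G, ring.add = monoid.mult G,
       smult = (\<lambda>a X. \<Union>c\<in>X. tensor_class A M N
                 (frag_extend (\<lambda>(x, y). frag_of (a \<odot>\<^bsub>M\<^esub> x, y)) c))\<rparr>)"

definition tensor_map ::
  "('a, 'r) ring_scheme \<Rightarrow> ('a, 'b, 's) module_scheme \<Rightarrow> ('a, 'c, 't) module_scheme \<Rightarrow>
   ('d \<Rightarrow> 'b) \<Rightarrow> ('d \<times> 'c \<Rightarrow>\<^sub>0 int) set \<Rightarrow> ('b \<times> 'c \<Rightarrow>\<^sub>0 int) set" where
  "tensor_map A M N h X =
     (\<Union>c\<in>X. tensor_class A M N (frag_extend (\<lambda>(x, y). frag_of (h x, y)) c))"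

text \<open>For gradings \<open>\<M>\<close> of \<open>M\<close> and \<open>\<N>\<close> of \<open>N\<close>, the component of degree \<open>j\<close>.\<close>

definition tensor_piece ::
  "('a, 'r) ring_scheme \<Rightarrow> ('a, 'b, 's) module_scheme \<Rightarrow> (int \<Rightarrow> 'b set) \<Rightarrow>
   ('a, 'c, 't) module_scheme \<Rightarrow> (int \<Rightarrow> 'c set) \<Rightarrow> int \<Rightarrow> ('b \<times> 'c \<Rightarrow>\<^sub>0 int) set set" where
  "tensor_piece A M \<M> N \<N> j = generate (add_monoid (tensor_product A M N))
     {tensor_class A M N (frag_of (x, y)) | x y p q. x \<in> \<M> p \<and> y \<in> \<N> q \<and> p + q = j}"


section \<open>Graded Tor and regularity\<close>

text \<open>A graded ring is a ring \<open>A\<close> together with the family \<open>\<A>\<close> of its homogeneous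
  components, and likewise for graded modules. With the grading below,
  \<^term>\<open>free_module A b\<close> is \<open>\<Oplus>\<^sub>l A(-s l)\<close>, that is, the basis vector with index \<open>l\<close> has
  degree \<open>s l\<close>.\<close>

definition free_piece ::
  "('a, 'r) ring_scheme \<Rightarrow> (int \<Rightarrow> 'a set) \<Rightarrow> nat \<Rightarrow> (nat \<Rightarrow> int) \<Rightarrow> int \<Rightarrow> (nat \<Rightarrow> 'a) set" where
  "free_piece A \<A> b s j = {v \<in> carrier (free_module A b). \<forall>l<b. v l \<in> \<A> (j - s l)}"

definition graded_free_resolution where
  "graded_free_resolution A \<A> N \<N> b s d \<epsilon> \<longleftrightarrow>
     free_resolution A N b d \<epsilon> \<and>
     (\<forall>n j. d n ` free_piece A \<A> (b (Suc n)) (s (Suc n)) j \<subseteq> free_piece A \<A> (b n) (s n) j) \<and>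
     (\<forall>j. \<epsilon> ` free_piece A \<A> (b 0) (s 0) j \<subseteq> \<N> j)"

text \<open>Ranks, degree shifts and differentials of a graded free resolution of \<open>N\<close>. Tor does not
  depend on the choice.\<close>

definition chosen_resolution ::
  "('a, 'r) ring_scheme \<Rightarrow> (int \<Rightarrow> 'a set) \<Rightarrow> ('a, 'b, 's) module_scheme \<Rightarrow> (int \<Rightarrow> 'b set) \<Rightarrow>
   (nat \<Rightarrow> nat) \<times> (nat \<Rightarrow> nat \<Rightarrow> int) \<times> (nat \<Rightarrow> (nat \<Rightarrow> 'a) \<Rightarrow> nat \<Rightarrow> 'a)" where
  "chosen_resolution A \<A> N \<N> =
     (SOME (b, s, d). \<exists>\<epsilon>. graded_free_resolution A \<A> N \<N> b s d \<epsilon>)"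

text \<open>\<open>Tor\<^sub>i(N, L)\<^sub>j\<close> is the set of homology classes of the cycles of degree \<open>j\<close> in
  \<open>F\<^sub>i \<otimes> L\<close>, for a graded free resolution \<open>F\<close> of \<open>N\<close>.\<close>

definition tor ::
  "('a, 'r) ring_scheme \<Rightarrow> (int \<Rightarrow> 'a set) \<Rightarrow> ('a, 'b, 's) module_scheme \<Rightarrow> (int \<Rightarrow> 'b set) \<Rightarrow>
   ('a, 'c, 't) module_scheme \<Rightarrow> nat \<Rightarrow> ('a, ((nat \<Rightarrow> 'a) \<times> 'c \<Rightarrow>\<^sub>0 int) set set) module" where
  "tor A \<A> N \<N> L i = (case chosen_resolution A \<A> N \<N> of (b, s, d) \<Rightarrow>
     homology (\<lambda>n. tensor_product A (free_module A (b n)) L)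
       (\<lambda>n. tensor_map A (free_module A (b n)) L (d n)) i)"

definition tor_piece ::
  "('a, 'r) ring_scheme \<Rightarrow> (int \<Rightarrow> 'a set) \<Rightarrow> ('a, 'b, 's) module_scheme \<Rightarrow> (int \<Rightarrow> 'b set) \<Rightarrow>
   ('a, 'c, 't) module_scheme \<Rightarrow> (int \<Rightarrow> 'c set) \<Rightarrow> nat \<Rightarrow> int \<Rightarrow>
   ((nat \<Rightarrow> 'a) \<times> 'c \<Rightarrow>\<^sub>0 int) set set set" where
  "tor_piece A \<A> N \<N> L \<L> i j = (case chosen_resolution A \<A> N \<N> of (b, s, d) \<Rightarrow>
     (let T = (\<lambda>n. tensor_product A (free_module A (b n)) L);
          \<delta> = (\<lambda>n. tensor_map A (free_module A (b n)) L (d n))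
      in (\<lambda>z. boundaries T \<delta> i +>\<^bsub>T i\<^esub> z) `
           (cycles T \<delta> i \<inter> tensor_piece A (free_module A (b i)) (free_piece A \<A> (b i) (s i)) L \<L> j)))"

text \<open>For a standard graded \<open>k\<close>-algebra \<open>A\<close>, the module \<open>k\<close> is \<open>A / A\<^sub>+\<close>, concentrated in
  degree 0.\<close>

definition irrelevant_ideal :: "('a, 'r) ring_scheme \<Rightarrow> (int \<Rightarrow> 'a set) \<Rightarrow> 'a set" where
  "irrelevant_ideal A \<A> = genideal A (\<Union>i\<in>{0<..}. \<A> i)"

definition graded_residue_field ::
  "('a, 'r) ring_scheme \<Rightarrow> (int \<Rightarrow> 'a set) \<Rightarrow> ('a, 'a set) module" where
  "graded_residue_field A \<A> = module_quot (self_module A) (irrelevant_ideal A \<A>)"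

definition residue_field_piece ::
  "('a, 'r) ring_scheme \<Rightarrow> (int \<Rightarrow> 'a set) \<Rightarrow> int \<Rightarrow> 'a set set" where
  "residue_field_piece A \<A> j =
     (if j = 0 then carrier (graded_residue_field A \<A>) else {\<zero>\<^bsub>graded_residue_field A \<A>\<^esub>})"

text \<open>In \<^typ>\<open>ereal\<close> the supremum of the empty set is \<open>-\<infinity>\<close>.\<close>

definition graded_reg ::
  "('a, 'r) ring_scheme \<Rightarrow> (int \<Rightarrow> 'a set) \<Rightarrow> ('a, 'b, 's) module_scheme \<Rightarrow> (int \<Rightarrow> 'b set) \<Rightarrow> ereal"
where
  "graded_reg A \<A> N \<N> = Sup {ereal (of_int (j - int i)) | i j.
     tor_piece A \<A> N \<N> (graded_residue_field A \<A>) (residue_field_piece A \<A>) i j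
       \<noteq> {\<zero>\<^bsub>tor A \<A> N \<N> (graded_residue_field A \<A>) i\<^esub>}}"

definition reg ::
  "('a, 'r) ring_scheme \<Rightarrow> 'a set \<Rightarrow> ('a, 'b, 's) module_scheme \<Rightarrow> ereal" where
  "reg R \<mm> M = graded_reg (gr_ring R \<mm>) (gr_piece (gr_ring R \<mm>))
     (gr_module R \<mm> M) (gr_piece (gr_module R \<mm> M))"

end

theory Submission
  imports Defs
begin

text \<open>
The hypothesis makes \<open>\<mm>\<^sup>3\<close> vanish: every \<open>x \<in> \<mm> - \<mm>\<^sup>2\<close> kills \<open>ann(x) \<mm> = \<mm>\<^sup>2\<close>, and the
elements of \<open>\<mm> - \<mm>\<^sup>2\<close> generate \<open>\<mm>\<close> (if there are none, \<open>\<mm> = 0\<close> by Nakayama). This is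
\<open>short_ring_if_ann\<close>.

The argument follows generating sequences \<open>g\<^sub>0, \<dots>, g\<^sub>s\<^sub>-\<^sub>1\<close> whose colon ideals
\<open>J\<^sub>i = (g\<^sub>0, \<dots>, g\<^sub>i\<^sub>-\<^sub>1) : g\<^sub>i\<close> satisfy \<open>\<mm>\<^sup>2 \<subseteq> J\<^sub>i \<mm>\<close> with \<open>J\<^sub>i \<subseteq> \<mm>\<close>; these are called good here.
The module of syzygies of a good sequence is again generated by a good sequence
(\<open>syzygies_good\<close>). Indeed it is filtered with quotients \<open>J\<^sub>i\<close>, each \<open>J\<^sub>i\<close> is generated by elements
\<open>y \<in> \<mm> - \<mm>\<^sup>2\<close> that are independent modulo \<open>\<mm>\<^sup>2\<close>, and the colon ideal of a syzygy lifting \<open>y\<close>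
contains \<open>ann(y)\<close>, so that the hypothesis on \<open>ann(y)\<close> gives the required inclusion. Iteration
yields a free resolution, \<open>good_resolution\<close>.

If the first sequence is a minimal system of generators, then the resolution is minimal, and for
each module \<open>\<Omega> \<subseteq> \<mm> F\<close> of syzygies in it the inclusion \<open>\<mm>\<^sup>2 F \<subseteq> \<mm> \<Omega>\<close> holds
(\<open>sq_in_syzygies\<close>). As \<open>\<mm>\<^sup>3 = 0\<close>, this is what exactness of the linear part amounts to
(\<open>koszul_module_if_good\<close>). A minimal system of generators is good as soon as each
generator is killed by an ideal \<open>J\<close> with \<open>\<mm>\<^sup>2 \<subseteq> J \<mm>\<close> (\<open>koszul_if_generated\<close>). In (i) such an
ideal is \<open>ann(x)\<close>, for the residue field it is \<open>\<mm>\<close>, and in (ii) the generator \<open>x\<^sub>j m\<close> is killed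
by \<open>ann(x\<^sub>j)\<close>. Since the hypothesis passes to \<open>R / I\<close>, (iv) follows.

For (iii) the same machinery is run over the associated graded ring, which inherits the hypothesis
(\<open>gr_short_ring\<close>). The associated graded module \<open>N\<close> of \<open>M\<close> is generated in degree \<open>0\<close>, and it has a good
homogeneous generating sequence in degrees \<open>0\<close> and \<open>1\<close>: first generators of \<open>\<mm> N\<close>, then
generators of \<open>N\<close> (\<open>degree_zero_generated_good\<close>). Lifting linear elements \<open>y\<close> raises degrees by
exactly one, so the free module in homological degree \<open>n\<close> has its generators in degrees at most
\<open>n + 1\<close>. This resolution need not be minimal, but it bounds the degrees of Tor, whichever graded
resolution is used to compute it: a comparison map factors the identity, up to homotopy, through it
(\<open>graded_reg_le_one\<close>). To treat both rings at once, the lemmas on good sequences are stated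
for a ring with projections onto homogeneous components; over \<open>R\<close> itself all of them are the
identity.
\<close>

section \<open>Linear combinations and free modules\<close>

text \<open>Sums are written by recursion on the length because the proofs split off the last
generator and extend sequences at the end.\<close>

primrec lincomb :: "('a, 'b, 's) module_scheme \<Rightarrow> (nat \<Rightarrow> 'b) \<Rightarrow> nat \<Rightarrow> (nat \<Rightarrow> 'a) \<Rightarrow> 'b" where
  "lincomb N g 0 c = \<zero>\<^bsub>N\<^esub>"
| "lincomb N g (Suc n) c = lincomb N g n c \<oplus>\<^bsub>N\<^esub> c n \<odot>\<^bsub>N\<^esub> g n"

definition lspan ::
  "('a, 'r) ring_scheme \<Rightarrow> ('a, 'b, 's) module_scheme \<Rightarrow> (nat \<Rightarrow> 'b) \<Rightarrow> nat \<Rightarrow> 'b set" where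
  "lspan R N g s = lincomb N g s ` (UNIV \<rightarrow> carrier R)"

lemma lincomb_cong:
  "\<lbrakk>\<And>l. l < s \<Longrightarrow> g l = g' l; \<And>l. l < s \<Longrightarrow> c l = c' l\<rbrakk> \<Longrightarrow> lincomb N g s c = lincomb N g' s c'"
  by (induction s) auto

context module
begin

lemma lincomb_closed:
  "\<lbrakk>\<And>l. l < s \<Longrightarrow> g l \<in> carrier M; \<And>l. l < s \<Longrightarrow> c l \<in> carrier R\<rbrakk> \<Longrightarrow> lincomb M g s c \<in> carrier M"
  by (induction s) auto

lemma lincomb_add:
  assumes "\<And>l. l < s \<Longrightarrow> g l \<in> carrier M" "\<And>l. l < s \<Longrightarrow> c l \<in> carrier R"
    "\<And>l. l < s \<Longrightarrow> c' l \<in> carrier R"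
  shows "lincomb M g s (\<lambda>l. c l \<oplus> c' l) = lincomb M g s c \<oplus>\<^bsub>M\<^esub> lincomb M g s c'"
  using assms by (induction s) (auto simp: lincomb_closed smult_l_distr M.a_ac)

lemma lincomb_smult:
  assumes "a \<in> carrier R" "\<And>l. l < s \<Longrightarrow> g l \<in> carrier M" "\<And>l. l < s \<Longrightarrow> c l \<in> carrier R"
  shows "lincomb M g s (\<lambda>l. a \<otimes> c l) = a \<odot>\<^bsub>M\<^esub> lincomb M g s c"
  using assms by (induction s) (auto simp: lincomb_closed smult_r_distr smult_assoc1)

lemma lincomb_zero:
  assumes "\<And>l. l < s \<Longrightarrow> g l \<in> carrier M" "\<And>l. l < s \<Longrightarrow> c l = \<zero>"
  shows "lincomb M g s c = \<zero>\<^bsub>M\<^esub>"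
  using assms by (induction s) auto

lemma lincomb_minus:
  assumes "\<And>l. l < s \<Longrightarrow> g l \<in> carrier M" "\<And>l. l < s \<Longrightarrow> c l \<in> carrier R"
  shows "lincomb M g s (\<lambda>l. \<ominus> c l) = \<ominus>\<^bsub>M\<^esub> lincomb M g s c"
proof -
  have "lincomb M g s (\<lambda>l. \<ominus> c l) \<oplus>\<^bsub>M\<^esub> lincomb M g s c = lincomb M g s (\<lambda>l. \<ominus> c l \<oplus> c l)"
    using assms by (simp add: lincomb_add)
  also have "\<dots> = \<zero>\<^bsub>M\<^esub>" using assms by (intro lincomb_zero) (auto simp: R.l_neg)
  finally show ?thesis using assms by (simp add: M.minus_equality lincomb_closed)
qed

lemma lincomb_pad:
  assumes "s \<le> s'" "\<And>l. l < s' \<Longrightarrow> g l \<in> carrier M" "\<And>l. l < s \<Longrightarrow> c l \<in> carrier R"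
    "\<And>l. \<lbrakk>s \<le> l; l < s'\<rbrakk> \<Longrightarrow> c l = \<zero>"
  shows "lincomb M g s' c = lincomb M g s c"
  using assms
proof (induction s')
  case (Suc s')
  then show ?case by (cases "s = Suc s'") (auto simp: lincomb_closed)
qed simp

lemma lincomb_single:
  assumes "i < s" "\<And>l. l < s \<Longrightarrow> g l \<in> carrier M" "a \<in> carrier R"
  shows "lincomb M g s (\<lambda>l. if l = i then a else \<zero>) = a \<odot>\<^bsub>M\<^esub> g i"
  using assms
proof (induction s)
  case (Suc s)
  show ?case
  proof (cases "i = s")
    case True
    have "lincomb M g s (\<lambda>l. if l = i then a else \<zero>) = \<zero>\<^bsub>M\<^esub>"
      using Suc.prems True by (intro lincomb_zero) auto
    then show ?thesis using True Suc.prems by simp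
  qed (use Suc in auto)
qed simp

lemma submodule_lincomb_terms:
  assumes "submodule H R M" "\<And>l. l < s \<Longrightarrow> c l \<odot>\<^bsub>M\<^esub> g l \<in> H"
  shows "lincomb M g s c \<in> H"
proof -
  have "\<zero>\<^bsub>M\<^esub> \<in> H" using subgroup.one_closed[OF submodule.axioms(1)[OF assms(1)]] by simp
  then show ?thesis using assms(2) submoduleE(5)[OF assms(1)] by (induction s) auto
qed

lemma submodule_lincomb:
  assumes "submodule H R M" "\<And>l. l < s \<Longrightarrow> g l \<in> H" "\<And>l. l < s \<Longrightarrow> c l \<in> carrier R"
  shows "lincomb M g s c \<in> H"
  using submoduleE(4)[OF assms(1)] assms by (intro submodule_lincomb_terms) auto

lemma submodule_criterion:
  assumes "H \<subseteq> carrier M" "\<zero>\<^bsub>M\<^esub> \<in> H" "\<And>x y. \<lbrakk>x \<in> H; y \<in> H\<rbrakk> \<Longrightarrow> x \<oplus>\<^bsub>M\<^esub> y \<in> H"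
    "\<And>a x. \<lbrakk>a \<in> carrier R; x \<in> H\<rbrakk> \<Longrightarrow> a \<odot>\<^bsub>M\<^esub> x \<in> H"
  shows "submodule H R M"
proof (rule submoduleI)
  fix x assume x: "x \<in> H"
  then have "\<ominus>\<^bsub>M\<^esub> x = (\<ominus> \<one>) \<odot>\<^bsub>M\<^esub> x" using assms(1) by (subst smult_l_minus) auto
  then show "\<ominus>\<^bsub>M\<^esub> x \<in> H" using x assms(4)[of "\<ominus> \<one>" x] by simp
qed (use assms in auto)

lemma submodule_zero: "submodule H R M \<Longrightarrow> \<zero>\<^bsub>M\<^esub> \<in> H"
  using subgroup.one_closed[OF submodule.axioms(1)] by fastforce

lemma submodule_minus:
  "\<lbrakk>submodule H R M; x \<in> H; y \<in> H\<rbrakk> \<Longrightarrow> x \<ominus>\<^bsub>M\<^esub> y \<in> H"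
  using submoduleE(3,5) by (simp add: a_minus_def)

lemma lspan_submodule:
  assumes "\<And>l. l < s \<Longrightarrow> g l \<in> carrier M"
  shows "submodule (lspan R M g s) R M"
proof (rule submoduleI)
  show "lspan R M g s \<subseteq> carrier M" using assms by (auto simp: lspan_def intro!: lincomb_closed)
  have "lincomb M g s (\<lambda>_. \<zero>) = \<zero>\<^bsub>M\<^esub>" using assms by (intro lincomb_zero) auto
  then show "\<zero>\<^bsub>M\<^esub> \<in> lspan R M g s" by (force simp: lspan_def)
  fix x assume "x \<in> lspan R M g s"
  then obtain c where c: "c \<in> UNIV \<rightarrow> carrier R" "x = lincomb M g s c" by (auto simp: lspan_def)
  have "\<ominus>\<^bsub>M\<^esub> x = lincomb M g s (\<lambda>l. \<ominus> c l)" using c assms by (subst lincomb_minus) auto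
  then show "\<ominus>\<^bsub>M\<^esub> x \<in> lspan R M g s" using c by (auto simp: lspan_def Pi_iff)
  {
    fix y assume "y \<in> lspan R M g s"
    then obtain c' where c': "c' \<in> UNIV \<rightarrow> carrier R" "y = lincomb M g s c'" by (auto simp: lspan_def)
    have "x \<oplus>\<^bsub>M\<^esub> y = lincomb M g s (\<lambda>l. c l \<oplus> c' l)" using c c' assms by (subst lincomb_add) auto
    then show "x \<oplus>\<^bsub>M\<^esub> y \<in> lspan R M g s" using c c' by (auto simp: lspan_def Pi_iff)
  }
  fix a assume a: "a \<in> carrier R"
  have "a \<odot>\<^bsub>M\<^esub> x = lincomb M g s (\<lambda>l. a \<otimes> c l)" using c a assms by (subst lincomb_smult) auto
  then show "a \<odot>\<^bsub>M\<^esub> x \<in> lspan R M g s" using c a by (auto simp: lspan_def Pi_iff)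
qed

lemma lspanI: "(\<And>l. l < s \<Longrightarrow> c l \<in> carrier R) \<Longrightarrow> lincomb M g s c \<in> lspan R M g s"
proof -
  assume "\<And>l. l < s \<Longrightarrow> c l \<in> carrier R"
  then have "(\<lambda>l. if l < s then c l else \<zero>) \<in> UNIV \<rightarrow> carrier R" by auto
  moreover have "lincomb M g s c = lincomb M g s (\<lambda>l. if l < s then c l else \<zero>)"
    by (intro lincomb_cong) auto
  ultimately show ?thesis by (auto simp: lspan_def)
qed

lemma lspanE:
  assumes "x \<in> lspan R M g s"
  obtains c where "\<And>l. c l \<in> carrier R" "x = lincomb M g s c"
proof -
  obtain c where "c \<in> UNIV \<rightarrow> carrier R" "x = lincomb M g s c" using assms by (auto simp: lspan_def)
  then show ?thesis using that[of c] by auto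
qed

lemma lspan_least:
  "\<lbrakk>submodule H R M; \<And>l. l < s \<Longrightarrow> g l \<in> H\<rbrakk> \<Longrightarrow> lspan R M g s \<subseteq> H"
  by (auto simp: lspan_def intro!: submodule_lincomb)

lemma lspan_mem:
  assumes "i < s" "\<And>l. l < s \<Longrightarrow> g l \<in> carrier M"
  shows "g i \<in> lspan R M g s"
proof -
  have "lincomb M g s (\<lambda>l. if l = i then \<one> else \<zero>) = g i"
    using assms by (subst lincomb_single) auto
  then show ?thesis using lspanI[of s "\<lambda>l. if l = i then \<one> else \<zero>" g] by auto
qed

lemma lspan_SucI:
  assumes "x \<in> lspan R M g s" "a \<in> carrier R" 
  shows "x \<oplus>\<^bsub>M\<^esub> a \<odot>\<^bsub>M\<^esub> g s \<in> lspan R M g (Suc s)"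
proof -
  obtain c where c: "\<And>l. c l \<in> carrier R" "x = lincomb M g s c" using assms(1) by (rule lspanE) blast
  have "x \<oplus>\<^bsub>M\<^esub> a \<odot>\<^bsub>M\<^esub> g s = lincomb M g (Suc s) (c(s := a))"
    using c by (simp cong: lincomb_cong)
  also have "\<dots> \<in> lspan R M g (Suc s)" using c assms by (intro lspanI) auto
  finally show ?thesis .
qed

lemma lspan_SucE:
  assumes "x \<in> lspan R M g (Suc s)"
  obtains y a where "y \<in> lspan R M g s" "a \<in> carrier R" "x = y \<oplus>\<^bsub>M\<^esub> a \<odot>\<^bsub>M\<^esub> g s"
proof -
  obtain c where c: "\<And>l. c l \<in> carrier R" "x = lincomb M g (Suc s) c" using assms(1) by (rule lspanE) blast
  then show ?thesis using that[of "lincomb M g s c" "c s"] by (auto intro: lspanI)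
qed

lemma lspan_cong: "(\<And>l. l < s \<Longrightarrow> g l = g' l) \<Longrightarrow> lspan R M g s = lspan R M g' s"
  unfolding lspan_def by (intro image_cong refl lincomb_cong) auto

end

lemma lincomb_hom:
  assumes "module R M" "module R N" "h \<in> module_homs R M N"
    "\<And>l. l < s \<Longrightarrow> g l \<in> carrier M" "\<And>l. l < s \<Longrightarrow> c l \<in> carrier R"
  shows "h (lincomb M g s c) = lincomb N (\<lambda>l. h (g l)) s c"
proof -
  interpret M: module R M by fact
  interpret N: module R N by fact
  have add: "h (x \<oplus>\<^bsub>M\<^esub> y) = h x \<oplus>\<^bsub>N\<^esub> h y" if "x \<in> carrier M" "y \<in> carrier M" for x y
    using assms(3) that by (auto simp: module_homs_def)
  have sm: "h (a \<odot>\<^bsub>M\<^esub> x) = a \<odot>\<^bsub>N\<^esub> h x" if "x \<in> carrier M" "a \<in> carrier R" for x a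
    using assms(3) that by (auto simp: module_homs_def)
  have cl: "h x \<in> carrier N" if "x \<in> carrier M" for x
    using assms(3) that by (auto simp: module_homs_def)
  have "h \<zero>\<^bsub>M\<^esub> = h (\<zero>\<^bsub>R\<^esub> \<odot>\<^bsub>M\<^esub> \<zero>\<^bsub>M\<^esub>)" by simp
  also have "\<dots> = \<zero>\<^bsub>N\<^esub>" by (subst sm) (auto simp: cl)
  finally have z: "h \<zero>\<^bsub>M\<^esub> = \<zero>\<^bsub>N\<^esub>" .
  show ?thesis using assms(4,5)
    by (induction s) (auto simp: z add sm cl M.lincomb_closed)
qed

lemma module_homs_zero:
  assumes "module R M" "module R N" "h \<in> module_homs R M N"
  shows "h \<zero>\<^bsub>M\<^esub> = \<zero>\<^bsub>N\<^esub>"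
  using lincomb_hom[OF assms, of 0] by simp

lemma module_homs_minus:
  assumes "module R M" "module R N" "h \<in> module_homs R M N" "x \<in> carrier M" "y \<in> carrier M"
  shows "h (x \<ominus>\<^bsub>M\<^esub> y) = h x \<ominus>\<^bsub>N\<^esub> h y"
proof -
  interpret M: module R M by fact
  interpret N: module R N by fact
  have cl: "h x \<in> carrier N" "h y \<in> carrier N" "h (\<ominus>\<^bsub>M\<^esub> y) \<in> carrier N" and
    add: "h (x \<ominus>\<^bsub>M\<^esub> y) = h x \<oplus>\<^bsub>N\<^esub> h (\<ominus>\<^bsub>M\<^esub> y)" "h (\<ominus>\<^bsub>M\<^esub> y \<oplus>\<^bsub>M\<^esub> y) = h (\<ominus>\<^bsub>M\<^esub> y) \<oplus>\<^bsub>N\<^esub> h y"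
    using assms by (auto simp: module_homs_def a_minus_def)
  have "h (\<ominus>\<^bsub>M\<^esub> y) \<oplus>\<^bsub>N\<^esub> h y = \<zero>\<^bsub>N\<^esub>"
    using add(2) assms module_homs_zero[OF assms(1-3)] by (simp add: M.M.l_neg)
  then have "h (\<ominus>\<^bsub>M\<^esub> y) = \<ominus>\<^bsub>N\<^esub> h y" using cl by (simp add: N.minus_equality)
  then show ?thesis using add by (simp add: a_minus_def)
qed

lemma free_module_simps:
  "carrier (free_module R b) = {..<b} \<rightarrow>\<^sub>E carrier R"
  "\<zero>\<^bsub>free_module R b\<^esub> = (\<lambda>l\<in>{..<b}. \<zero>\<^bsub>R\<^esub>)"
  "u \<oplus>\<^bsub>free_module R b\<^esub> v = (\<lambda>l\<in>{..<b}. u l \<oplus>\<^bsub>R\<^esub> v l)"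
  "a \<odot>\<^bsub>free_module R b\<^esub> u = (\<lambda>l\<in>{..<b}. a \<otimes>\<^bsub>R\<^esub> u l)"
  by (auto simp: free_module_def)

context cring
begin

lemma self_module_module: "module R (self_module R)"
proof (rule moduleI)
  show "abelian_group (self_module R)"
  proof (rule abelian_groupI)
    fix x assume x: "x \<in> carrier (self_module R)"
    then show "\<exists>y\<in>carrier (self_module R). y \<oplus>\<^bsub>self_module R\<^esub> x = \<zero>\<^bsub>self_module R\<^esub>"
      by (intro bexI[of _ "\<ominus> x"]) (auto simp: self_module_def l_neg)
  qed (auto simp: self_module_def a_ac)
qed (auto simp: self_module_def l_distr r_distr m_assoc cring_axioms)

lemma free_module_module: "module R (free_module R b)"
proof (rule moduleI)
  show "abelian_group (free_module R b)"
  proof (rule abelian_groupI)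
    fix x assume x: "x \<in> carrier (free_module R b)"
    then show "\<exists>y\<in>carrier (free_module R b). y \<oplus>\<^bsub>free_module R b\<^esub> x = \<zero>\<^bsub>free_module R b\<^esub>"
      by (intro bexI[of _ "\<lambda>l\<in>{..<b}. \<ominus> x l"])
         (auto simp: free_module_simps PiE_iff l_neg cong: restrict_cong)
    show "\<zero>\<^bsub>free_module R b\<^esub> \<oplus>\<^bsub>free_module R b\<^esub> x = x"
      using x by (auto simp: free_module_simps PiE_iff extensional_def fun_eq_iff)
  qed (auto simp: free_module_simps PiE_iff a_ac cong: restrict_cong)
  fix x assume "x \<in> carrier (free_module R b)"
  then show "\<one> \<odot>\<^bsub>free_module R b\<^esub> x = x"
    by (auto simp: free_module_simps PiE_iff extensional_def fun_eq_iff)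
qed (auto simp: free_module_simps PiE_iff l_distr r_distr m_assoc cring_axioms cong: restrict_cong)

lemma free_module_nth:
  assumes "\<And>l. l < s \<Longrightarrow> w l \<in> carrier (free_module R b)" "\<And>l. l < s \<Longrightarrow> c l \<in> carrier R" "i < b"
  shows "lincomb (free_module R b) w s c i = lincomb (self_module R) (\<lambda>l. w l i) s c"
  using assms by (induction s) (auto simp: free_module_simps self_module_def)

definition unit_vec :: "nat \<Rightarrow> nat \<Rightarrow> nat \<Rightarrow> 'a" where
  "unit_vec b l = (\<lambda>i\<in>{..<b}. if i = l then \<one> else \<zero>)"

lemma unit_vec_closed: "unit_vec b l \<in> carrier (free_module R b)"
  by (auto simp: unit_vec_def free_module_simps)

lemma lincomb_unit_vec:
  assumes "k \<le> b" "\<And>l. l < k \<Longrightarrow> v l \<in> carrier R"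
  shows "lincomb (free_module R b) (unit_vec b) k v = (\<lambda>i\<in>{..<b}. if i < k then v i else \<zero>)"
  using assms
  by (induction k) (auto simp: free_module_simps unit_vec_def fun_eq_iff restrict_def less_Suc_eq)

lemma vec_eq_lincomb:
  assumes "v \<in> carrier (free_module R b)"
  shows "v = lincomb (free_module R b) (unit_vec b) b v"
  using assms by (subst lincomb_unit_vec) (auto simp: free_module_simps PiE_iff fun_eq_iff extensional_def)

lemma lincomb_hom_free:
  assumes "module R N" "\<And>l. l < b \<Longrightarrow> g l \<in> carrier N"
  shows "lincomb N g b \<in> module_homs R (free_module R b) N"
proof -
  interpret N: module R N by fact
  show ?thesis unfolding module_homs_def
  proof (intro CollectI conjI ballI funcsetI)
    fix x y assume x: "x \<in> carrier (free_module R b)" and y: "y \<in> carrier (free_module R b)"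
    have "lincomb N g b (x \<oplus>\<^bsub>free_module R b\<^esub> y) = lincomb N g b (\<lambda>l. x l \<oplus> y l)"
      by (intro lincomb_cong) (auto simp: free_module_simps)
    also have "\<dots> = lincomb N g b x \<oplus>\<^bsub>N\<^esub> lincomb N g b y"
      using x y assms by (intro N.lincomb_add) (auto simp: free_module_simps)
    finally show "lincomb N g b (x \<oplus>\<^bsub>free_module R b\<^esub> y) = lincomb N g b x \<oplus>\<^bsub>N\<^esub> lincomb N g b y" .
  next
    fix a x assume x: "x \<in> carrier (free_module R b)" and a: "a \<in> carrier R"
    have "lincomb N g b (a \<odot>\<^bsub>free_module R b\<^esub> x) = lincomb N g b (\<lambda>l. a \<otimes> x l)"
      by (intro lincomb_cong) (auto simp: free_module_simps)
    also have "\<dots> = a \<odot>\<^bsub>N\<^esub> lincomb N g b x"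
      using x a assms by (intro N.lincomb_smult) (auto simp: free_module_simps)
    finally show "lincomb N g b (a \<odot>\<^bsub>free_module R b\<^esub> x) = a \<odot>\<^bsub>N\<^esub> lincomb N g b x" .
  next
    fix x assume "x \<in> carrier (free_module R b)"
    then show "lincomb N g b x \<in> carrier N" using assms 
      by (intro N.lincomb_closed) (auto simp: free_module_simps)
  qed
qed

end

section \<open>Good sequences and their syzygies\<close>

text \<open>A grading is encoded by its projections \<open>gcomp j\<close>. The axioms are chosen so that the
family of identity maps satisfies them as well: every ring is an instance in which all elements are
homogeneous of all degrees.\<close>

locale graded_cring = cring R for R (structure) +
  fixes gcomp :: "int \<Rightarrow> 'a \<Rightarrow> 'a"
  assumes gcomp_closed: "a \<in> carrier R \<Longrightarrow> gcomp j a \<in> carrier R"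
    and gcomp_add: "\<lbrakk>a \<in> carrier R; b \<in> carrier R\<rbrakk> \<Longrightarrow> gcomp j (a \<oplus> b) = gcomp j a \<oplus> gcomp j b"
    and gcomp_idem: "a \<in> carrier R \<Longrightarrow> gcomp j (gcomp j a) = gcomp j a"
    and gcomp_mult: "\<lbrakk>a \<in> carrier R; y \<in> carrier R; gcomp p y = y\<rbrakk> \<Longrightarrow> gcomp j (a \<otimes> y) = gcomp (j - p) a \<otimes> y"

lemma (in abelian_group) additive_zero:
  assumes "f \<zero> \<in> carrier G" "f (\<zero> \<oplus> \<zero>) = f \<zero> \<oplus> f \<zero>"
  shows "f \<zero> = \<zero>"
  using assms by (metis add.l_cancel_one l_zero zero_closed)

lemma (in graded_cring) gcomp_zero: "gcomp j \<zero> = \<zero>"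
  using additive_zero[of "gcomp j"] gcomp_closed gcomp_add[of \<zero> \<zero>] by simp

locale graded_module = graded_cring R gcomp + module R N
  for R (structure) and gcomp :: "int \<Rightarrow> 'a \<Rightarrow> 'a" and N :: "('a, 'b, 's) module_scheme" (structure) +
  fixes ncomp :: "int \<Rightarrow> 'b \<Rightarrow> 'b"
  assumes ncomp_closed: "x \<in> carrier N \<Longrightarrow> ncomp j x \<in> carrier N"
    and ncomp_add: "\<lbrakk>x \<in> carrier N; y \<in> carrier N\<rbrakk> \<Longrightarrow> ncomp j (x \<oplus>\<^bsub>N\<^esub> y) = ncomp j x \<oplus>\<^bsub>N\<^esub> ncomp j y"
    and ncomp_idem: "x \<in> carrier N \<Longrightarrow> ncomp j (ncomp j x) = ncomp j x"
    and ncomp_smult: "\<lbrakk>a \<in> carrier R; y \<in> carrier N; ncomp p y = y\<rbrakk>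
      \<Longrightarrow> ncomp j (a \<odot>\<^bsub>N\<^esub> y) = gcomp (j - p) a \<odot>\<^bsub>N\<^esub> y"
begin

lemma ncomp_zero: "ncomp j \<zero>\<^bsub>N\<^esub> = \<zero>\<^bsub>N\<^esub>"
  using M.additive_zero[of "ncomp j"] ncomp_closed ncomp_add[of "\<zero>\<^bsub>N\<^esub>" "\<zero>\<^bsub>N\<^esub>"] by simp

text \<open>Hence a relation between homogeneous elements decomposes into homogeneous relations.\<close>

lemma ncomp_lincomb:
  assumes "\<And>l. l < s \<Longrightarrow> g l \<in> carrier N" "\<And>l. l < s \<Longrightarrow> ncomp (t l) (g l) = g l"
    "\<And>l. l < s \<Longrightarrow> c l \<in> carrier R"
  shows "ncomp j (lincomb N g s c) = lincomb N g s (\<lambda>l. gcomp (j - t l) (c l))"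
  using assms
proof (induction s)
  case (Suc s)
  have "ncomp j (c s \<odot>\<^bsub>N\<^esub> g s) = gcomp (j - t s) (c s) \<odot>\<^bsub>N\<^esub> g s"
    using Suc.prems by (intro ncomp_smult) auto
  then show ?case using Suc by (simp add: ncomp_add lincomb_closed)
qed (simp add: ncomp_zero)

end

text \<open>The component of degree \<open>j\<close> of a vector in \<open>\<Oplus>\<^sub>l R(-t l)\<close>.\<close>

definition vcomp :: "(int \<Rightarrow> 'a \<Rightarrow> 'a) \<Rightarrow> nat \<Rightarrow> (nat \<Rightarrow> int) \<Rightarrow> int \<Rightarrow> (nat \<Rightarrow> 'a) \<Rightarrow> nat \<Rightarrow> 'a" where
  "vcomp gcomp s t j v = (\<lambda>l\<in>{..<s}. gcomp (j - t l) (v l))"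

lemma (in graded_cring) free_module_graded:
  "graded_module R gcomp (free_module R s) (vcomp gcomp s t)"
proof (intro graded_module.intro graded_module_axioms.intro free_module_module)
  show "graded_cring R gcomp" by (rule graded_cring_axioms)
next
  fix j x assume "x \<in> carrier (free_module R s)"
  then show "vcomp gcomp s t j (vcomp gcomp s t j x) = vcomp gcomp s t j x"
    by (auto simp: vcomp_def free_module_simps gcomp_idem PiE_iff)
next
  fix a y p j
  assume a: "a \<in> carrier R" and y: "y \<in> carrier (free_module R s)" "vcomp gcomp s t p y = y"
  show "vcomp gcomp s t j (a \<odot>\<^bsub>free_module R s\<^esub> y) = gcomp (j - p) a \<odot>\<^bsub>free_module R s\<^esub> y"
  proof
    fix l
    have "gcomp (p - t l) (y l) = y l" if "l < s"
      using fun_cong[OF y(2), of l] that by (simp add: vcomp_def)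
    then show "vcomp gcomp s t j (a \<odot>\<^bsub>free_module R s\<^esub> y) l = (gcomp (j - p) a \<odot>\<^bsub>free_module R s\<^esub> y) l"
      using a y(1) gcomp_mult[of a "y l" "p - t l" "j - t l"]
      by (auto simp: vcomp_def free_module_simps PiE_iff)
  qed
qed (auto simp: vcomp_def free_module_simps gcomp_closed gcomp_add PiE_iff)

definition colon ::
  "('a, 'r) ring_scheme \<Rightarrow> ('a, 'b, 's) module_scheme \<Rightarrow> 'b set \<Rightarrow> 'b \<Rightarrow> 'a set" where
  "colon R N S v = {a \<in> carrier R. a \<odot>\<^bsub>N\<^esub> v \<in> S}"

lemma ideal_prod_mono:
  assumes "I \<subseteq> I'" "J \<subseteq> J'"
  shows "ideal_prod R I J \<subseteq> ideal_prod R I' J'"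
proof
  fix x assume "x \<in> ideal_prod R I J"
  then show "x \<in> ideal_prod R I' J'"
    by induction (use assms in \<open>auto intro: ideal_prod.intros\<close>)
qed

definition syzygies ::
  "('a, 'r) ring_scheme \<Rightarrow> ('a, 'b, 's) module_scheme \<Rightarrow> (nat \<Rightarrow> 'b) \<Rightarrow> nat \<Rightarrow> (nat \<Rightarrow> 'a) set" where
  "syzygies R N g s = {c \<in> carrier (free_module R s). lincomb N g s c = \<zero>\<^bsub>N\<^esub>}"

text \<open>The colon ideals of the successive generators are proper and large enough to produce
\<open>\<mm>\<^sup>2\<close>. The condition depends on the order of the sequence.\<close>

definition good_seq ::
  "('a, 'r) ring_scheme \<Rightarrow> 'a set \<Rightarrow> ('a, 'b, 's) module_scheme \<Rightarrow> (nat \<Rightarrow> 'b) \<Rightarrow> nat \<Rightarrow> bool" where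
  "good_seq R \<mm> N g s \<longleftrightarrow> (\<forall>i<s. g i \<in> carrier N \<and> colon R N (lspan R N g i) (g i) \<subseteq> \<mm> \<and>
     ideal_prod R \<mm> \<mm> \<subseteq> ideal_prod R (colon R N (lspan R N g i) (g i)) \<mm>)"

text \<open>The common properties of a local ring with the annihilator condition, with all components
the identity, and of its associated graded ring, with the components of the grading. In the second
case the linear part of an element of \<open>\<mm>\<close> represents it modulo \<open>\<mm>\<^sup>2\<close>. The axiom
\<open>linear_chain\<close> is the only trace of the Noetherian property: no infinite sequence of linear
elements is independent modulo \<open>\<mm>\<^sup>2\<close>.\<close>

locale short_ring = graded_cring R gcomp + ideal \<mm> R for \<mm> and R (structure) and gcomp +
  assumes one_notin: "\<one> \<notin> \<mm>"
    and unitI: "\<lbrakk>a \<in> carrier R; a \<notin> \<mm>\<rbrakk> \<Longrightarrow> a \<in> Units R"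
    and ann_prod: "\<lbrakk>x \<in> \<mm>; x \<notin> \<mm> \<cdot> \<mm>\<rbrakk> \<Longrightarrow> \<mm> \<cdot> \<mm> \<subseteq> annihilator R x \<cdot> \<mm>"
    and cube_zero: "\<lbrakk>a \<in> \<mm>; b \<in> \<mm> \<cdot> \<mm>\<rbrakk> \<Longrightarrow> a \<otimes> b = \<zero>"
    and gcomp_max: "u \<in> \<mm> \<Longrightarrow> gcomp 1 u \<in> \<mm>"
    and gcomp_linear: "u \<in> \<mm> \<Longrightarrow> u \<ominus> gcomp 1 u \<in> \<mm> \<cdot> \<mm>"
    and linear_chain: "\<lbrakk>\<And>n. y n \<in> \<mm>; \<And>n. gcomp 1 (y n) = y n\<rbrakk>
      \<Longrightarrow> \<exists>n. \<exists>z\<in>lspan R (self_module R) y n. y n \<ominus> z \<in> \<mm> \<cdot> \<mm>"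
begin

sublocale sq: ideal "\<mm> \<cdot> \<mm>" R
  using ideal_prod_is_ideal[OF is_ideal is_ideal] .

sublocale S: module R "self_module R"
  by (rule self_module_module)

lemma self_simps: "carrier (self_module R) = carrier R" "\<zero>\<^bsub>self_module R\<^esub> = \<zero>"
  "x \<oplus>\<^bsub>self_module R\<^esub> y = x \<oplus> y" "x \<odot>\<^bsub>self_module R\<^esub> y = x \<otimes> y"
  by (auto simp: self_module_def)

lemma self_minus: "x \<in> carrier R \<Longrightarrow> \<ominus>\<^bsub>self_module R\<^esub> x = \<ominus> x"
  using S.M.minus_equality[of "\<ominus> x" x] by (simp add: self_simps l_neg)

text \<open>Choose linear elements of \<open>J\<close> independent modulo \<open>\<mm>\<^sup>2\<close> until no further one exists,
and let \<open>L\<close> be their span. Then \<open>J \<subseteq> L + \<mm>\<^sup>2\<close>, hence \<open>J \<mm> \<subseteq> L\<close> as \<open>\<mm>\<^sup>3 = 0\<close>, and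
\<open>\<mm>\<^sup>2 \<subseteq> J \<mm> \<subseteq> L\<close> shows that \<open>L\<close> already contains \<open>J\<close>.\<close>

lemma linear_generators:
  assumes J: "submodule J R (self_module R)" "J \<subseteq> \<mm>" "\<mm> \<cdot> \<mm> \<subseteq> J \<cdot> \<mm>"
    and gcomp: "\<And>u. u \<in> J \<Longrightarrow> gcomp 1 u \<in> J"
  obtains y p where "\<And>l. l < p \<Longrightarrow> y l \<in> J" "\<And>l. l < p \<Longrightarrow> gcomp 1 (y l) = y l"
    "\<And>l z. \<lbrakk>l < p; z \<in> lspan R (self_module R) y l\<rbrakk> \<Longrightarrow> y l \<ominus> z \<notin> \<mm> \<cdot> \<mm>"
    "J = lspan R (self_module R) y p"
proof -
  define P where "P f x r \<longleftrightarrow> r \<in> J \<and> gcomp 1 r = r \<and>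
    (\<forall>z\<in>lspan R (self_module R) f x. r \<ominus> z \<notin> \<mm> \<cdot> \<mm>)" for f :: "nat \<Rightarrow> 'a" and x r
  have "\<exists>f x. (\<forall>l<x. P f l (f l)) \<and> \<not> (\<exists>r. P f x r)"
  proof (rule ccontr)
    assume "\<not> ?thesis"
    then have ex: "\<exists>r. P f x r" if "\<forall>l<x. P f l (f l)" for f x using that by blast
    have "\<exists>f. \<forall>x. P f x (f x)"
    proof (rule dependent_wellorder_choice)
      fix r and f g :: "nat \<Rightarrow> 'a" and x assume "\<And>y. y < x \<Longrightarrow> f y = g y"
      then show "P f x r = P g x r" unfolding P_def by (simp cong: S.lspan_cong)
    qed (use ex in blast)
    then obtain f where f: "\<And>x. P f x (f x)" by blast
    then have "\<exists>n. \<exists>z\<in>lspan R (self_module R) f n. f n \<ominus> z \<in> \<mm> \<cdot> \<mm>"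
      using J(2) by (intro linear_chain) (auto simp: P_def)
    then show False using f unfolding P_def by blast
  qed
  then obtain y p where y: "\<And>l. l < p \<Longrightarrow> P y l (y l)" and max: "\<And>r. \<not> P y p r" by blast
  define L where "L = lspan R (self_module R) y p"
  have yJ: "y l \<in> J" if "l < p" for l using y[OF that] by (simp add: P_def)
  have L: "submodule L R (self_module R)" unfolding L_def
    using yJ S.submoduleE(1)[OF J(1)] by (intro S.lspan_submodule) blast
  have LJ: "L \<subseteq> J" unfolding L_def using yJ J(1) by (intro S.lspan_least) auto
  have approx: "\<exists>z\<in>L. u \<ominus> z \<in> \<mm> \<cdot> \<mm>" if u: "u \<in> J" for u
  proof -
    have "\<not> P y p (gcomp 1 u)" by (rule max)
    then obtain z where z: "z \<in> L" "gcomp 1 u \<ominus> z \<in> \<mm> \<cdot> \<mm>"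
      using u gcomp J(2) unfolding P_def L_def by (auto simp: gcomp_idem)
    have c: "u \<in> carrier R" "gcomp 1 u \<in> carrier R" "z \<in> carrier R"
      using u z LJ J(2) gcomp_closed by auto
    have "u \<ominus> z = (u \<ominus> gcomp 1 u) \<oplus> (gcomp 1 u \<ominus> z)" using c
      by (simp add: a_minus_def a_assoc r_neg1)
    also have "\<dots> \<in> \<mm> \<cdot> \<mm>" using gcomp_linear[of u] u J(2) z(2) by auto
    finally show ?thesis using z(1) by blast
  qed
  have prodL: "J \<cdot> \<mm> \<subseteq> L"
  proof
    fix x assume "x \<in> J \<cdot> \<mm>"
    then show "x \<in> L"
    proof induction
      case (prod i j)
      obtain z where z: "z \<in> L" "i \<ominus> z \<in> \<mm> \<cdot> \<mm>" using approx[OF prod(1)] by blast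
      have c: "i \<in> carrier R" "z \<in> carrier R" "j \<in> carrier R" using prod z LJ J(2) by auto
      have "j \<otimes> (i \<ominus> z) = \<zero>" using prod z by (intro cube_zero)
      moreover have "i = (i \<ominus> z) \<oplus> z" using c by (simp add: a_minus_def a_assoc l_neg)
      then have "j \<otimes> i = j \<otimes> (i \<ominus> z) \<oplus> j \<otimes> z" using c r_distr[of "i \<ominus> z" z j] by simp
      ultimately have "i \<otimes> j = j \<otimes> z" using c by (simp add: m_comm)
      then show ?case using S.submoduleE(4)[OF L c(3) z(1)] by (simp add: self_simps)
    next
      case (sum a b)
      then show ?case using S.submoduleE(5)[OF L] by (simp add: self_simps)
    qed
  qed
  have "J \<subseteq> L"
  proof
    fix u assume u: "u \<in> J"
    obtain z where z: "z \<in> L" "u \<ominus> z \<in> \<mm> \<cdot> \<mm>" using approx[OF u] by blast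
    have c: "u \<in> carrier R" "z \<in> carrier R" using u z LJ J(2) by auto
    have "u \<ominus> z \<in> L" using z(2) J(3) prodL by blast
    then have "(u \<ominus> z) \<oplus> z \<in> L" using z(1) S.submoduleE(5)[OF L, of "u \<ominus> z" z] by (simp add: self_simps)
    then show "u \<in> L" using c by (simp add: a_minus_def a_assoc l_neg)
  qed
  then have "J = L" using LJ by blast
  then show ?thesis using that[of p y] y by (auto simp: P_def L_def)
qed

text \<open>The source of all good sequences: a vector annihilated modulo \<open>S\<close> by everything that
annihilates some \<open>y \<in> \<mm> - \<mm>\<^sup>2\<close> inherits the condition on \<open>ann(y)\<close>.\<close>

lemma annihilator_colon:
  assumes "module R N" "submodule S R N" "y \<in> \<mm>" "y \<notin> \<mm> \<cdot> \<mm>"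
    "\<And>a. \<lbrakk>a \<in> carrier R; a \<otimes> y = \<zero>\<rbrakk> \<Longrightarrow> a \<odot>\<^bsub>N\<^esub> v \<in> S"
  shows "\<mm> \<cdot> \<mm> \<subseteq> colon R N S v \<cdot> \<mm>"
proof -
  have "annihilator R y \<subseteq> colon R N S v"
    using assms(5) by (auto simp: annihilator_def colon_def)
  then show ?thesis using ann_prod[OF assms(3,4)] ideal_prod_mono by (metis order_refl order_trans)
qed

text \<open>Minimality of the next generators, in a form that also controls vectors mapped into
\<open>\<mm>\<^sup>2\<close> instead of \<open>0\<close>. This is injectivity of the lowest strand of the linear part.\<close>

definition indep_mod_sq :: "nat \<Rightarrow> (nat \<Rightarrow> nat \<Rightarrow> 'a) \<Rightarrow> nat \<Rightarrow> bool" where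
  "indep_mod_sq s w n \<longleftrightarrow> (\<forall>c\<in>UNIV \<rightarrow> carrier R.
     (\<forall>i<s. lincomb (free_module R s) w n c i \<in> \<mm> \<cdot> \<mm>) \<longrightarrow> (\<forall>l<n. c l \<in> \<mm>))"

lemma syzygies_submodule:
  assumes "module R N" "\<And>l. l < s \<Longrightarrow> g l \<in> carrier N"
  shows "submodule (syzygies R N g s) R (free_module R s)"
proof -
  interpret N: module R N by fact
  interpret F: module R "free_module R s" by (rule free_module_module)
  have h: "lincomb N g s \<in> module_homs R (free_module R s) N"
    using assms by (rule lincomb_hom_free)
  show ?thesis
  proof (rule F.submodule_criterion)
    show "\<zero>\<^bsub>free_module R s\<^esub> \<in> syzygies R N g s"
      using module_homs_zero[OF F.module_axioms N.module_axioms h] by (simp add: syzygies_def)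
  qed (use h in \<open>auto simp: syzygies_def module_homs_def\<close>)
qed

lemma colon_eq_last_coords:
  assumes N: "module R N" and g: "\<And>l. l < s \<Longrightarrow> g l \<in> carrier N" and i: "i < s"
  shows "colon R N (lspan R N g i) (g i) =
    (\<lambda>c. c i) ` {c \<in> syzygies R N g s. \<forall>l. i < l \<and> l < s \<longrightarrow> c l = \<zero>}" (is "_ = ?J")
proof
  interpret N: module R N by fact
  show "colon R N (lspan R N g i) (g i) \<subseteq> ?J"
  proof
    fix a assume "a \<in> colon R N (lspan R N g i) (g i)"
    then have a: "a \<in> carrier R" "a \<odot>\<^bsub>N\<^esub> g i \<in> lspan R N g i" by (auto simp: colon_def)
    obtain c where c: "\<And>l. c l \<in> carrier R" "a \<odot>\<^bsub>N\<^esub> g i = lincomb N g i c"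
      using a(2) by (rule N.lspanE) blast
    define v where "v = (\<lambda>l\<in>{..<s}. if l < i then \<ominus> c l else if l = i then a else \<zero>)"
    have v: "v \<in> carrier (free_module R s)" using a c by (auto simp: v_def free_module_simps)
    have "lincomb N g s v = lincomb N g (Suc i) v"
      using v g i by (intro N.lincomb_pad) (auto simp: v_def free_module_simps a c)
    also have "\<dots> = lincomb N g i (\<lambda>l. \<ominus> c l) \<oplus>\<^bsub>N\<^esub> a \<odot>\<^bsub>N\<^esub> g i"
      using i by (auto simp: v_def cong: lincomb_cong)
    also have "\<dots> = \<zero>\<^bsub>N\<^esub>" using a c g i N.lincomb_minus[of i g c] 
      by (auto simp: N.lincomb_closed N.l_neg)
    finally have "v \<in> {c \<in> syzygies R N g s. \<forall>l. i < l \<and> l < s \<longrightarrow> c l = \<zero>}"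
      using v by (auto simp: syzygies_def v_def)
    moreover have "v i = a" using i by (simp add: v_def)
    ultimately show "a \<in> ?J" by blast
  qed
  show "?J \<subseteq> colon R N (lspan R N g i) (g i)"
  proof (clarsimp simp: syzygies_def colon_def)
    fix c assume c: "c \<in> carrier (free_module R s)" "lincomb N g s c = \<zero>\<^bsub>N\<^esub>"
      "\<forall>l. i < l \<and> l < s \<longrightarrow> c l = \<zero>"
    have cR: "c l \<in> carrier R" if "l < s" for l using c that by (auto simp: free_module_simps)
    have "lincomb N g s c = lincomb N g (Suc i) c"
      using g i c cR by (intro N.lincomb_pad) auto
    then have "lincomb N g i c \<oplus>\<^bsub>N\<^esub> c i \<odot>\<^bsub>N\<^esub> g i = \<zero>\<^bsub>N\<^esub>" using c by simp
    moreover have cl: "lincomb N g i c \<in> carrier N" "c i \<odot>\<^bsub>N\<^esub> g i \<in> carrier N"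
      using g cR i by (auto intro!: N.lincomb_closed)
    ultimately have "c i \<odot>\<^bsub>N\<^esub> g i \<oplus>\<^bsub>N\<^esub> lincomb N g i c = \<zero>\<^bsub>N\<^esub>" by (simp add: N.M.a_comm)
    then have "c i \<odot>\<^bsub>N\<^esub> g i = \<ominus>\<^bsub>N\<^esub> lincomb N g i c"
      using N.M.minus_equality[OF _ cl] by simp
    also have "\<dots> = lincomb N g i (\<lambda>l. \<ominus> c l)" using g cR i by (simp add: N.lincomb_minus)
    also have "\<dots> \<in> lspan R N g i" using cR i by (intro N.lspanI) auto
    finally show "c i \<in> carrier R \<and> c i \<odot>\<^bsub>N\<^esub> g i \<in> lspan R N g i" using cR i by auto
  qed
qed

lemma good_seq_Suc:
  "good_seq R \<mm> N g (Suc n) \<longleftrightarrow> good_seq R \<mm> N g n \<and> g n \<in> carrier N \<and>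
     colon R N (lspan R N g n) (g n) \<subseteq> \<mm> \<and> \<mm> \<cdot> \<mm> \<subseteq> colon R N (lspan R N g n) (g n) \<cdot> \<mm>"
  by (auto simp: good_seq_def less_Suc_eq)

lemma good_seq_cong:
  assumes "module R N" "\<And>l. l < n \<Longrightarrow> g l = g' l"
  shows "good_seq R \<mm> N g n = good_seq R \<mm> N g' n"
proof -
  interpret N: module R N by fact
  have "lspan R N g i = lspan R N g' i" if "i < n" for i
    using that assms(2) by (intro N.lspan_cong) auto
  then show ?thesis using assms(2) unfolding good_seq_def by simp
qed

text \<open>Let \<open>K i\<close> be the syzygies whose coordinates from \<open>i\<close> on vanish. The \<open>i\<close>-th coordinate
maps \<open>K (i + 1)\<close> onto the colon ideal \<open>J\<close> of \<open>g i\<close> with kernel \<open>K i\<close>. So generators of \<open>K (i + 1)\<close>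
arise from those of \<open>K i\<close> by appending lifts \<open>v\<close> of linear generators \<open>y\<close> of \<open>J\<close>, one at a time.
If \<open>a y = 0\<close> then \<open>a v\<close> lies in \<open>K i\<close>; this bounds the colon ideal of \<open>v\<close> from below. As \<open>y\<close> has
degree one, a homogeneous lift has degree one more than \<open>g i\<close>.\<close>

theorem syzygies_good:
  assumes N: "graded_module R gcomp N ncomp" and good: "good_seq R \<mm> N g s"
    and homog: "\<And>l. l < s \<Longrightarrow> ncomp (t l) (g l) = g l"
  obtains w n t' where "good_seq R \<mm> (free_module R s) w n"
    "lspan R (free_module R s) w n = syzygies R N g s"
    "\<And>l. l < n \<Longrightarrow> vcomp gcomp s t (t' l) (w l) = w l"
    "\<And>l. l < n \<Longrightarrow> \<exists>i<s. t' l = t i + 1"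
    "(\<And>c l. \<lbrakk>c \<in> syzygies R N g s; l < s\<rbrakk> \<Longrightarrow> c l \<in> \<mm>) \<Longrightarrow> indep_mod_sq s w n"
proof -
  interpret N: graded_module R gcomp N ncomp by fact
  let ?F = "free_module R s"
  interpret F: graded_module R gcomp ?F "vcomp gcomp s t" by (rule free_module_graded)
  define K where "K i = {c \<in> syzygies R N g s. \<forall>l. i \<le> l \<and> l < s \<longrightarrow> c l = \<zero>}" for i
  have gN: "g l \<in> carrier N" if "l < s" for l using good that by (auto simp: good_seq_def)
  have syz: "submodule (syzygies R N g s) R ?F" by (rule syzygies_submodule[OF N.module_axioms gN])
  have KF: "c \<in> carrier ?F" if "c \<in> K i" for c i using that by (auto simp: K_def syzygies_def)
  have KR: "c l \<in> carrier R" if "c \<in> K i" "l < s" for c i l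
    using KF[OF that(1)] that by (auto simp: free_module_simps)
  have Ksub: "submodule (K i) R ?F" for i
  proof (rule F.submodule_criterion)
    show "K i \<subseteq> carrier ?F" using KF by blast
    show "\<zero>\<^bsub>?F\<^esub> \<in> K i" using F.submodule_zero[OF syz] by (auto simp: K_def free_module_simps)
  next
    fix a b assume "a \<in> K i" "b \<in> K i"
    then show "a \<oplus>\<^bsub>?F\<^esub> b \<in> K i" using F.submoduleE(5)[OF syz, of a b]
      by (auto simp: K_def free_module_simps)
  next
    fix a b assume "a \<in> carrier R" "b \<in> K i"
    then show "a \<odot>\<^bsub>?F\<^esub> b \<in> K i" using F.submoduleE(4)[OF syz, of a b]
      by (auto simp: K_def free_module_simps)
  qed
  have Kcomp: "vcomp gcomp s t j c \<in> K i" if c: "c \<in> K i" for c i j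
  proof -
    have "lincomb N g s (vcomp gcomp s t j c) = lincomb N g s (\<lambda>l. gcomp (j - t l) (c l))"
      by (intro lincomb_cong) (auto simp: vcomp_def)
    also have "\<dots> = ncomp j (lincomb N g s c)"
      using gN homog KR[OF c] by (subst N.ncomp_lincomb) auto
    also have "\<dots> = \<zero>\<^bsub>N\<^esub>" using c N.ncomp_zero by (simp add: K_def syzygies_def)
    finally show ?thesis using c F.ncomp_closed[OF KF[OF c]]
      by (auto simp: K_def syzygies_def vcomp_def gcomp_zero)
  qed
  \<comment> \<open>All requirements on a sequence of syzygies, with the part \<open>H\<close> of the syzygies spanned so far.\<close>
  define Q where "Q w n t' H \<longleftrightarrow> good_seq R \<mm> ?F w n \<and> lspan R ?F w n = H \<and>
      (\<forall>l<n. vcomp gcomp s t (t' l) (w l) = w l) \<and> (\<forall>l<n. \<exists>i<s. t' l = t i + 1) \<and>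
      ((\<forall>c\<in>syzygies R N g s. \<forall>l<s. c l \<in> \<mm>) \<longrightarrow> indep_mod_sq s w n)" for w n and t' :: "nat \<Rightarrow> int" and H
  have "\<exists>w n t'. Q w n t' (K i)" if "i \<le> s" for i using that
  proof (induction i)
    case 0
    have "K 0 = {\<zero>\<^bsub>?F\<^esub>}"
      using F.submodule_zero[OF Ksub, of 0] by (auto simp: K_def syzygies_def free_module_simps PiE_iff extensional_def)
    then have "Q undefined 0 undefined (K 0)"
      by (auto simp: Q_def good_seq_def lspan_def indep_mod_sq_def)
    then show ?case by blast
  next
    case (Suc i)
    then have i: "i < s" by simp
    define J where "J = (\<lambda>c. c i) ` K (Suc i)"
    have Jcolon: "J = colon R N (lspan R N g i) (g i)"
      using colon_eq_last_coords[of N s g i, OF N.module_axioms gN i] by (simp add: J_def K_def Suc_le_eq)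
    have Jm: "J \<subseteq> \<mm>" "\<mm> \<cdot> \<mm> \<subseteq> J \<cdot> \<mm>" using good i unfolding Jcolon good_seq_def by auto
    have "submodule J R (self_module R)"
    proof (rule S.submodule_criterion)
      show "J \<subseteq> carrier (self_module R)" using KR i by (auto simp: J_def self_simps)
      have "\<zero>\<^bsub>?F\<^esub> i \<in> J" unfolding J_def by (rule imageI[OF F.submodule_zero[OF Ksub]])
      then show "\<zero>\<^bsub>self_module R\<^esub> \<in> J" using i by (simp add: self_simps free_module_simps)
    next
      fix a b assume "a \<in> J" "b \<in> J"
      then obtain c d where cd: "a = c i" "b = d i" "c \<in> K (Suc i)" "d \<in> K (Suc i)"
        by (auto simp: J_def)
      have "(c \<oplus>\<^bsub>?F\<^esub> d) i \<in> J" using F.submoduleE(5)[OF Ksub cd(3,4)] by (auto simp: J_def)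
      then show "a \<oplus>\<^bsub>self_module R\<^esub> b \<in> J" using i cd by (simp add: free_module_simps self_simps)
    next
      fix a b assume a: "a \<in> carrier R" and "b \<in> J"
      then obtain d where d: "b = d i" "d \<in> K (Suc i)" by (auto simp: J_def)
      have "(a \<odot>\<^bsub>?F\<^esub> d) i \<in> J" using F.submoduleE(4)[OF Ksub a d(2)] by (auto simp: J_def)
      then show "a \<odot>\<^bsub>self_module R\<^esub> b \<in> J" using i d by (simp add: free_module_simps self_simps)
    qed
    moreover have Jcomp: "\<exists>v\<in>K (Suc i). v i = gcomp 1 u \<and> vcomp gcomp s t (t i + 1) v = v" if uJ: "u \<in> J" for u
    proof -
      obtain c where c: "u = c i" "c \<in> K (Suc i)" using uJ by (auto simp: J_def)
      have "vcomp gcomp s t (t i + 1) c i = gcomp 1 u" using c i by (simp add: vcomp_def)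
      then show ?thesis using Kcomp[OF c(2)] F.ncomp_idem[OF KF[OF c(2)]] by blast
    qed
    then have "gcomp 1 u \<in> J" if "u \<in> J" for u using that unfolding J_def by (metis imageI)
    ultimately obtain y p where y: "\<And>l. l < p \<Longrightarrow> y l \<in> J" "\<And>l. l < p \<Longrightarrow> gcomp 1 (y l) = y l"
        "\<And>l z. \<lbrakk>l < p; z \<in> lspan R (self_module R) y l\<rbrakk> \<Longrightarrow> y l \<ominus> z \<notin> \<mm> \<cdot> \<mm>"
        "J = lspan R (self_module R) y p"
      using linear_generators[OF _ Jm] by metis
    have yR: "y l \<in> carrier R" if "l < p" for l using y(1)[OF that] Jm by auto
    have "\<exists>w n t'. Q w n t' {c \<in> K (Suc i). c i \<in> lspan R (self_module R) y q}" if "q \<le> p" for q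
      using that
    proof (induction q)
      case 0
      have "{c \<in> K (Suc i). c i \<in> lspan R (self_module R) y 0} = K i" using i
        by (force simp: K_def lspan_def self_simps le_Suc_eq Suc_le_eq order.strict_iff_order)
      then show ?case using Suc.IH Suc.prems by simp
    next
      case (Suc q)
      define Lq where "Lq = lspan R (self_module R) y q"
      define H where "H = {c \<in> K (Suc i). c i \<in> Lq}"
      obtain w n t' where IH: "Q w n t' H" using Suc unfolding H_def Lq_def by auto
      obtain v where v: "v \<in> K (Suc i)" "v i = y q" "vcomp gcomp s t (t i + 1) v = v"
        using Jcomp[OF y(1), of q] y(2) Suc.prems by auto
      have q: "q < p" using Suc.prems by simp
      have Lq: "submodule Lq R (self_module R)" unfolding Lq_def
        using yR q by (intro S.lspan_submodule) (auto simp: self_simps)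
      have LqR: "z \<in> carrier R" if "z \<in> Lq" for z using S.submoduleE(1)[OF Lq] that by (auto simp: self_simps)
      have span: "lspan R ?F w n = H" and gw: "good_seq R \<mm> ?F w n" using IH by (auto simp: Q_def)
      have wF: "w l \<in> carrier ?F" if "l < n" for l using gw that by (auto simp: good_seq_def)
      have Hsub: "submodule H R ?F" unfolding span[symmetric] using wF by (rule F.lspan_submodule)
      define w' where "w' = w(n := v)"
      define u where "u = t'(n := t i + 1)"
      have eqw: "w' l = w l" if "l < n" for l using that by (simp add: w'_def)
      have span': "lspan R ?F w' n = H" using span F.lspan_cong[of n w' w] eqw by simp
      have vF: "v \<in> carrier ?F" using KF v by blast
      \<comment> \<open>If \<open>a\<close> were a unit, \<open>y q\<close> would depend on its predecessors modulo \<open>\<mm>\<^sup>2\<close>.\<close>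
      have unit_case: "a \<in> \<mm>" if a: "a \<in> carrier R" and z: "z \<in> carrier R" "z \<in> Lq" 
        "z \<oplus> a \<otimes> y q \<in> \<mm> \<cdot> \<mm>" for a z
      proof (rule ccontr)
        assume "a \<notin> \<mm>"
        then have U: "a \<in> Units R" using unitI a by blast
        have "inv a \<otimes> (z \<oplus> a \<otimes> y q) \<in> \<mm> \<cdot> \<mm>" using z U by (intro sq.I_l_closed) auto
        moreover have "inv a \<otimes> (z \<oplus> a \<otimes> y q) = inv a \<otimes> z \<oplus> y q"
          using U a z yR[OF q] by (simp add: r_distr m_assoc[symmetric])
        moreover have "inv a \<otimes> z \<oplus> y q = y q \<ominus> (\<ominus> (inv a \<otimes> z))"
          using U a z yR[OF q] by (simp add: a_minus_def a_ac)
        moreover have "inv a \<otimes> z \<in> Lq"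
          using S.submoduleE(4)[OF Lq, of "inv a" z] U z by (simp add: self_simps)
        then have "\<ominus> (inv a \<otimes> z) \<in> Lq"
          using S.submoduleE(3)[OF Lq, of "inv a \<otimes> z"] U z by (simp add: self_minus)
        ultimately show False using y(3)[OF q] unfolding Lq_def by metis
      qed
      have good': "good_seq R \<mm> ?F w' (Suc n)"
      proof -
        have c1: "colon R ?F H v \<subseteq> \<mm>"
        proof
          fix a assume "a \<in> colon R ?F H v"
          then have a: "a \<in> carrier R" "a \<odot>\<^bsub>?F\<^esub> v \<in> H" by (auto simp: colon_def)
          then have "a \<otimes> y q \<in> Lq" using i v by (auto simp: H_def free_module_simps)
          then have "\<ominus> (a \<otimes> y q) \<in> Lq"
            using S.submoduleE(3)[OF Lq, of "a \<otimes> y q"] a yR[OF q] by (simp add: self_minus)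
          moreover have "\<ominus> (a \<otimes> y q) \<oplus> a \<otimes> y q = \<zero>" using a yR[OF q] by (simp add: l_neg)
          ultimately show "a \<in> \<mm>" using unit_case[of a "\<ominus> (a \<otimes> y q)"] a yR[OF q]
            by (simp add: sq.zero_closed)
        qed
        have "y q \<ominus> \<zero> \<notin> \<mm> \<cdot> \<mm>" using y(3)[OF q] S.submodule_zero[OF Lq]
          by (simp add: Lq_def self_simps)
        then have "y q \<notin> \<mm> \<cdot> \<mm>" using yR[OF q] by (simp add: a_minus_def)
        moreover have "a \<odot>\<^bsub>?F\<^esub> v \<in> H" if a: "a \<in> carrier R" "a \<otimes> y q = \<zero>" for a
          using F.submoduleE(4)[OF Ksub a(1) v(1)] a v i S.submodule_zero[OF Lq]
          by (auto simp: H_def free_module_simps self_simps)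
        ultimately have c2: "\<mm> \<cdot> \<mm> \<subseteq> colon R ?F H v \<cdot> \<mm>"
          using y(1)[OF q] Jm by (intro annihilator_colon[OF F.module_axioms Hsub]) auto
        show ?thesis unfolding good_seq_Suc span'
          using c1 c2 vF gw good_seq_cong[OF F.module_axioms, of n w' w] eqw by (simp add: w'_def)
      qed
      have lsp: "lspan R ?F w' (Suc n) = {c \<in> K (Suc i). c i \<in> lspan R (self_module R) y (Suc q)}"
      proof (intro equalityI subsetI)
        fix x assume "x \<in> lspan R ?F w' (Suc n)"
        then obtain h a where h: "h \<in> H" "a \<in> carrier R" "x = h \<oplus>\<^bsub>?F\<^esub> a \<odot>\<^bsub>?F\<^esub> v"
          using span' by (elim F.lspan_SucE) (simp add: w'_def)
        have "x \<in> K (Suc i)" unfolding h(3) using h v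
          by (intro F.submoduleE(5)[OF Ksub] F.submoduleE(4)[OF Ksub]) (auto simp: H_def)
        moreover have "x i = h i \<oplus>\<^bsub>self_module R\<^esub> a \<odot>\<^bsub>self_module R\<^esub> y q" using h v i
          by (simp add: free_module_simps self_simps)
        ultimately show "x \<in> {c \<in> K (Suc i). c i \<in> lspan R (self_module R) y (Suc q)}"
          using S.lspan_SucI[of "h i" y q a] h by (simp add: H_def Lq_def)
      next
        fix x assume x: "x \<in> {c \<in> K (Suc i). c i \<in> lspan R (self_module R) y (Suc q)}"
        then obtain z a where z: "z \<in> Lq" "a \<in> carrier R" "x i = z \<oplus> a \<otimes> y q"
          by (auto elim: S.lspan_SucE simp: Lq_def self_simps)
        define h where "h = x \<ominus>\<^bsub>?F\<^esub> a \<odot>\<^bsub>?F\<^esub> v"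
        have xK: "x \<in> K (Suc i)" "x \<in> carrier ?F" using x KF by auto
        have av: "a \<odot>\<^bsub>?F\<^esub> v \<in> K (Suc i)" "a \<odot>\<^bsub>?F\<^esub> v \<in> carrier ?F"
          using F.submoduleE(4)[OF Ksub z(2) v(1)] KF by auto
        have hx: "h \<oplus>\<^bsub>?F\<^esub> a \<odot>\<^bsub>?F\<^esub> v = x" using xK av
          by (simp add: h_def a_minus_def F.M.a_assoc F.M.l_neg)
        have hK: "h \<in> K (Suc i)" unfolding h_def using xK av by (intro F.submodule_minus[OF Ksub])
        have "(h \<oplus>\<^bsub>?F\<^esub> a \<odot>\<^bsub>?F\<^esub> v) i = h i \<oplus> a \<otimes> y q" using i v by (simp add: free_module_simps)
        then have "h i \<oplus> a \<otimes> y q = z \<oplus> a \<otimes> y q" unfolding hx using z(3) by simp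
        then have "h i = z" using KR[OF hK i] LqR z yR[OF q] by simp
        then have "h \<in> H" using hK z by (simp add: H_def)
        then show "x \<in> lspan R ?F w' (Suc n)"
          using F.lspan_SucI[of h w' n a] z(2) span' hx by (simp add: w'_def)
      qed
      have ind: "indep_mod_sq s w' (Suc n)" if min: "\<forall>c\<in>syzygies R N g s. \<forall>l<s. c l \<in> \<mm>"
        unfolding indep_mod_sq_def
      proof (intro ballI impI)
        fix c assume c: "c \<in> UNIV \<rightarrow> carrier R" and sm: "\<forall>i'<s. lincomb ?F w' (Suc n) c i' \<in> \<mm> \<cdot> \<mm>"
        define h where "h = lincomb ?F w n c"
        have cR: "c l \<in> carrier R" for l using c by auto
        have hH: "h \<in> H" unfolding h_def span[symmetric] using cR by (intro F.lspanI) auto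
        have eq: "lincomb ?F w' (Suc n) c = h \<oplus>\<^bsub>?F\<^esub> c n \<odot>\<^bsub>?F\<^esub> v"
          using eqw lincomb_cong[of n w' w c c ?F] by (simp add: h_def w'_def)
        have co: "h l \<oplus> c n \<otimes> v l \<in> \<mm> \<cdot> \<mm>" if "l < s" for l
          using sm that unfolding eq by (auto simp: free_module_simps)
        have hK: "h \<in> K (Suc i)" using hH by (simp add: H_def)
        have "c n \<in> \<mm>" using unit_case[of "c n" "h i"] co[OF i] v hH LqR cR by (simp add: H_def)
        moreover have "h l \<in> \<mm> \<cdot> \<mm>" if l: "l < s" for l
        proof -
          have "v l \<in> \<mm>" using min v l by (auto simp: K_def)
          then have "c n \<otimes> v l \<in> \<mm> \<cdot> \<mm>" using \<open>c n \<in> \<mm>\<close> by (rule ideal_prod.prod[rotated])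
          then have "(h l \<oplus> c n \<otimes> v l) \<ominus> c n \<otimes> v l \<in> \<mm> \<cdot> \<mm>"
            using co[OF l] by (simp add: a_minus_def)
          then show ?thesis using KR[OF hK l] KR[OF v(1) l] cR
            by (simp add: a_minus_def a_assoc r_neg)
        qed
        then have "\<forall>l<n. c l \<in> \<mm>" using IH min c unfolding Q_def indep_mod_sq_def h_def by blast
        ultimately show "\<forall>l<Suc n. c l \<in> \<mm>" by (simp add: less_Suc_eq)
      qed
      have "Q w' (Suc n) u {c \<in> K (Suc i). c i \<in> lspan R (self_module R) y (Suc q)}"
        unfolding Q_def using good' lsp ind IH v i
        by (auto simp: Q_def w'_def u_def less_Suc_eq)
      then show ?case by blast
    qed
    from this[of p] have "\<exists>w n t'. Q w n t' {c \<in> K (Suc i). c i \<in> J}" using y(4) by simp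
    moreover have "{c \<in> K (Suc i). c i \<in> J} = K (Suc i)" by (auto simp: J_def)
    ultimately show ?case by simp
  qed
  from this[of s] obtain w n t' where "Q w n t' (K s)" by blast
  moreover have "K s = syzygies R N g s" by (auto simp: K_def)
  ultimately show ?thesis using that[of w n t'] unfolding Q_def by blast
qed

end

section \<open>Associated graded modules and homology\<close>

lemma additive_image_subgroup:
  assumes "abelian_group G" "abelian_group H" "f \<in> carrier G \<rightarrow> carrier H"
    "\<And>x y. \<lbrakk>x \<in> carrier G; y \<in> carrier G\<rbrakk> \<Longrightarrow> f (x \<oplus>\<^bsub>G\<^esub> y) = f x \<oplus>\<^bsub>H\<^esub> f y"
  shows "additive_subgroup (f ` carrier G) H"
proof -
  have "group_hom (add_monoid G) (add_monoid H) f"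
    using assms abelian_group.a_group[OF assms(1)] abelian_group.a_group[OF assms(2)]
    by (intro group_hom.intro group_hom_axioms.intro) (auto simp: hom_def)
  from group_hom.img_is_subgroup[OF this] show ?thesis
    by (intro additive_subgroup.intro) simp
qed

lemma homology_zeroI:
  assumes "abelian_group (C n)" "abelian_group (C (Suc n))" "d n \<in> carrier (C (Suc n)) \<rightarrow> carrier (C n)"
    "\<And>x y. \<lbrakk>x \<in> carrier (C (Suc n)); y \<in> carrier (C (Suc n))\<rbrakk>
      \<Longrightarrow> d n (x \<oplus>\<^bsub>C (Suc n)\<^esub> y) = d n x \<oplus>\<^bsub>C n\<^esub> d n y"
    and eq: "cycles C d n = boundaries C d n"
  shows "homology_zero C d n"
proof -
  interpret G: abelian_group "C n" by fact
  define B where "B = boundaries C d n"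
  have sub: "additive_subgroup B (C n)"
    unfolding B_def boundaries_def by (rule additive_image_subgroup) fact+
  interpret B: abelian_subgroup B "C n" by (intro abelian_subgroupI3 sub) fact
  have "a_r_coset ((C n)\<lparr>carrier := B\<rparr>) B x = B" if "x \<in> B" for x
    using B.a_rcos_const[OF that] by (simp add: a_r_coset_def r_coset_def)
  then have "a_rcosets\<^bsub>(C n)\<lparr>carrier := B\<rparr>\<^esub> B = (\<Union>x\<in>B. {B})"
    by (simp add: A_RCOSETS_def RCOSETS_def a_r_coset_def)
  also have "\<dots> = {B}" using B.zero_closed by blast
  finally show ?thesis
    unfolding homology_zero_def homology_def module_quot_def eq B_def[symmetric] by simp
qed

lemma (in module) submodule_abelian_subgroup: "submodule H R M \<Longrightarrow> abelian_subgroup H M"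
  by (intro abelian_subgroupI3 additive_subgroup.intro submodule.axioms(1) M.abelian_group_axioms)

lemma (in module) coset_eq_iff:
  assumes "submodule H R M" "x \<in> carrier M" "y \<in> carrier M"
  shows "H +>\<^bsub>M\<^esub> x = H +>\<^bsub>M\<^esub> y \<longleftrightarrow> x \<ominus>\<^bsub>M\<^esub> y \<in> H"
proof -
  interpret H: abelian_subgroup H M by (rule submodule_abelian_subgroup) fact
  show ?thesis
    using H.a_rcos_module[of y x] H.a_repr_independence'[of x y] H.a_rcos_self[of x] assms
    by (auto simp: a_minus_def)
qed

lemma (in module) coset_zero: "submodule H R M \<Longrightarrow> H +>\<^bsub>M\<^esub> \<zero>\<^bsub>M\<^esub> = H"
  using submoduleE(1) by simp

text \<open>The element of the associated graded module with prescribed representatives of its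
components.\<close>

definition gr_class :: "('a, 'b, 's) module_scheme \<Rightarrow> (nat \<Rightarrow> 'b set) \<Rightarrow> (nat \<Rightarrow> 'b) \<Rightarrow> nat \<Rightarrow> 'b set" where
  "gr_class M \<Phi> x = (\<lambda>i. \<Phi> (Suc i) +>\<^bsub>M\<^esub> x i)"

text \<open>Boundedness makes the finite support condition in the associated graded module
vacuous. All filtrations here are bounded because \<open>\<mm>\<^sup>3 = 0\<close>.\<close>

locale filtered_module = module R M for R and M (structure) +
  fixes \<Phi> :: "nat \<Rightarrow> 'c set"
  assumes filt_sub: "submodule (\<Phi> i) R M"
    and filt_desc: "\<Phi> (Suc i) \<subseteq> \<Phi> i"
    and filt_bound: "\<exists>k. \<forall>i\<ge>k. \<Phi> i = {\<zero>\<^bsub>M\<^esub>}"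
begin

abbreviation "cls \<equiv> gr_class M \<Phi>"
abbreviation "Gr \<equiv> assoc_graded M \<Phi>"

lemma filt_carrier: "x \<in> \<Phi> i \<Longrightarrow> x \<in> carrier M"
  using submoduleE(1)[OF filt_sub] by blast

lemma filt_zero: "\<zero>\<^bsub>M\<^esub> \<in> \<Phi> i" using submodule_zero[OF filt_sub] .

lemma carrier_Gr: "carrier Gr = cls ` {x. \<forall>i. x i \<in> \<Phi> i}"
proof (intro equalityI subsetI)
  fix f assume "f \<in> carrier Gr"
  then have "\<forall>i. \<exists>y. y \<in> \<Phi> i \<and> f i = \<Phi> (Suc i) +>\<^bsub>M\<^esub> y" by (auto simp: assoc_graded_def)
  then obtain y where "\<forall>i. y i \<in> \<Phi> i \<and> f i = \<Phi> (Suc i) +>\<^bsub>M\<^esub> y i" by metis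
  then show "f \<in> cls ` {x. \<forall>i. x i \<in> \<Phi> i}" by (auto simp: gr_class_def fun_eq_iff)
next
  fix f assume "f \<in> cls ` {x. \<forall>i. x i \<in> \<Phi> i}"
  then obtain x where x: "f = cls x" "\<And>i. x i \<in> \<Phi> i" by auto
  obtain k where k: "\<And>i. i \<ge> k \<Longrightarrow> \<Phi> i = {\<zero>\<^bsub>M\<^esub>}" using filt_bound by blast
  have "f i = \<Phi> (Suc i)" if "i \<ge> k" for i
    using x(2)[of i] k[OF that] coset_zero[OF filt_sub] by (simp add: x(1) gr_class_def)
  then have "{i. f i \<noteq> \<Phi> (Suc i)} \<subseteq> {..<k}" by (auto simp: not_le[symmetric])
  then have "finite {i. f i \<noteq> \<Phi> (Suc i)}" by (rule finite_subset) simp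
  then show "f \<in> carrier Gr" using x by (auto simp: assoc_graded_def gr_class_def)
qed

lemma GrE:
  assumes "f \<in> carrier Gr"
  obtains x where "\<And>i. x i \<in> \<Phi> i" "f = cls x"
  using assms carrier_Gr by auto

lemma cls_closed: "(\<And>i. x i \<in> \<Phi> i) \<Longrightarrow> cls x \<in> carrier Gr" using carrier_Gr by auto

lemma cls_eq_iff:
  assumes "\<And>i. x i \<in> \<Phi> i" "\<And>i. y i \<in> \<Phi> i"
  shows "cls x = cls y \<longleftrightarrow> (\<forall>i. x i \<ominus>\<^bsub>M\<^esub> y i \<in> \<Phi> (Suc i))"
proof -
  have "x i \<in> carrier M" "y i \<in> carrier M" for i using assms filt_carrier by blast+
  then show ?thesis using coset_eq_iff[OF filt_sub] by (simp add: gr_class_def fun_eq_iff)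
qed

lemma cls_zero: "cls (\<lambda>i. \<zero>\<^bsub>M\<^esub>) = \<zero>\<^bsub>Gr\<^esub>"
  using coset_zero[OF filt_sub] by (simp add: gr_class_def assoc_graded_def)

lemma cls_add:
  assumes "\<And>i. x i \<in> \<Phi> i" "\<And>i. y i \<in> \<Phi> i"
  shows "cls x \<oplus>\<^bsub>Gr\<^esub> cls y = cls (\<lambda>i. x i \<oplus>\<^bsub>M\<^esub> y i)"
proof -
  have "x i \<in> carrier M" "y i \<in> carrier M" for i using assms filt_carrier by blast+
  then show ?thesis using abelian_subgroup.a_rcos_sum[OF submodule_abelian_subgroup[OF filt_sub]]
    by (simp add: gr_class_def assoc_graded_def)
qed

lemma cls_eq_zero_iff:
  assumes "\<And>i. x i \<in> \<Phi> i"
  shows "cls x = \<zero>\<^bsub>Gr\<^esub> \<longleftrightarrow> (\<forall>i. x i \<in> \<Phi> (Suc i))"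
proof -
  have "x i \<in> carrier M" for i using assms filt_carrier by blast
  moreover have "\<ominus>\<^bsub>M\<^esub> \<zero>\<^bsub>M\<^esub> = \<zero>\<^bsub>M\<^esub>" by (rule M.minus_equality) auto
  then have "y \<ominus>\<^bsub>M\<^esub> \<zero>\<^bsub>M\<^esub> = y" if "y \<in> carrier M" for y using that by (metis a_minus_def M.r_zero)
  ultimately show ?thesis using cls_eq_iff[of x "\<lambda>i. \<zero>\<^bsub>M\<^esub>"] assms filt_zero
    by (simp add: cls_zero)
qed

lemma filt_add: "\<lbrakk>x \<in> \<Phi> i; y \<in> \<Phi> i\<rbrakk> \<Longrightarrow> x \<oplus>\<^bsub>M\<^esub> y \<in> \<Phi> i"
  using submoduleE(5)[OF filt_sub] by blast

lemma Gr_abelian_group: "abelian_group Gr"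
proof (rule abelian_groupI)
  show "\<zero>\<^bsub>Gr\<^esub> \<in> carrier Gr" unfolding cls_zero[symmetric] by (intro cls_closed filt_zero)
next
  fix f g h assume "f \<in> carrier Gr" "g \<in> carrier Gr" "h \<in> carrier Gr"
  then obtain x y z where xyz: "\<And>i. x i \<in> \<Phi> i" "f = cls x" "\<And>i. y i \<in> \<Phi> i" "g = cls y"
    "\<And>i. z i \<in> \<Phi> i" "h = cls z" by (metis GrE)
  have M: "x i \<in> carrier M" "y i \<in> carrier M" "z i \<in> carrier M" for i
    using xyz filt_carrier by blast+
  show "f \<oplus>\<^bsub>Gr\<^esub> g \<oplus>\<^bsub>Gr\<^esub> h = f \<oplus>\<^bsub>Gr\<^esub> (g \<oplus>\<^bsub>Gr\<^esub> h)"
    using xyz M by (simp add: cls_add filt_add M.a_assoc)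
  show "f \<oplus>\<^bsub>Gr\<^esub> g \<in> carrier Gr" using xyz by (simp add: cls_add filt_add cls_closed)
  show "f \<oplus>\<^bsub>Gr\<^esub> g = g \<oplus>\<^bsub>Gr\<^esub> f"
    using xyz M by (simp add: cls_add filt_add M.a_comm)
  show "\<zero>\<^bsub>Gr\<^esub> \<oplus>\<^bsub>Gr\<^esub> f = f" using xyz M filt_zero by (simp add: cls_zero[symmetric] cls_add)
  have "cls (\<lambda>i. \<ominus>\<^bsub>M\<^esub> x i) \<oplus>\<^bsub>Gr\<^esub> f = \<zero>\<^bsub>Gr\<^esub>"
    using xyz M submoduleE(3)[OF filt_sub] by (simp add: cls_zero[symmetric] cls_add M.l_neg)
  moreover have "\<ominus>\<^bsub>M\<^esub> x i \<in> \<Phi> i" for i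
    using submoduleE(3)[OF filt_sub xyz(1)] .
  then have "cls (\<lambda>i. \<ominus>\<^bsub>M\<^esub> x i) \<in> carrier Gr" by (rule cls_closed)
  ultimately show "\<exists>k\<in>carrier Gr. k \<oplus>\<^bsub>Gr\<^esub> f = \<zero>\<^bsub>Gr\<^esub>" by blast
qed

end

section \<open>Free resolutions from good sequences\<close>

lemma restrict_in_PiE: "(\<And>l. l \<in> A \<Longrightarrow> f l \<in> B) \<Longrightarrow> restrict f A \<in> A \<rightarrow>\<^sub>E B"
  by (auto simp: PiE_iff)

lemma ideal_smult_subset: "\<lbrakk>submodule H R M; I \<subseteq> carrier R; N \<subseteq> H; module R M\<rbrakk> \<Longrightarrow> ideal_smult M I N \<subseteq> H"
proof
  fix x assume H: "submodule H R M" "I \<subseteq> carrier R" "N \<subseteq> H" "module R M" and x: "x \<in> ideal_smult M I N"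
  interpret module R M by fact
  show "x \<in> H" using x by induction (use H submoduleE(4,5)[OF H(1)] in auto)
qed

context cring
begin

lemma ideal_smult_submodule:
  assumes "module R M" "ideal I R" "submodule N R M"
  shows "submodule (ideal_smult M I N) R M"
proof -
  interpret module R M by fact
  interpret I: ideal I R by fact
  have sub: "ideal_smult M I N \<subseteq> carrier M"
    using submoduleE(1)[OF assms(3)] I.a_subset carrier_is_submodule assms(1)
    by (intro ideal_smult_subset) auto
  show ?thesis
  proof (rule submodule_criterion[OF sub])
    have "\<zero> \<odot>\<^bsub>M\<^esub> \<zero>\<^bsub>M\<^esub> \<in> ideal_smult M I N"
      using submodule_zero[OF assms(3)] by (intro ideal_smult.smult) auto
    then show "\<zero>\<^bsub>M\<^esub> \<in> ideal_smult M I N" by simp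
  next
    fix a x assume a: "a \<in> carrier R" and "x \<in> ideal_smult M I N"
    from this(2) show "a \<odot>\<^bsub>M\<^esub> x \<in> ideal_smult M I N"
    proof induction
      case (smult i x)
      then have "a \<odot>\<^bsub>M\<^esub> (i \<odot>\<^bsub>M\<^esub> x) = (a \<otimes> i) \<odot>\<^bsub>M\<^esub> x"
        using a submoduleE(1)[OF assms(3)] by (subst smult_assoc1) auto
      then show ?case using smult a by (simp add: ideal_smult.smult I.I_l_closed)
    next
      case (sum x y)
      then have "a \<odot>\<^bsub>M\<^esub> (x \<oplus>\<^bsub>M\<^esub> y) = a \<odot>\<^bsub>M\<^esub> x \<oplus>\<^bsub>M\<^esub> a \<odot>\<^bsub>M\<^esub> y"
        using a sub by (intro smult_r_distr) blast+
      then show ?case using sum.IH by (simp add: ideal_smult.sum)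
    qed
  qed (rule ideal_smult.sum)
qed

lemma ideal_smult_free:
  assumes "ideal I R"
  shows "ideal_smult (free_module R b) I (carrier (free_module R b)) = {..<b} \<rightarrow>\<^sub>E I"
proof
  interpret F: module R "free_module R b" by (rule free_module_module)
  interpret I: ideal I R by fact
  show "ideal_smult (free_module R b) I (carrier (free_module R b)) \<subseteq> {..<b} \<rightarrow>\<^sub>E I"
  proof
    fix x assume "x \<in> ideal_smult (free_module R b) I (carrier (free_module R b))"
    then show "x \<in> {..<b} \<rightarrow>\<^sub>E I"
    proof induction
      case (smult a x)
      then have "x l \<in> carrier R" if "l < b" for l using that by (auto simp: free_module_simps)
      then show ?case using smult(1) unfolding free_module_simps
        by (intro restrict_in_PiE) (auto intro: I.I_r_closed)
    next
      case (sum x y)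
      then have "x l \<in> I" "y l \<in> I" if "l < b" for l using that by auto
      then show ?case unfolding free_module_simps by (intro restrict_in_PiE) auto
    qed
  qed
  show "{..<b} \<rightarrow>\<^sub>E I \<subseteq> ideal_smult (free_module R b) I (carrier (free_module R b))" (is "_ \<subseteq> ?S")
  proof
    fix v assume v: "v \<in> {..<b} \<rightarrow>\<^sub>E I"
    have S: "submodule ?S R (free_module R b)"
      using ideal_smult_submodule[OF F.module_axioms assms F.carrier_is_submodule] .
    have "lincomb (free_module R b) (unit_vec b) k v \<in> ?S" if "k \<le> b" for k
      using that
    proof (induction k)
      case 0
      then show ?case using F.submodule_zero[OF S] by simp
    next
      case (Suc k)
      then have "lincomb (free_module R b) (unit_vec b) k v \<in> ?S" by simp
      moreover have "v k \<odot>\<^bsub>free_module R b\<^esub> unit_vec b k \<in> ?S"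
        using PiE_mem[OF v, of k] Suc.prems by (intro ideal_smult.smult unit_vec_closed) simp
      ultimately show ?case by (simp add: ideal_smult.sum)
    qed
    from this[of b] have mem: "lincomb (free_module R b) (unit_vec b) b v \<in> ?S" by blast
    have "v \<in> carrier (free_module R b)"
      using v I.a_subset PiE_mono[of "{..<b}" "\<lambda>_. I" "\<lambda>_. carrier R"] unfolding free_module_simps by blast
    then show "v \<in> ?S" using mem vec_eq_lincomb by metis
  qed
qed

end

context short_ring
begin

text \<open>The last coordinates of the syzygies in \<open>K (i + 1)\<close> form the colon ideal \<open>J\<^sub>i\<close>, and
\<open>\<mm>\<^sup>2 \<subseteq> J\<^sub>i \<mm>\<close>. Hence the last nonzero coordinate of a vector over \<open>\<mm>\<^sup>2\<close> can be cleared by an element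
of \<open>\<mm> \<Omega>\<close>. The minimality assumption keeps the other coordinates of that element in \<open>\<mm>\<^sup>2\<close>, so the
process can be repeated.\<close>

lemma sq_in_syzygies:
  assumes N: "module R N" and good: "good_seq R \<mm> N g s"
    and min: "\<And>c l. \<lbrakk>c \<in> syzygies R N g s; l < s\<rbrakk> \<Longrightarrow> c l \<in> \<mm>"
    and v: "v \<in> {..<s} \<rightarrow>\<^sub>E \<mm> \<cdot> \<mm>"
  shows "v \<in> ideal_smult (free_module R s) \<mm> (syzygies R N g s)"
proof -
  let ?F = "free_module R s"
  interpret F: module R ?F by (rule free_module_module)
  have gN: "g l \<in> carrier N" if "l < s" for l using good that by (auto simp: good_seq_def)
  have syz: "submodule (syzygies R N g s) R ?F" by (rule syzygies_submodule[OF N gN])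
  let ?S = "ideal_smult ?F \<mm> (syzygies R N g s)"
  have S: "submodule ?S R ?F" by (rule ideal_smult_submodule[OF F.module_axioms is_ideal syz])
  have lift: "\<exists>k\<in>?S. k i = c \<and> (\<forall>l. i < l \<and> l < s \<longrightarrow> k l = \<zero>) \<and> (\<forall>l<s. k l \<in> \<mm> \<cdot> \<mm>)"
    if i: "i < s" and c: "c \<in> \<mm> \<cdot> \<mm>" for i c
  proof -
    have "c \<in> colon R N (lspan R N g i) (g i) \<cdot> \<mm>" using good i c by (auto simp: good_seq_def)
    then show ?thesis
    proof induction
      case (prod y a)
      then obtain u where u: "u \<in> syzygies R N g s" "u i = y" "\<forall>l. i < l \<and> l < s \<longrightarrow> u l = \<zero>"
        using colon_eq_last_coords[of N s g i, OF N gN i] by auto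
      have um: "u l \<in> \<mm>" if "l < s" for l using min u that by blast
      show ?case
      proof (intro bexI conjI)
        show "a \<odot>\<^bsub>?F\<^esub> u \<in> ?S" using prod u by (intro ideal_smult.smult)
        show "(a \<odot>\<^bsub>?F\<^esub> u) i = y \<otimes> a" using i u prod um by (auto simp: free_module_simps m_comm)
        show "\<forall>l<s. (a \<odot>\<^bsub>?F\<^esub> u) l \<in> \<mm> \<cdot> \<mm>" using um prod
          by (auto simp: free_module_simps intro: ideal_prod.prod)
      qed (use u prod in \<open>auto simp: free_module_simps\<close>)
    next
      case (sum c c')
      then obtain k k' where k: "k \<in> ?S" "k i = c" "\<forall>l. i < l \<and> l < s \<longrightarrow> k l = \<zero>" "\<forall>l<s. k l \<in> \<mm> \<cdot> \<mm>"
        "k' \<in> ?S" "k' i = c'" "\<forall>l. i < l \<and> l < s \<longrightarrow> k' l = \<zero>" "\<forall>l<s. k' l \<in> \<mm> \<cdot> \<mm>" by blast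
      then have "k \<oplus>\<^bsub>?F\<^esub> k' \<in> ?S" by (intro ideal_smult.sum)
      then show ?case using k i by (intro bexI[of _ "k \<oplus>\<^bsub>?F\<^esub> k'"]) (auto simp: free_module_simps)
    qed
  qed
  have "v \<in> ?S" if "i \<le> s" "v \<in> {..<s} \<rightarrow>\<^sub>E \<mm> \<cdot> \<mm>" "\<forall>l. i \<le> l \<and> l < s \<longrightarrow> v l = \<zero>" for i v
    using that
  proof (induction i arbitrary: v)
    case 0
    then have "v = \<zero>\<^bsub>?F\<^esub>" by (auto simp: free_module_simps PiE_iff extensional_def)
    then show ?case using F.submodule_zero[OF S] by simp
  next
    case (Suc i)
    then obtain k where k: "k \<in> ?S" "k i = v i" "\<forall>l. i < l \<and> l < s \<longrightarrow> k l = \<zero>" "\<forall>l<s. k l \<in> \<mm> \<cdot> \<mm>"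
      using lift[of i "v i"] PiE_mem[OF Suc.prems(2), of i] by (auto simp: Suc_le_eq)
    define u where "u = (\<lambda>l\<in>{..<s}. v l \<ominus> k l)"
    have cR: "v l \<in> carrier R" "k l \<in> carrier R" if "l < s" for l
      using PiE_mem[OF Suc.prems(2), of l] k(4) that by auto
    have "u \<in> ?S"
    proof (rule Suc.IH)
      show "u \<in> {..<s} \<rightarrow>\<^sub>E \<mm> \<cdot> \<mm>" using Suc.prems(2) k(4)
        by (auto simp: u_def a_minus_def intro!: sq.a_closed sq.a_inv_closed)
      show "\<forall>l. i \<le> l \<and> l < s \<longrightarrow> u l = \<zero>"
      proof (intro allI impI)
        fix l assume l: "i \<le> l \<and> l < s"
        have "v l = k l" using l k Suc.prems(3) by (cases "l = i") auto
        then show "u l = \<zero>" using cR l by (simp add: u_def a_minus_def r_neg)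
      qed
    qed (use Suc.prems in simp)
    moreover have "v = u \<oplus>\<^bsub>?F\<^esub> k"
    proof
      fix l show "v l = (u \<oplus>\<^bsub>?F\<^esub> k) l"
        using cR[of l] Suc.prems(2)
        by (auto simp: free_module_simps u_def a_minus_def a_assoc l_neg PiE_iff extensional_def)
    qed
    ultimately show ?case using ideal_smult.sum[OF _ k(1)] by simp
  qed
  moreover have "\<forall>l. s \<le> l \<and> l < s \<longrightarrow> v l = \<zero>" by auto
  ultimately show ?thesis using v by blast
qed

end

lemma (in cring) ideal_smult_lspan:
  assumes I: "ideal \<mm> R"
    and "module R N" "\<And>l. l < n \<Longrightarrow> w l \<in> carrier N" "x \<in> ideal_smult N \<mm> (lspan R N w n)"
  obtains c where "c \<in> {..<n} \<rightarrow>\<^sub>E \<mm>" "x = lincomb N w n c"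
proof -
  interpret N: module R N by fact
  interpret I: ideal \<mm> R by fact
  have "\<exists>c. c \<in> {..<n} \<rightarrow>\<^sub>E \<mm> \<and> x = lincomb N w n c" using assms(4)
  proof induction
    case (smult a x)
    then obtain c where c: "\<And>l. c l \<in> carrier R" "x = lincomb N w n c" by (elim N.lspanE) blast
    have "a \<odot>\<^bsub>N\<^esub> x = lincomb N w n (\<lambda>l. a \<otimes> c l)"
      using c smult assms(3) by (simp add: N.lincomb_smult)
    also have "\<dots> = lincomb N w n (\<lambda>l\<in>{..<n}. a \<otimes> c l)" by (intro lincomb_cong) auto
    finally have "a \<odot>\<^bsub>N\<^esub> x = lincomb N w n (\<lambda>l\<in>{..<n}. a \<otimes> c l)" .
    moreover have "(\<lambda>l\<in>{..<n}. a \<otimes> c l) \<in> {..<n} \<rightarrow>\<^sub>E \<mm>"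
      using smult c I.I_r_closed by (intro restrict_in_PiE) blast
    ultimately show ?case by blast
  next
    case (sum x y)
    then obtain c c' where c: "c \<in> {..<n} \<rightarrow>\<^sub>E \<mm>" "x = lincomb N w n c"
      "c' \<in> {..<n} \<rightarrow>\<^sub>E \<mm>" "y = lincomb N w n c'" by blast
    have cm: "c l \<in> \<mm>" "c' l \<in> \<mm>" if "l < n" for l
      using PiE_mem[OF c(1)] PiE_mem[OF c(3)] that by auto
    have "x \<oplus>\<^bsub>N\<^esub> y = lincomb N w n (\<lambda>l. c l \<oplus> c' l)"
      unfolding c(2,4) using cm I.Icarr assms(3) by (intro N.lincomb_add[symmetric]) blast+
    also have "lincomb N w n (\<lambda>l. c l \<oplus> c' l) = lincomb N w n (\<lambda>l\<in>{..<n}. c l \<oplus> c' l)"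
      by (intro lincomb_cong) auto
    finally have eq: "x \<oplus>\<^bsub>N\<^esub> y = lincomb N w n (\<lambda>l\<in>{..<n}. c l \<oplus> c' l)" .
    have "(\<lambda>l\<in>{..<n}. c l \<oplus> c' l) \<in> {..<n} \<rightarrow>\<^sub>E \<mm>"
      using cm by (intro restrict_in_PiE) auto
    with eq show ?case by blast
  qed
  then show ?thesis using that by blast
qed

context cring
begin

lemma lspan_image:
  assumes "module R N" "\<And>l. l < n \<Longrightarrow> w l \<in> carrier N"
  shows "lspan R N w n = lincomb N w n ` carrier (free_module R n)"
proof -
  interpret N: module R N by fact
  show ?thesis
  proof (intro equalityI subsetI)
    fix x assume "x \<in> lspan R N w n"
    then obtain c where c: "\<And>l. c l \<in> carrier R" "x = lincomb N w n c" by (elim N.lspanE) blast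
    have "lincomb N w n c = lincomb N w n (\<lambda>l\<in>{..<n}. c l)" by (intro lincomb_cong) auto
    moreover have "(\<lambda>l\<in>{..<n}. c l) \<in> carrier (free_module R n)"
      unfolding free_module_simps using c by (intro restrict_in_PiE) auto
    ultimately show "x \<in> lincomb N w n ` carrier (free_module R n)" using c by blast
  qed (auto simp: free_module_simps intro!: N.lspanI)
qed

lemma resolution_of_syzygies:
  fixes w :: "nat \<Rightarrow> nat \<Rightarrow> nat \<Rightarrow> 'a"
  assumes N: "module R N" and g: "\<And>l. l < b 0 \<Longrightarrow> g l \<in> carrier N"
    and w: "\<And>n l. l < b (Suc n) \<Longrightarrow> w n l \<in> carrier (free_module R (b n))"
    and span: "lspan R N g (b 0) = carrier N"
    and syz0: "lspan R (free_module R (b 0)) (w 0) (b 1) = syzygies R N g (b 0)"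
    and syz: "\<And>n. lspan R (free_module R (b (Suc n))) (w (Suc n)) (b (Suc (Suc n))) =
      syzygies R (free_module R (b n)) (w n) (b (Suc n))"
  defines "d \<equiv> \<lambda>n. lincomb (free_module R (b n)) (w n) (b (Suc n))"
  shows "free_resolution R N b d (lincomb N g (b 0))"
proof -
  let ?C = "\<lambda>n. free_module R (b n)"
  have hom: "d n \<in> module_homs R (?C (Suc n)) (?C n)" for n
    unfolding d_def using w by (intro lincomb_hom_free free_module_module)
  have im: "d n ` carrier (?C (Suc n)) = lspan R (?C n) (w n) (b (Suc n))" for n
    unfolding d_def using w lspan_image[OF free_module_module] by blast
  have kernel: "d (Suc n) ` carrier (?C (Suc (Suc n))) = {x \<in> carrier (?C (Suc n)). d n x = \<zero>\<^bsub>?C n\<^esub>}" for n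
    unfolding im syz by (simp add: syzygies_def d_def)
  have "chain_complex R ?C d" unfolding chain_complex_def
    using free_module_module hom kernel by blast
  moreover have "homology_zero ?C d n" if "n > 0" for n
  proof -
    obtain k where n: "n = Suc k" using \<open>n > 0\<close> by (cases n) auto
    have "abelian_group (?C m)" for m using free_module_module by (rule module.axioms)
    then show ?thesis using hom[of n]
      by (intro homology_zeroI) (auto simp: module_homs_def n cycles_def boundaries_def kernel)
  qed
  moreover have "lincomb N g (b 0) \<in> module_homs R (?C 0) N" using N g by (rule lincomb_hom_free)
  moreover have "lincomb N g (b 0) ` carrier (?C 0) = carrier N"
    using lspan_image[OF N g] span by simp
  moreover have "{x \<in> carrier (?C 0). lincomb N g (b 0) x = \<zero>\<^bsub>N\<^esub>} = boundaries ?C d 0"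
    using im[of 0] syz0 by (simp add: boundaries_def syzygies_def)
  ultimately show ?thesis unfolding free_resolution_def by blast
qed

lemma ideal_pow_ideal: "ideal I R \<Longrightarrow> ideal (ideal_pow R I n) R"
  by (induction n) (auto intro: oneideal ideal_prod_is_ideal simp: ideal_pow.simps(2))

declare ideal_pow.simps(2) [simp del]

end

context short_ring
begin

lemma ideal_pow_simps:
  "ideal_pow R \<mm> 0 = carrier R" "ideal_pow R \<mm> (Suc 0) = \<mm>" "ideal_pow R \<mm> (Suc (Suc 0)) = \<mm> \<cdot> \<mm>"
proof -
  have "carrier R \<cdot> \<mm> = \<mm>"
  proof
    show "carrier R \<cdot> \<mm> \<subseteq> \<mm>" using ideal_prod_inter[OF oneideal is_ideal] by blast
    show "\<mm> \<subseteq> carrier R \<cdot> \<mm>" using ideal_prod.prod[of \<one> "carrier R" _ \<mm> R] by force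
  qed
  then show "ideal_pow R \<mm> (Suc 0) = \<mm>" "ideal_pow R \<mm> (Suc (Suc 0)) = \<mm> \<cdot> \<mm>"
    by (simp_all add: ideal_pow.simps(2))
qed simp

lemma ideal_pow_bound: "ideal_pow R \<mm> (n + 3) = {\<zero>}"
proof (induction n)
  case 0
  have "x = \<zero>" if "x \<in> (\<mm> \<cdot> \<mm>) \<cdot> \<mm>" for x using that
  proof induction
    case (prod i j)
    then show ?case using cube_zero[of j i] by (simp add: m_comm sq.Icarr)
  qed auto
  moreover have "\<zero> \<in> (\<mm> \<cdot> \<mm>) \<cdot> \<mm>"
    using ideal_prod_is_ideal[OF sq.is_ideal is_ideal] by (simp add: additive_subgroup.zero_closed ideal.axioms)
  ultimately have "(\<mm> \<cdot> \<mm>) \<cdot> \<mm> = {\<zero>}" by blast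
  then show ?case using ideal_pow_simps(3) by (simp add: numeral_3_eq_3 ideal_pow.simps(2)[of R \<mm> "Suc (Suc 0)"])
next
  case (Suc n)
  have "x = \<zero>" if "x \<in> {\<zero>} \<cdot> \<mm>" for x using that by induction auto
  moreover have "\<zero> \<in> {\<zero>} \<cdot> \<mm>" using ideal_prod.prod[of \<zero> "{\<zero>}" \<zero> \<mm> R] zero_closed by simp
  ultimately have "{\<zero>} \<cdot> \<mm> = {\<zero>}" by blast
  then show ?case using Suc by (simp only: add_Suc ideal_pow.simps(2))
qed

lemma ideal_pow_desc: "ideal_pow R \<mm> (Suc n) \<subseteq> ideal_pow R \<mm> n"
  using ideal_prod_inter[OF ideal_pow_ideal[OF is_ideal] is_ideal] by (auto simp: ideal_pow.simps(2))

lemma indep_mod_sq_syzygies: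
  assumes "indep_mod_sq s w n" "c \<in> syzygies R (free_module R s) w n" "l < n"
  shows "c l \<in> \<mm>"
proof -
  define c' where "c' l = (if l < n then c l else \<zero>)" for l
  have c: "c \<in> carrier (free_module R n)" "lincomb (free_module R s) w n c = \<zero>\<^bsub>free_module R s\<^esub>"
    using assms by (auto simp: syzygies_def)
  have "lincomb (free_module R s) w n c' = \<zero>\<^bsub>free_module R s\<^esub>"
    unfolding c(2)[symmetric] by (intro lincomb_cong) (auto simp: c'_def)
  moreover have "c l \<in> carrier R" if "l < n" for l
    using c(1) that PiE_mem[of c "{..<n}" "\<lambda>_. carrier R" l] by (simp add: free_module_simps)
  then have "c' \<in> UNIV \<rightarrow> carrier R" by (simp add: c'_def)
  moreover have "\<zero>\<^bsub>free_module R s\<^esub> i \<in> \<mm> \<cdot> \<mm>" if "i < s" for i using that by (simp add: free_module_simps)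
  ultimately have "c' l \<in> \<mm>" using assms(1,3) unfolding indep_mod_sq_def by metis
  then show ?thesis using assms(3) by (simp add: c'_def)
qed

text \<open>The last conclusion says that minimality of the given generators propagates through the
whole resolution.\<close>

theorem good_resolution:
  assumes N: "graded_module R gcomp N ncomp" and good: "good_seq R \<mm> N g s"
    and homog: "\<And>l. l < s \<Longrightarrow> ncomp (t0 l) (g l) = g l"
  obtains b t w where "b 0 = s" "t 0 = t0"
    "\<And>n. good_seq R \<mm> (free_module R (b n)) (w n) (b (Suc n))"
    "\<And>n l. l < b (Suc n) \<Longrightarrow> vcomp gcomp (b n) (t n) (t (Suc n) l) (w n l) = w n l"
    "lspan R (free_module R (b 0)) (w 0) (b 1) = syzygies R N g s"
    "\<And>n. lspan R (free_module R (b (Suc n))) (w (Suc n)) (b (Suc (Suc n))) =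
      syzygies R (free_module R (b n)) (w n) (b (Suc n))"
    "\<And>n l. l < b (Suc n) \<Longrightarrow> \<exists>i<b n. t (Suc n) l = t n i + 1"
    "\<And>n. (\<And>c l. \<lbrakk>c \<in> syzygies R N g s; l < s\<rbrakk> \<Longrightarrow> c l \<in> \<mm>) \<Longrightarrow> indep_mod_sq (b n) (w n) (b (Suc n))"
proof -
  define min where "min \<longleftrightarrow> (\<forall>c\<in>syzygies R N g s. \<forall>l<s. c l \<in> \<mm>)"
  define P where "P = (\<lambda>(b, t, b', t', w). good_seq R \<mm> (free_module R b) w b' \<and>
    (\<forall>l<b'. vcomp gcomp b t (t' l) (w l) = w l) \<and> (\<forall>l<b'. \<exists>i<b. t' l = t i + (1::int)) \<and>
    (min \<longrightarrow> indep_mod_sq b w b'))"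

  define Q where "Q = (\<lambda>(b :: nat, t :: nat \<Rightarrow> int, b', t' :: nat \<Rightarrow> int, w) (c, u, c' :: nat, u' :: nat \<Rightarrow> int, v).
    c = b' \<and> u = t' \<and> lspan R (free_module R c) v c' = syzygies R (free_module R b) w b')"
  obtain w0 n0 t1 where start: "good_seq R \<mm> (free_module R s) w0 n0"
    "lspan R (free_module R s) w0 n0 = syzygies R N g s"
    "\<And>l. l < n0 \<Longrightarrow> vcomp gcomp s t0 (t1 l) (w0 l) = w0 l"
    "\<And>l. l < n0 \<Longrightarrow> \<exists>i<s. t1 l = t0 i + 1" "min \<Longrightarrow> indep_mod_sq s w0 n0"
    unfolding min_def using syzygies_good[OF N good homog] by metis
  define S where "S = (s, t0, n0, t1, w0)"
  have "\<exists>f. \<forall>n. (P (f n) \<and> (n = 0 \<longrightarrow> f n = S)) \<and> Q (f n) (f (Suc n))"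
  proof (rule dependent_nat_choice[of "\<lambda>n x. P x \<and> (n = 0 \<longrightarrow> x = S)" "\<lambda>_. Q"])
    show "\<exists>x. P x \<and> ((0::nat) = 0 \<longrightarrow> x = S)" using start by (auto simp: P_def S_def)
    fix x and n :: nat assume x: "P x \<and> (n = 0 \<longrightarrow> x = S)"
    obtain b t b' t' w where xs: "x = (b, t, b', t', w)" by (metis prod_cases5)
    have "good_seq R \<mm> (free_module R b) w b'" "\<And>l. l < b' \<Longrightarrow> vcomp gcomp b t (t' l) (w l) = w l"
      and mi: "min \<Longrightarrow> indep_mod_sq b w b'"
      using x by (auto simp: P_def xs)
    from syzygies_good[OF free_module_graded this(1,2)] obtain v c' u' where
      v: "good_seq R \<mm> (free_module R b') v c'"
      "lspan R (free_module R b') v c' = syzygies R (free_module R b) w b'"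
      "\<And>l. l < c' \<Longrightarrow> vcomp gcomp b' t' (u' l) (v l) = v l"
      "\<And>l. l < c' \<Longrightarrow> \<exists>i<b'. u' l = t' i + 1"
      "(\<And>c l. \<lbrakk>c \<in> syzygies R (free_module R b) w b'; l < b'\<rbrakk> \<Longrightarrow> c l \<in> \<mm>) \<Longrightarrow> indep_mod_sq b' v c'"
      by metis
    have "min \<longrightarrow> indep_mod_sq b' v c'" using v(5) indep_mod_sq_syzygies mi by blast
    then have "P (b', t', c', u', v)" using v by (auto simp: P_def)
    moreover have "Q x (b', t', c', u', v)" using v by (auto simp: Q_def xs)
    ultimately show "\<exists>y. (P y \<and> (Suc n = 0 \<longrightarrow> y = S)) \<and> Q x y"
      by (intro exI[of _ "(b', t', c', u', v)"]) simp
  qed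
  then obtain f where fP: "\<And>n. P (f n)" and f0: "f 0 = S" and fQ: "\<And>n. Q (f n) (f (Suc n))" by blast
  define b where "b n = fst (f n)" for n
  define t where "t n = fst (snd (f n))" for n
  define w where "w n = snd (snd (snd (snd (f n))))" for n
  have f: "f n = (b n, t n, b (Suc n), t (Suc n), w n)" for n
    using fQ[of n] by (auto simp: Q_def b_def t_def w_def split: prod.splits)
  have f0': "b 0 = s" "t 0 = t0" "b (Suc 0) = n0" "w 0 = w0"
    using f[of 0] unfolding f0 S_def by auto
  show ?thesis
  proof (rule that[of b t w])
    show "b 0 = s" "t 0 = t0" using f0' by auto
    show "lspan R (free_module R (b 0)) (w 0) (b 1) = syzygies R N g s" using start(2) f0' by simp
    fix n
    have P: "P (b n, t n, b (Suc n), t (Suc n), w n)" using fP[of n] f by simp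
    then show "good_seq R \<mm> (free_module R (b n)) (w n) (b (Suc n))" by (simp add: P_def)
    show "lspan R (free_module R (b (Suc n))) (w (Suc n)) (b (Suc (Suc n))) =
      syzygies R (free_module R (b n)) (w n) (b (Suc n))"
      using fQ[of n] unfolding f by (simp add: Q_def)
    show "indep_mod_sq (b n) (w n) (b (Suc n))"
      if "\<And>c l. \<lbrakk>c \<in> syzygies R N g s; l < s\<rbrakk> \<Longrightarrow> c l \<in> \<mm>"
      using P that by (auto simp: P_def min_def)
    fix l assume l: "l < b (Suc n)"
    show "vcomp gcomp (b n) (t n) (t (Suc n) l) (w n l) = w n l" using P l by (simp add: P_def)
    show "\<exists>i<b n. t (Suc n) l = t n i + 1" using P l by (simp add: P_def)
  qed
qed

end

section \<open>The linear part of a minimal resolution\<close>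

lemma lin_diff_cls:
  assumes "filtered_module R M \<Phi>" "filtered_module R M' \<Phi>'" "h \<in> module_homs R M' M"
    "\<And>i x. x \<in> \<Phi>' i \<Longrightarrow> h x \<in> \<Phi> i" "\<And>i. x i \<in> \<Phi>' i"
  shows "(\<lambda>i. \<Union>u\<in>gr_class M' \<Phi>' x i. \<Phi> (Suc i) +>\<^bsub>M\<^esub> h u) = gr_class M \<Phi> (\<lambda>i. h (x i))"
proof
  fix i
  interpret M: filtered_module R M \<Phi> by fact
  interpret M': filtered_module R M' \<Phi>' by fact
  interpret H': abelian_subgroup "\<Phi>' (Suc i)" M' by (intro M'.submodule_abelian_subgroup M'.filt_sub)
  have x: "x i \<in> carrier M'" using assms(5) M'.filt_carrier by blast
  have eq: "\<Phi> (Suc i) +>\<^bsub>M\<^esub> h u = \<Phi> (Suc i) +>\<^bsub>M\<^esub> h (x i)" if "u \<in> gr_class M' \<Phi>' x i" for u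
  proof -
    have u: "u \<in> carrier M'" "u \<ominus>\<^bsub>M'\<^esub> x i \<in> \<Phi>' (Suc i)"
      using that x H'.a_elemrcos_carrier H'.a_rcos_module_imp by (auto simp: gr_class_def a_minus_def)
    have "h u \<ominus>\<^bsub>M\<^esub> h (x i) = h (u \<ominus>\<^bsub>M'\<^esub> x i)"
      using module_homs_minus[OF M'.module_axioms M.module_axioms assms(3) u(1) x] by simp
    also have "\<dots> \<in> \<Phi> (Suc i)" using u assms(4) by blast
    finally show ?thesis using M.coset_eq_iff[OF M.filt_sub] assms(3) u x
      by (auto simp: module_homs_def)
  qed
  have "x i \<in> gr_class M' \<Phi>' x i" using H'.a_rcos_self[OF x] by (simp add: gr_class_def)
  then have "(\<Union>u\<in>gr_class M' \<Phi>' x i. \<Phi> (Suc i) +>\<^bsub>M\<^esub> h u) = \<Phi> (Suc i) +>\<^bsub>M\<^esub> h (x i)"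
    using eq by blast
  then show "(\<Union>u\<in>gr_class M' \<Phi>' x i. \<Phi> (Suc i) +>\<^bsub>M\<^esub> h u) = gr_class M \<Phi> (\<lambda>i. h (x i)) i"
    by (simp add: gr_class_def)
qed

context short_ring
begin

lemma lin_filtration_free:
  "lin_filtration R \<mm> (\<lambda>n. free_module R (b n)) n i = {..<b n} \<rightarrow>\<^sub>E ideal_pow R \<mm> (i - n)"
  unfolding lin_filtration_def by (rule ideal_smult_free[OF ideal_pow_ideal[OF is_ideal]])

lemma lin_filtration_filtered:
  "filtered_module R (free_module R (b n)) (lin_filtration R \<mm> (\<lambda>n. free_module R (b n)) n)"
proof (intro filtered_module.intro filtered_module_axioms.intro free_module_module)
  interpret F: module R "free_module R (b n)" by (rule free_module_module)
  fix i
  show "submodule (lin_filtration R \<mm> (\<lambda>n. free_module R (b n)) n i) R (free_module R (b n))"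
    unfolding lin_filtration_def
    by (intro ideal_smult_submodule F.module_axioms ideal_pow_ideal is_ideal F.carrier_is_submodule)
  have "ideal_pow R \<mm> (Suc i - n) \<subseteq> ideal_pow R \<mm> (i - n)"
    using ideal_pow_desc[of "i - n"] by (cases "n \<le> i") (auto simp: Suc_diff_le)
  then show "lin_filtration R \<mm> (\<lambda>n. free_module R (b n)) n (Suc i)
      \<subseteq> lin_filtration R \<mm> (\<lambda>n. free_module R (b n)) n i"
    unfolding lin_filtration_free by (intro PiE_mono)
  have "{..<b n} \<rightarrow>\<^sub>E ideal_pow R \<mm> (i - n) = {\<zero>\<^bsub>free_module R (b n)\<^esub>}" if "i \<ge> n + 3" for i
  proof -
    have "i - n = (i - n - 3) + 3" using that by simp
    then have "ideal_pow R \<mm> (i - n) = {\<zero>}" using ideal_pow_bound by metis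
    then show ?thesis by (auto simp: free_module_simps PiE_iff extensional_def fun_eq_iff)
  qed
  then show "\<exists>k. \<forall>i\<ge>k. lin_filtration R \<mm> (\<lambda>n. free_module R (b n)) n i = {\<zero>\<^bsub>free_module R (b n)\<^esub>}"
    unfolding lin_filtration_free by blast
qed

lemma lincomb_ideal_pow:
  assumes w: "\<And>l. l < n \<Longrightarrow> w l \<in> {..<s} \<rightarrow>\<^sub>E \<mm>" and c: "c \<in> {..<n} \<rightarrow>\<^sub>E ideal_pow R \<mm> j"
  shows "lincomb (free_module R s) w n c \<in> {..<s} \<rightarrow>\<^sub>E ideal_pow R \<mm> (Suc j)"
proof -
  interpret F: module R "free_module R s" by (rule free_module_module)
  interpret J: ideal "ideal_pow R \<mm> (Suc j)" R by (rule ideal_pow_ideal[OF is_ideal])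
  have "lincomb (free_module R s) w k c \<in> {..<s} \<rightarrow>\<^sub>E ideal_pow R \<mm> (Suc j)" if "k \<le> n" for k
    using that
  proof (induction k)
    case 0
    have "(\<lambda>l\<in>{..<s}. \<zero>) \<in> {..<s} \<rightarrow>\<^sub>E ideal_pow R \<mm> (Suc j)" by (intro restrict_in_PiE J.zero_closed)
    then show ?case by (simp only: lincomb.simps free_module_simps)
  next
    case (Suc k)
    have "c k \<otimes> w k l \<in> ideal_pow R \<mm> (Suc j)" if "l < s" for l
      using PiE_mem[OF c, of k] PiE_mem[OF w[of k], of l] Suc.prems that
      by (auto simp: ideal_pow.simps(2) intro: ideal_prod.prod)
    moreover have "lincomb (free_module R s) w k c l \<in> ideal_pow R \<mm> (Suc j)" if "l < s" for l
      using PiE_mem[OF Suc.IH, of l] Suc.prems that by simp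
    ultimately have "(\<lambda>l\<in>{..<s}. lincomb (free_module R s) w k c l \<oplus> c k \<otimes> w k l)
        \<in> {..<s} \<rightarrow>\<^sub>E ideal_pow R \<mm> (Suc j)"
      by (intro restrict_in_PiE J.a_closed) auto
    moreover have "lincomb (free_module R s) w (Suc k) c =
        (\<lambda>l\<in>{..<s}. lincomb (free_module R s) w k c l \<oplus> c k \<otimes> w k l)"
      by (simp add: free_module_simps cong: restrict_cong)
    ultimately show ?case by (simp only:)
  qed
  then show ?thesis by blast
qed

text \<open>The cycles of the linear part are treated one internal degree at a time; the claim
\<open>exact\<close> in the proof states what exactness means for representatives.\<close>

theorem koszul_module_if_good:
  assumes N: "graded_module R gcomp N ncomp" and good: "good_seq R \<mm> N g s"
    and homog: "\<And>l. l < s \<Longrightarrow> ncomp (t l) (g l) = g l"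
    and span: "lspan R N g s = carrier N"
    and min: "\<And>c l. \<lbrakk>c \<in> syzygies R N g s; l < s\<rbrakk> \<Longrightarrow> c l \<in> \<mm>"
  shows "koszul_module R \<mm> N"
proof -
  interpret N: graded_module R gcomp N ncomp by fact
  have gN: "g l \<in> carrier N" if "l < s" for l using good that by (auto simp: good_seq_def)
  obtain b w where b0: "b 0 = s"
    and gw: "\<And>n. good_seq R \<mm> (free_module R (b n)) (w n) (b (Suc n))"
    and sp0: "lspan R (free_module R (b 0)) (w 0) (b 1) = syzygies R N g s"
    and sp: "\<And>n. lspan R (free_module R (b (Suc n))) (w (Suc n)) (b (Suc (Suc n))) =
      syzygies R (free_module R (b n)) (w n) (b (Suc n))"
    and ind: "\<And>n. indep_mod_sq (b n) (w n) (b (Suc n))"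
    using good_resolution[of N ncomp g s t, OF N good homog] min by metis
  define C where "C = (\<lambda>n. free_module R (b n))"
  define d where "d = (\<lambda>n. lincomb (free_module R (b n)) (w n) (b (Suc n)))"
  define \<Phi> where "\<Phi> n = lin_filtration R \<mm> C n" for n
  have \<Phi>: "\<Phi> n i = {..<b n} \<rightarrow>\<^sub>E ideal_pow R \<mm> (i - n)" for n i
    unfolding \<Phi>_def C_def by (rule lin_filtration_free)
  have wF: "w n l \<in> carrier (free_module R (b n))" if "l < b (Suc n)" for n l
    using gw[of n] that by (auto simp: good_seq_def)
  have res: "free_resolution R N b d (lincomb N g (b 0))"
    unfolding d_def using resolution_of_syzygies[of N b g w, OF N.module_axioms] gN wF span sp0 sp b0 by simp
  have wm: "w n l \<in> {..<b n} \<rightarrow>\<^sub>E \<mm>" if l: "l < b (Suc n)" for n l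
  proof -
    interpret F: module R "free_module R (b n)" by (rule free_module_module)
    have mem: "w n l \<in> lspan R (free_module R (b n)) (w n) (b (Suc n))" using l wF by (intro F.lspan_mem)
    have "w n l i \<in> \<mm>" if i: "i < b n" for i
    proof (cases n)
      case 0
      then show ?thesis using mem sp0 min i b0 by simp
    next
      case (Suc k)
      then show ?thesis using mem sp[of k] indep_mod_sq_syzygies[OF ind] i by simp
    qed
    then show ?thesis using wF[OF l] by (auto simp: free_module_simps PiE_iff)
  qed
  have dpow: "d n x \<in> \<Phi> n i" if "x \<in> \<Phi> (Suc n) i" for n i x
  proof -
    have "d n x \<in> {..<b n} \<rightarrow>\<^sub>E ideal_pow R \<mm> (Suc (i - Suc n))"
      using that wm unfolding d_def \<Phi> by (intro lincomb_ideal_pow)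
    moreover have "ideal_pow R \<mm> (Suc (i - Suc n)) \<subseteq> ideal_pow R \<mm> (i - n)"
    proof (cases "n < i")
      case True
      then have "Suc (i - Suc n) = i - n" by simp
      then show ?thesis by simp
    next
      case False
      then show ?thesis using ideal.Icarr[OF ideal_pow_ideal[OF is_ideal]] ideal_pow_desc[of 0] by (simp add: ideal_pow_simps)
    qed
    ultimately show ?thesis using PiE_mono[of "{..<b n}" "\<lambda>_. ideal_pow R \<mm> (Suc (i - Suc n))" "\<lambda>_. ideal_pow R \<mm> (i - n)"]
      unfolding \<Phi> by blast
  qed
  have minimal: "minimal_complex \<mm> C d"
  proof -
    have "d n x \<in> {..<b n} \<rightarrow>\<^sub>E \<mm>" if "x \<in> carrier (C (Suc n))" for n x
      using lincomb_ideal_pow[OF wm, where c = x and j = 0] that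
      by (simp add: d_def C_def free_module_simps ideal_pow_simps)
    then show ?thesis using ideal_smult_free[OF is_ideal] by (auto simp: minimal_complex_def C_def)
  qed
  have hom: "d n \<in> module_homs R (C (Suc n)) (C n)" for n
    unfolding d_def C_def using wF by (intro lincomb_hom_free free_module_module)
  have filt: "filtered_module R (C n) (\<Phi> n)" for n
    unfolding \<Phi>_def C_def by (rule lin_filtration_filtered)
  have zero\<Phi>: "\<zero>\<^bsub>C n\<^esub> \<in> \<Phi> n i" for n i using filtered_module.filt_zero[OF filt] .
  have exact: "\<exists>z\<in>\<Phi> (Suc (Suc k)) i. x \<ominus>\<^bsub>C (Suc k)\<^esub> d (Suc k) z \<in> \<Phi> (Suc k) (Suc i)"
    if x: "x \<in> \<Phi> (Suc k) i" and dx: "d k x \<in> \<Phi> k (Suc i)" for k i x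
  proof -
    interpret F: filtered_module R "C (Suc k)" "\<Phi> (Suc k)" by (rule filt)
    have xC: "x \<in> carrier (C (Suc k))" using x F.filt_carrier by blast
    have d0: "d (Suc k) \<zero>\<^bsub>C (Suc (Suc k))\<^esub> = \<zero>\<^bsub>C (Suc k)\<^esub>"
      using module_homs_zero[OF _ _ hom] free_module_module unfolding C_def by blast
    have "x \<ominus>\<^bsub>C (Suc k)\<^esub> \<zero>\<^bsub>C (Suc k)\<^esub> = x"
      using xC F.M.minus_equality[of "\<zero>\<^bsub>C (Suc k)\<^esub>" "\<zero>\<^bsub>C (Suc k)\<^esub>"] by (metis F.M.r_zero F.M.zero_closed a_minus_def)
    \<comment> \<open>If \<open>x\<close> represents the zero class, the preimage \<open>0\<close> works.\<close>
    then have triv: ?thesis if "x \<in> \<Phi> (Suc k) (Suc i)"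
      using that xC zero\<Phi>[of "Suc (Suc k)" i] d0 by (intro bexI[of _ "\<zero>\<^bsub>C (Suc (Suc k))\<^esub>"]) simp_all
    have hit: ?thesis if "z \<in> \<Phi> (Suc (Suc k)) i" "x = d (Suc k) z" for z
      using that xC F.filt_zero by (intro bexI[of _ z]) (auto simp: a_minus_def F.M.r_neg)
    \<comment> \<open>With \<open>F = C (Suc k)\<close>, the element \<open>x\<close> is in \<open>F\<close>, \<open>F\<close>, \<open>\<mm> F\<close>, \<open>\<mm>\<^sup>2 F\<close> and \<open>0\<close>, respectively. In the first case
      the filtration is still constant. In the second \<open>d k x\<close> lies in \<open>\<mm>\<^sup>2\<close>, so \<open>x\<close> lies in \<open>\<mm> F\<close> by independence.
      In the third \<open>d k x\<close> lies in \<open>\<mm>\<^sup>3 = 0\<close>, so \<open>x\<close> is a boundary. In the fourth \<open>x\<close> is the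
      boundary of an element with coordinates in \<open>\<mm>\<close>.\<close>
    consider "i \<le> k" | "i = Suc k" | "i = Suc (Suc k)" | "i = Suc (Suc (Suc k))" | "i \<ge> k + 4" by linarith
    then show ?thesis
    proof cases
      case 1
      then show ?thesis using xC by (intro triv) (simp add: \<Phi> C_def free_module_simps)
    next
      case 2
      define c where "c l = (if l < b (Suc k) then x l else \<zero>)" for l
      have c: "lincomb (free_module R (b k)) (w k) (b (Suc k)) c = d k x"
        unfolding d_def by (intro lincomb_cong) (auto simp: c_def)
      have "d k x \<in> {..<b k} \<rightarrow>\<^sub>E \<mm> \<cdot> \<mm>" using dx 2 ideal_pow_simps by (simp add: \<Phi> Suc_diff_le)
      then have "\<forall>i<b k. lincomb (free_module R (b k)) (w k) (b (Suc k)) c i \<in> \<mm> \<cdot> \<mm>"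
        unfolding c by (meson PiE_mem lessThan_iff)
      moreover have "c \<in> UNIV \<rightarrow> carrier R"
        using PiE_mem[of x "{..<b (Suc k)}" "\<lambda>_. carrier R"] xC by (auto simp: c_def C_def free_module_simps)
      ultimately have "c l \<in> \<mm>" if "l < b (Suc k)" for l
        using ind[of k] that unfolding indep_mod_sq_def by blast
      then have "x l \<in> \<mm>" if "l < b (Suc k)" for l using that by (simp add: c_def)
      then have "x \<in> {..<b (Suc k)} \<rightarrow>\<^sub>E \<mm>" using xC by (simp add: C_def free_module_simps PiE_iff)
      then show ?thesis using 2 ideal_pow_simps by (intro triv) (simp add: \<Phi>)
    next
      case 3
      have "d k x \<in> {..<b k} \<rightarrow>\<^sub>E {\<zero>}" using dx 3 ideal_pow_bound[of 0] 
        by (simp add: \<Phi> numeral_3_eq_3 Suc_diff_le)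
      then have "d k x = \<zero>\<^bsub>C k\<^esub>" by (auto simp: C_def free_module_simps PiE_iff extensional_def fun_eq_iff)
      then have "x \<in> syzygies R (free_module R (b k)) (w k) (b (Suc k))"
        using xC by (simp add: syzygies_def C_def d_def)
      then have "x \<in> d (Suc k) ` carrier (C (Suc (Suc k)))"
        using lspan_image[OF free_module_module wF] unfolding sp[symmetric] by (simp add: d_def C_def)
      then obtain z where "z \<in> carrier (C (Suc (Suc k)))" "x = d (Suc k) z" by blast
      then show ?thesis using 3 by (intro hit) (auto simp: \<Phi> C_def free_module_simps)
    next
      case 4
      have "x \<in> {..<b (Suc k)} \<rightarrow>\<^sub>E \<mm> \<cdot> \<mm>" using x 4 ideal_pow_simps by (simp add: \<Phi> Suc_diff_le)
      then have "x \<in> ideal_smult (free_module R (b (Suc k))) \<mm> (syzygies R (free_module R (b k)) (w k) (b (Suc k)))"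
        using indep_mod_sq_syzygies[OF ind] by (intro sq_in_syzygies[OF free_module_module gw]) auto
      then have "x \<in> ideal_smult (free_module R (b (Suc k))) \<mm>
          (lspan R (free_module R (b (Suc k))) (w (Suc k)) (b (Suc (Suc k))))"
        by (simp only: sp)
      then have "\<exists>z. z \<in> {..<b (Suc (Suc k))} \<rightarrow>\<^sub>E \<mm> \<and> x = d (Suc k) z"
        by (rule ideal_smult_lspan[OF is_ideal free_module_module wF, rotated]) (simp_all add: d_def, metis)
      then obtain z where z: "z \<in> {..<b (Suc (Suc k))} \<rightarrow>\<^sub>E \<mm>" "x = d (Suc k) z" by blast
      then show ?thesis using 4 ideal_pow_simps by (intro hit) (simp_all add: \<Phi> Suc_diff_le)
    next
      case 5
      then have "i - Suc k = (i - Suc k - 3) + 3" by simp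
      then have "ideal_pow R \<mm> (i - Suc k) = {\<zero>}" using ideal_pow_bound by metis
      then have "x = \<zero>\<^bsub>C (Suc k)\<^esub>" using x
        by (auto simp: \<Phi> C_def free_module_simps PiE_iff extensional_def fun_eq_iff)
      then show ?thesis using F.filt_zero by (intro triv) simp
    qed
  qed
  have "homology_zero (lin_complex R \<mm> C) (lin_diff R \<mm> C d) n" if "n > 0" for n
  proof -
    obtain k where n: "n = Suc k" using \<open>n > 0\<close> by (cases n) auto
    have lin: "lin_complex R \<mm> C m = assoc_graded (C m) (\<Phi> m)" for m by (simp add: lin_complex_def \<Phi>_def)
    have diff: "lin_diff R \<mm> C d m (gr_class (C (Suc m)) (\<Phi> (Suc m)) x) = gr_class (C m) (\<Phi> m) (\<lambda>i. d m (x i))"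
      if "\<And>i. x i \<in> \<Phi> (Suc m) i" for m x
      unfolding lin_diff_def \<Phi>_def[symmetric] by (rule lin_diff_cls[OF filt filt hom dpow that])
    interpret A: filtered_module R "C k" "\<Phi> k" by (rule filt)
    interpret B: filtered_module R "C (Suc k)" "\<Phi> (Suc k)" by (rule filt)
    interpret D: filtered_module R "C (Suc (Suc k))" "\<Phi> (Suc (Suc k))" by (rule filt)
    have dd: "d k (d (Suc k) x) = \<zero>\<^bsub>C k\<^esub>" if "x \<in> carrier (C (Suc (Suc k)))" for x
      using res that by (simp add: free_resolution_def chain_complex_def C_def)
    show ?thesis unfolding n
    proof (rule homology_zeroI)
      show "abelian_group (lin_complex R \<mm> C (Suc k))" "abelian_group (lin_complex R \<mm> C (Suc (Suc k)))"
        unfolding lin by (rule B.Gr_abelian_group D.Gr_abelian_group)+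
      show "lin_diff R \<mm> C d (Suc k) \<in> carrier (lin_complex R \<mm> C (Suc (Suc k))) \<rightarrow> carrier (lin_complex R \<mm> C (Suc k))"
        unfolding lin
      proof
        fix f assume "f \<in> carrier D.Gr"
        then obtain x where x: "\<And>i. x i \<in> \<Phi> (Suc (Suc k)) i" "f = D.cls x" by (rule D.GrE) (rule that; simp)
        show "lin_diff R \<mm> C d (Suc k) f \<in> carrier B.Gr"
          unfolding x(2) diff[OF x(1)] by (rule B.cls_closed[OF dpow[OF x(1)]])
      qed
      fix f h assume fh: "f \<in> carrier (lin_complex R \<mm> C (Suc (Suc k)))" "h \<in> carrier (lin_complex R \<mm> C (Suc (Suc k)))"
      obtain x where x: "\<And>i. x i \<in> \<Phi> (Suc (Suc k)) i" "f = D.cls x"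
        using fh(1) unfolding lin by (rule D.GrE) (rule that; simp)
      obtain y where y: "\<And>i. y i \<in> \<Phi> (Suc (Suc k)) i" "h = D.cls y"
        using fh(2) unfolding lin by (rule D.GrE) (rule that; simp)
      note xy = x y
      have "d (Suc k) (x i \<oplus>\<^bsub>C (Suc (Suc k))\<^esub> y i) = d (Suc k) (x i) \<oplus>\<^bsub>C (Suc k)\<^esub> d (Suc k) (y i)" for i
        using hom[of "Suc k"] D.filt_carrier[OF xy(1)[of i]] D.filt_carrier[OF xy(3)[of i]] by (simp add: module_homs_def)
      then show "lin_diff R \<mm> C d (Suc k) (f \<oplus>\<^bsub>lin_complex R \<mm> C (Suc (Suc k))\<^esub> h) =
        lin_diff R \<mm> C d (Suc k) f \<oplus>\<^bsub>lin_complex R \<mm> C (Suc k)\<^esub> lin_diff R \<mm> C d (Suc k) h"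
        unfolding lin xy(2,4) using xy(1,3) by (simp add: D.cls_add B.cls_add diff dpow D.filt_add)
    next
      show "cycles (lin_complex R \<mm> C) (lin_diff R \<mm> C d) (Suc k) = boundaries (lin_complex R \<mm> C) (lin_diff R \<mm> C d) (Suc k)"
      proof (intro equalityI subsetI)
        fix f assume "f \<in> boundaries (lin_complex R \<mm> C) (lin_diff R \<mm> C d) (Suc k)"
        then obtain h where h: "h \<in> carrier D.Gr" "f = lin_diff R \<mm> C d (Suc k) h"
          unfolding boundaries_def lin by (elim imageE) simp
        obtain x where x: "\<And>i. x i \<in> \<Phi> (Suc (Suc k)) i" "h = D.cls x" using h(1) by (rule D.GrE) (rule that; simp)
        have f: "f = B.cls (\<lambda>i. d (Suc k) (x i))" using x h diff by simp
        have "lin_diff R \<mm> C d k f = A.cls (\<lambda>i. d k (d (Suc k) (x i)))"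
          unfolding f using x(1) dpow by (subst diff) auto
        also have "\<dots> = \<zero>\<^bsub>A.Gr\<^esub>" using dd[OF D.filt_carrier[OF x(1)]] A.cls_zero by simp
        finally show "f \<in> cycles (lin_complex R \<mm> C) (lin_diff R \<mm> C d) (Suc k)"
          unfolding cycles_def lin using x(1) dpow B.cls_closed f by simp
      next
        fix f assume "f \<in> cycles (lin_complex R \<mm> C) (lin_diff R \<mm> C d) (Suc k)"
        then have f: "f \<in> carrier B.Gr" "lin_diff R \<mm> C d k f = \<zero>\<^bsub>A.Gr\<^esub>" unfolding cycles_def lin by auto
        obtain x where x: "\<And>i. x i \<in> \<Phi> (Suc k) i" "f = B.cls x" using f(1) by (rule B.GrE) (rule that; simp)
        have "A.cls (\<lambda>i. d k (x i)) = \<zero>\<^bsub>A.Gr\<^esub>" using f(2) x diff by simp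
        then have dx: "d k (x i) \<in> \<Phi> k (Suc i)" for i
          using A.cls_eq_zero_iff[of "\<lambda>i. d k (x i)", OF dpow[OF x(1)]] by simp
        have "\<forall>i. \<exists>z. z \<in> \<Phi> (Suc (Suc k)) i \<and> x i \<ominus>\<^bsub>C (Suc k)\<^esub> d (Suc k) z \<in> \<Phi> (Suc k) (Suc i)"
          using exact[OF x(1) dx] by blast
        from choice[OF this] obtain z where zz: "\<forall>i. z i \<in> \<Phi> (Suc (Suc k)) i \<and>
          x i \<ominus>\<^bsub>C (Suc k)\<^esub> d (Suc k) (z i) \<in> \<Phi> (Suc k) (Suc i)" ..
        then have z: "\<And>i. z i \<in> \<Phi> (Suc (Suc k)) i"
          "\<And>i. x i \<ominus>\<^bsub>C (Suc k)\<^esub> d (Suc k) (z i) \<in> \<Phi> (Suc k) (Suc i)" by simp_all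
        have "f = B.cls (\<lambda>i. d (Suc k) (z i))" unfolding x(2)
          using z x(1) dpow by (subst B.cls_eq_iff) auto
        also have "\<dots> = lin_diff R \<mm> C d (Suc k) (D.cls z)" using z diff by simp
        finally show "f \<in> boundaries (lin_complex R \<mm> C) (lin_diff R \<mm> C d) (Suc k)"
          unfolding boundaries_def lin using D.cls_closed[OF z(1)] by blast
      qed
    qed
  qed
  then show ?thesis using res minimal
    unfolding koszul_module_def minimal_free_resolution_def C_def by blast
qed

end

section \<open>Quotient modules and residue fields\<close>

lemma module_quot_simps:
  "\<zero>\<^bsub>module_quot M N\<^esub> = N" "X \<oplus>\<^bsub>module_quot M N\<^esub> Y = X <+>\<^bsub>M\<^esub> Y"
  "carrier (module_quot M N) = a_rcosets\<^bsub>M\<^esub> N"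
  "a \<odot>\<^bsub>module_quot M N\<^esub> X = (\<Union>x\<in>X. N +>\<^bsub>M\<^esub> (a \<odot>\<^bsub>M\<^esub> x))"
  by (simp_all add: module_quot_def)

context module
begin

lemma module_quot_carrier: "carrier (module_quot M N) = (\<lambda>x. N +>\<^bsub>M\<^esub> x) ` carrier M"
  by (auto simp: module_quot_def A_RCOSETS_def')

lemma module_quot_add:
  assumes "submodule N R M" "x \<in> carrier M" "y \<in> carrier M"
  shows "(N +>\<^bsub>M\<^esub> x) \<oplus>\<^bsub>module_quot M N\<^esub> (N +>\<^bsub>M\<^esub> y) = N +>\<^bsub>M\<^esub> (x \<oplus>\<^bsub>M\<^esub> y)"
  using abelian_subgroup.a_rcos_sum[OF submodule_abelian_subgroup[OF assms(1)] assms(2,3)]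
  by (simp add: module_quot_simps)

lemma coset_mem_iff:
  assumes "submodule N R M" "x \<in> carrier M"
  shows "u \<in> N +>\<^bsub>M\<^esub> x \<longleftrightarrow> u \<in> carrier M \<and> u \<ominus>\<^bsub>M\<^esub> x \<in> N"
proof -
  interpret N: abelian_subgroup N M by (rule submodule_abelian_subgroup[OF assms(1)])
  show ?thesis using N.a_elemrcos_carrier[OF assms(2)] N.a_rcos_module[OF assms(2)]
    by (auto simp: a_minus_def)
qed

lemma module_quot_smult:
  assumes N: "submodule N R M" and "a \<in> carrier R" and x: "x \<in> carrier M"
  shows "a \<odot>\<^bsub>module_quot M N\<^esub> (N +>\<^bsub>M\<^esub> x) = N +>\<^bsub>M\<^esub> (a \<odot>\<^bsub>M\<^esub> x)"
proof -
  have eq: "N +>\<^bsub>M\<^esub> (a \<odot>\<^bsub>M\<^esub> u) = N +>\<^bsub>M\<^esub> (a \<odot>\<^bsub>M\<^esub> x)" if "u \<in> N +>\<^bsub>M\<^esub> x" for u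
  proof -
    have u: "u \<in> carrier M" "u \<ominus>\<^bsub>M\<^esub> x \<in> N" using that coset_mem_iff[OF N x] by auto
    have "a \<odot>\<^bsub>M\<^esub> (u \<ominus>\<^bsub>M\<^esub> x) \<in> N" using submoduleE(4)[OF N] assms(2) u by blast
    moreover have "a \<odot>\<^bsub>M\<^esub> (u \<ominus>\<^bsub>M\<^esub> x) = a \<odot>\<^bsub>M\<^esub> u \<ominus>\<^bsub>M\<^esub> a \<odot>\<^bsub>M\<^esub> x"
      using assms u by (simp add: a_minus_def smult_r_distr smult_r_minus)
    ultimately show ?thesis using assms u by (subst coset_eq_iff[OF N]) auto
  qed
  have "x \<in> N +>\<^bsub>M\<^esub> x"
    using abelian_subgroup.a_rcos_self[OF submodule_abelian_subgroup[OF N] x] .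
  then show ?thesis unfolding module_quot_simps using eq by blast
qed

lemma module_quot_zero: "submodule N R M \<Longrightarrow> \<zero>\<^bsub>module_quot M N\<^esub> = N +>\<^bsub>M\<^esub> \<zero>\<^bsub>M\<^esub>"
  using coset_zero by (simp add: module_quot_simps)

lemma module_quot_module:
  assumes N: "submodule N R M"
  shows "module R (module_quot M N)"
proof (rule moduleI)
  show "abelian_group (module_quot M N)"
  proof (rule abelian_groupI)
    show "\<zero>\<^bsub>module_quot M N\<^esub> \<in> carrier (module_quot M N)"
      unfolding module_quot_zero[OF N] module_quot_carrier by blast
  next
    fix X assume "X \<in> carrier (module_quot M N)"
    then obtain x where x: "X = N +>\<^bsub>M\<^esub> x" "x \<in> carrier M" unfolding module_quot_carrier by blast
    show "\<zero>\<^bsub>module_quot M N\<^esub> \<oplus>\<^bsub>module_quot M N\<^esub> X = X"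
      unfolding module_quot_zero[OF N] x(1) using x by (simp add: module_quot_add[OF N] del: a_coset_add_zero)
    have "(N +>\<^bsub>M\<^esub> (\<ominus>\<^bsub>M\<^esub> x)) \<oplus>\<^bsub>module_quot M N\<^esub> X = \<zero>\<^bsub>module_quot M N\<^esub>"
      unfolding x(1) module_quot_zero[OF N] using x by (subst module_quot_add[OF N]) (auto simp: M.l_neg)
    then show "\<exists>Y\<in>carrier (module_quot M N). Y \<oplus>\<^bsub>module_quot M N\<^esub> X = \<zero>\<^bsub>module_quot M N\<^esub>"
      unfolding module_quot_carrier using x by blast
  qed (auto simp: module_quot_carrier module_quot_add[OF N] M.a_ac)
qed (auto simp: module_quot_carrier module_quot_add[OF N] module_quot_smult[OF N] cring_axioms
    is_cring smult_l_distr smult_r_distr smult_assoc1)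

lemma finite_subset_lspan:
  assumes "finite X" "X \<subseteq> carrier M"
  obtains g s where "\<And>l. l < s \<Longrightarrow> g l \<in> X" "X \<subseteq> lspan R M g s" "s = card X" "inj_on g {..<s}"
proof -
  obtain g where g: "bij_betw g {0..<card X} X" using ex_bij_betw_nat_finite[OF assms(1)] by blast
  have gX: "g l \<in> X" if "l < card X" for l using g that by (auto simp: bij_betw_def)
  have "x \<in> lspan R M g (card X)" if "x \<in> X" for x
  proof -
    have "x \<in> g ` {0..<card X}" using g \<open>x \<in> X\<close> by (simp add: bij_betw_def)
    then obtain l where "l < card X" "x = g l" by auto
    then show ?thesis using gX assms(2) by (auto intro!: lspan_mem)
  qed
  then show ?thesis using that[of "card X" g] gX g by (auto simp: bij_betw_def atLeast0LessThan)
qed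

end

section \<open>Local rings with the annihilator condition\<close>

context cring
begin

lemma self_submodule_iff_ideal: "submodule H R (self_module R) \<longleftrightarrow> ideal H R"
proof
  interpret S: module R "self_module R" by (rule self_module_module)
  assume H: "submodule H R (self_module R)"
  have eq: "subgroup H (add_monoid (self_module R)) \<longleftrightarrow> subgroup H (add_monoid R)"
    by (simp add: subgroup_def self_module_def m_inv_def)
  show "ideal H R"
  proof (rule idealI)
    show "subgroup H (add_monoid R)" using submodule.axioms(1)[OF H] eq by simp
    fix a x assume a: "a \<in> H" and x: "x \<in> carrier R"
    show "x \<otimes> a \<in> H" using S.submoduleE(4)[OF H x a] by (simp add: self_module_def)
    moreover have "a \<in> carrier R" using S.submoduleE(1)[OF H] a by (auto simp: self_module_def)
    ultimately show "a \<otimes> x \<in> H" using x by (simp add: m_comm)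
  qed (rule ring_axioms)
next
  interpret S: module R "self_module R" by (rule self_module_module)
  assume "ideal H R"
  then interpret ideal H R .
  show "submodule H R (self_module R)"
    by (rule S.submodule_criterion) (auto simp: self_module_def I_l_closed)
qed

text \<open>Used to recognise the quotients of a local ring as local.\<close>

lemma local_criterion:
  assumes "ideal \<mm> R" "\<one> \<notin> \<mm>" "\<And>a. \<lbrakk>a \<in> carrier R; a \<notin> \<mm>\<rbrakk> \<Longrightarrow> a \<in> Units R"
  shows "maximalideal \<mm> R" "maximalideal J R \<Longrightarrow> J = \<mm>"
proof -
  interpret ideal \<mm> R by fact
  have sub: "J \<subseteq> \<mm> \<or> J = carrier R" if "ideal J R" for J
  proof -
    interpret J: ideal J R by fact
    show ?thesis
    proof (rule disjCI)
      assume "J \<noteq> carrier R"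
      then have "\<one> \<notin> J" using J.one_imp_carrier by blast
      show "J \<subseteq> \<mm>"
      proof
        fix a assume "a \<in> J"
        show "a \<in> \<mm>"
        proof (rule ccontr)
          assume "a \<notin> \<mm>"
          then have "a \<in> Units R" using assms(3) J.Icarr[OF \<open>a \<in> J\<close>] by blast
          then have "inv a \<otimes> a = \<one>" "inv a \<in> carrier R" by auto
          then show False using J.I_l_closed[OF \<open>a \<in> J\<close>, of "inv a"] \<open>\<one> \<notin> J\<close> by simp
        qed
      qed
    qed
  qed
  show "maximalideal \<mm> R"
  proof (rule maximalidealI)
    show "carrier R \<noteq> \<mm>" using assms(2) by blast
  qed (use sub assms in blast)+
  show "J = \<mm>" if "maximalideal J R"
  proof -
    interpret J: maximalideal J R by fact
    have "J \<subseteq> \<mm>" using sub[OF J.is_ideal] J.I_notcarr by blast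
    from J.I_maximal[OF is_ideal this a_subset] show ?thesis
    proof
      assume "\<mm> = carrier R"
      then show ?thesis using assms(2) by simp
    qed simp
  qed
qed

end

context noetherian_local_ring
begin

lemma nonunit_in_max:
  assumes "a \<in> carrier R" "a \<notin> \<mm>"
  shows "a \<in> Units R"
proof (rule ccontr)
  assume nu: "a \<notin> Units R"
  define \<A> where "\<A> = {I. ideal I R \<and> a \<in> I \<and> \<one> \<notin> I}"
  have "PIdl a \<in> \<A>"
  proof -
    have "\<one> \<notin> PIdl a"
    proof
      assume "\<one> \<in> PIdl a"
      then obtain b where "b \<in> carrier R" "\<one> = b \<otimes> a" by (auto simp: cgenideal_def)
      then have "b \<otimes> a = \<one>" "a \<otimes> b = \<one>" using assms(1) by (auto simp: m_comm)
      then have "a \<in> Units R" using assms(1) \<open>b \<in> carrier R\<close> unfolding Units_def by blast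
      then show False using nu by simp
    qed
    then show ?thesis using cgenideal_ideal[OF assms(1)] cgenideal_self[OF assms(1)] by (simp add: \<A>_def)
  qed
  have "\<exists>J\<in>\<A>. \<forall>X\<in>\<A>. J \<subseteq> X \<longrightarrow> X = J"
  proof (rule subset_Zorn)
    fix C assume C: "subset.chain \<A> C"
    show "\<exists>U\<in>\<A>. \<forall>X\<in>C. X \<subseteq> U"
    proof (cases "C = {}")
      case True
      then show ?thesis using \<open>PIdl a \<in> \<A>\<close> by blast
    next
      case False
      have "subset.chain {I. ideal I R} C" using C unfolding pred_on.chain_def \<A>_def by blast
      then have "\<Union>C \<in> C" using False ideal_chain_is_trivial by blast
      moreover have "C \<subseteq> \<A>" using C by (simp add: pred_on.chain_def)
      ultimately have "\<Union>C \<in> \<A>" by (rule rev_subsetD)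
      then show ?thesis by (rule bexI[rotated]) (simp add: Union_upper)
    qed
  qed
  then obtain J where J: "J \<in> \<A>" "\<And>X. \<lbrakk>X \<in> \<A>; J \<subseteq> X\<rbrakk> \<Longrightarrow> X = J" by blast
  have "maximalideal J R"
  proof (rule maximalidealI)
    show "ideal J R" "carrier R \<noteq> J" using J(1) by (auto simp: \<A>_def)
    fix K assume K: "ideal K R" "J \<subseteq> K" "K \<subseteq> carrier R"
    show "K = J \<or> K = carrier R"
    proof (cases "\<one> \<in> K")
      case True
      then show ?thesis using ideal.one_imp_carrier[OF K(1)] by blast
    next
      case False
      then have "K \<in> \<A>" using K J(1) by (auto simp: \<A>_def)
      then show ?thesis using J(2) K(2) by blast
    qed
  qed
  then have "J = \<mm>" by (rule maximal_unique)
  then show False using J(1) assms(2) by (simp add: \<A>_def)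
qed

lemma one_notin_max: "\<one> \<notin> \<mm>"
  using I_notcarr one_imp_carrier by blast

lemma ideal_pow_two: "ideal_pow R \<mm> 2 = \<mm> \<cdot> \<mm>"
proof -
  have "carrier R \<cdot> \<mm> = \<mm>"
  proof
    show "carrier R \<cdot> \<mm> \<subseteq> \<mm>" using ideal_prod_inter[OF oneideal is_ideal] by blast
    show "\<mm> \<subseteq> carrier R \<cdot> \<mm>" using ideal_prod.prod[of \<one> "carrier R" _ \<mm> R] by force
  qed
  then show ?thesis by (simp add: numeral_2_eq_2 ideal_pow.simps(2))
qed

lemma ideal_lspan:
  assumes "ideal I R"
  obtains y s where "\<And>l. l < s \<Longrightarrow> y l \<in> I" "I = lspan R (self_module R) y s"
proof -
  interpret S: module R "self_module R" by (rule self_module_module)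
  obtain A where A: "A \<subseteq> carrier R" "finite A" "I = Idl A" using finetely_gen[OF assms] by blast
  then obtain y s where y: "\<And>l. l < s \<Longrightarrow> y l \<in> A" "A \<subseteq> lspan R (self_module R) y s"
    using S.finite_subset_lspan[of A] by (metis self_module_def partial_object.select_convs(1))
  have AI: "A \<subseteq> I" using genideal_self[OF A(1)] A(3) by simp
  have "submodule I R (self_module R)" using assms self_submodule_iff_ideal by blast
  then have "lspan R (self_module R) y s \<subseteq> I" using y(1) AI by (intro S.lspan_least) auto
  moreover have "ideal (lspan R (self_module R) y s) R"
    unfolding self_submodule_iff_ideal[symmetric] using y(1) A(1)
    by (intro S.lspan_submodule) (auto simp: self_module_def)
  then have "I \<subseteq> lspan R (self_module R) y s" unfolding A(3) using y(2) by (rule genideal_minimal)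
  ultimately show ?thesis using that[of s y] y(1) AI by blast
qed

text \<open>Nakayama's lemma for the maximal ideal itself: in a shortest generating sequence the last element
is a combination with coefficients in \<open>\<mm>\<close>, hence redundant as \<open>\<one> \<ominus> c\<close> is a unit for \<open>c \<in> \<mm>\<close>.\<close>

lemma idempotent_max_zero:
  assumes "\<mm> \<subseteq> \<mm> \<cdot> \<mm>"
  shows "\<mm> = {\<zero>}"
proof -
  interpret S: module R "self_module R" by (rule self_module_module)
  define P where "P s \<longleftrightarrow> (\<exists>y. (\<forall>l<s. y l \<in> \<mm>) \<and> \<mm> = lspan R (self_module R) y s)" for s
  have "\<exists>s. P s" using ideal_lspan[OF is_ideal] unfolding P_def by metis
  define s where "s = (LEAST s. P s)"
  have "P s" unfolding s_def using \<open>\<exists>s. P s\<close> by (rule LeastI_ex)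
  then obtain y where y: "\<And>l. l < s \<Longrightarrow> y l \<in> \<mm>" "\<mm> = lspan R (self_module R) y s" unfolding P_def by blast
  show ?thesis
  proof (cases s)
    case 0
    then show ?thesis using y(2) one_notin_max by (auto simp: lspan_def self_module_def)
  next
    case (Suc r)
    have yR: "y l \<in> carrier (self_module R)" if "l < s" for l using y(1)[OF that] by (auto simp: self_module_def)
    have "x \<in> ideal_smult (self_module R) \<mm> \<mm>" if "x \<in> \<mm> \<cdot> \<mm>" for x using that
    proof induction
      case (prod i j)
      then show ?case using ideal_smult.smult[of i \<mm> j \<mm> "self_module R"] by (simp add: self_module_def)
    next
      case (sum a b)
      then show ?case using ideal_smult.sum[of a "self_module R" \<mm> \<mm> b] by (simp add: self_module_def)
    qed
    then have "y r \<in> ideal_smult (self_module R) \<mm> (lspan R (self_module R) y s)"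
      using assms y(1)[of r] Suc y(2) by auto
    then obtain c where c: "c \<in> {..<s} \<rightarrow>\<^sub>E \<mm>" "y r = lincomb (self_module R) y s c"
      by (rule ideal_smult_lspan[OF is_ideal S.module_axioms yR, rotated])
    have cm: "c l \<in> \<mm>" if "l < s" for l using PiE_mem[OF c(1), of l] that by simp
    define z where "z = lincomb (self_module R) y r c"
    have z: "z \<in> lspan R (self_module R) y r" unfolding z_def using cm Suc by (intro S.lspanI) auto
    have zR: "z \<in> carrier R" unfolding z_def using S.lincomb_closed[of r y c] yR cm Suc by (auto simp: self_module_def)
    have yr: "y r \<in> carrier R" "c r \<in> carrier R" using y(1) cm Suc by auto
    have eq: "y r = z \<oplus> c r \<otimes> y r" using c(2) Suc by (simp add: z_def self_module_def)
    have "\<one> \<ominus> c r \<notin> \<mm>"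
    proof
      assume "\<one> \<ominus> c r \<in> \<mm>"
      then have "(\<one> \<ominus> c r) \<oplus> c r \<in> \<mm>" using cm Suc by auto
      then show False using yr one_notin_max by (simp add: a_minus_def a_assoc l_neg)
    qed
    then have U: "\<one> \<ominus> c r \<in> Units R" using nonunit_in_max yr by simp
    have "(\<one> \<ominus> c r) \<otimes> y r = y r \<ominus> c r \<otimes> y r"
      using yr by (simp add: a_minus_def l_distr l_minus)
    also have "\<dots> = (z \<oplus> c r \<otimes> y r) \<ominus> c r \<otimes> y r" using eq by simp
    also have "\<dots> = z" using yr zR by (simp add: a_minus_def a_assoc r_neg)
    finally have "(\<one> \<ominus> c r) \<otimes> y r = z" .
    then have "y r = inv (\<one> \<ominus> c r) \<otimes> z" using U yr by (metis Units_closed Units_inv_closed Units_l_inv l_one m_assoc)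
    moreover have L: "submodule (lspan R (self_module R) y r) R (self_module R)"
      using yR Suc by (intro S.lspan_submodule) auto
    ultimately have "y r \<in> lspan R (self_module R) y r"
      using S.submoduleE(4)[OF L, of "inv (\<one> \<ominus> c r)" z] U z by (simp add: self_module_def)
    then have "y l \<in> lspan R (self_module R) y r" if "l < s" for l
      using that Suc yR S.lspan_mem[of l r y] by (cases "l = r") auto
    then have "\<mm> \<subseteq> lspan R (self_module R) y r" unfolding y(2) by (intro S.lspan_least[OF L])
    moreover have "lspan R (self_module R) y r \<subseteq> \<mm>"
      using y(1) Suc is_ideal by (intro S.lspan_least) (auto simp: self_submodule_iff_ideal)
    ultimately have "\<mm> = lspan R (self_module R) y r" by (rule equalityI)
    moreover have "\<forall>l<r. y l \<in> \<mm>" using y(1) Suc by simp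
    ultimately have "P r" unfolding P_def by blast
    then have "s \<le> r" unfolding s_def by (rule Least_le)
    then show ?thesis using Suc by simp
  qed
qed

text \<open>For \<open>x \<in> \<mm> - \<mm>\<^sup>2\<close> the hypothesis gives \<open>x \<mm>\<^sup>2 = x ann(x) \<mm> = 0\<close>. An element \<open>a \<in> \<mm>\<^sup>2\<close>
is a difference of two such elements, \<open>(a + x) - x\<close>, provided one exists; otherwise \<open>\<mm> = 0\<close>.\<close>

lemma short_ring_if_ann:
  assumes ann: "\<forall>x \<in> \<mm> - ideal_pow R \<mm> 2. annihilator R x \<cdot> \<mm> = ideal_pow R \<mm> 2"
  shows "short_ring \<mm> R (\<lambda>_ a. a)"
proof -
  interpret S: module R "self_module R" by (rule self_module_module)
  interpret sq: ideal "\<mm> \<cdot> \<mm>" R by (rule ideal_prod_is_ideal[OF is_ideal is_ideal])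
  have ann': "annihilator R x \<cdot> \<mm> = \<mm> \<cdot> \<mm>" if "x \<in> \<mm>" "x \<notin> \<mm> \<cdot> \<mm>" for x
    using ann that unfolding ideal_pow_two by blast
  have kill: "x \<otimes> b = \<zero>" if x: "x \<in> \<mm>" "x \<notin> \<mm> \<cdot> \<mm>" and b: "b \<in> \<mm> \<cdot> \<mm>" for x b
  proof -
    have "b \<in> annihilator R x \<cdot> \<mm>" using ann' x b by simp
    then show ?thesis
    proof induction
      case (prod i j)
      then have c: "i \<in> carrier R" "i \<otimes> x = \<zero>" "j \<in> carrier R" "x \<in> carrier R"
        using x by (auto simp: annihilator_def)
      have "x \<otimes> i = \<zero>" using c m_comm[of x i] by simp
      then show ?case using c(1,3,4) m_assoc[of x i j, symmetric] by simp
    next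
      case (sum a b)
      have "annihilator R x \<cdot> \<mm> \<subseteq> carrier R" using ann' x sq.a_subset by simp
      then have "a \<in> carrier R" "b \<in> carrier R" "x \<in> carrier R" using sum x by auto
      then show ?case using sum by (simp add: r_distr)
    qed
  qed
  have cube: "a \<otimes> b = \<zero>" if a: "a \<in> \<mm>" and b: "b \<in> \<mm> \<cdot> \<mm>" for a b
  proof (cases "\<mm> \<subseteq> \<mm> \<cdot> \<mm>")
    case True
    then have "\<mm> = {\<zero>}" by (rule idempotent_max_zero)
    then show ?thesis using a sq.Icarr[OF b] by simp
  next
    case False
    then obtain x where x: "x \<in> \<mm>" "x \<notin> \<mm> \<cdot> \<mm>" by blast
    show ?thesis
    proof (cases "a \<in> \<mm> \<cdot> \<mm>")
      case True
      have "(a \<oplus> x) \<notin> \<mm> \<cdot> \<mm>"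
      proof
        assume "a \<oplus> x \<in> \<mm> \<cdot> \<mm>"
        then have "(\<ominus> a) \<oplus> (a \<oplus> x) \<in> \<mm> \<cdot> \<mm>" using True by blast
        then show False using x a by (simp add: r_neg1)
      qed
      moreover have "a \<oplus> x \<in> \<mm>" using a x by blast
      ultimately have "(a \<oplus> x) \<otimes> b = \<zero>" using kill b by blast
      then show ?thesis using kill[OF x b] a x sq.Icarr[OF b] by (simp add: l_distr)
    qed (use kill a b in blast)
  qed
  show ?thesis
  proof (intro short_ring.intro short_ring_axioms.intro graded_cring.intro graded_cring_axioms.intro)
    fix y :: "nat \<Rightarrow> 'a" assume y: "\<And>n. y n \<in> \<mm>"
    define L where "L n = lspan R (self_module R) y n" for n
    have yR: "y n \<in> carrier (self_module R)" for n using y[of n] by (auto simp: self_module_def)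
    have L: "ideal (L n) R" for n
      unfolding L_def self_submodule_iff_ideal[symmetric] using yR by (intro S.lspan_submodule)
    have mono: "L n \<subseteq> L k" if "n \<le> k" for n k
    proof -
      have sub: "submodule (L k) R (self_module R)" using L self_submodule_iff_ideal by blast
      show ?thesis unfolding L_def
        using that yR S.lspan_mem[of _ k y] by (intro S.lspan_least[OF sub[unfolded L_def]]) auto
    qed
    have "L a \<subseteq> L b \<or> L b \<subseteq> L a" for a b using mono nat_le_linear[of a b] by blast
    then have "subset.chain {I. ideal I R} (range L)"
      unfolding pred_on.chain_def using L by (simp add: image_subset_iff subset_iff_psubset_eq) blast
    then have "\<Union>(range L) \<in> range L" by (intro ideal_chain_is_trivial) auto
    then obtain n where n: "\<Union>(range L) = L n" by blast
    have "y n \<in> L (Suc n)" unfolding L_def using yR by (intro S.lspan_mem) auto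
    then have "y n \<in> L n" using n by blast
    moreover have "y n \<ominus> y n \<in> \<mm> \<cdot> \<mm>" using y[of n] by (simp add: a_minus_def r_neg)
    ultimately show "\<exists>n. \<exists>z\<in>lspan R (self_module R) y n. y n \<ominus> z \<in> \<mm> \<cdot> \<mm>" unfolding L_def by blast
  next
    fix u assume "u \<in> \<mm>"
    then show "u \<ominus> u \<in> \<mm> \<cdot> \<mm>" by (simp add: a_minus_def r_neg)
  qed (use cube ann' one_notin_max nonunit_in_max cring_axioms is_ideal is_cring in auto)
qed

text \<open>A subset \<open>Y\<close> of \<open>X\<close> of least cardinality that still generates has only syzygies with
coordinates in \<open>\<mm>\<close>, because a unit coordinate would make a generator redundant. The colon ideals of
\<open>Y\<close>, in any order, contain the annihilators of its elements, so \<open>Y\<close> is good.\<close>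

lemma koszul_if_generated:
  assumes ann: "\<forall>x \<in> \<mm> - ideal_pow R \<mm> 2. annihilator R x \<cdot> \<mm> = ideal_pow R \<mm> 2"
    and N: "module R N" and X: "finite X" "X \<subseteq> carrier N"
    and gen: "\<And>H. \<lbrakk>submodule H R N; X \<subseteq> H\<rbrakk> \<Longrightarrow> H = carrier N"
    and colon: "\<And>x. x \<in> X \<Longrightarrow> \<mm> \<cdot> \<mm> \<subseteq> {a \<in> carrier R. a \<odot>\<^bsub>N\<^esub> x = \<zero>\<^bsub>N\<^esub>} \<cdot> \<mm>"
  shows "koszul_module R \<mm> N"
proof -
  interpret sr: short_ring \<mm> R "\<lambda>_ a. a" by (rule short_ring_if_ann[OF ann])
  interpret N: module R N by fact
  define P where "P Y \<longleftrightarrow> Y \<subseteq> X \<and> (\<forall>H. submodule H R N \<and> Y \<subseteq> H \<longrightarrow> H = carrier N)" for Y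
  have "P X" using gen by (auto simp: P_def)
  then obtain Y where Y: "P Y" "\<And>Z. P Z \<Longrightarrow> card Y \<le> card Z"
    using ex_has_least_nat[of P X card] by blast
  have fY: "finite Y" and YN: "Y \<subseteq> carrier N" using Y(1) X by (auto simp: P_def intro: finite_subset)
  obtain g s where g: "\<And>l. l < s \<Longrightarrow> g l \<in> Y" "Y \<subseteq> lspan R N g s" "s = card Y" "inj_on g {..<s}"
    using N.finite_subset_lspan[OF fY YN] by metis
  have gN: "g l \<in> carrier N" if "l < s" for l using g(1)[OF that] YN by blast
  have gY: "g ` {..<s} = Y"
    using g(1,3,4) fY by (intro card_subset_eq) (auto simp: card_image)
  have span: "lspan R N g s = carrier N" using Y(1) g(2) N.lspan_submodule[of s g] gN by (auto simp: P_def)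
  have min: "c l \<in> \<mm>" if c: "c \<in> syzygies R N g s" and l: "l < s" for c l
  proof (rule ccontr)
    assume nm: "c l \<notin> \<mm>"
    have cR: "c i \<in> carrier R" if "i < s" for i
      using c that PiE_mem[of c "{..<s}" "\<lambda>_. carrier R" i] by (simp add: syzygies_def free_module_simps)
    have U: "c l \<in> Units R" using nonunit_in_max cR l nm by blast
    have "H = carrier N" if H: "submodule H R N" "Y - {g l} \<subseteq> H" for H
    proof -
      have gH: "g i \<in> H" if "i < s" "i \<noteq> l" for i
        using that g(4) l gY H(2) by (auto simp: inj_on_def)
      define c' where "c' i = (if i = l then \<zero> else c i)" for i
      have in_H: "lincomb N g s c' \<in> H"
      proof (rule N.submodule_lincomb_terms[OF H(1)])
        fix i assume i: "i < s"
        show "c' i \<odot>\<^bsub>N\<^esub> g i \<in> H"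
        proof (cases "i = l")
          case True
          then show ?thesis using gN[OF i] N.submodule_zero[OF H(1)] by (simp add: c'_def)
        next
          case False
          then show ?thesis using N.submoduleE(4)[OF H(1) cR[OF i] gH[OF i]] by (simp add: c'_def)
        qed
      qed
      have "\<zero>\<^bsub>N\<^esub> = lincomb N g s c" using c by (simp add: syzygies_def)
      also have "\<dots> = lincomb N g s (\<lambda>i. c' i \<oplus> (if i = l then c l else \<zero>))"
        using cR by (intro lincomb_cong) (auto simp: c'_def)
      also have "\<dots> = lincomb N g s c' \<oplus>\<^bsub>N\<^esub> lincomb N g s (\<lambda>i. if i = l then c l else \<zero>)"
        using cR gN l by (intro N.lincomb_add) (auto simp: c'_def)
      also have "lincomb N g s (\<lambda>i. if i = l then c l else \<zero>) = c l \<odot>\<^bsub>N\<^esub> g l"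
        using l gN cR by (intro N.lincomb_single) auto
      finally have eq: "lincomb N g s c' \<oplus>\<^bsub>N\<^esub> c l \<odot>\<^bsub>N\<^esub> g l = \<zero>\<^bsub>N\<^esub>" by simp
      have cl: "lincomb N g s c' \<in> carrier N" "c l \<odot>\<^bsub>N\<^esub> g l \<in> carrier N"
        using in_H N.submoduleE(1)[OF H(1)] cR gN l by auto
      have "c l \<odot>\<^bsub>N\<^esub> g l = \<ominus>\<^bsub>N\<^esub> lincomb N g s c'"
        using eq cl N.M.minus_equality[of "c l \<odot>\<^bsub>N\<^esub> g l" "lincomb N g s c'"] by (simp add: N.M.a_comm)
      then have "c l \<odot>\<^bsub>N\<^esub> g l \<in> H" using N.submoduleE(3)[OF H(1) in_H] by simp
      then have "inv (c l) \<odot>\<^bsub>N\<^esub> (c l \<odot>\<^bsub>N\<^esub> g l) \<in> H"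
        using U N.submoduleE(4)[OF H(1), of "inv (c l)"] by simp
      moreover have "inv (c l) \<odot>\<^bsub>N\<^esub> (c l \<odot>\<^bsub>N\<^esub> g l) = g l"
        using U gN[OF l] by (subst N.smult_assoc1[symmetric]) auto
      ultimately have "Y \<subseteq> H" using H(2) by auto
      then show ?thesis using Y(1) H(1) by (auto simp: P_def)
    qed
    then have "P (Y - {g l})" using Y(1) by (auto simp: P_def)
    then have "card Y \<le> card (Y - {g l})" by (rule Y(2))
    then show False using g(1)[OF l] fY by (meson card_Diff1_less leD)
  qed
  have good: "good_seq R \<mm> N g s" unfolding good_seq_def
  proof (intro allI impI conjI)
    fix i assume i: "i < s"
    show "g i \<in> carrier N" using gN i .
    show "colon R N (lspan R N g i) (g i) \<subseteq> \<mm>"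
      using sr.colon_eq_last_coords[of N s g i, OF N gN i] min i by auto
    have "\<zero>\<^bsub>N\<^esub> \<in> lspan R N g i" using gN i by (intro N.submodule_zero N.lspan_submodule) auto
    then have "{a \<in> carrier R. a \<odot>\<^bsub>N\<^esub> g i = \<zero>\<^bsub>N\<^esub>} \<subseteq> colon R N (lspan R N g i) (g i)"
      by (auto simp: colon_def)
    then have "{a \<in> carrier R. a \<odot>\<^bsub>N\<^esub> g i = \<zero>\<^bsub>N\<^esub>} \<cdot> \<mm> \<subseteq> colon R N (lspan R N g i) (g i) \<cdot> \<mm>"
      by (intro ideal_prod_mono) auto
    moreover have "g i \<in> X" using g(1)[OF i] Y(1) by (auto simp: P_def)
    ultimately show "\<mm> \<cdot> \<mm> \<subseteq> colon R N (lspan R N g i) (g i) \<cdot> \<mm>"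
      using local.colon by blast
  qed
  have "graded_module R (\<lambda>_ a. a) N (\<lambda>_ x. x)"
    by (intro graded_module.intro graded_module_axioms.intro sr.graded_cring_axioms N) auto
  from this good _ span min show ?thesis
    by (rule sr.koszul_module_if_good[where t = "\<lambda>_. 0"]) auto
qed

theorem koszul_ring_if_ann:
  assumes ann: "\<forall>x \<in> \<mm> - ideal_pow R \<mm> 2. annihilator R x \<cdot> \<mm> = ideal_pow R \<mm> 2"
  shows "koszul_ring R"
proof -
  interpret S: module R "self_module R" by (rule self_module_module)
  have sub: "submodule \<mm> R (self_module R)" using is_ideal self_submodule_iff_ideal by blast
  have simps: "carrier (self_module R) = carrier R" "\<And>a b. a \<odot>\<^bsub>self_module R\<^esub> b = a \<otimes> b"
    by (auto simp: self_module_def)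
  let ?k = "residue_field_module R \<mm>"
  have k: "?k = module_quot (self_module R) \<mm>" by (simp add: residue_field_module_def)
  interpret k: module R ?k unfolding k by (rule S.module_quot_module[OF sub])
  let ?e = "\<mm> +>\<^bsub>self_module R\<^esub> \<one>"
  have smult: "a \<odot>\<^bsub>?k\<^esub> ?e = \<mm> +>\<^bsub>self_module R\<^esub> a" if "a \<in> carrier R" for a
    using S.module_quot_smult[OF sub, of a \<one>] that by (simp add: k simps)
  have "koszul_module R \<mm> ?k"
  proof (rule koszul_if_generated[OF ann k.module_axioms, of "{?e}"])
    show "{?e} \<subseteq> carrier ?k" unfolding k S.module_quot_carrier simps by blast
    then have "?e \<in> carrier ?k" by blast
    show "H = carrier ?k" if H: "submodule H R ?k" "{?e} \<subseteq> H" for H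
    proof
      show "H \<subseteq> carrier ?k" using k.submoduleE(1)[OF H(1)] .
      show "carrier ?k \<subseteq> H"
      proof
        fix X assume "X \<in> carrier ?k"
        then obtain a where "a \<in> carrier R" "X = \<mm> +>\<^bsub>self_module R\<^esub> a"
          unfolding k S.module_quot_carrier simps by blast
        then show "X \<in> H" using smult k.submoduleE(4)[OF H(1), of a ?e] H(2) by simp
      qed
    qed
    fix x assume "x \<in> {?e}"
    then have x: "x = ?e" by simp
    have "a \<odot>\<^bsub>?k\<^esub> x = \<zero>\<^bsub>?k\<^esub>" if "a \<in> \<mm>" for a
    proof -
      have "a \<odot>\<^bsub>?k\<^esub> x = \<mm> +>\<^bsub>self_module R\<^esub> a" unfolding x using smult Icarr[OF that] by blast
      also have "\<dots> = \<mm>" 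
        using abelian_subgroup.a_rcos_const[OF S.submodule_abelian_subgroup[OF sub] that] .
      finally show ?thesis by (simp add: k module_quot_simps)
    qed
    then have "\<mm> \<subseteq> {a \<in> carrier R. a \<odot>\<^bsub>?k\<^esub> x = \<zero>\<^bsub>?k\<^esub>}" by auto
    then show "\<mm> \<cdot> \<mm> \<subseteq> {a \<in> carrier R. a \<odot>\<^bsub>?k\<^esub> x = \<zero>\<^bsub>?k\<^esub>} \<cdot> \<mm>"
      by (intro ideal_prod_mono) auto
  qed simp
  then show ?thesis unfolding koszul_ring_def using noetherian_local_ring_axioms by blast
qed

end

section \<open>Koszul modules and Koszul quotient rings\<close>

context noetherian_local_ring
begin

lemma annihilated_koszul:
  assumes ann: "\<forall>x \<in> \<mm> - ideal_pow R \<mm> 2. annihilator R x \<cdot> \<mm> = ideal_pow R \<mm> 2"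
    and M: "fg_module R M" and x: "x \<in> \<mm> - ideal_pow R \<mm> 2"
    and zero: "ideal_smult M (annihilator R x) (carrier M) = {\<zero>\<^bsub>M\<^esub>}"
  shows "koszul_module R \<mm> M"
proof -
  obtain X where X: "finite X" "X \<subseteq> carrier M" "\<And>N. \<lbrakk>submodule N R M; X \<subseteq> N\<rbrakk> \<Longrightarrow> N = carrier M"
    and mod: "module R M" using M unfolding fg_module_def by blast
  show ?thesis
  proof (rule koszul_if_generated[OF ann mod X])
    fix g assume "g \<in> X"
    then have "a \<odot>\<^bsub>M\<^esub> g = \<zero>\<^bsub>M\<^esub>" if "a \<in> annihilator R x" for a
      using ideal_smult.smult[of a "annihilator R x" g "carrier M" M] that X(2) zero by blast
    then have "annihilator R x \<subseteq> {a \<in> carrier R. a \<odot>\<^bsub>M\<^esub> g = \<zero>\<^bsub>M\<^esub>}"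
      by (auto simp: annihilator_def)
    then have "annihilator R x \<cdot> \<mm> \<subseteq> {a \<in> carrier R. a \<odot>\<^bsub>M\<^esub> g = \<zero>\<^bsub>M\<^esub>} \<cdot> \<mm>"
      by (intro ideal_prod_mono) auto
    then show "\<mm> \<cdot> \<mm> \<subseteq> {a \<in> carrier R. a \<odot>\<^bsub>M\<^esub> g = \<zero>\<^bsub>M\<^esub>} \<cdot> \<mm>"
      using ann x ideal_pow_two by simp
  qed
qed

text \<open>The products \<open>x g\<close>, with \<open>g\<close> from a finite generating set of \<open>M\<close>, are generators killed
by \<open>ann(x)\<close>.\<close>

lemma linear_ideal_times_module_koszul:
  assumes ann: "\<forall>x \<in> \<mm> - ideal_pow R \<mm> 2. annihilator R x \<cdot> \<mm> = ideal_pow R \<mm> 2"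
    and M: "fg_module R M" and xs: "set xs \<subseteq> \<mm> - ideal_pow R \<mm> 2"
  shows "koszul_module R \<mm> (M\<lparr>carrier := ideal_smult M (genideal R (set xs)) (carrier M)\<rparr>)"
    (is "koszul_module R \<mm> ?N")
proof -
  obtain Y where Y: "finite Y" "Y \<subseteq> carrier M" "\<And>N. \<lbrakk>submodule N R M; Y \<subseteq> N\<rbrakk> \<Longrightarrow> N = carrier M"
    and mod: "module R M" using M unfolding fg_module_def by blast
  interpret M: module R M by fact
  have xsm: "set xs \<subseteq> \<mm>" "set xs \<subseteq> carrier R" using xs by auto
  have I: "ideal (Idl (set xs)) R" by (rule genideal_ideal[OF xsm(2)])
  define C where "C = ideal_smult M (Idl (set xs)) (carrier M)"
  have C: "submodule C R M" unfolding C_def by (rule ideal_smult_submodule[OF mod I M.carrier_is_submodule])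
  have N: "?N = M\<lparr>carrier := C\<rparr>" by (simp add: C_def)
  interpret N: module R "M\<lparr>carrier := C\<rparr>" by (rule submodule.submodule_is_module[OF C mod])
  define X where "X = (\<lambda>(x, g). x \<odot>\<^bsub>M\<^esub> g) ` (set xs \<times> Y)"
  show ?thesis unfolding N
  proof (rule koszul_if_generated[OF ann N.module_axioms, of X])
    show "finite X" using Y(1) by (simp add: X_def)
    show "X \<subseteq> carrier (M\<lparr>carrier := C\<rparr>)"
      using genideal_self[OF xsm(2)] Y(2) by (auto simp: X_def C_def intro!: ideal_smult.smult)
  next
    fix H assume H: "submodule H R (M\<lparr>carrier := C\<rparr>)" "X \<subseteq> H"
    have HC: "H \<subseteq> C" using N.submoduleE(1)[OF H(1)] by simp
    have HM: "submodule H R M"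
    proof (rule M.submodule_criterion)
      show "H \<subseteq> carrier M" using HC M.submoduleE(1)[OF C] by blast
      show "\<zero>\<^bsub>M\<^esub> \<in> H" using N.submodule_zero[OF H(1)] by simp
      show "y \<oplus>\<^bsub>M\<^esub> z \<in> H" if "y \<in> H" "z \<in> H" for y z using N.submoduleE(5)[OF H(1) that] by simp
      show "a \<odot>\<^bsub>M\<^esub> y \<in> H" if "a \<in> carrier R" "y \<in> H" for a y using N.submoduleE(4)[OF H(1) that] by simp
    qed
    have step1: "x \<odot>\<^bsub>M\<^esub> y \<in> H" if x: "x \<in> set xs" and y: "y \<in> carrier M" for x y
    proof -
      have xR: "x \<in> carrier R" using x xsm by auto
      have "submodule {y \<in> carrier M. x \<odot>\<^bsub>M\<^esub> y \<in> H} R M"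
      proof (rule M.submodule_criterion)
        show "\<zero>\<^bsub>M\<^esub> \<in> {y \<in> carrier M. x \<odot>\<^bsub>M\<^esub> y \<in> H}" using xR M.submodule_zero[OF HM] by simp
        show "y \<oplus>\<^bsub>M\<^esub> z \<in> {y \<in> carrier M. x \<odot>\<^bsub>M\<^esub> y \<in> H}"
          if "y \<in> {y \<in> carrier M. x \<odot>\<^bsub>M\<^esub> y \<in> H}" "z \<in> {y \<in> carrier M. x \<odot>\<^bsub>M\<^esub> y \<in> H}" for y z
          using that xR M.submoduleE(5)[OF HM] by (simp add: M.smult_r_distr)
        show "a \<odot>\<^bsub>M\<^esub> y \<in> {y \<in> carrier M. x \<odot>\<^bsub>M\<^esub> y \<in> H}"
          if "a \<in> carrier R" "y \<in> {y \<in> carrier M. x \<odot>\<^bsub>M\<^esub> y \<in> H}" for a y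
        proof -
          have "x \<odot>\<^bsub>M\<^esub> (a \<odot>\<^bsub>M\<^esub> y) = a \<odot>\<^bsub>M\<^esub> (x \<odot>\<^bsub>M\<^esub> y)"
            using that xR M.smult_assoc1[of x a y] M.smult_assoc1[of a x y] m_comm[of a x] by simp
          then show ?thesis using that M.submoduleE(4)[OF HM, of a "x \<odot>\<^bsub>M\<^esub> y"] by simp
        qed
      qed auto
      moreover have "Y \<subseteq> {y \<in> carrier M. x \<odot>\<^bsub>M\<^esub> y \<in> H}" using x Y(2) H(2) by (auto simp: X_def)
      ultimately have "{y \<in> carrier M. x \<odot>\<^bsub>M\<^esub> y \<in> H} = carrier M" by (rule Y(3))
      then show ?thesis using y by blast
    qed
    have "ideal {a \<in> carrier R. \<forall>y\<in>carrier M. a \<odot>\<^bsub>M\<^esub> y \<in> H} R"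
    proof -
      interpret S: module R "self_module R" by (rule self_module_module)
      show ?thesis unfolding self_submodule_iff_ideal[symmetric]
        by (rule S.submodule_criterion)
          (auto simp: self_module_def M.smult_l_distr M.smult_assoc1 M.submodule_zero[OF HM]
            intro: M.submoduleE(4)[OF HM] M.submoduleE(5)[OF HM])
    qed
    then have sub: "Idl (set xs) \<subseteq> {a \<in> carrier R. \<forall>y\<in>carrier M. a \<odot>\<^bsub>M\<^esub> y \<in> H}"
      using step1 xsm by (intro genideal_minimal) auto
    have "c \<in> H" if "c \<in> C" for c
      using that unfolding C_def
    proof induction
      case (smult a y)
      then show ?case using sub by blast
    qed (rule M.submoduleE(5)[OF HM])
    then show "H = carrier (M\<lparr>carrier := C\<rparr>)" using HC by auto
  next
    fix g assume "g \<in> X"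
    then obtain x y where g: "g = x \<odot>\<^bsub>M\<^esub> y" "x \<in> set xs" "y \<in> carrier M"
      using Y(2) by (auto simp: X_def)
    have "a \<odot>\<^bsub>M\<^esub> g = \<zero>\<^bsub>M\<^esub>" if "a \<in> annihilator R x" for a
      using that g xsm M.smult_assoc1[of a x y] by (auto simp: annihilator_def)
    then have "annihilator R x \<subseteq> {a \<in> carrier R. a \<odot>\<^bsub>M\<lparr>carrier := C\<rparr>\<^esub> g = \<zero>\<^bsub>M\<lparr>carrier := C\<rparr>\<^esub>}"
      by (auto simp: annihilator_def)
    then have "annihilator R x \<cdot> \<mm> \<subseteq> {a \<in> carrier R. a \<odot>\<^bsub>M\<lparr>carrier := C\<rparr>\<^esub> g = \<zero>\<^bsub>M\<lparr>carrier := C\<rparr>\<^esub>} \<cdot> \<mm>"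
      by (intro ideal_prod_mono) auto
    moreover have "x \<in> \<mm> - ideal_pow R \<mm> 2" using g(2) xs by (rule rev_subsetD)
    then have "annihilator R x \<cdot> \<mm> = \<mm> \<cdot> \<mm>" using ann ideal_pow_two by simp
    ultimately show "\<mm> \<cdot> \<mm> \<subseteq> {a \<in> carrier R. a \<odot>\<^bsub>M\<lparr>carrier := C\<rparr>\<^esub> g = \<zero>\<^bsub>M\<lparr>carrier := C\<rparr>\<^esub>} \<cdot> \<mm>"
      by simp
  qed
qed

text \<open>The annihilator condition descends to \<open>R / I\<close>: an element \<open>y\<close> outside the square of the
maximal ideal lifts to an element \<open>x\<close> outside \<open>\<mm>\<^sup>2\<close>, and \<open>ann(x)\<close> maps into \<open>ann(y)\<close>.\<close>

lemma quotient_koszul: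
  assumes ann: "\<forall>x \<in> \<mm> - ideal_pow R \<mm> 2. annihilator R x \<cdot> \<mm> = ideal_pow R \<mm> 2"
    and I: "ideal I R" "I \<subseteq> \<mm>"
  shows "koszul_ring (R Quot I)"
proof -
  interpret I: ideal I R by fact
  let ?Q = "R Quot I"
  define \<pi> where "\<pi> = (+>) I"
  interpret Q: cring ?Q by (rule I.quotient_is_cring[OF is_cring])
  interpret \<pi>: ring_hom_ring R ?Q \<pi> unfolding \<pi>_def by (rule I.rcos_ring_hom_ring)
  have surj: "\<exists>r\<in>carrier R. X = \<pi> r" if "X \<in> carrier ?Q" for X
    using that by (auto simp: FactRing_def A_RCOSETS_def' \<pi>_def)
  define \<nn> where "\<nn> = \<pi> ` \<mm>"
  have \<pi>_mem: "r \<in> \<mm>" if r: "r \<in> carrier R" "\<pi> r \<in> \<nn>" for r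
  proof -
    obtain s where s: "s \<in> \<mm>" "\<pi> r = \<pi> s" using r by (auto simp: \<nn>_def)
    have "r \<in> I +> s" using I.a_rcos_self[OF r(1)] s(2) by (simp add: \<pi>_def)
    then have "r \<ominus> s \<in> I" using I.a_rcos_module_imp[of s r] s(1) by (simp add: a_minus_def)
    then have "(r \<ominus> s) \<oplus> s \<in> \<mm>" using I(2) s(1) by blast
    then show ?thesis using r(1) s(1) by (simp add: a_minus_def a_assoc l_neg)
  qed
  have \<nn>: "ideal \<nn> ?Q"
  proof -
    have "ideal (\<pi> ` \<mm>) ?Q" unfolding \<pi>_def using ring_ideal_imp_quot_ideal[OF I(1) is_ideal] by simp
    then show ?thesis by (simp add: \<nn>_def)
  qed
  interpret n: ideal \<nn> ?Q by fact
  have one: "\<one>\<^bsub>?Q\<^esub> \<notin> \<nn>" using \<pi>_mem[of \<one>] one_notin_max by auto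
  have unit: "X \<in> Units ?Q" if X: "X \<in> carrier ?Q" "X \<notin> \<nn>" for X
  proof -
    obtain r where r: "r \<in> carrier R" "X = \<pi> r" using surj[OF X(1)] by blast
    then have U: "r \<in> Units R" using X(2) nonunit_in_max by (auto simp: \<nn>_def)
    then have inv: "\<pi> (inv r) \<otimes>\<^bsub>?Q\<^esub> X = \<one>\<^bsub>?Q\<^esub>" "\<pi> (inv r) \<in> carrier ?Q"
      using \<pi>.hom_mult[of "inv r" r] r by simp_all
    then have "X \<otimes>\<^bsub>?Q\<^esub> \<pi> (inv r) = \<one>\<^bsub>?Q\<^esub>" using X(1) Q.m_comm by metis
    then show ?thesis using X(1) inv unfolding Units_def by blast
  qed
  have noeth: "noetherian_ring ?Q"
  proof (rule Q.noetherian_ringI)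
    fix K assume K: "ideal K ?Q"
    have vim: "ideal {r \<in> carrier R. \<pi> r \<in> L} R" if "ideal L ?Q" for L
      using \<pi>.ideal_vimage[OF that] by simp
    obtain A where A: "A \<subseteq> carrier R" "finite A" "{r \<in> carrier R. \<pi> r \<in> K} = Idl A"
      using finetely_gen[OF vim[OF K]] by blast
    have AK: "\<pi> ` A \<subseteq> K" using genideal_self[OF A(1)] A(3) by blast
    have Ac: "\<pi> ` A \<subseteq> carrier ?Q" using A(1) by auto
    have "K \<subseteq> Idl\<^bsub>?Q\<^esub> (\<pi> ` A)"
    proof
      fix X assume X: "X \<in> K"
      obtain r where r: "r \<in> carrier R" "X = \<pi> r" using surj ideal.Icarr[OF K X] by blast
      have "Idl A \<subseteq> {r \<in> carrier R. \<pi> r \<in> Idl\<^bsub>?Q\<^esub> (\<pi> ` A)}"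
        using vim[OF Q.genideal_ideal[OF Ac]] A(1) Q.genideal_self[OF Ac] by (intro genideal_minimal) auto
      then show "X \<in> Idl\<^bsub>?Q\<^esub> (\<pi> ` A)" using r X A(3) by auto
    qed
    then have "K = Idl\<^bsub>?Q\<^esub> (\<pi> ` A)" using Q.genideal_minimal[OF K AK] by blast
    then show "\<exists>A\<subseteq>carrier ?Q. finite A \<and> K = Idl\<^bsub>?Q\<^esub> A" using Ac A(2) by blast
  qed
  have local: "noetherian_local_ring \<nn> ?Q"
  proof (intro noetherian_local_ring.intro noetherian_local_ring_axioms.intro)
    show "cring ?Q" by (rule Q.is_cring)
    show "maximalideal \<nn> ?Q" by (rule Q.local_criterion(1)[OF \<nn> one unit])
    show "J = \<nn>" if "maximalideal J ?Q" for J by (rule Q.local_criterion(2)[OF \<nn> one unit that])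
  qed (rule noeth)
  interpret q: noetherian_local_ring \<nn> ?Q by (rule local)
  have sq: "\<pi> x \<in> \<nn> \<cdot>\<^bsub>?Q\<^esub> \<nn>" if "x \<in> \<mm> \<cdot> \<mm>" for x
    using that
  proof induction
    case (prod i j)
    then have "\<pi> (i \<otimes> j) = \<pi> i \<otimes>\<^bsub>?Q\<^esub> \<pi> j" by simp
    then show ?case using prod by (auto simp: \<nn>_def intro!: ideal_prod.prod)
  next
    case (sum a b)
    then have "a \<in> carrier R" "b \<in> carrier R"
      using ideal_prod_in_carrier[OF is_ideal is_ideal] by auto
    then have "\<pi> (a \<oplus> b) = \<pi> a \<oplus>\<^bsub>?Q\<^esub> \<pi> b" by simp
    then show ?case using sum ideal_prod.sum by metis
  qed
  have "annihilator ?Q y \<cdot>\<^bsub>?Q\<^esub> \<nn> = \<nn> \<cdot>\<^bsub>?Q\<^esub> \<nn>" if y: "y \<in> \<nn>" "y \<notin> \<nn> \<cdot>\<^bsub>?Q\<^esub> \<nn>" for y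
  proof
    have sqz: "\<zero>\<^bsub>?Q\<^esub> \<in> \<nn> \<cdot>\<^bsub>?Q\<^esub> \<nn>"
      using ideal_prod.prod[of "\<zero>\<^bsub>?Q\<^esub>" \<nn> "\<zero>\<^bsub>?Q\<^esub>" \<nn> ?Q] n.zero_closed by simp
    have "X \<in> \<nn>" if "X \<in> annihilator ?Q y" for X
    proof (rule ccontr)
      assume "X \<notin> \<nn>"
      have X: "X \<in> carrier ?Q" "X \<otimes>\<^bsub>?Q\<^esub> y = \<zero>\<^bsub>?Q\<^esub>" using that by (auto simp: annihilator_def)
      then have U: "X \<in> Units ?Q" using unit \<open>X \<notin> \<nn>\<close> by blast
      have yc: "y \<in> carrier ?Q" using y by auto
      have "y = (inv\<^bsub>?Q\<^esub> X \<otimes>\<^bsub>?Q\<^esub> X) \<otimes>\<^bsub>?Q\<^esub> y" using U yc by simp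
      also have "\<dots> = inv\<^bsub>?Q\<^esub> X \<otimes>\<^bsub>?Q\<^esub> (X \<otimes>\<^bsub>?Q\<^esub> y)" using U yc X by (intro Q.m_assoc) auto
      also have "\<dots> = \<zero>\<^bsub>?Q\<^esub>" using X U by simp
      finally show False using y(2) sqz by simp
    qed
    then show "annihilator ?Q y \<cdot>\<^bsub>?Q\<^esub> \<nn> \<subseteq> \<nn> \<cdot>\<^bsub>?Q\<^esub> \<nn>" by (intro ideal_prod_mono) auto
    obtain x where x: "x \<in> \<mm>" "y = \<pi> x" using y(1) by (auto simp: \<nn>_def)
    have "x \<notin> \<mm> \<cdot> \<mm>" using sq y(2) x(2) by blast
    then have eq: "annihilator R x \<cdot> \<mm> = \<mm> \<cdot> \<mm>" using ann x(1) unfolding ideal_pow_two by blast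
    have lift: "\<pi> u \<in> annihilator ?Q y \<cdot>\<^bsub>?Q\<^esub> \<nn>" if "u \<in> annihilator R x \<cdot> \<mm>" for u
      using that
    proof induction
      case (prod i j)
      then have ij: "i \<in> carrier R" "i \<otimes> x = \<zero>" "j \<in> \<mm>" by (auto simp: annihilator_def)
      have "\<pi> i \<otimes>\<^bsub>?Q\<^esub> y = \<pi> (i \<otimes> x)" using ij(1) x by simp
      then have "\<pi> i \<in> annihilator ?Q y" using ij by (simp add: annihilator_def)
      moreover have "\<pi> (i \<otimes> j) = \<pi> i \<otimes>\<^bsub>?Q\<^esub> \<pi> j" using ij by simp
      ultimately show ?case using ij by (auto simp: \<nn>_def intro!: ideal_prod.prod)
    next
      case (sum a b)
      then have "a \<in> carrier R" "b \<in> carrier R"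
        using ideal_prod_in_carrier[OF is_ideal is_ideal] eq by auto
      then have "\<pi> (a \<oplus> b) = \<pi> a \<oplus>\<^bsub>?Q\<^esub> \<pi> b" by simp
      then show ?case using sum ideal_prod.sum by metis
    qed
    show "\<nn> \<cdot>\<^bsub>?Q\<^esub> \<nn> \<subseteq> annihilator ?Q y \<cdot>\<^bsub>?Q\<^esub> \<nn>"
    proof
      fix z assume "z \<in> \<nn> \<cdot>\<^bsub>?Q\<^esub> \<nn>"
      then show "z \<in> annihilator ?Q y \<cdot>\<^bsub>?Q\<^esub> \<nn>"
      proof induction
        case (prod i j)
        then obtain a b where ab: "a \<in> \<mm>" "i = \<pi> a" "b \<in> \<mm>" "j = \<pi> b" by (auto simp: \<nn>_def)
        have "\<pi> (a \<otimes> b) \<in> annihilator ?Q y \<cdot>\<^bsub>?Q\<^esub> \<nn>"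
          using lift eq ideal_prod.prod[OF ab(1,3)] by blast
        then show ?case using ab by simp
      qed (rule ideal_prod.sum)
    qed
  qed
  then show ?thesis by (intro q.koszul_ring_if_ann) (auto simp: q.ideal_pow_two)
qed

end

section \<open>Associated graded rings and their modules\<close>

text \<open>The convolution that represents the action of an associated graded ring on an
associated graded module. Writing it as a linear combination makes the module laws instances of
those for \<open>lincomb\<close>.\<close>

definition conv :: "('a, 'b, 's) module_scheme \<Rightarrow> (nat \<Rightarrow> 'a) \<Rightarrow> (nat \<Rightarrow> 'b) \<Rightarrow> nat \<Rightarrow> 'b" where
  "conv M a x n = lincomb M (\<lambda>i. x (n - i)) (Suc n) a"

lemma lincomb_cong_terms:
  "(\<And>l. l < s \<Longrightarrow> c l \<odot>\<^bsub>M\<^esub> g l = c' l \<odot>\<^bsub>M\<^esub> g' l) \<Longrightarrow> lincomb M g s c = lincomb M g' s c'"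
  by (induction s) auto

context module
begin

lemma lincomb_add_vectors:
  assumes "\<And>l. l < s \<Longrightarrow> g l \<in> carrier M" "\<And>l. l < s \<Longrightarrow> g' l \<in> carrier M"
    "\<And>l. l < s \<Longrightarrow> c l \<in> carrier R"
  shows "lincomb M (\<lambda>l. g l \<oplus>\<^bsub>M\<^esub> g' l) s c = lincomb M g s c \<oplus>\<^bsub>M\<^esub> lincomb M g' s c"
  using assms by (induction s) (auto simp: lincomb_closed smult_r_distr M.a_ac)

lemma lincomb_zero_terms:
  assumes "\<And>l. l < s \<Longrightarrow> c l \<odot>\<^bsub>M\<^esub> g l = \<zero>\<^bsub>M\<^esub>"
  shows "lincomb M g s c = \<zero>\<^bsub>M\<^esub>"
  using assms by (induction s) auto

lemma lincomb_smult_vector: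
  assumes "z \<in> carrier M" "\<And>l. l < s \<Longrightarrow> b l \<in> carrier R" "\<And>l. l < s \<Longrightarrow> c l \<in> carrier R"
  shows "lincomb M (\<lambda>l. b l \<odot>\<^bsub>M\<^esub> z) s c = lincomb (self_module R) b s c \<odot>\<^bsub>M\<^esub> z"
proof -
  have "(\<lambda>r. r \<odot>\<^bsub>M\<^esub> z) \<in> module_homs R (self_module R) M"
    using assms(1) by (auto simp: module_homs_def self_module_def smult_l_distr smult_assoc1)
  from lincomb_hom[OF self_module_module module_axioms this, of s b c] show ?thesis
    using assms by (simp add: self_module_def)
qed

lemma conv_closed:
  assumes "\<And>i. a i \<in> carrier R" "\<And>i. x i \<in> carrier M"
  shows "conv M a x n \<in> carrier M"
  unfolding conv_def using assms by (intro lincomb_closed)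

text \<open>Associativity of the associated graded action, proved once on representatives.\<close>

lemma conv_assoc:
  assumes a: "\<And>i. a i \<in> carrier R" and b: "\<And>i. b i \<in> carrier R" and x: "\<And>i. x i \<in> carrier M"
  shows "conv M (conv (self_module R) a b) x n = conv M a (conv M b x) n"
proof -
  interpret S: module R "self_module R" by (rule self_module_module)
  have ab: "conv (self_module R) a b j \<in> carrier R" for j
    using S.conv_closed[of a b j] a b by (simp add: self_module_def)
  define T where "T i m = lincomb M (\<lambda>m. x (n - i - m)) m b" for i m
  have T: "T i m \<in> carrier M" for i m unfolding T_def using b x by (intro lincomb_closed)
  have "lincomb M (\<lambda>j. x (n - j)) k (conv (self_module R) a b) = lincomb M (\<lambda>i. T i (k - i)) k a"
    if "k \<le> Suc n" for k
    using that
  proof (induction k)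
    case 0
    then show ?case by simp
  next
    case (Suc k)
    have step: "T i (Suc k - i) = T i (k - i) \<oplus>\<^bsub>M\<^esub> b (k - i) \<odot>\<^bsub>M\<^esub> x (n - k)" if "i < Suc k" for i
      using that Suc.prems by (simp add: T_def Suc_diff_le)
    have "lincomb M (\<lambda>i. T i (Suc k - i)) (Suc k) a =
        lincomb M (\<lambda>i. T i (k - i) \<oplus>\<^bsub>M\<^esub> b (k - i) \<odot>\<^bsub>M\<^esub> x (n - k)) (Suc k) a"
      using step by (intro lincomb_cong) auto
    also have "\<dots> = lincomb M (\<lambda>i. T i (k - i)) (Suc k) a
        \<oplus>\<^bsub>M\<^esub> lincomb M (\<lambda>i. b (k - i) \<odot>\<^bsub>M\<^esub> x (n - k)) (Suc k) a"
      using a b x T by (intro lincomb_add_vectors) auto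
    also have "lincomb M (\<lambda>i. b (k - i) \<odot>\<^bsub>M\<^esub> x (n - k)) (Suc k) a =
        conv (self_module R) a b k \<odot>\<^bsub>M\<^esub> x (n - k)"
      unfolding conv_def using a b x by (intro lincomb_smult_vector) auto
    also have "lincomb M (\<lambda>i. T i (k - i)) (Suc k) a = lincomb M (\<lambda>i. T i (k - i)) k a"
      using a T lincomb_closed[of k "\<lambda>i. T i (k - i)" a] by (simp add: T_def)
    finally show ?case using Suc by simp
  qed
  from this[of "Suc n"] show ?thesis
    unfolding conv_def[of M _ _ n]
    by (simp only: order_refl) (intro lincomb_cong refl, simp add: T_def conv_def Suc_diff_le less_Suc_eq_le)
qed

lemma conv_single_left:
  assumes "a \<in> carrier R" "\<And>i. x i \<in> carrier M"
  shows "conv M (\<lambda>i. if i = k then a else \<zero>) x n = (if k \<le> n then a \<odot>\<^bsub>M\<^esub> x (n - k) else \<zero>\<^bsub>M\<^esub>)"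
proof (cases "k \<le> n")
  case True
  then show ?thesis unfolding conv_def using assms by (subst lincomb_single) auto
next
  case False
  then show ?thesis unfolding conv_def using assms by (subst lincomb_zero) auto
qed

end

lemma (in cring) conv_comm:
  assumes a: "\<And>i. a i \<in> carrier R" and b: "\<And>i. b i \<in> carrier R"
  shows "conv (self_module R) a b n = conv (self_module R) b a n"
proof -
  have fin: "lincomb (self_module R) g s c = (\<Oplus>l\<in>{..<s}. c l \<otimes> g l)"
    if "\<And>l. l < s \<Longrightarrow> c l \<in> carrier R" "\<And>l. l < s \<Longrightarrow> g l \<in> carrier R" for g c s
    using that
  proof (induction s)
    case (Suc s)
    then show ?case
      by (simp add: lessThan_Suc self_module_def finsum_insert Pi_def a_comm)
  qed (simp add: self_module_def)
  have im: "(\<lambda>i. n - i) ` {..<Suc n} = {..<Suc n}"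
  proof
    show "{..<Suc n} \<subseteq> (\<lambda>i. n - i) ` {..<Suc n}"
    proof
      fix i assume "i \<in> {..<Suc n}"
      then have "i = n - (n - i)" "n - i \<in> {..<Suc n}" by auto
      then show "i \<in> (\<lambda>i. n - i) ` {..<Suc n}" by (rule image_eqI)
    qed
  qed auto
  have "(\<Oplus>l\<in>{..<Suc n}. a l \<otimes> b (n - l)) = (\<Oplus>l\<in>(\<lambda>i. n - i) ` {..<Suc n}. a l \<otimes> b (n - l))"
    by (simp add: im)
  also have "\<dots> = (\<Oplus>l\<in>{..<Suc n}. a (n - l) \<otimes> b (n - (n - l)))"
    using a b by (intro finsum_reindex) (auto simp: inj_on_def)
  also have "\<dots> = (\<Oplus>l\<in>{..<Suc n}. b l \<otimes> a (n - l))"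
    using a b by (intro finsum_cong') (auto simp: m_comm)
  finally show ?thesis unfolding conv_def using a b by (simp add: fin del: lincomb.simps)
qed

locale filtered_pair = A: filtered_module R "self_module R" P + N: filtered_module R M \<Phi>
  for R (structure) and P and M (structure) and \<Phi> +
  assumes filt_mult: "\<lbrakk>a \<in> P i; x \<in> \<Phi> j\<rbrakk> \<Longrightarrow> a \<odot>\<^bsub>M\<^esub> x \<in> \<Phi> (i + j)"
begin

lemma P_carrier: "a \<in> P i \<Longrightarrow> a \<in> carrier R"
  using A.filt_carrier by (fastforce simp: self_module_def)

lemma conv_filt:
  assumes "\<And>i. a i \<in> P i" "\<And>i. x i \<in> \<Phi> i"
  shows "conv M a x n \<in> \<Phi> n"
  unfolding conv_def
proof (rule N.submodule_lincomb_terms[OF N.filt_sub])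
  fix l assume "l < Suc n"
  then show "a l \<odot>\<^bsub>M\<^esub> x (n - l) \<in> \<Phi> n" using filt_mult[OF assms(1)[of l] assms(2)[of "n - l"]] by simp
qed

text \<open>Changing the representatives by \<open>p \<in> P (i + 1)\<close> and \<open>q \<in> \<Phi> (j + 1)\<close> changes the product by
an element of \<open>\<Phi> (i + j + 1)\<close>, so all cosets in the union agree.\<close>

lemma coset_product:
  assumes a: "a \<in> P i" and x: "x \<in> \<Phi> j"
  shows "(\<Union>\<alpha>\<in>P (Suc i) +>\<^bsub>self_module R\<^esub> a. \<Union>\<xi>\<in>\<Phi> (Suc j) +>\<^bsub>M\<^esub> x. \<Phi> (Suc (i + j)) +>\<^bsub>M\<^esub> (\<alpha> \<odot>\<^bsub>M\<^esub> \<xi>))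
    = \<Phi> (Suc (i + j)) +>\<^bsub>M\<^esub> (a \<odot>\<^bsub>M\<^esub> x)"
proof -
  let ?S = "self_module R"
  have aR: "a \<in> carrier R" "a \<in> carrier ?S" using P_carrier[OF a] by (auto simp: self_module_def)
  have xM: "x \<in> carrier M" using N.filt_carrier[OF x] .
  have eq: "\<Phi> (Suc (i + j)) +>\<^bsub>M\<^esub> (\<alpha> \<odot>\<^bsub>M\<^esub> \<xi>) = \<Phi> (Suc (i + j)) +>\<^bsub>M\<^esub> (a \<odot>\<^bsub>M\<^esub> x)"
    if \<alpha>: "\<alpha> \<in> P (Suc i) +>\<^bsub>?S\<^esub> a" and \<xi>: "\<xi> \<in> \<Phi> (Suc j) +>\<^bsub>M\<^esub> x" for \<alpha> \<xi>
  proof -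
    have d: "\<alpha> \<in> carrier ?S" "\<alpha> \<ominus>\<^bsub>?S\<^esub> a \<in> P (Suc i)"
      using \<alpha> A.coset_mem_iff[OF A.filt_sub aR(2)] by auto
    define p where "p = \<alpha> \<ominus>\<^bsub>?S\<^esub> a"
    have p: "p \<in> P (Suc i)" "\<alpha> = p \<oplus>\<^bsub>?S\<^esub> a"
      using d aR by (simp_all add: p_def a_minus_def A.M.a_assoc A.M.l_neg)
    define q where "q = \<xi> \<ominus>\<^bsub>M\<^esub> x"
    have \<xi>M: "\<xi> \<in> carrier M" "q \<in> \<Phi> (Suc j)" using \<xi> N.coset_mem_iff[OF N.filt_sub xM] by (auto simp: q_def)
    have q: "\<xi> = q \<oplus>\<^bsub>M\<^esub> x" using \<xi>M xM by (simp add: q_def a_minus_def N.M.a_assoc N.M.l_neg)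
    have pR: "p \<in> carrier R" using P_carrier[OF p(1)] .
    have \<alpha>': "\<alpha> = p \<oplus> a" "\<alpha> \<in> carrier R" using p(2) d(1) by (auto simp: self_module_def)
    have \<alpha>P: "\<alpha> \<in> P i" unfolding p(2) using A.filt_desc p(1) a by (intro A.filt_add) auto
    have qM: "q \<in> carrier M" using N.filt_carrier[OF \<xi>M(2)] .
    have "\<alpha> \<odot>\<^bsub>M\<^esub> \<xi> = \<alpha> \<odot>\<^bsub>M\<^esub> q \<oplus>\<^bsub>M\<^esub> \<alpha> \<odot>\<^bsub>M\<^esub> x"
      unfolding q using \<alpha>' qM xM by (intro N.smult_r_distr)
    also have "\<alpha> \<odot>\<^bsub>M\<^esub> x = p \<odot>\<^bsub>M\<^esub> x \<oplus>\<^bsub>M\<^esub> a \<odot>\<^bsub>M\<^esub> x"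
      unfolding \<alpha>'(1) using pR aR xM by (intro N.smult_l_distr)
    finally have expand: "\<alpha> \<odot>\<^bsub>M\<^esub> \<xi> = \<alpha> \<odot>\<^bsub>M\<^esub> q \<oplus>\<^bsub>M\<^esub> (p \<odot>\<^bsub>M\<^esub> x \<oplus>\<^bsub>M\<^esub> a \<odot>\<^bsub>M\<^esub> x)" .
    have "\<alpha> \<odot>\<^bsub>M\<^esub> \<xi> \<ominus>\<^bsub>M\<^esub> a \<odot>\<^bsub>M\<^esub> x = \<alpha> \<odot>\<^bsub>M\<^esub> q \<oplus>\<^bsub>M\<^esub> p \<odot>\<^bsub>M\<^esub> x"
      unfolding expand a_minus_def using \<alpha>' pR aR xM qM by (simp add: N.M.a_assoc N.M.r_neg)
    moreover have "\<alpha> \<odot>\<^bsub>M\<^esub> q \<in> \<Phi> (Suc (i + j))" using filt_mult[OF \<alpha>P \<xi>M(2)] by simp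
    moreover have "p \<odot>\<^bsub>M\<^esub> x \<in> \<Phi> (Suc (i + j))" using filt_mult[OF p(1) x] by simp
    ultimately have "\<alpha> \<odot>\<^bsub>M\<^esub> \<xi> \<ominus>\<^bsub>M\<^esub> a \<odot>\<^bsub>M\<^esub> x \<in> \<Phi> (Suc (i + j))" using N.filt_add by simp
    then show ?thesis using \<alpha>' \<xi>M aR xM by (subst N.coset_eq_iff[OF N.filt_sub]) auto
  qed
  have "a \<in> P (Suc i) +>\<^bsub>?S\<^esub> a"
    using abelian_subgroup.a_rcos_self[OF A.submodule_abelian_subgroup[OF A.filt_sub] aR(2)] .
  moreover have "x \<in> \<Phi> (Suc j) +>\<^bsub>M\<^esub> x"
    using abelian_subgroup.a_rcos_self[OF N.submodule_abelian_subgroup[OF N.filt_sub] xM] .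
  ultimately show ?thesis using eq by blast
qed

lemma smult_cls:
  assumes a: "\<And>i. a i \<in> P i" and x: "\<And>i. x i \<in> \<Phi> i"
  shows "A.cls a \<odot>\<^bsub>N.Gr\<^esub> N.cls x = N.cls (conv M a x)"
proof
  fix n
  let ?Q = "module_quot M (\<Phi> (Suc n))"
  interpret Q: module R ?Q by (rule N.module_quot_module[OF N.filt_sub])
  have aR: "a i \<in> carrier R" for i using P_carrier[OF a] .
  have xM: "x i \<in> carrier M" for i using N.filt_carrier[OF x] .
  have "(A.cls a \<odot>\<^bsub>N.Gr\<^esub> N.cls x) n =
      finsum ?Q (\<lambda>i. \<Union>\<alpha>\<in>A.cls a i. \<Union>\<xi>\<in>N.cls x (n - i). \<Phi> (Suc n) +>\<^bsub>M\<^esub> (\<alpha> \<odot>\<^bsub>M\<^esub> \<xi>)) {..n}"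
    by (simp add: assoc_graded_def)
  also have "\<dots> = finsum ?Q (\<lambda>i. \<Phi> (Suc n) +>\<^bsub>M\<^esub> (a i \<odot>\<^bsub>M\<^esub> x (n - i))) {..n}"
  proof (rule Q.finsum_cong')
    show "(\<lambda>i. \<Phi> (Suc n) +>\<^bsub>M\<^esub> (a i \<odot>\<^bsub>M\<^esub> x (n - i))) \<in> {..n} \<rightarrow> carrier ?Q"
      unfolding N.module_quot_carrier using aR xM by auto
    fix i assume "i \<in> {..n}"
    then show "(\<Union>\<alpha>\<in>A.cls a i. \<Union>\<xi>\<in>N.cls x (n - i). \<Phi> (Suc n) +>\<^bsub>M\<^esub> (\<alpha> \<odot>\<^bsub>M\<^esub> \<xi>)) =
        \<Phi> (Suc n) +>\<^bsub>M\<^esub> (a i \<odot>\<^bsub>M\<^esub> x (n - i))"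
      using coset_product[OF a x, of i "n - i"] by (simp add: gr_class_def)
  qed simp
  also have "\<dots> = \<Phi> (Suc n) +>\<^bsub>M\<^esub> lincomb M (\<lambda>i. x (n - i)) (Suc n) a"
  proof -
    have "finsum ?Q (\<lambda>i. \<Phi> (Suc n) +>\<^bsub>M\<^esub> (a i \<odot>\<^bsub>M\<^esub> x (n - i))) {..<k} =
        \<Phi> (Suc n) +>\<^bsub>M\<^esub> lincomb M (\<lambda>i. x (n - i)) k a" for k
    proof (induction k)
      case 0
      then show ?case using N.module_quot_zero[OF N.filt_sub] by simp
    next
      case (Suc k)
      have cl: "(\<lambda>i. \<Phi> (Suc n) +>\<^bsub>M\<^esub> (a i \<odot>\<^bsub>M\<^esub> x (n - i))) \<in> {..<k} \<rightarrow> carrier ?Q"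
        "\<Phi> (Suc n) +>\<^bsub>M\<^esub> (a k \<odot>\<^bsub>M\<^esub> x (n - k)) \<in> carrier ?Q"
        unfolding N.module_quot_carrier using aR xM by auto
      have "finsum ?Q (\<lambda>i. \<Phi> (Suc n) +>\<^bsub>M\<^esub> (a i \<odot>\<^bsub>M\<^esub> x (n - i))) {..<Suc k} =
          (\<Phi> (Suc n) +>\<^bsub>M\<^esub> (a k \<odot>\<^bsub>M\<^esub> x (n - k))) \<oplus>\<^bsub>?Q\<^esub>
          (\<Phi> (Suc n) +>\<^bsub>M\<^esub> lincomb M (\<lambda>i. x (n - i)) k a)"
        using cl by (simp add: lessThan_Suc Q.finsum_insert Suc)
      also have "\<dots> = \<Phi> (Suc n) +>\<^bsub>M\<^esub> (a k \<odot>\<^bsub>M\<^esub> x (n - k) \<oplus>\<^bsub>M\<^esub> lincomb M (\<lambda>i. x (n - i)) k a)"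
        using aR xM by (intro N.module_quot_add[OF N.filt_sub] N.lincomb_closed) auto
      finally show ?case using aR xM by (simp add: N.M.a_comm N.lincomb_closed)
    qed
    from this[of "Suc n"] show ?thesis by (simp only: lessThan_Suc_atMost)
  qed
  finally show "(A.cls a \<odot>\<^bsub>N.Gr\<^esub> N.cls x) n = N.cls (conv M a x) n"
    by (simp add: gr_class_def conv_def)
qed

end

lemma (in filtered_module) Gr_rep: "f \<in> carrier Gr \<Longrightarrow> \<exists>x. (\<forall>i. x i \<in> \<Phi> i) \<and> f = cls x"
  using carrier_Gr by auto

text \<open>The projection onto degree \<open>j\<close>; it is zero for negative \<open>j\<close>.\<close>

definition gr_comp :: "(nat \<Rightarrow> 'b set) \<Rightarrow> int \<Rightarrow> (nat \<Rightarrow> 'b set) \<Rightarrow> nat \<Rightarrow> 'b set" where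
  "gr_comp \<Phi> j f = (\<lambda>i. if int i = j then f i else \<Phi> (Suc i))"

context filtered_module
begin

lemma gr_comp_cls: "gr_comp \<Phi> j (cls x) = cls (\<lambda>i. if int i = j then x i else \<zero>\<^bsub>M\<^esub>)"
  using coset_zero[OF filt_sub] by (intro ext) (simp add: gr_comp_def gr_class_def)

lemma gr_comp_closed: "f \<in> carrier Gr \<Longrightarrow> gr_comp \<Phi> j f \<in> carrier Gr"
  using Gr_rep[of f] filt_zero by (auto simp: gr_comp_cls intro!: cls_closed)

lemma gr_comp_idem: "gr_comp \<Phi> j (gr_comp \<Phi> j f) = gr_comp \<Phi> j f"
  by (intro ext) (simp add: gr_comp_def)

lemma gr_comp_add:
  assumes "f \<in> carrier Gr" "h \<in> carrier Gr"
  shows "gr_comp \<Phi> j (f \<oplus>\<^bsub>Gr\<^esub> h) = gr_comp \<Phi> j f \<oplus>\<^bsub>Gr\<^esub> gr_comp \<Phi> j h"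
proof -
  obtain x where x: "\<forall>i. x i \<in> \<Phi> i" "f = cls x" using Gr_rep[OF assms(1)] by blast
  obtain y where y: "\<forall>i. y i \<in> \<Phi> i" "h = cls y" using Gr_rep[OF assms(2)] by blast
  have "gr_comp \<Phi> j (f \<oplus>\<^bsub>Gr\<^esub> h) = cls (\<lambda>i. if int i = j then x i \<oplus>\<^bsub>M\<^esub> y i else \<zero>\<^bsub>M\<^esub>)"
    using x y by (simp add: cls_add gr_comp_cls)
  also have "(\<lambda>i. if int i = j then x i \<oplus>\<^bsub>M\<^esub> y i else \<zero>\<^bsub>M\<^esub>) =
      (\<lambda>i. (if int i = j then x i else \<zero>\<^bsub>M\<^esub>) \<oplus>\<^bsub>M\<^esub> (if int i = j then y i else \<zero>\<^bsub>M\<^esub>))"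
    by auto
  also have "cls \<dots> = gr_comp \<Phi> j f \<oplus>\<^bsub>Gr\<^esub> gr_comp \<Phi> j h"
    using x y filt_zero by (simp add: gr_comp_cls cls_add)
  finally show ?thesis .
qed

lemma gr_piece_iff: "f \<in> gr_piece Gr j \<longleftrightarrow> f \<in> carrier Gr \<and> gr_comp \<Phi> j f = f"
  by (auto simp: gr_piece_def gr_comp_def assoc_graded_def fun_eq_iff)

end

lemma (in filtered_pair) gr_comp_smult:
  assumes f: "f \<in> carrier A.Gr" and y: "y \<in> carrier N.Gr" "gr_comp \<Phi> p y = y"
  shows "gr_comp \<Phi> j (f \<odot>\<^bsub>N.Gr\<^esub> y) = gr_comp P (j - p) f \<odot>\<^bsub>N.Gr\<^esub> y"
proof -
  obtain a where a: "\<forall>i. a i \<in> P i" "f = A.cls a" using A.Gr_rep[OF f] by blast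
  obtain x' where x': "\<forall>i. x' i \<in> \<Phi> i" "y = N.cls x'" using N.Gr_rep[OF y(1)] by blast
  define x where "x i = (if int i = p then x' i else \<zero>\<^bsub>M\<^esub>)" for i
  have x: "x i \<in> \<Phi> i" for i using x' N.filt_zero by (simp add: x_def)
  have yx: "y = N.cls x" using y(2) unfolding x'(2) N.gr_comp_cls x_def by simp
  have aR: "a i \<in> carrier R" for i using a P_carrier by blast
  have z: "\<zero> \<in> P i" for i using A.filt_zero by (simp add: self_module_def)
  have zS: "\<zero>\<^bsub>self_module R\<^esub> = \<zero>" by (simp add: self_module_def)
  define a' where "a' i = (if int i = j - p then a i else \<zero>)" for i
  have a': "a' i \<in> P i" for i using a z by (simp add: a'_def)
  have "gr_comp P (j - p) f = A.cls a'" unfolding a(2) A.gr_comp_cls a'_def zS ..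
  then have "gr_comp P (j - p) f \<odot>\<^bsub>N.Gr\<^esub> y = N.cls (conv M a' x)"
    unfolding yx using smult_cls[of a' x] a' x by simp
  moreover have "f \<odot>\<^bsub>N.Gr\<^esub> y = N.cls (conv M a x)" unfolding yx a(2) using a x by (intro smult_cls) auto
  moreover have "(if int n = j then conv M a x n else \<zero>\<^bsub>M\<^esub>) = conv M a' x n" for n
  proof (cases "int n = j")
    case True
    have "a l \<odot>\<^bsub>M\<^esub> x (n - l) = a' l \<odot>\<^bsub>M\<^esub> x (n - l)" if "l < Suc n" for l
      using True that aR by (auto simp: a'_def x_def)
    then have "conv M a x n = conv M a' x n" unfolding conv_def by (intro lincomb_cong_terms)
    then show ?thesis using True by simp
  next
    case False
    have "a' l \<odot>\<^bsub>M\<^esub> x (n - l) = \<zero>\<^bsub>M\<^esub>" if "l < Suc n" for l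
      using False that aR N.filt_carrier[OF x[of "n - l"]] by (auto simp: a'_def x_def)
    then have "conv M a' x n = \<zero>\<^bsub>M\<^esub>" unfolding conv_def by (intro N.lincomb_zero_terms)
    then show ?thesis using False by simp
  qed
  ultimately show ?thesis by (simp add: N.gr_comp_cls)
qed

text \<open>The vanishing of \<open>\<mm>\<^sup>3\<close> serves to make the \<open>\<mm>\<close>-adic filtrations bounded.\<close>

locale gr_setup = cring R + ideal \<mm> R for \<mm> and R (structure) +
  assumes nil: "i \<ge> 3 \<Longrightarrow> ideal_pow R \<mm> i = {\<zero>}"
begin

abbreviation "P \<equiv> ideal_pow R \<mm>"
abbreviation "A \<equiv> gr_ring R \<mm>"

lemma P_ideal: "ideal (P i) R" by (rule ideal_pow_ideal[OF is_ideal])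

lemma P_carrier: "a \<in> P i \<Longrightarrow> a \<in> carrier R" using ideal.Icarr[OF P_ideal] .

lemma P_zero: "\<zero> \<in> P i" using additive_subgroup.zero_closed[OF ideal.axioms(1)[OF P_ideal]] .

lemma P_desc: "P (Suc i) \<subseteq> P i"
  using ideal_prod_inter[OF P_ideal is_ideal] by (auto simp: ideal_pow.simps(2))

lemma P_mult: "\<lbrakk>a \<in> P i; b \<in> P j\<rbrakk> \<Longrightarrow> a \<otimes> b \<in> P (i + j)"
proof (induction j arbitrary: b)
  case 0
  then show ?case using ideal.I_r_closed[OF P_ideal] by simp
next
  case (Suc j)
  from Suc.prems(2) have "b \<in> P j \<cdot> \<mm>" by (simp add: ideal_pow.simps(2))
  then show ?case
  proof induction
    case (prod b c)
    have "(a \<otimes> b) \<otimes> c \<in> P (i + j) \<cdot> \<mm>" using Suc.IH[OF Suc.prems(1) prod(1)] prod(2) by (rule ideal_prod.prod)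
    moreover have "a \<otimes> (b \<otimes> c) = (a \<otimes> b) \<otimes> c"
      using P_carrier[OF Suc.prems(1)] P_carrier[OF prod(1)] Icarr[OF prod(2)] by (simp add: m_assoc)
    ultimately show ?case by (simp add: ideal_pow.simps(2))
  next
    case (sum b c)
    have "P j \<cdot> \<mm> \<subseteq> carrier R" using ideal_prod_in_carrier[OF P_ideal is_ideal] .
    then have "a \<otimes> (b \<oplus> c) = a \<otimes> b \<oplus> a \<otimes> c"
      using sum(1,2) P_carrier[OF Suc.prems(1)] by (intro r_distr) auto
    then show ?case using sum ideal_prod.sum[of "a \<otimes> b" R "P (i + j)" \<mm> "a \<otimes> c"]
      by (simp add: ideal_pow.simps(2))
  qed
qed

lemma self_filtered: "filtered_module R (self_module R) P"
proof (intro filtered_module.intro filtered_module_axioms.intro self_module_module)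
  show "submodule (P i) R (self_module R)" for i using P_ideal self_submodule_iff_ideal by blast
  show "\<exists>k. \<forall>i\<ge>k. P i = {\<zero>\<^bsub>self_module R\<^esub>}" using nil by (auto simp: self_module_def)
qed (rule P_desc)

lemma module_filtered_pair:
  assumes "module R M"
  shows "filtered_pair R P M (\<lambda>i. ideal_smult M (P i) (carrier M))"
proof (intro filtered_pair.intro filtered_pair_axioms.intro self_filtered
    filtered_module.intro filtered_module_axioms.intro assms)
  interpret M: module R M by fact
  show sub: "submodule (ideal_smult M (P i) (carrier M)) R M" for i
    by (rule ideal_smult_submodule[OF assms P_ideal M.carrier_is_submodule])
  show "ideal_smult M (P (Suc i)) (carrier M) \<subseteq> ideal_smult M (P i) (carrier M)" for i
  proof
    fix x assume "x \<in> ideal_smult M (P (Suc i)) (carrier M)"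
    then show "x \<in> ideal_smult M (P i) (carrier M)"
      by induction (use P_desc in \<open>auto intro: ideal_smult.intros\<close>)
  qed
  have "x = \<zero>\<^bsub>M\<^esub>" if "x \<in> ideal_smult M (P i) (carrier M)" "i \<ge> 3" for x i
    using that(1) unfolding nil[OF that(2)] by induction auto
  then have "ideal_smult M (P i) (carrier M) = {\<zero>\<^bsub>M\<^esub>}" if "i \<ge> 3" for i
    using that M.submodule_zero[OF sub[of i]] by blast
  then show "\<exists>k. \<forall>i\<ge>k. ideal_smult M (P i) (carrier M) = {\<zero>\<^bsub>M\<^esub>}" by blast
  fix a x i j assume a: "a \<in> P i" and x: "x \<in> ideal_smult M (P j) (carrier M)"
  from x show "a \<odot>\<^bsub>M\<^esub> x \<in> ideal_smult M (P (i + j)) (carrier M)"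
  proof induction
    case (smult b y)
    then have "a \<odot>\<^bsub>M\<^esub> (b \<odot>\<^bsub>M\<^esub> y) = (a \<otimes> b) \<odot>\<^bsub>M\<^esub> y"
      using P_carrier a by (simp add: M.smult_assoc1)
    then show ?case using P_mult[OF a smult(1)] smult(2) by (simp add: ideal_smult.smult)
  next
    case (sum y z)
    have "ideal_smult M (P j) (carrier M) \<subseteq> carrier M" using M.submoduleE(1)[OF sub] .
    then have "a \<odot>\<^bsub>M\<^esub> (y \<oplus>\<^bsub>M\<^esub> z) = a \<odot>\<^bsub>M\<^esub> y \<oplus>\<^bsub>M\<^esub> a \<odot>\<^bsub>M\<^esub> z"
      using sum(1,2) P_carrier[OF a] by (intro M.smult_r_distr) auto
    then show ?case using sum by (simp add: ideal_smult.sum)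
  qed
qed

lemma self_pair: "filtered_pair R P (self_module R) P"
  by (intro filtered_pair.intro filtered_pair_axioms.intro self_filtered)
    (use P_mult in \<open>auto simp: self_module_def\<close>)

sublocale S: filtered_pair R P "self_module R" P
  by (rule self_pair)

lemma gr_ring_simps:
  "carrier A = carrier S.A.Gr" "\<zero>\<^bsub>A\<^esub> = \<zero>\<^bsub>S.A.Gr\<^esub>" "f \<oplus>\<^bsub>A\<^esub> h = f \<oplus>\<^bsub>S.A.Gr\<^esub> h"
  "f \<otimes>\<^bsub>A\<^esub> h = f \<odot>\<^bsub>S.A.Gr\<^esub> h"
  by (simp_all add: gr_ring_def Let_def)

lemma one_rep: "(if i = 0 then \<one> else \<zero>) \<in> P i"
  using P_zero by simp

lemma gr_ring_one: "\<one>\<^bsub>A\<^esub> = S.A.cls (\<lambda>i. if i = 0 then \<one> else \<zero>)"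
proof
  fix i
  have "P (Suc i) +>\<^bsub>self_module R\<^esub> x = P (Suc i) +> x" for x
    by (simp add: a_r_coset_def r_coset_def self_module_def)
  moreover have "P (Suc i) +>\<^bsub>self_module R\<^esub> \<zero> = P (Suc i)"
    using S.A.coset_zero[OF S.A.filt_sub] by (simp add: self_module_def)
  ultimately show "\<one>\<^bsub>A\<^esub> i = S.A.cls (\<lambda>i. if i = 0 then \<one> else \<zero>) i"
    by (simp add: gr_ring_def gr_class_def Let_def)
qed

context
  fixes M :: "('a, 'c, 's) module_scheme" and \<Phi>
  assumes pair: "filtered_pair R P M \<Phi>"
begin

interpretation N: filtered_pair R P M \<Phi> by (rule pair)

lemma gr_smult_closed: "\<lbrakk>f \<in> carrier A; y \<in> carrier N.N.Gr\<rbrakk> \<Longrightarrow> f \<odot>\<^bsub>N.N.Gr\<^esub> y \<in> carrier N.N.Gr"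
  using S.A.Gr_rep[of f] N.N.Gr_rep[of y]
  by (auto simp: gr_ring_simps N.smult_cls N.conv_filt intro!: N.N.cls_closed)

lemma gr_smult_l_distr:
  assumes "f \<in> carrier A" "h \<in> carrier A" "y \<in> carrier N.N.Gr"
  shows "(f \<oplus>\<^bsub>A\<^esub> h) \<odot>\<^bsub>N.N.Gr\<^esub> y = f \<odot>\<^bsub>N.N.Gr\<^esub> y \<oplus>\<^bsub>N.N.Gr\<^esub> h \<odot>\<^bsub>N.N.Gr\<^esub> y"
proof -
  obtain a where a: "\<forall>i. a i \<in> P i" "f = S.A.cls a" using S.A.Gr_rep assms(1) by (auto simp: gr_ring_simps)
  obtain b where b: "\<forall>i. b i \<in> P i" "h = S.A.cls b" using S.A.Gr_rep assms(2) by (auto simp: gr_ring_simps)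
  obtain x where x: "\<forall>i. x i \<in> \<Phi> i" "y = N.N.cls x" using N.N.Gr_rep assms(3) by blast
  have c: "a i \<in> carrier R" "b i \<in> carrier R" "x i \<in> carrier M" for i
    using a b x P_carrier N.N.filt_carrier by blast+
  have ab: "a i \<oplus>\<^bsub>self_module R\<^esub> b i \<in> P i" for i using S.A.filt_add a b by blast
  have "conv M (\<lambda>i. a i \<oplus>\<^bsub>self_module R\<^esub> b i) x = (\<lambda>n. conv M a x n \<oplus>\<^bsub>M\<^esub> conv M b x n)"
    unfolding conv_def self_module_def
    using c N.N.lincomb_add[of _ _ a b] by (intro ext) (simp del: lincomb.simps)
  then show ?thesis unfolding a(2) b(2) x(2)
    using a(1) b(1) x(1) ab by (simp add: gr_ring_simps S.A.cls_add N.smult_cls N.N.cls_add N.conv_filt)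
qed

lemma gr_smult_r_distr:
  assumes "f \<in> carrier A" "y \<in> carrier N.N.Gr" "z \<in> carrier N.N.Gr"
  shows "f \<odot>\<^bsub>N.N.Gr\<^esub> (y \<oplus>\<^bsub>N.N.Gr\<^esub> z) = f \<odot>\<^bsub>N.N.Gr\<^esub> y \<oplus>\<^bsub>N.N.Gr\<^esub> f \<odot>\<^bsub>N.N.Gr\<^esub> z"
proof -
  obtain a where a: "\<forall>i. a i \<in> P i" "f = S.A.cls a" using S.A.Gr_rep assms(1) by (auto simp: gr_ring_simps)
  obtain x where x: "\<forall>i. x i \<in> \<Phi> i" "y = N.N.cls x" using N.N.Gr_rep assms(2) by blast
  obtain u where u: "\<forall>i. u i \<in> \<Phi> i" "z = N.N.cls u" using N.N.Gr_rep assms(3) by blast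
  have c: "a i \<in> carrier R" "u i \<in> carrier M" "x i \<in> carrier M" for i
    using a u x P_carrier N.N.filt_carrier by blast+
  have "conv M a (\<lambda>i. x i \<oplus>\<^bsub>M\<^esub> u i) = (\<lambda>n. conv M a x n \<oplus>\<^bsub>M\<^esub> conv M a u n)"
    unfolding conv_def using c by (intro ext N.N.lincomb_add_vectors) auto
  then show ?thesis unfolding a(2) u(2) x(2)
    using a(1) u(1) x(1) by (simp add: N.smult_cls N.N.cls_add N.conv_filt N.N.filt_add)
qed

lemma gr_smult_assoc:
  assumes "f \<in> carrier A" "h \<in> carrier A" "y \<in> carrier N.N.Gr"
  shows "(f \<otimes>\<^bsub>A\<^esub> h) \<odot>\<^bsub>N.N.Gr\<^esub> y = f \<odot>\<^bsub>N.N.Gr\<^esub> (h \<odot>\<^bsub>N.N.Gr\<^esub> y)"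
proof -
  obtain a where a: "\<forall>i. a i \<in> P i" "f = S.A.cls a" using S.A.Gr_rep assms(1) by (auto simp: gr_ring_simps)
  obtain b where b: "\<forall>i. b i \<in> P i" "h = S.A.cls b" using S.A.Gr_rep assms(2) by (auto simp: gr_ring_simps)
  obtain x where x: "\<forall>i. x i \<in> \<Phi> i" "y = N.N.cls x" using N.N.Gr_rep assms(3) by blast
  have c: "a i \<in> carrier R" "b i \<in> carrier R" "x i \<in> carrier M" for i
    using a b x P_carrier N.N.filt_carrier by blast+
  have "conv M (conv (self_module R) a b) x = conv M a (conv M b x)"
    using N.N.conv_assoc[of a b x] c by blast
  then show ?thesis unfolding a(2) b(2) x(2)
    using a(1) b(1) x(1) by (simp add: gr_ring_simps S.smult_cls N.smult_cls N.conv_filt S.conv_filt)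
qed

lemma gr_smult_one:
  assumes "y \<in> carrier N.N.Gr"
  shows "\<one>\<^bsub>A\<^esub> \<odot>\<^bsub>N.N.Gr\<^esub> y = y"
proof -
  obtain x where x: "\<forall>i. x i \<in> \<Phi> i" "y = N.N.cls x" using N.N.Gr_rep assms by blast
  have "x i \<in> carrier M" for i using x N.N.filt_carrier by blast
  then have "conv M (\<lambda>i. if i = 0 then \<one> else \<zero>) x = x"
    using N.N.conv_single_left[of \<one> x 0] by (simp add: fun_eq_iff)
  then show ?thesis unfolding gr_ring_one x(2) using one_rep x(1) by (subst N.smult_cls) auto
qed

end

lemma gr_ring_cring: "cring A"
proof (rule cringI)
  interpret G: abelian_group S.A.Gr by (rule S.A.Gr_abelian_group)
  show "abelian_group A"
  proof (rule abelian_groupI)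
    fix x assume "x \<in> carrier A"
    then have "(\<ominus>\<^bsub>S.A.Gr\<^esub> x) \<oplus>\<^bsub>S.A.Gr\<^esub> x = \<zero>\<^bsub>S.A.Gr\<^esub>" "\<ominus>\<^bsub>S.A.Gr\<^esub> x \<in> carrier S.A.Gr"
      by (auto simp: gr_ring_simps G.l_neg)
    then show "\<exists>y\<in>carrier A. y \<oplus>\<^bsub>A\<^esub> x = \<zero>\<^bsub>A\<^esub>" by (auto simp: gr_ring_simps)
  qed (auto simp: gr_ring_simps G.a_ac)
  have comm: "f \<otimes>\<^bsub>A\<^esub> h = h \<otimes>\<^bsub>A\<^esub> f" if f: "f \<in> carrier A" and h: "h \<in> carrier A" for f h
  proof -
    obtain a where a: "\<forall>i. a i \<in> P i" "f = S.A.cls a" using S.A.Gr_rep f by (auto simp: gr_ring_simps)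
    obtain b where b: "\<forall>i. b i \<in> P i" "h = S.A.cls b" using S.A.Gr_rep h by (auto simp: gr_ring_simps)
    have "conv (self_module R) a b = conv (self_module R) b a"
      using conv_comm[of a b] a b P_carrier by blast
    then show ?thesis using a b by (simp add: gr_ring_simps S.smult_cls)
  qed
  have one: "\<one>\<^bsub>A\<^esub> \<in> carrier A" unfolding gr_ring_one gr_ring_simps by (rule S.A.cls_closed[OF one_rep])
  show "comm_monoid A"
  proof (rule comm_monoidI)
    fix f h k assume "f \<in> carrier A" "h \<in> carrier A" "k \<in> carrier A"
    then show "f \<otimes>\<^bsub>A\<^esub> h \<otimes>\<^bsub>A\<^esub> k = f \<otimes>\<^bsub>A\<^esub> (h \<otimes>\<^bsub>A\<^esub> k)"
      using gr_smult_assoc[OF self_pair] by (simp add: gr_ring_simps)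
  next
    fix f h assume "f \<in> carrier A" "h \<in> carrier A"
    then show "f \<otimes>\<^bsub>A\<^esub> h \<in> carrier A" using gr_smult_closed[OF self_pair] by (simp add: gr_ring_simps)
  next
    fix f assume "f \<in> carrier A"
    then show "\<one>\<^bsub>A\<^esub> \<otimes>\<^bsub>A\<^esub> f = f" using gr_smult_one[OF self_pair] by (simp add: gr_ring_simps)
  qed (use comm one in auto)
  fix f h k assume "f \<in> carrier A" "h \<in> carrier A" "k \<in> carrier A"
  then show "(f \<oplus>\<^bsub>A\<^esub> h) \<otimes>\<^bsub>A\<^esub> k = f \<otimes>\<^bsub>A\<^esub> k \<oplus>\<^bsub>A\<^esub> h \<otimes>\<^bsub>A\<^esub> k"
    using gr_smult_l_distr[OF self_pair] by (simp add: gr_ring_simps)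
qed

lemma gr_graded_cring: "graded_cring A (gr_comp P)"
  by (intro graded_cring.intro graded_cring_axioms.intro gr_ring_cring)
    (auto simp: gr_ring_simps S.A.gr_comp_closed S.A.gr_comp_add S.A.gr_comp_idem S.gr_comp_smult)

lemma gr_graded_module:
  assumes pair: "filtered_pair R P M \<Phi>"
  shows "graded_module A (gr_comp P) (assoc_graded M \<Phi>) (gr_comp \<Phi>)"
proof (intro graded_module.intro graded_module_axioms.intro gr_graded_cring)
  interpret N: filtered_pair R P M \<Phi> by (rule pair)
  show "module A N.N.Gr"
    by (intro moduleI gr_ring_cring N.N.Gr_abelian_group gr_smult_closed[OF pair] gr_smult_l_distr[OF pair]
        gr_smult_r_distr[OF pair] gr_smult_assoc[OF pair] gr_smult_one[OF pair])
  fix j p f x y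
  show "gr_comp \<Phi> j x \<in> carrier N.N.Gr" if "x \<in> carrier N.N.Gr"
    using that by (rule N.N.gr_comp_closed)
  show "gr_comp \<Phi> j (x \<oplus>\<^bsub>N.N.Gr\<^esub> y) = gr_comp \<Phi> j x \<oplus>\<^bsub>N.N.Gr\<^esub> gr_comp \<Phi> j y"
    if "x \<in> carrier N.N.Gr" "y \<in> carrier N.N.Gr"
    using that by (rule N.N.gr_comp_add)
  show "gr_comp \<Phi> j (gr_comp \<Phi> j x) = gr_comp \<Phi> j x" by (rule N.N.gr_comp_idem)
  show "gr_comp \<Phi> j (f \<odot>\<^bsub>N.N.Gr\<^esub> y) = gr_comp P (j - p) f \<odot>\<^bsub>N.N.Gr\<^esub> y"
    if "f \<in> carrier A" "y \<in> carrier N.N.Gr" "gr_comp \<Phi> p y = y"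
    using that by (intro N.gr_comp_smult) (simp_all add: gr_ring_simps)
qed

end

section \<open>The annihilator condition for the associated graded ring\<close>

lemma (in cring) one_plus_nilpotent_unit:
  assumes w: "w \<in> carrier R" and z: "w \<otimes> (w \<otimes> w) = \<zero>"
  shows "\<one> \<oplus> w \<in> Units R"
proof -
  define v where "v = w \<otimes> w"
  have v: "v \<in> carrier R" "w \<otimes> v = \<zero>" using w z by (auto simp: v_def)
  have "(\<one> \<oplus> w) \<otimes> ((\<one> \<ominus> w) \<oplus> v) = ((\<one> \<ominus> w) \<oplus> v) \<oplus> w \<otimes> ((\<one> \<ominus> w) \<oplus> v)"
    using w v(1) by (simp add: l_distr)
  also have "w \<otimes> ((\<one> \<ominus> w) \<oplus> v) = w \<ominus> v"
    using w v by (simp add: a_minus_def r_distr r_minus v_def)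
  also have "((\<one> \<ominus> w) \<oplus> v) \<oplus> (w \<ominus> v) = (\<one> \<ominus> w) \<oplus> (w \<oplus> (v \<ominus> v))"
    using w v(1) by (simp add: a_minus_def a_ac)
  also have "\<dots> = \<one>" using w v(1) by (simp add: a_minus_def a_assoc l_neg r_neg)
  finally show ?thesis using w v(1) unfolding Units_def
    by (auto intro!: bexI[of _ "(\<one> \<ominus> w) \<oplus> v"] simp: m_comm)
qed

lemma self_module_simps:
  "carrier (self_module R) = carrier R" "\<zero>\<^bsub>self_module R\<^esub> = \<zero>\<^bsub>R\<^esub>"
  "x \<oplus>\<^bsub>self_module R\<^esub> y = x \<oplus>\<^bsub>R\<^esub> y" "x \<odot>\<^bsub>self_module R\<^esub> y = x \<otimes>\<^bsub>R\<^esub> y"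
  by (simp_all add: self_module_def)

locale gr_short = noetherian_local_ring \<mm> R for \<mm> and R (structure) +
  assumes ann: "\<forall>x \<in> \<mm> - ideal_pow R \<mm> 2. annihilator R x \<cdot> \<mm> = ideal_pow R \<mm> 2"
begin

interpretation sr: short_ring \<mm> R "\<lambda>_ a. a"
  by (rule short_ring_if_ann[OF ann])

lemma pow_nil: "i \<ge> 3 \<Longrightarrow> ideal_pow R \<mm> i = {\<zero>}"
  using sr.ideal_pow_bound[of "i - 3"] by simp

sublocale G: gr_setup \<mm> R
  by unfold_locales (rule pow_nil)

interpretation A: cring G.A by (rule G.gr_ring_cring)

abbreviation "P \<equiv> ideal_pow R \<mm>"
abbreviation "A \<equiv> gr_ring R \<mm>"
abbreviation "cls \<equiv> gr_class (self_module R) P"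

lemmas P_simps = sr.ideal_pow_simps

text \<open>The homogeneous element of degree \<open>k\<close> represented by \<open>r \<in> \<mm>\<^sup>k\<close>.\<close>

definition E :: "nat \<Rightarrow> 'a \<Rightarrow> nat \<Rightarrow> 'a set" where
  "E k r = cls (\<lambda>i. if i = k then r else \<zero>)"

text \<open>The ideal of elements of positive degree, described through representatives; membership
of the representative \<open>a 0\<close> in \<open>\<mm>\<close> says that the component of degree zero vanishes.\<close>

definition gr_max :: "(nat \<Rightarrow> 'a set) set" where
  "gr_max = {cls a | a. (\<forall>i. a i \<in> P i) \<and> a 0 \<in> \<mm>}"

lemma A_rep: "f \<in> carrier A \<Longrightarrow> \<exists>a. (\<forall>i. a i \<in> P i) \<and> f = cls a"
  using G.S.A.Gr_rep by (simp add: G.gr_ring_simps)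

lemma cls_closed: "(\<And>i. a i \<in> P i) \<Longrightarrow> cls a \<in> carrier A"
  using G.S.A.cls_closed by (simp add: G.gr_ring_simps)

lemma cls_mult:
  "\<lbrakk>\<And>i. a i \<in> P i; \<And>i. b i \<in> P i\<rbrakk> \<Longrightarrow> cls a \<otimes>\<^bsub>A\<^esub> cls b = cls (conv (self_module R) a b)"
  by (simp add: G.gr_ring_simps G.S.smult_cls)

lemma cls_add:
  "\<lbrakk>\<And>i. a i \<in> P i; \<And>i. b i \<in> P i\<rbrakk> \<Longrightarrow> cls a \<oplus>\<^bsub>A\<^esub> cls b = cls (\<lambda>i. a i \<oplus> b i)"
  using G.S.A.cls_add[of a b] by (simp add: G.gr_ring_simps self_module_def)

lemma cls_zero_iff: "(\<And>i. a i \<in> P i) \<Longrightarrow> cls a = \<zero>\<^bsub>A\<^esub> \<longleftrightarrow> (\<forall>i. a i \<in> P (Suc i))"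
  using G.S.A.cls_eq_zero_iff by (simp add: G.gr_ring_simps)

lemma cls_cong:
  assumes a: "\<And>i. a i \<in> P i" and b: "\<And>i. b i \<in> P i"
    and "a 0 \<ominus> b 0 \<in> \<mm>" "a (Suc 0) \<ominus> b (Suc 0) \<in> \<mm> \<cdot> \<mm>" "a (Suc (Suc 0)) = b (Suc (Suc 0))"
  shows "cls a = cls b"
proof -
  have R: "a i \<in> carrier R" "b i \<in> carrier R" for i using G.P_carrier a b by blast+
  have "a i \<ominus>\<^bsub>self_module R\<^esub> b i \<in> P (Suc i)" for i
  proof -
    have eq: "a i \<ominus>\<^bsub>self_module R\<^esub> b i = a i \<ominus> b i"
      using R by (simp add: a_minus_def sr.self_minus sr.self_simps)
    consider "i = 0" | "i = Suc 0" | "i = Suc (Suc 0)" | "i \<ge> 3" by linarith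
    then show ?thesis
    proof cases
      case 3
      then show ?thesis unfolding eq using assms(5) R G.P_zero by (simp add: a_minus_def r_neg)
    next
      case 4
      then have "a i = \<zero>" "b i = \<zero>" using a[of i] b[of i] pow_nil by auto
      then show ?thesis unfolding eq using G.P_zero by (simp add: a_minus_def)
    qed (use assms(3,4) P_simps eq in simp_all)
  qed
  then show ?thesis using G.S.A.cls_eq_iff[of a b] a b by blast
qed

lemma single_filt: "r \<in> P k \<Longrightarrow> (if i = k then r else \<zero>) \<in> P i"
  using G.P_zero by simp

lemma E_closed: "r \<in> P k \<Longrightarrow> E k r \<in> carrier A"
  unfolding E_def by (intro cls_closed single_filt)

lemma E_add: "\<lbrakk>r \<in> P k; s \<in> P k\<rbrakk> \<Longrightarrow> E k (r \<oplus> s) = E k r \<oplus>\<^bsub>A\<^esub> E k s"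
proof -
  assume r: "r \<in> P k" and s: "s \<in> P k"
  have "(\<lambda>i. if i = k then r \<oplus> s else \<zero>) = (\<lambda>i. (if i = k then r else \<zero>) \<oplus> (if i = k then s else \<zero>))"
    by auto
  then show ?thesis unfolding E_def using cls_add[OF single_filt[OF r] single_filt[OF s]] by simp
qed

lemma E_eq_zero: "r \<in> P (Suc k) \<Longrightarrow> E k r = \<zero>\<^bsub>A\<^esub>"
proof -
  assume r: "r \<in> P (Suc k)"
  then have "r \<in> P k" using G.P_desc by blast
  then show ?thesis unfolding E_def using r G.P_zero by (subst cls_zero_iff[OF single_filt]) auto
qed

lemma E_mult_cls:
  assumes "r \<in> P k" "\<And>i. a i \<in> P i"
  shows "E k r \<otimes>\<^bsub>A\<^esub> cls a = cls (\<lambda>n. if k \<le> n then r \<otimes> a (n - k) else \<zero>)"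
proof -
  have "conv (self_module R) (\<lambda>i. if i = k then r else \<zero>) a = (\<lambda>n. if k \<le> n then r \<otimes> a (n - k) else \<zero>)"
    using sr.S.conv_single_left[of r a k] G.P_carrier[OF assms(1)] G.P_carrier[OF assms(2)]
    by (intro ext) (simp add: sr.self_simps)
  then show ?thesis unfolding E_def using cls_mult[OF single_filt[OF assms(1)] assms(2)] by simp
qed

lemma E_mult:
  assumes "r \<in> P k" "s \<in> P l"
  shows "E k r \<otimes>\<^bsub>A\<^esub> E l s = E (k + l) (r \<otimes> s)"
proof -
  have "E k r \<otimes>\<^bsub>A\<^esub> E l s = cls (\<lambda>n. if k \<le> n then r \<otimes> (if n - k = l then s else \<zero>) else \<zero>)"
    unfolding E_def[of l] using assms by (intro E_mult_cls single_filt)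
  also have "(\<lambda>n. if k \<le> n then r \<otimes> (if n - k = l then s else \<zero>) else \<zero>) = (\<lambda>n. if n = k + l then r \<otimes> s else \<zero>)"
  proof
    fix n
    have "n - k = l \<longleftrightarrow> n = k + l" if "k \<le> n" using that by auto
    then show "(if k \<le> n then r \<otimes> (if n - k = l then s else \<zero>) else \<zero>) = (if n = k + l then r \<otimes> s else \<zero>)"
      using G.P_carrier[OF assms(1)] by auto
  qed
  finally show ?thesis by (simp add: E_def)
qed

lemma gr_max_cls: 
  assumes "\<And>i. a i \<in> P i"
  shows "cls a \<in> gr_max \<longleftrightarrow> a 0 \<in> \<mm>"
proof
  assume "cls a \<in> gr_max"
  then obtain b where b: "cls a = cls b" "\<forall>i. b i \<in> P i" "b 0 \<in> \<mm>" unfolding gr_max_def by blast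
  have R: "a 0 \<in> carrier R" "b 0 \<in> carrier R" using G.P_carrier assms b by blast+
  have "a 0 \<ominus>\<^bsub>self_module R\<^esub> b 0 \<in> P (Suc 0)"
    using b G.S.A.cls_eq_iff[of a b] assms by blast
  then have "a 0 \<ominus> b 0 \<in> \<mm>"
    using R P_simps by (simp add: a_minus_def sr.self_minus sr.self_simps)
  then have "(a 0 \<ominus> b 0) \<oplus> b 0 \<in> \<mm>" using b by blast
  then show "a 0 \<in> \<mm>" using R by (simp add: a_minus_def a_assoc l_neg)
qed (use assms in \<open>auto simp: gr_max_def\<close>)

lemma gr_max_rep: "f \<in> gr_max \<Longrightarrow> \<exists>a. (\<forall>i. a i \<in> P i) \<and> a 0 \<in> \<mm> \<and> f = cls a"
  by (auto simp: gr_max_def)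

lemma E_gr_max: "\<lbrakk>r \<in> P k; k > 0\<rbrakk> \<Longrightarrow> E k r \<in> gr_max"
  unfolding E_def by (subst gr_max_cls[OF single_filt]) auto

lemma gr_max_ideal: "ideal gr_max A"
proof -
  interpret AS: module A "self_module A" by (rule A.self_module_module)
  show ?thesis unfolding A.self_submodule_iff_ideal[symmetric]
  proof (rule AS.submodule_criterion)
    show "gr_max \<subseteq> carrier (self_module A)" using cls_closed by (auto simp: gr_max_def self_module_simps(1)[of A])
    have "cls (\<lambda>_. \<zero>) = \<zero>\<^bsub>A\<^esub>" using G.P_zero by (subst cls_zero_iff) auto
    then show "\<zero>\<^bsub>self_module A\<^esub> \<in> gr_max" using gr_max_cls[of "\<lambda>_. \<zero>"] G.P_zero
      by (simp add: self_module_simps(2)[of A])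
  next
    fix f h assume "f \<in> gr_max" "h \<in> gr_max"
    then obtain a b where ab: "\<forall>i. a i \<in> P i" "a 0 \<in> \<mm>" "f = cls a" "\<forall>i. b i \<in> P i" "b 0 \<in> \<mm>" "h = cls b"
      using gr_max_rep by meson
    have "a i \<oplus> b i \<in> P i" for i
      using ab additive_subgroup.a_closed[OF ideal.axioms(1)[OF G.P_ideal]] by blast
    then show "f \<oplus>\<^bsub>self_module A\<^esub> h \<in> gr_max"
      using ab gr_max_cls[of "\<lambda>i. a i \<oplus> b i"] by (simp add: self_module_simps(3)[of A] cls_add)
  next
    fix f h assume "f \<in> carrier A" "h \<in> gr_max"
    then obtain a b where ab: "\<forall>i. a i \<in> P i" "f = cls a" "\<forall>i. b i \<in> P i" "b 0 \<in> \<mm>" "h = cls b"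
      using gr_max_rep A_rep by meson
    have "a 0 \<in> carrier R" "b 0 \<in> carrier R" using ab G.P_carrier by blast+
    then have "conv (self_module R) a b 0 = a 0 \<otimes> b 0" by (simp add: conv_def sr.self_simps)
    also have "\<dots> \<in> \<mm>" using ab G.P_carrier by (intro I_l_closed) auto
    finally have "cls (conv (self_module R) a b) \<in> gr_max"
      using ab by (subst gr_max_cls) (auto intro: G.S.conv_filt)
    then show "f \<odot>\<^bsub>self_module A\<^esub> h \<in> gr_max" using ab
      by (simp add: self_module_simps(4)[of A] cls_mult)
  qed
qed

lemma gr_max_sq: "f \<in> ideal_prod A gr_max gr_max \<longleftrightarrow> (\<exists>c\<in>\<mm> \<cdot> \<mm>. f = E (Suc (Suc 0)) c)"
proof
  have E2: "cls x = E (Suc (Suc 0)) (x (Suc (Suc 0)))"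
    if "\<And>i. x i \<in> P i" "x 0 \<in> \<mm>" "x (Suc 0) \<in> \<mm> \<cdot> \<mm>" for x
    unfolding E_def using that single_filt[OF that(1)] G.P_carrier[OF that(1)]
    by (intro cls_cong) (simp_all add: a_minus_def)
  assume "f \<in> ideal_prod A gr_max gr_max"
  then show "\<exists>c\<in>\<mm> \<cdot> \<mm>. f = E (Suc (Suc 0)) c"
  proof induction
    case (prod f h)
    then obtain a b where ab: "\<forall>i. a i \<in> P i" "a 0 \<in> \<mm>" "f = cls a" "\<forall>i. b i \<in> P i" "b 0 \<in> \<mm>" "h = cls b"
      using gr_max_rep by meson
    let ?x = "conv (self_module R) a b"
    have R: "a i \<in> carrier R" "b i \<in> carrier R" for i using ab G.P_carrier by blast+
    have m: "a (Suc 0) \<in> \<mm>" "b (Suc 0) \<in> \<mm>" using ab P_simps(2) by metis+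
    have "?x 0 = a 0 \<otimes> b 0" using R by (simp add: conv_def self_module_def)
    then have x0: "?x 0 \<in> \<mm>" using ab R by (simp add: I_l_closed)
    have "?x (Suc 0) = a 0 \<otimes> b (Suc 0) \<oplus> a (Suc 0) \<otimes> b 0" using R by (simp add: conv_def self_module_def)
    then have x1: "?x (Suc 0) \<in> \<mm> \<cdot> \<mm>" using ab m by (simp add: ideal_prod.intros)
    have x: "?x i \<in> P i" for i using ab G.S.conv_filt by blast
    then have "?x (Suc (Suc 0)) \<in> \<mm> \<cdot> \<mm>" using P_simps(3) by metis
    then show ?case using E2[OF x x0 x1] ab cls_mult by auto
  next
    case (sum f h)
    then obtain c d where "c \<in> \<mm> \<cdot> \<mm>" "d \<in> \<mm> \<cdot> \<mm>" "f = E (Suc (Suc 0)) c" "h = E (Suc (Suc 0)) d" by blast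
    then show ?case using P_simps(3) E_add[of c "Suc (Suc 0)" d] by (auto intro!: bexI[of _ "c \<oplus> d"] ideal_prod.sum)
  qed
next
  assume "\<exists>c\<in>\<mm> \<cdot> \<mm>. f = E (Suc (Suc 0)) c"
  then obtain c where c: "c \<in> \<mm> \<cdot> \<mm>" and f: "f = E (Suc (Suc 0)) c" by blast
  from c show "f \<in> ideal_prod A gr_max gr_max" unfolding f
  proof induction
    case (prod i j)
    then have "E (Suc (Suc 0)) (i \<otimes> j) = E (Suc 0) i \<otimes>\<^bsub>A\<^esub> E (Suc 0) j"
      using E_mult[of i "Suc 0" j "Suc 0"] P_simps by simp
    then show ?case using prod P_simps E_gr_max by (simp add: ideal_prod.prod)
  next
    case (sum a b)
    then show ?case using E_add[of a "Suc (Suc 0)" b] P_simps by (simp add: ideal_prod.sum)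
  qed
qed

text \<open>An element \<open>f\<close> of positive degree is outside the square iff its linear component
\<open>a\<^sub>1\<close> is outside \<open>\<mm>\<^sup>2\<close>. If \<open>i\<close> annihilates \<open>a\<^sub>1\<close>, then the linear element of \<open>i\<close> annihilates \<open>f\<close>, since the other
components of the product involve \<open>i a\<^sub>0 \<in> \<mm>\<^sup>2\<close>, which vanishes in \<open>\<mm> / \<mm>\<^sup>2\<close>, and
\<open>i a\<^sub>2 \<in> \<mm>\<^sup>3 = 0\<close>. So the condition on \<open>ann(a\<^sub>1)\<close> carries over.\<close>

theorem gr_short_ring: "short_ring gr_max A (gr_comp P)"
proof (intro short_ring.intro short_ring_axioms.intro G.gr_graded_cring gr_max_ideal)
  show "\<one>\<^bsub>A\<^esub> \<notin> gr_max"
    unfolding G.gr_ring_one using one_notin_max by (subst gr_max_cls[OF G.one_rep]) simp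
  have cube: "f \<otimes>\<^bsub>A\<^esub> h = \<zero>\<^bsub>A\<^esub>" if f: "f \<in> gr_max" and h: "h \<in> ideal_prod A gr_max gr_max" for f h
  proof -
    obtain c where c: "c \<in> \<mm> \<cdot> \<mm>" "h = E (Suc (Suc 0)) c" using h gr_max_sq by blast
    then have cP: "c \<in> P (Suc (Suc 0))" using P_simps by simp
    obtain a where a: "\<forall>i. a i \<in> P i" "a 0 \<in> \<mm>" "f = cls a" using gr_max_rep[OF f] by blast
    have "c \<otimes> a 0 = \<zero>" using sr.cube_zero[OF a(2) c(1)] m_comm a(2) cP G.P_carrier by (metis Icarr)
    have "h \<otimes>\<^bsub>A\<^esub> f = cls (\<lambda>n. if Suc (Suc 0) \<le> n then c \<otimes> a (n - Suc (Suc 0)) else \<zero>)"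
      unfolding c(2) a(3) using cP a(1) by (intro E_mult_cls) auto
    also have "(\<lambda>n. if Suc (Suc 0) \<le> n then c \<otimes> a (n - Suc (Suc 0)) else \<zero>) = (\<lambda>_. \<zero>)"
    proof
      fix n
      have "c \<otimes> a (n - Suc (Suc 0)) = \<zero>" if "n \<ge> 3"
      proof -
        have "c \<otimes> a (n - Suc (Suc 0)) \<in> P (Suc (Suc 0) + (n - Suc (Suc 0)))" using G.P_mult[OF cP] a(1) by blast
        also have "P (Suc (Suc 0) + (n - Suc (Suc 0))) = {\<zero>}" using that by (intro pow_nil) simp
        finally show ?thesis by simp
      qed
      then show "(if Suc (Suc 0) \<le> n then c \<otimes> a (n - Suc (Suc 0)) else \<zero>) = \<zero>"
        using \<open>c \<otimes> a 0 = \<zero>\<close> by (cases "n = Suc (Suc 0)") auto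
    qed
    also have "cls (\<lambda>_. \<zero>) = \<zero>\<^bsub>A\<^esub>" using G.P_zero by (subst cls_zero_iff) auto
    finally have "h \<otimes>\<^bsub>A\<^esub> f = \<zero>\<^bsub>A\<^esub>" .
    moreover have "f \<in> carrier A" "h \<in> carrier A" using a c cP cls_closed E_closed by auto
    ultimately show ?thesis using A.m_comm by metis
  qed
  then show "f \<otimes>\<^bsub>A\<^esub> h = \<zero>\<^bsub>A\<^esub>" if "f \<in> gr_max" "h \<in> ideal_prod A gr_max gr_max" for f h
    using that by blast
  show "f \<in> Units A" if f: "f \<in> carrier A" and nf: "f \<notin> gr_max" for f
  proof -
    obtain a where a: "\<forall>i. a i \<in> P i" "f = cls a" using A_rep[OF f] by blast
    have aR: "a i \<in> carrier R" for i using a G.P_carrier by blast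
    have "a 0 \<notin> \<mm>" using nf a gr_max_cls by blast
    then have U: "a 0 \<in> Units R" using nonunit_in_max aR by blast
    define g where "g = E 0 (inv (a 0))"
    have g: "g \<in> carrier A" unfolding g_def using U by (intro E_closed) simp
    define x where "x n = (if n = 0 then \<zero> else inv (a 0) \<otimes> a n)" for n
    have x: "x n \<in> P n" for n
      using G.P_zero ideal.I_l_closed[OF G.P_ideal] a U by (simp add: x_def)
    define w where "w = cls x"
    have w: "w \<in> gr_max" unfolding w_def using x by (subst gr_max_cls) (auto simp: x_def)
    have wA: "w \<in> carrier A" unfolding w_def using x by (rule cls_closed)
    have "g \<otimes>\<^bsub>A\<^esub> f = cls (\<lambda>n. if 0 \<le> n then inv (a 0) \<otimes> a (n - 0) else \<zero>)"
      unfolding g_def a(2) using U a(1) by (intro E_mult_cls) auto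
    also have "(\<lambda>n. if 0 \<le> n then inv (a 0) \<otimes> a (n - 0) else \<zero>) = (\<lambda>n. (if n = 0 then \<one> else \<zero>) \<oplus> x n)"
      using U aR by (auto simp: x_def)
    also have "cls \<dots> = \<one>\<^bsub>A\<^esub> \<oplus>\<^bsub>A\<^esub> w"
      unfolding G.gr_ring_one w_def using cls_add[OF G.one_rep x] by simp
    finally have eq: "g \<otimes>\<^bsub>A\<^esub> f = \<one>\<^bsub>A\<^esub> \<oplus>\<^bsub>A\<^esub> w" .
    have "w \<otimes>\<^bsub>A\<^esub> (w \<otimes>\<^bsub>A\<^esub> w) = \<zero>\<^bsub>A\<^esub>" using cube[OF w] w by (simp add: ideal_prod.prod)
    then have "g \<otimes>\<^bsub>A\<^esub> f \<in> Units A" unfolding eq using wA by (intro A.one_plus_nilpotent_unit)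
    then show ?thesis using f g A.unit_factor[of f g] A.m_comm[OF f g] by simp
  qed
  show "ideal_prod A gr_max gr_max \<subseteq> ideal_prod A (annihilator A f) gr_max"
    if f: "f \<in> gr_max" "f \<notin> ideal_prod A gr_max gr_max" for f
  proof
    obtain a where a: "\<forall>i. a i \<in> P i" "a 0 \<in> \<mm>" "f = cls a" using gr_max_rep[OF f(1)] by blast
    have aR: "a i \<in> carrier R" for i using a G.P_carrier by blast
    have a1: "a (Suc 0) \<in> \<mm>" using a(1) P_simps(2) by metis
    have "a (Suc 0) \<notin> \<mm> \<cdot> \<mm>"
    proof
      assume "a (Suc 0) \<in> \<mm> \<cdot> \<mm>"
      then have "cls a = E (Suc (Suc 0)) (a (Suc (Suc 0)))" unfolding E_def
        using a single_filt aR by (intro cls_cong) (simp_all add: a_minus_def)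
      moreover have "a (Suc (Suc 0)) \<in> \<mm> \<cdot> \<mm>" using a(1) P_simps(3) by metis
      ultimately show False using f(2) a(3) gr_max_sq by blast
    qed
    then have sub: "\<mm> \<cdot> \<mm> \<subseteq> annihilator R (a (Suc 0)) \<cdot> \<mm>" using sr.ann_prod a1 by blast
    fix h assume "h \<in> ideal_prod A gr_max gr_max"
    then obtain c where c: "c \<in> \<mm> \<cdot> \<mm>" "h = E (Suc (Suc 0)) c" using gr_max_sq by blast
    have im: "i \<in> \<mm>" if "i \<in> annihilator R (a (Suc 0))" for i
    proof (rule ccontr)
      assume "i \<notin> \<mm>"
      have i: "i \<in> carrier R" "i \<otimes> a (Suc 0) = \<zero>" using that by (auto simp: annihilator_def)
      then have U: "i \<in> Units R" using nonunit_in_max \<open>i \<notin> \<mm>\<close> by blast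
      have "inv i \<otimes> (i \<otimes> a (Suc 0)) = (inv i \<otimes> i) \<otimes> a (Suc 0)"
        using U aR i(1) by (intro m_assoc[symmetric]) auto
      then have "a (Suc 0) = inv i \<otimes> (i \<otimes> a (Suc 0))" using U aR by simp
      then have "a (Suc 0) = \<zero>" using i U by simp
      then show False using \<open>a (Suc 0) \<notin> \<mm> \<cdot> \<mm>\<close> sr.sq.zero_closed by simp
    qed
    have annm: "annihilator R (a (Suc 0)) \<cdot> \<mm> \<subseteq> \<mm> \<cdot> \<mm>" using im by (intro ideal_prod_mono) auto
    have "c \<in> annihilator R (a (Suc 0)) \<cdot> \<mm>" using sub c(1) by blast
    then show "h \<in> ideal_prod A (annihilator A f) gr_max" unfolding c(2)
    proof induction
      case (prod i j)
      have i: "i \<in> \<mm>" "i \<otimes> a (Suc 0) = \<zero>" "i \<in> carrier R"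
        using im[OF prod(1)] prod(1) by (simp_all add: annihilator_def)
      have iP: "i \<in> P (Suc 0)" "j \<in> P (Suc 0)" using i prod P_simps by simp_all
      have "E (Suc 0) i \<otimes>\<^bsub>A\<^esub> f = cls (\<lambda>n. if Suc 0 \<le> n then i \<otimes> a (n - Suc 0) else \<zero>)"
        unfolding a(3) using iP a(1) by (intro E_mult_cls) auto
      also have "\<dots> = \<zero>\<^bsub>A\<^esub>"
      proof (subst cls_zero_iff)
        have mem: "(if Suc 0 \<le> n then i \<otimes> a (n - Suc 0) else \<zero>) \<in> P n" for n
          using G.P_mult[OF iP(1), of "a (n - Suc 0)" "n - Suc 0"] a(1) G.P_zero by (cases n) simp_all
        then show "(if Suc 0 \<le> n then i \<otimes> a (n - Suc 0) else \<zero>) \<in> P n" for n .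
        show "\<forall>n. (if Suc 0 \<le> n then i \<otimes> a (n - Suc 0) else \<zero>) \<in> P (Suc n)"
        proof
          fix n
          consider "n = 0" | "n = Suc 0" | "n = Suc (Suc 0)" | "n \<ge> 3" by linarith
          then show "(if Suc 0 \<le> n then i \<otimes> a (n - Suc 0) else \<zero>) \<in> P (Suc n)"
          proof cases
            case 2
            then show ?thesis using i a(2) P_simps by (simp add: ideal_prod.prod)
          next
            case 3
            then show ?thesis using i G.P_zero by simp
          next
            case 4
            then show ?thesis using mem[of n] pow_nil G.P_zero by auto
          qed (use G.P_zero in simp)
        qed
      qed
      finally have "E (Suc 0) i \<in> annihilator A f" using E_closed[OF iP(1)] by (simp add: annihilator_def)
      moreover have "E (Suc (Suc 0)) (i \<otimes> j) = E (Suc 0) i \<otimes>\<^bsub>A\<^esub> E (Suc 0) j"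
        using E_mult[OF iP] by simp
      ultimately show ?case using E_gr_max[OF iP(2)] by (simp add: ideal_prod.prod)
    next
      case (sum c d)
      then have "c \<in> P (Suc (Suc 0))" "d \<in> P (Suc (Suc 0))" using annm P_simps by auto
      then show ?case using sum by (simp add: E_add ideal_prod.sum)
    qed
  qed
  have comp1: "gr_comp P 1 (cls a) = E (Suc 0) (a (Suc 0))" for a
  proof -
    have "(\<lambda>i. if int i = 1 then a i else \<zero>\<^bsub>self_module R\<^esub>) = (\<lambda>i. if i = Suc 0 then a (Suc 0) else \<zero>)"
      by (auto simp: sr.self_simps)
    then show ?thesis using G.S.A.gr_comp_cls[of 1 a] by (simp only: E_def)
  qed
  show "gr_comp P 1 u \<in> gr_max" if "u \<in> gr_max" for u
  proof -
    obtain a where a: "\<forall>i. a i \<in> P i" "a 0 \<in> \<mm>" "u = cls a" using gr_max_rep[OF \<open>u \<in> gr_max\<close>] by blast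
    show ?thesis unfolding a(3) comp1 using a(1) by (intro E_gr_max) auto
  qed
  show "u \<ominus>\<^bsub>A\<^esub> gr_comp P 1 u \<in> ideal_prod A gr_max gr_max" if "u \<in> gr_max" for u
  proof -
    obtain a where a: "\<forall>i. a i \<in> P i" "a 0 \<in> \<mm>" "u = cls a" using gr_max_rep[OF \<open>u \<in> gr_max\<close>] by blast
    have aR: "a i \<in> carrier R" for i using a G.P_carrier by blast
    let ?c = "E (Suc (Suc 0)) (a (Suc (Suc 0)))" and ?l = "E (Suc 0) (a (Suc 0))"
    have "?c \<oplus>\<^bsub>A\<^esub> ?l = cls (\<lambda>i. (if i = Suc (Suc 0) then a (Suc (Suc 0)) else \<zero>) \<oplus> (if i = Suc 0 then a (Suc 0) else \<zero>))"
      unfolding E_def using a(1) by (intro cls_add single_filt) auto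
    also have "\<dots> = cls a"
      using a aR G.P_zero by (intro cls_cong) (auto simp: a_minus_def r_neg)
    finally have "u = ?c \<oplus>\<^bsub>A\<^esub> ?l" using a(3) by simp
    moreover have c: "?c \<in> carrier A" "?l \<in> carrier A" using a(1) E_closed by blast+
    ultimately have "u \<ominus>\<^bsub>A\<^esub> gr_comp P 1 u = ?c"
      unfolding a(3) comp1 by (simp add: a_minus_def A.a_assoc A.r_neg)
    moreover have "a (Suc (Suc 0)) \<in> \<mm> \<cdot> \<mm>" using a(1) P_simps(3) by metis
    ultimately show ?thesis using gr_max_sq by blast
  qed
  fix y :: "nat \<Rightarrow> nat \<Rightarrow> 'a set"
  assume y: "\<And>n. y n \<in> gr_max" "\<And>n. gr_comp P 1 (y n) = y n"
  have "\<exists>r. r \<in> \<mm> \<and> y n = E (Suc 0) r" for n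
  proof -
    obtain a where a: "\<forall>i. a i \<in> P i" "y n = cls a" using gr_max_rep[OF y(1)] by blast
    then have "y n = E (Suc 0) (a (Suc 0))" using y(2)[of n] comp1[of a] by simp
    moreover have "a (Suc 0) \<in> \<mm>" using a(1) P_simps(2) by metis
    ultimately show ?thesis by blast
  qed
  then obtain r where r: "\<And>n. r n \<in> \<mm>" "\<And>n. y n = E (Suc 0) (r n)" by metis
  have rP: "r n \<in> P (Suc 0)" for n using r(1) P_simps by simp
  obtain n z where z: "z \<in> lspan R (self_module R) r n" "r n \<ominus> z \<in> \<mm> \<cdot> \<mm>"
    using sr.linear_chain[of r] r(1) by blast
  obtain c where c: "\<And>l. c l \<in> carrier R" "z = lincomb (self_module R) r n c"
    using z(1) by (rule sr.S.lspanE) (rule that; simp)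
  interpret AS: module A "self_module A" by (rule A.self_module_module)
  have lin: "E (Suc 0) (lincomb (self_module R) r k c) = lincomb (self_module A) y k (\<lambda>l. E 0 (c l))
      \<and> lincomb (self_module R) r k c \<in> P (Suc 0)" for k
  proof (induction k)
    case 0
    then show ?case using E_eq_zero[of \<zero> "Suc 0"] G.P_zero by (simp add: self_module_def)
  next
    case (Suc k)
    have m: "c k \<otimes> r k \<in> P (Suc 0)" using G.P_mult[of "c k" 0 "r k" "Suc 0"] c(1) rP by simp
    have s: "lincomb (self_module R) r k c \<oplus> c k \<otimes> r k \<in> P (Suc 0)"
      using additive_subgroup.a_closed[OF ideal.axioms(1)[OF G.P_ideal]] Suc m by blast
    have "E 0 (c k) \<otimes>\<^bsub>A\<^esub> y k = E (Suc 0) (c k \<otimes> r k)" unfolding r(2) using E_mult[of "c k" 0 "r k" "Suc 0"] c(1) rP by simp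
    then show ?case using Suc m s E_add[of "lincomb (self_module R) r k c" "Suc 0" "c k \<otimes> r k"]
      by (simp add: self_module_def)
  qed
  have zP: "z \<in> P (Suc 0)" unfolding c(2) using lin by blast
  have zR: "z \<in> carrier R" "r n \<in> carrier R" using zP rP G.P_carrier by blast+
  have "E (Suc 0) z \<in> lspan A (self_module A) y n"
    unfolding c(2) lin[THEN conjunct1] using c(1) E_closed[of _ 0] by (intro AS.lspanI) simp
  moreover have "y n \<ominus>\<^bsub>A\<^esub> E (Suc 0) z = \<zero>\<^bsub>A\<^esub>"
  proof -
    have d: "r n \<ominus> z \<in> P (Suc (Suc 0))" using z(2) P_simps by simp
    have "y n = E (Suc 0) ((r n \<ominus> z) \<oplus> z)" using zR r(2) by (simp add: a_minus_def a_assoc l_neg)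
    also have "\<dots> = E (Suc 0) (r n \<ominus> z) \<oplus>\<^bsub>A\<^esub> E (Suc 0) z" using d G.P_desc zP by (intro E_add) auto
    also have "E (Suc 0) (r n \<ominus> z) = \<zero>\<^bsub>A\<^esub>" using d by (rule E_eq_zero)
    finally show ?thesis using E_closed[OF zP] by (simp add: a_minus_def A.r_neg)
  qed
  moreover have "\<zero>\<^bsub>A\<^esub> \<in> ideal_prod A gr_max gr_max"
    using A.ideal_prod_is_ideal[OF gr_max_ideal gr_max_ideal] by (simp add: additive_subgroup.zero_closed ideal.axioms)
  ultimately show "\<exists>n. \<exists>z\<in>lspan A (self_module A) y n. y n \<ominus>\<^bsub>A\<^esub> z \<in> ideal_prod A gr_max gr_max"
    by (intro exI[of _ n] bexI[of _ "E (Suc 0) z"]) simp_all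
qed

end

section \<open>Good sequences in degrees zero and one\<close>

context short_ring
begin

text \<open>The vectors of \<open>Y\<close> are appended one by one, omitting those already in the span. This
keeps the colon ideals proper, and they only grow when more vectors precede.\<close>

lemma good_seq_extend:
  assumes N: "graded_module R gcomp N ncomp" and fin: "finite Y" and YN: "Y \<subseteq> carrier N"
    and hY: "\<And>v. v \<in> Y \<Longrightarrow> ncomp e v = v"
    and good: "good_seq R \<mm> N g s" and hg: "\<And>l. l < s \<Longrightarrow> ncomp (t l) (g l) = g l"
    and col: "\<And>v. v \<in> Y \<Longrightarrow> \<mm> \<cdot> \<mm> \<subseteq> colon R N (lspan R N g s) v \<cdot> \<mm>"
  shows "\<exists>g' s' t'. good_seq R \<mm> N g' s' \<and> (\<forall>l<s'. ncomp (t' l) (g' l) = g' l) \<and>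
    lspan R N g s \<subseteq> lspan R N g' s' \<and> Y \<subseteq> lspan R N g' s' \<and> (\<forall>l<s'. t' l \<in> insert e (t ` {..<s}))"
  using fin YN hY col
proof (induction Y)
  case empty
  then show ?case using good hg by (intro exI[of _ g] exI[of _ s] exI[of _ t]) auto
next
  case (insert v Y)
  interpret N: graded_module R gcomp N ncomp by fact
  obtain g' s' t' where IH: "good_seq R \<mm> N g' s'" "\<forall>l<s'. ncomp (t' l) (g' l) = g' l"
    "lspan R N g s \<subseteq> lspan R N g' s'" "Y \<subseteq> lspan R N g' s'" "\<forall>l<s'. t' l \<in> insert e (t ` {..<s})"
    using insert by auto
  have gN: "g' l \<in> carrier N" if "l < s'" for l using IH(1) that by (auto simp: good_seq_def)
  have sub: "submodule (lspan R N g' s') R N" using gN by (rule N.lspan_submodule)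
  show ?case
  proof (cases "v \<in> lspan R N g' s'")
    case True
    then show ?thesis using IH by blast
  next
    case False
    define g2 where "g2 = g'(s' := v)"
    define t2 where "t2 = t'(s' := e)"
    have v: "v \<in> carrier N" "ncomp e v = v" "\<mm> \<cdot> \<mm> \<subseteq> colon R N (lspan R N g s) v \<cdot> \<mm>"
      using insert.prems by auto
    have eqg: "g2 l = g' l" if "l < s'" for l using that by (simp add: g2_def)
    have sp: "lspan R N g2 s' = lspan R N g' s'" using N.lspan_cong[of s' g2 g'] eqg by simp
    have "colon R N (lspan R N g' s') v \<subseteq> \<mm>"
    proof
      fix a assume "a \<in> colon R N (lspan R N g' s') v"
      then have a: "a \<in> carrier R" "a \<odot>\<^bsub>N\<^esub> v \<in> lspan R N g' s'" by (auto simp: colon_def)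
      show "a \<in> \<mm>"
      proof (rule ccontr)
        assume "a \<notin> \<mm>"
        then have U: "a \<in> Units R" using unitI a by blast
        then have "inv a \<odot>\<^bsub>N\<^esub> (a \<odot>\<^bsub>N\<^esub> v) \<in> lspan R N g' s'"
          using N.submoduleE(4)[OF sub _ a(2), of "inv a"] by simp
        moreover have "inv a \<odot>\<^bsub>N\<^esub> (a \<odot>\<^bsub>N\<^esub> v) = v"
          using U a(1) v by (subst N.smult_assoc1[symmetric]) auto
        ultimately show False using False by simp
      qed
    qed
    moreover have "colon R N (lspan R N g s) v \<subseteq> colon R N (lspan R N g' s') v"
      using IH(3) by (auto simp: colon_def)
    then have "\<mm> \<cdot> \<mm> \<subseteq> colon R N (lspan R N g' s') v \<cdot> \<mm>"
      using v(3) ideal_prod_mono[of _ _ \<mm> \<mm> R] by (meson order_refl order_trans)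
    ultimately have "good_seq R \<mm> N g2 (Suc s')"
      unfolding good_seq_Suc sp using IH(1) good_seq_cong[OF N.module_axioms, of s' g2 g'] eqg v(1)
      by (simp add: g2_def)
    moreover have "\<forall>l<Suc s'. ncomp (t2 l) (g2 l) = g2 l"
      using IH(2) v by (auto simp: g2_def t2_def less_Suc_eq)
    moreover have incl: "lspan R N g' s' \<subseteq> lspan R N g2 (Suc s')"
    proof (rule N.lspan_least)
      have g2N: "g2 l \<in> carrier N" if "l < Suc s'" for l
        using gN v(1) that by (auto simp: g2_def less_Suc_eq)
      then show "submodule (lspan R N g2 (Suc s')) R N" by (rule N.lspan_submodule)
      show "g' l \<in> lspan R N g2 (Suc s')" if "l < s'" for l
        using N.lspan_mem[of l "Suc s'" g2] g2N that eqg[OF that] by simp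
    qed
    moreover have "v \<in> lspan R N g2 (Suc s')"
    proof -
      have "\<zero>\<^bsub>N\<^esub> \<oplus>\<^bsub>N\<^esub> \<one> \<odot>\<^bsub>N\<^esub> g2 s' \<in> lspan R N g2 (Suc s')"
        using N.submodule_zero[OF sub] sp by (intro N.lspan_SucI) auto
      then show ?thesis using v(1) by (simp add: g2_def)
    qed
    moreover have "\<forall>l<Suc s'. t2 l \<in> insert e (t ` {..<s})"
      using IH(5) by (auto simp: t2_def less_Suc_eq)
    ultimately show ?thesis using IH(3,4)
      by (intro exI[of _ g2] exI[of _ "Suc s'"] exI[of _ t2]) auto
  qed
qed

text \<open>For the generators \<open>y\<close> of \<open>\<mm>\<close> and \<open>u \<in> U\<close>, the products \<open>y u\<close> have degree one and are killed by
\<open>ann(y)\<close>, and once they span \<open>\<mm> N\<close>, the colon ideal of each \<open>u\<close> contains \<open>\<mm>\<close>. The sequence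
\<open>U\<close> alone would in general fail to be good. The redundant products cost one degree in the regularity
bound.\<close>

theorem degree_zero_generated_good:
  assumes N: "graded_module R gcomp N ncomp" and fin: "finite U" and UN: "U \<subseteq> carrier N"
    and hU: "\<And>u. u \<in> U \<Longrightarrow> ncomp 0 u = u"
    and gen: "\<And>H. \<lbrakk>submodule H R N; U \<subseteq> H\<rbrakk> \<Longrightarrow> H = carrier N"
  obtains g s t where "good_seq R \<mm> N g s" "\<And>l. l < s \<Longrightarrow> ncomp (t l) (g l) = g l"
    "lspan R N g s = carrier N" "\<And>l. l < s \<Longrightarrow> t l \<le> 1"
proof -
  interpret N: graded_module R gcomp N ncomp by fact
  have "submodule \<mm> R (self_module R)" using is_ideal self_submodule_iff_ideal by blast
  then obtain y p where y: "\<And>l. l < p \<Longrightarrow> y l \<in> \<mm>" "\<And>l. l < p \<Longrightarrow> gcomp 1 (y l) = y l"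
    "\<And>l z. \<lbrakk>l < p; z \<in> lspan R (self_module R) y l\<rbrakk> \<Longrightarrow> y l \<ominus> z \<notin> \<mm> \<cdot> \<mm>"
    "\<mm> = lspan R (self_module R) y p"
    using linear_generators[of \<mm>, OF _ order_refl order_refl gcomp_max] by metis
  have ysq: "y l \<notin> \<mm> \<cdot> \<mm>" if "l < p" for l
  proof -
    have "\<zero> \<in> lspan R (self_module R) y l"
      using S.submodule_zero[OF S.lspan_submodule[of l y]] y(1) that by (auto simp: self_simps)
    then have "y l \<ominus> \<zero> \<notin> \<mm> \<cdot> \<mm>" using y(3)[OF that] by blast
    then show ?thesis using y(1)[OF that] by (simp add: a_minus_def)
  qed
  define Y where "Y = (\<lambda>(l, u). y l \<odot>\<^bsub>N\<^esub> u) ` ({..<p} \<times> U)"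
  have "\<exists>g' s' t'. good_seq R \<mm> N g' s' \<and> (\<forall>l<s'. ncomp (t' l) (g' l) = g' l) \<and>
    lspan R N undefined 0 \<subseteq> lspan R N g' s' \<and> Y \<subseteq> lspan R N g' s' \<and>
    (\<forall>l<s'. t' l \<in> insert (1::int) ((\<lambda>_. 0) ` {..<0::nat}))"
  proof (rule good_seq_extend[OF N])
    show "finite Y" using fin by (simp add: Y_def)
    show "Y \<subseteq> carrier N" using y(1) UN by (auto simp: Y_def)
    show "good_seq R \<mm> N undefined 0" by (simp add: good_seq_def)
    fix v assume "v \<in> Y"
    then obtain l u where lu: "l < p" "u \<in> U" "v = y l \<odot>\<^bsub>N\<^esub> u" by (auto simp: Y_def)
    have yR: "y l \<in> carrier R" and uN: "u \<in> carrier N" using lu y(1) UN by auto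
    have "ncomp 1 v = gcomp (1 - 0) (y l) \<odot>\<^bsub>N\<^esub> u"
      unfolding lu(3) using yR uN hU[OF lu(2)] by (intro N.ncomp_smult)
    then show "ncomp 1 v = v" using y(2)[OF lu(1)] lu(3) by simp
    have sub0: "submodule (lspan R N undefined 0) R N" by (intro N.lspan_submodule) simp
    show "\<mm> \<cdot> \<mm> \<subseteq> colon R N (lspan R N undefined 0) v \<cdot> \<mm>"
    proof (rule annihilator_colon[OF N.module_axioms sub0 y(1)[OF lu(1)] ysq[OF lu(1)]])
      fix a assume a: "a \<in> carrier R" "a \<otimes> y l = \<zero>"
      have "a \<odot>\<^bsub>N\<^esub> v = (a \<otimes> y l) \<odot>\<^bsub>N\<^esub> u" unfolding lu(3) using a yR uN by (simp add: N.smult_assoc1[symmetric])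
      then show "a \<odot>\<^bsub>N\<^esub> v \<in> lspan R N undefined 0" using a uN N.submodule_zero[OF sub0] by simp
    qed
  qed simp
  then obtain g1 s1 and t1 :: "nat \<Rightarrow> int" where 1: "good_seq R \<mm> N g1 s1"
    "\<And>l. l < s1 \<Longrightarrow> ncomp (t1 l) (g1 l) = g1 l" "Y \<subseteq> lspan R N g1 s1" "\<forall>l<s1. t1 l = 1" by auto
  have g1N: "g1 l \<in> carrier N" if "l < s1" for l using 1(1) that by (auto simp: good_seq_def)
  have sub1: "submodule (lspan R N g1 s1) R N" using g1N by (rule N.lspan_submodule)
  have "\<exists>g' s' t'. good_seq R \<mm> N g' s' \<and> (\<forall>l<s'. ncomp (t' l) (g' l) = g' l) \<and>
    lspan R N g1 s1 \<subseteq> lspan R N g' s' \<and> U \<subseteq> lspan R N g' s' \<and> (\<forall>l<s'. t' l \<in> insert (0::int) (t1 ` {..<s1}))"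
  proof (rule good_seq_extend[OF N fin UN hU 1(1,2)])
    fix u assume u: "u \<in> U"
    then have uN: "u \<in> carrier N" using UN by auto
    have hom: "(\<lambda>r. r \<odot>\<^bsub>N\<^esub> u) \<in> module_homs R (self_module R) N"
      using uN by (auto simp: module_homs_def self_simps N.smult_l_distr N.smult_assoc1)
    have "a \<odot>\<^bsub>N\<^esub> u \<in> lspan R N g1 s1" if a: "a \<in> \<mm>" for a
    proof -
      obtain c where c: "\<And>l. c l \<in> carrier R" "a = lincomb (self_module R) y p c"
        using a unfolding y(4) by (rule S.lspanE) (rule that; simp)
      have "a \<odot>\<^bsub>N\<^esub> u = lincomb N (\<lambda>l. y l \<odot>\<^bsub>N\<^esub> u) p c"
        unfolding c(2) using lincomb_hom[OF S.module_axioms N.module_axioms hom, of p y c] y(1) c(1)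
        by (simp add: self_simps)
      also have "\<dots> \<in> lspan R N g1 s1"
      proof (rule N.submodule_lincomb[OF sub1])
        show "y l \<odot>\<^bsub>N\<^esub> u \<in> lspan R N g1 s1" if "l < p" for l
          using 1(3) u that by (auto simp: Y_def)
      qed (rule c(1))
      finally show ?thesis .
    qed
    then have "\<mm> \<subseteq> colon R N (lspan R N g1 s1) u" by (auto simp: colon_def)
    then show "\<mm> \<cdot> \<mm> \<subseteq> colon R N (lspan R N g1 s1) u \<cdot> \<mm>" by (intro ideal_prod_mono) auto
  qed
  then obtain g s and t :: "nat \<Rightarrow> int" where g: "good_seq R \<mm> N g s" "\<forall>l<s. ncomp (t l) (g l) = g l"
    "U \<subseteq> lspan R N g s" "\<forall>l<s. t l \<in> insert 0 (t1 ` {..<s1})" by blast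
  have "g l \<in> carrier N" if "l < s" for l using g(1) that by (auto simp: good_seq_def)
  then have "submodule (lspan R N g s) R N" by (rule N.lspan_submodule)
  then have "lspan R N g s = carrier N" using g(3) by (rule gen)
  moreover have "t l \<le> 1" if "l < s" for l using g(4) 1(4) that by fastforce
  ultimately show ?thesis using that[of g s t] g by blast
qed

end

context gr_short
begin

text \<open>The component \<open>\<mm>\<^sup>i M / \<mm>\<^sup>i\<^sup>+\<^sup>1 M\<close> consists of the sums of products of a homogeneous
element of degree \<open>i\<close> and the class in \<open>M / \<mm> M\<close> of an element of \<open>M\<close>.\<close>

lemma gr_module_degree_zero_generated:
  assumes M: "module R M" and XM: "X \<subseteq> carrier M"
    and gen: "\<And>H. \<lbrakk>submodule H R M; X \<subseteq> H\<rbrakk> \<Longrightarrow> H = carrier M"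
  defines "\<Phi> \<equiv> \<lambda>i. ideal_smult M (P i) (carrier M)"
  defines "U \<equiv> (\<lambda>g. gr_class M \<Phi> (\<lambda>i. if i = 0 then g else \<zero>\<^bsub>M\<^esub>)) ` X"
  shows "U \<subseteq> carrier (gr_module R \<mm> M)" "u \<in> U \<Longrightarrow> gr_comp \<Phi> 0 u = u"
    "\<lbrakk>submodule H A (gr_module R \<mm> M); U \<subseteq> H\<rbrakk> \<Longrightarrow> H = carrier (gr_module R \<mm> M)"
proof -
  have pair: "filtered_pair R P M \<Phi>" unfolding \<Phi>_def by (rule G.module_filtered_pair[OF M])
  interpret N: filtered_pair R P M \<Phi> by (rule pair)
  interpret sr: short_ring \<mm> R "\<lambda>_ a. a" by (rule short_ring_if_ann[OF ann])
  have gr: "gr_module R \<mm> M = N.N.Gr" by (simp add: gr_module_def \<Phi>_def)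
  interpret NA: graded_module A "gr_comp P" N.N.Gr "gr_comp \<Phi>" by (rule G.gr_graded_module[OF pair])
  have \<Phi>0: "x \<in> \<Phi> 0" if "x \<in> carrier M" for x
    using ideal_smult.smult[of \<one> "P 0" x "carrier M" M] that by (simp add: \<Phi>_def)
  define EN where "EN k x = N.N.cls (\<lambda>i. if i = k then x else \<zero>\<^bsub>M\<^esub>)" for k x
  have sing: "(if i = k then x else \<zero>\<^bsub>M\<^esub>) \<in> \<Phi> i" if "x \<in> \<Phi> k" for i k x
    using that N.N.filt_zero by simp
  have EN_closed: "EN k x \<in> carrier N.N.Gr" if "x \<in> \<Phi> k" for k x
    unfolding EN_def using sing[OF that] by (rule N.N.cls_closed)
  have EN_add: "EN k (x \<oplus>\<^bsub>M\<^esub> y) = EN k x \<oplus>\<^bsub>N.N.Gr\<^esub> EN k y" if x: "x \<in> \<Phi> k" and y: "y \<in> \<Phi> k" for k x y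
  proof -
    have "(\<lambda>i. if i = k then x \<oplus>\<^bsub>M\<^esub> y else \<zero>\<^bsub>M\<^esub>) =
        (\<lambda>i. (if i = k then x else \<zero>\<^bsub>M\<^esub>) \<oplus>\<^bsub>M\<^esub> (if i = k then y else \<zero>\<^bsub>M\<^esub>))" by auto
    then show ?thesis unfolding EN_def using N.N.cls_add[OF sing[OF x] sing[OF y]] by simp
  qed
  have EN_mult: "E k a \<odot>\<^bsub>N.N.Gr\<^esub> EN 0 g = EN k (a \<odot>\<^bsub>M\<^esub> g)" if a: "a \<in> P k" and g: "g \<in> carrier M" for k a g
  proof -
    have aR: "a \<in> carrier R" using G.P_carrier[OF a] .
    have "E k a \<odot>\<^bsub>N.N.Gr\<^esub> EN 0 g =
        N.N.cls (conv M (\<lambda>i. if i = k then a else \<zero>) (\<lambda>i. if i = 0 then g else \<zero>\<^bsub>M\<^esub>))"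
      unfolding EN_def E_def using single_filt[OF a] sing[OF \<Phi>0[OF g]] by (rule N.smult_cls)
    also have "conv M (\<lambda>i. if i = k then a else \<zero>) (\<lambda>i. if i = 0 then g else \<zero>\<^bsub>M\<^esub>) =
        (\<lambda>i. if i = k then a \<odot>\<^bsub>M\<^esub> g else \<zero>\<^bsub>M\<^esub>)"
    proof
      fix n
      show "conv M (\<lambda>i. if i = k then a else \<zero>) (\<lambda>i. if i = 0 then g else \<zero>\<^bsub>M\<^esub>) n =
        (if n = k then a \<odot>\<^bsub>M\<^esub> g else \<zero>\<^bsub>M\<^esub>)"
        using g aR by (subst N.N.conv_single_left) auto
    qed
    finally show ?thesis by (simp add: EN_def)
  qed
  show "U \<subseteq> carrier (gr_module R \<mm> M)"
    unfolding gr U_def using EN_closed[OF \<Phi>0] XM by (auto simp: EN_def)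
  show "gr_comp \<Phi> 0 u = u" if u: "u \<in> U"
  proof -
    obtain g where "u = N.N.cls (\<lambda>i. if i = 0 then g else \<zero>\<^bsub>M\<^esub>)" using u by (auto simp: U_def)
    moreover have "(\<lambda>i. if int i = 0 then if i = 0 then g else \<zero>\<^bsub>M\<^esub> else \<zero>\<^bsub>M\<^esub>) = (\<lambda>i. if i = 0 then g else \<zero>\<^bsub>M\<^esub>)"
      by auto
    ultimately show ?thesis using N.N.gr_comp_cls[of 0 "\<lambda>i. if i = 0 then g else \<zero>\<^bsub>M\<^esub>"] by (simp only:)
  qed
  assume H: "submodule H A (gr_module R \<mm> M)" "U \<subseteq> H"
  note H' = H(1)[unfolded gr]
  have step: "EN k (a \<odot>\<^bsub>M\<^esub> m) \<in> H" if a: "a \<in> P k" and m: "m \<in> carrier M" for k a m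
  proof -
    have mem: "a \<odot>\<^bsub>M\<^esub> m \<in> \<Phi> k" if "a \<in> P k" "m \<in> carrier M" for a m
      using that by (simp add: \<Phi>_def ideal_smult.smult)
    define W where "W = {m \<in> carrier M. \<forall>a\<in>P k. EN k (a \<odot>\<^bsub>M\<^esub> m) \<in> H}"
    have "submodule W R M"
    proof (rule N.N.submodule_criterion)
      have "EN k \<zero>\<^bsub>M\<^esub> = \<zero>\<^bsub>N.N.Gr\<^esub>"
        unfolding EN_def using N.N.cls_zero by simp
      then show "\<zero>\<^bsub>M\<^esub> \<in> W" using NA.submodule_zero[OF H'] G.P_carrier by (simp add: W_def)
    next
      fix x y assume "x \<in> W" "y \<in> W"
      then show "x \<oplus>\<^bsub>M\<^esub> y \<in> W"
        using G.P_carrier mem NA.submoduleE(5)[OF H'] by (simp add: W_def N.N.smult_r_distr EN_add)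
    next
      fix r x assume r: "r \<in> carrier R" and x: "x \<in> W"
      have "EN k (a \<odot>\<^bsub>M\<^esub> (r \<odot>\<^bsub>M\<^esub> x)) \<in> H" if a: "a \<in> P k" for a
      proof -
        have "a \<otimes> r \<in> P k" using ideal.I_r_closed[OF G.P_ideal a r] .
        then have "EN k ((a \<otimes> r) \<odot>\<^bsub>M\<^esub> x) \<in> H" using x by (simp add: W_def)
        then show ?thesis using G.P_carrier[OF a] r x by (simp add: W_def N.N.smult_assoc1)
      qed
      then show "r \<odot>\<^bsub>M\<^esub> x \<in> W" using r x by (simp add: W_def)
    qed (auto simp: W_def)
    moreover have "X \<subseteq> W"
    proof
      fix g assume g: "g \<in> X"
      then have gM: "g \<in> carrier M" and gH: "EN 0 g \<in> H" using XM H(2) by (auto simp: U_def EN_def)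
      have "EN k (a \<odot>\<^bsub>M\<^esub> g) \<in> H" if a: "a \<in> P k" for a
        using NA.submoduleE(4)[OF H' E_closed[OF a] gH] EN_mult[OF a gM] by simp
      then show "g \<in> W" using gM by (simp add: W_def)
    qed
    ultimately have "W = carrier M" by (rule gen)
    then show ?thesis using a m by (auto simp: W_def)
  qed
  have single: "EN k x \<in> H" if "x \<in> \<Phi> k" for k x
    using that unfolding \<Phi>_def
  proof induction
    case (smult a m)
    then show ?case by (rule step)
  next
    case (sum x y)
    then show ?case using EN_add[of x k y] NA.submoduleE(5)[OF H'] by (simp add: \<Phi>_def)
  qed
  show "H = carrier (gr_module R \<mm> M)" unfolding gr
  proof
    show "H \<subseteq> carrier N.N.Gr" using NA.submoduleE(1)[OF H'] .
    show "carrier N.N.Gr \<subseteq> H"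
    proof
      fix f assume "f \<in> carrier N.N.Gr"
      then obtain x where x: "\<forall>i. x i \<in> \<Phi> i" "f = N.N.cls x" using N.N.Gr_rep by blast
      have xM: "x i \<in> carrier M" for i using x N.N.filt_carrier by blast
      have high: "x i = \<zero>\<^bsub>M\<^esub>" if "i \<ge> 3" for i
      proof -
        have "y = \<zero>\<^bsub>M\<^esub>" if "y \<in> ideal_smult M {\<zero>} (carrier M)" for y
          using that by induction auto
        moreover have "x i \<in> ideal_smult M (P i) (carrier M)" using x(1) by (simp add: \<Phi>_def)
        ultimately show ?thesis using pow_nil[OF that] by simp
      qed
      have c: "EN k (x k) \<in> carrier N.N.Gr" for k using x(1) by (intro EN_closed) simp
      have "x = (\<lambda>i. (if i = 0 then x 0 else \<zero>\<^bsub>M\<^esub>) \<oplus>\<^bsub>M\<^esub> ((if i = 1 then x 1 else \<zero>\<^bsub>M\<^esub>) \<oplus>\<^bsub>M\<^esub> (if i = 2 then x 2 else \<zero>\<^bsub>M\<^esub>)))"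
      proof
        fix i :: nat
        consider "i = 0" | "i = 1" | "i = 2" | "i \<ge> 3" by linarith
        then show "x i = (if i = 0 then x 0 else \<zero>\<^bsub>M\<^esub>) \<oplus>\<^bsub>M\<^esub> ((if i = 1 then x 1 else \<zero>\<^bsub>M\<^esub>) \<oplus>\<^bsub>M\<^esub> (if i = 2 then x 2 else \<zero>\<^bsub>M\<^esub>))"
          by cases (use xM high in auto)
      qed
      then have "f = N.N.cls (\<lambda>i. (if i = 0 then x 0 else \<zero>\<^bsub>M\<^esub>) \<oplus>\<^bsub>M\<^esub> ((if i = 1 then x 1 else \<zero>\<^bsub>M\<^esub>) \<oplus>\<^bsub>M\<^esub> (if i = 2 then x 2 else \<zero>\<^bsub>M\<^esub>)))"
        unfolding x(2) by (rule arg_cong)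
      also have "\<dots> = EN 0 (x 0) \<oplus>\<^bsub>N.N.Gr\<^esub> (EN 1 (x 1) \<oplus>\<^bsub>N.N.Gr\<^esub> EN 2 (x 2))"
        unfolding EN_def using sing x(1) N.N.filt_zero
        by (subst N.N.cls_add, simp, simp, subst N.N.cls_add) (auto intro: N.N.filt_add)
      also have "\<dots> \<in> H" using single x(1) NA.submoduleE(5)[OF H'] by simp
      finally show "f \<in> H" .
    qed
  qed
qed

end

section \<open>Comparison of free resolutions\<close>

lemma module_homsD:
  assumes "h \<in> module_homs R M N"
  shows "x \<in> carrier M \<Longrightarrow> h x \<in> carrier N"
    "\<lbrakk>x \<in> carrier M; y \<in> carrier M\<rbrakk> \<Longrightarrow> h (x \<oplus>\<^bsub>M\<^esub> y) = h x \<oplus>\<^bsub>N\<^esub> h y"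
    "\<lbrakk>a \<in> carrier R; x \<in> carrier M\<rbrakk> \<Longrightarrow> h (a \<odot>\<^bsub>M\<^esub> x) = a \<odot>\<^bsub>N\<^esub> h x"
  using assms by (auto simp: module_homs_def)

lemma module_homs_comp:
  "\<lbrakk>h \<in> module_homs R M N; k \<in> module_homs R N Q\<rbrakk> \<Longrightarrow> (\<lambda>x. k (h x)) \<in> module_homs R M Q"
  unfolding module_homs_def[of R M Q]
  by (simp add: Pi_iff module_homsD[of h R M N] module_homsD[of k R N Q])

lemma module_homs_diff:
  assumes "module R M" "module R N" and h: "h \<in> module_homs R M N" and k: "k \<in> module_homs R M N"
  shows "(\<lambda>x. h x \<ominus>\<^bsub>N\<^esub> k x) \<in> module_homs R M N"
proof -
  interpret M: module R M by fact
  interpret N: module R N by fact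
  note H = module_homsD[OF h] and K = module_homsD[OF k]
  show ?thesis unfolding module_homs_def
  proof (intro CollectI conjI ballI funcsetI)
    fix x y assume "x \<in> carrier M" "y \<in> carrier M"
    then show "h (x \<oplus>\<^bsub>M\<^esub> y) \<ominus>\<^bsub>N\<^esub> k (x \<oplus>\<^bsub>M\<^esub> y) = h x \<ominus>\<^bsub>N\<^esub> k x \<oplus>\<^bsub>N\<^esub> (h y \<ominus>\<^bsub>N\<^esub> k y)"
      using H(1,2) K(1,2) by (simp add: a_minus_def N.M.minus_add N.M.a_ac)
  next
    fix a x assume "a \<in> carrier R" "x \<in> carrier M"
    then show "h (a \<odot>\<^bsub>M\<^esub> x) \<ominus>\<^bsub>N\<^esub> k (a \<odot>\<^bsub>M\<^esub> x) = a \<odot>\<^bsub>N\<^esub> (h x \<ominus>\<^bsub>N\<^esub> k x)"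
      using H(1,3) K(1,3) by (simp add: a_minus_def N.smult_r_distr N.smult_r_minus)
  qed (use H(1) K(1) in simp)
qed

lemma homology_zeroD:
  assumes G: "abelian_group (C n)" and B: "additive_subgroup (boundaries C d n) (C n)"
    and sub: "boundaries C d n \<subseteq> cycles C d n" and cyc: "cycles C d n \<subseteq> carrier (C n)"
    and z: "homology_zero C d n"
  shows "cycles C d n \<subseteq> boundaries C d n"
proof
  interpret G: abelian_group "C n" by fact
  interpret B: abelian_subgroup "boundaries C d n" "C n" by (intro abelian_subgroupI3 B) fact
  fix x assume x: "x \<in> cycles C d n"
  let ?Z = "(C n)\<lparr>carrier := cycles C d n\<rparr>"
  have eq: "a_r_coset ?Z (boundaries C d n) x = boundaries C d n +>\<^bsub>C n\<^esub> x"
    by (simp add: a_r_coset_def r_coset_def)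
  have "a_rcosets\<^bsub>?Z\<^esub> (boundaries C d n) = {boundaries C d n}"
    using z by (simp add: homology_zero_def homology_def module_quot_def)
  moreover have "a_r_coset ?Z (boundaries C d n) x \<in> a_rcosets\<^bsub>?Z\<^esub> (boundaries C d n)"
    using x by (simp add: A_RCOSETS_def RCOSETS_def a_r_coset_def) blast
  ultimately have "boundaries C d n +>\<^bsub>C n\<^esub> x = boundaries C d n" unfolding eq by blast
  then show "x \<in> boundaries C d n" using B.a_rcos_self[of x] x cyc by blast
qed

lemma (in cring) exact_at:
  assumes res: "free_resolution R N b d \<epsilon>"
    and y: "y \<in> carrier (free_module R (b (Suc n)))" "d n y = \<zero>\<^bsub>free_module R (b n)\<^esub>"
  shows "\<exists>u\<in>carrier (free_module R (b (Suc (Suc n)))). d (Suc n) u = y"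
proof -
  let ?F = "\<lambda>n. free_module R (b n)"
  have d: "d n \<in> module_homs R (?F (Suc n)) (?F n)" for n
    using res by (simp add: free_resolution_def chain_complex_def)
  have dd: "d n (d (Suc n) x) = \<zero>\<^bsub>?F n\<^esub>" if "x \<in> carrier (?F (Suc (Suc n)))" for x
    using res that by (simp add: free_resolution_def chain_complex_def)
  have ab: "abelian_group (?F m)" for m using free_module_module by (rule module.axioms)
  have "cycles ?F d (Suc n) \<subseteq> boundaries ?F d (Suc n)"
  proof (rule homology_zeroD)
    show "abelian_group (?F (Suc n))" by (rule ab)
    show "additive_subgroup (boundaries ?F d (Suc n)) (?F (Suc n))"
      unfolding boundaries_def using module_homsD(1,2)[OF d] by (intro additive_image_subgroup ab) auto
    show "boundaries ?F d (Suc n) \<subseteq> cycles ?F d (Suc n)"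
      using dd module_homsD(1)[OF d] by (auto simp: boundaries_def cycles_def)
    show "homology_zero ?F d (Suc n)" using res by (simp add: free_resolution_def)
  qed (auto simp: cycles_def)
  then have "y \<in> boundaries ?F d (Suc n)" using y by (auto simp: cycles_def)
  then show ?thesis by (auto simp: boundaries_def)
qed

lemma (in cring) free_lift:
  assumes X: "module R X" and Y: "module R Y"
    and f: "f \<in> module_homs R (free_module R p) Y" and g: "g \<in> module_homs R X Y"
    and ex: "\<And>l. l < p \<Longrightarrow> \<exists>u\<in>U l. u \<in> carrier X \<and> g u = f (unit_vec p l)"
  obtains x where "\<And>l. l < p \<Longrightarrow> x l \<in> U l" "\<And>l. l < p \<Longrightarrow> x l \<in> carrier X"
    "lincomb X x p \<in> module_homs R (free_module R p) X"
    "\<And>c. c \<in> carrier (free_module R p) \<Longrightarrow> g (lincomb X x p c) = f c"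
proof -
  have "\<forall>l. \<exists>u. l < p \<longrightarrow> u \<in> U l \<and> u \<in> carrier X \<and> g u = f (unit_vec p l)" using ex by blast
  from choice[OF this] obtain x where x: "\<forall>l. l < p \<longrightarrow> x l \<in> U l \<and> x l \<in> carrier X \<and> g (x l) = f (unit_vec p l)" ..
  have "g (lincomb X x p c) = f c" if c: "c \<in> carrier (free_module R p)" for c
  proof -
    have cR: "c l \<in> carrier R" if "l < p" for l
      using PiE_mem[of c "{..<p}" "\<lambda>_. carrier R" l] c that by (simp add: free_module_simps)
    have "g (lincomb X x p c) = lincomb Y (\<lambda>l. g (x l)) p c"
      using x cR by (intro lincomb_hom[OF X Y g]) auto
    also have "\<dots> = lincomb Y (\<lambda>l. f (unit_vec p l)) p c" using x by (intro lincomb_cong) auto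
    also have "\<dots> = f (lincomb (free_module R p) (unit_vec p) p c)"
      using cR unit_vec_closed by (intro lincomb_hom[OF free_module_module Y f, symmetric]) auto
    also have "lincomb (free_module R p) (unit_vec p) p c = c" using vec_eq_lincomb[OF c] by simp
    finally show ?thesis .
  qed
  then show ?thesis using that[of x] x lincomb_hom_free[OF X, of p x] by blast
qed

text \<open>Homogeneous components given as subsets, as in the definition of graded resolutions. Taking
the whole ring in every degree turns the statements into their ungraded versions.\<close>

locale piece_cring = cring R for R (structure) +
  fixes \<A> :: "int \<Rightarrow> 'a set"
  assumes piece_carrier: "\<A> j \<subseteq> carrier R"
    and piece_zero: "\<zero> \<in> \<A> j"
    and piece_add: "\<lbrakk>a \<in> \<A> j; b \<in> \<A> j\<rbrakk> \<Longrightarrow> a \<oplus> b \<in> \<A> j"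
    and piece_mult: "\<lbrakk>a \<in> \<A> i; b \<in> \<A> j\<rbrakk> \<Longrightarrow> a \<otimes> b \<in> \<A> (i + j)"
    and piece_one: "\<one> \<in> \<A> 0"
begin

lemma free_piece_closed: "v \<in> free_piece R \<A> b s j \<Longrightarrow> v \<in> carrier (free_module R b)"
  by (simp add: free_piece_def)

lemma unit_vec_piece: "l < b \<Longrightarrow> unit_vec b l \<in> free_piece R \<A> b s (s l)"
  using piece_one piece_zero unit_vec_closed by (auto simp: free_piece_def unit_vec_def)

lemma lincomb_piece:
  assumes x: "\<And>l. l < p \<Longrightarrow> x l \<in> free_piece R \<A> b t (s l)" and c: "c \<in> free_piece R \<A> p s j"
  shows "lincomb (free_module R b) x p c \<in> free_piece R \<A> b t j"
proof -
  interpret F: module R "free_module R b" by (rule free_module_module)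
  have cA: "c l \<in> \<A> (j - s l)" if "l < p" for l using c that by (simp add: free_piece_def)
  have xF: "x l \<in> carrier (free_module R b)" if "l < p" for l using x[OF that] by (rule free_piece_closed)
  have cR: "c l \<in> carrier R" if "l < p" for l using cA[OF that] piece_carrier by blast
  have "lincomb (free_module R b) x p c i \<in> \<A> (j - t i)" if i: "i < b" for i
  proof -
    have "lincomb (self_module R) (\<lambda>l. x l i) k c \<in> \<A> (j - t i)" if "k \<le> p" for k
      using that
    proof (induction k)
      case 0
      then show ?case using piece_zero by (simp add: self_module_def)
    next
      case (Suc k)
      have "x k i \<in> \<A> (s k - t i)" using x[of k] Suc.prems i by (simp add: free_piece_def)
      then have "c k \<otimes> x k i \<in> \<A> ((j - s k) + (s k - t i))" using cA Suc.prems by (intro piece_mult) simp_all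
      then show ?case using Suc piece_add by (simp add: self_module_def)
    qed
    then show ?thesis using free_module_nth[of p x b c i] xF cR i by simp
  qed
  moreover have "lincomb (free_module R b) x p c \<in> carrier (free_module R b)"
    using xF cR by (rule F.lincomb_closed)
  ultimately show ?thesis by (simp add: free_piece_def)
qed

text \<open>The cycle condition in degree \<open>n\<close> of an augmented complex.\<close>

definition kills :: "(nat \<Rightarrow> nat) \<Rightarrow> ((nat \<Rightarrow> 'a) \<Rightarrow> 'c) \<Rightarrow> 'c \<Rightarrow> (nat \<Rightarrow> (nat \<Rightarrow> 'a) \<Rightarrow> nat \<Rightarrow> 'a) \<Rightarrow>
    nat \<Rightarrow> (nat \<Rightarrow> 'a) \<Rightarrow> bool" where
  "kills b \<epsilon> z d n y = (case n of 0 \<Rightarrow> \<epsilon> y = z | Suc k \<Rightarrow> d k y = \<zero>\<^bsub>free_module R (b k)\<^esub>)"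

text \<open>Only lifts of cycles of the target are required, for homogeneous elements. So the same
statement serves for maps that preserve degrees and, with the trivial grading, for maps that need
not.\<close>

theorem comparison_map:
  fixes N :: "('a, 'c, 's) module_scheme"
  assumes N: "module R N"
    and d: "\<And>n. d n \<in> module_homs R (free_module R (b (Suc n))) (free_module R (b n))"
    and dd: "\<And>n x. x \<in> carrier (free_module R (b (Suc (Suc n)))) \<Longrightarrow> d n (d (Suc n) x) = \<zero>\<^bsub>free_module R (b n)\<^esub>"
    and dp: "\<And>n j x. x \<in> free_piece R \<A> (b (Suc n)) (s (Suc n)) j \<Longrightarrow> d n x \<in> free_piece R \<A> (b n) (s n) j"
    and e: "\<epsilon> \<in> module_homs R (free_module R (b 0)) N"
    and ed: "\<And>x. x \<in> carrier (free_module R (b 1)) \<Longrightarrow> \<epsilon> (d 0 x) = \<zero>\<^bsub>N\<^esub>"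
    and d': "\<And>n. d' n \<in> module_homs R (free_module R (b' (Suc n))) (free_module R (b' n))"
    and e': "\<epsilon>' \<in> module_homs R (free_module R (b' 0)) N"
    and h0: "\<And>j x. x \<in> free_piece R \<A> (b 0) (s 0) j \<Longrightarrow> \<exists>u\<in>free_piece R \<A> (b' 0) (s' 0) j. \<epsilon>' u = \<epsilon> x"
    and h1: "\<And>n j y. \<lbrakk>y \<in> free_piece R \<A> (b' n) (s' n) j; kills b' \<epsilon>' \<zero>\<^bsub>N\<^esub> d' n y\<rbrakk>
      \<Longrightarrow> \<exists>u\<in>free_piece R \<A> (b' (Suc n)) (s' (Suc n)) j. d' n u = y"
  obtains \<psi> where "\<And>n. \<psi> n \<in> module_homs R (free_module R (b n)) (free_module R (b' n))"
    "\<And>n j x. x \<in> free_piece R \<A> (b n) (s n) j \<Longrightarrow> \<psi> n x \<in> free_piece R \<A> (b' n) (s' n) j"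
    "\<And>x. x \<in> carrier (free_module R (b 0)) \<Longrightarrow> \<epsilon>' (\<psi> 0 x) = \<epsilon> x"
    "\<And>n x. x \<in> carrier (free_module R (b (Suc n))) \<Longrightarrow> d' n (\<psi> (Suc n) x) = \<psi> n (d n x)"
proof -
  let ?F = "\<lambda>n. free_module R (b n)" and ?G = "\<lambda>n. free_module R (b' n)"
  define P where "P n h \<longleftrightarrow> h \<in> module_homs R (?F n) (?G n) \<and>
    (\<forall>j. \<forall>x\<in>free_piece R \<A> (b n) (s n) j. h x \<in> free_piece R \<A> (b' n) (s' n) j) \<and>
    (\<forall>x\<in>carrier (?F (Suc n)). kills b' \<epsilon>' \<zero>\<^bsub>N\<^esub> d' n (h (d n x))) \<and>
    (n = 0 \<longrightarrow> (\<forall>x\<in>carrier (?F 0). \<epsilon>' (h x) = \<epsilon> x))" for n h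
  define Q where "Q n h h' \<longleftrightarrow> (\<forall>x\<in>carrier (?F (Suc n)). d' n (h' x) = h (d n x))" for n h h'
  note Fm = free_module_module
  have "\<exists>f. \<forall>n. P n (f n) \<and> Q n (f n) (f (Suc n))"
  proof (rule dependent_nat_choice)
    have "\<exists>u\<in>free_piece R \<A> (b' 0) (s' 0) (s 0 l). u \<in> carrier (?G 0) \<and> \<epsilon>' u = \<epsilon> (unit_vec (b 0) l)"
      if "l < b 0" for l
      using h0[OF unit_vec_piece[OF that]] free_piece_closed by blast
    from free_lift[OF Fm N e e' this] obtain x where
      x: "\<And>l. l < b 0 \<Longrightarrow> x l \<in> free_piece R \<A> (b' 0) (s' 0) (s 0 l)"
        "lincomb (?G 0) x (b 0) \<in> module_homs R (?F 0) (?G 0)"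
        "\<And>c. c \<in> carrier (?F 0) \<Longrightarrow> \<epsilon>' (lincomb (?G 0) x (b 0) c) = \<epsilon> c" by metis
    have "P 0 (lincomb (?G 0) x (b 0))"
      unfolding P_def using x lincomb_piece[OF x(1)] ed module_homsD(1)[OF d[of 0]] by (simp add: kills_def)
    then show "\<exists>h. P 0 h" by blast
  next
    fix h n assume "P n h"
    then have h: "h \<in> module_homs R (?F n) (?G n)"
      "\<And>j x. x \<in> free_piece R \<A> (b n) (s n) j \<Longrightarrow> h x \<in> free_piece R \<A> (b' n) (s' n) j"
      "\<And>x. x \<in> carrier (?F (Suc n)) \<Longrightarrow> kills b' \<epsilon>' \<zero>\<^bsub>N\<^esub> d' n (h (d n x))" by (simp_all add: P_def)
    have hd: "(\<lambda>x. h (d n x)) \<in> module_homs R (?F (Suc n)) (?G n)" using d h(1) by (rule module_homs_comp)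
    have "\<exists>u\<in>free_piece R \<A> (b' (Suc n)) (s' (Suc n)) (s (Suc n) l). u \<in> carrier (?G (Suc n)) \<and>
        d' n u = h (d n (unit_vec (b (Suc n)) l))" if "l < b (Suc n)" for l
      using h1[OF h(2)[OF dp[OF unit_vec_piece[OF that]]] h(3)[OF unit_vec_closed]] free_piece_closed by blast
    from free_lift[OF Fm Fm hd d' this] obtain x where
      x: "\<And>l. l < b (Suc n) \<Longrightarrow> x l \<in> free_piece R \<A> (b' (Suc n)) (s' (Suc n)) (s (Suc n) l)"
        "lincomb (?G (Suc n)) x (b (Suc n)) \<in> module_homs R (?F (Suc n)) (?G (Suc n))"
        "\<And>c. c \<in> carrier (?F (Suc n)) \<Longrightarrow> d' n (lincomb (?G (Suc n)) x (b (Suc n)) c) = h (d n c)" by metis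
    have "h \<zero>\<^bsub>?F n\<^esub> = \<zero>\<^bsub>?G n\<^esub>" using module_homs_zero[OF Fm Fm h(1)] .
    then have "P (Suc n) (lincomb (?G (Suc n)) x (b (Suc n)))"
      unfolding P_def using x lincomb_piece[OF x(1)] module_homsD(1)[OF d] dd by (simp add: kills_def)
    moreover have "Q n h (lincomb (?G (Suc n)) x (b (Suc n)))" using x(3) by (simp add: Q_def)
    ultimately show "\<exists>k. P (Suc n) k \<and> Q n h k" by blast
  qed
  then obtain \<psi> where \<psi>: "\<forall>n. P n (\<psi> n) \<and> Q n (\<psi> n) (\<psi> (Suc n))" ..
  show ?thesis
  proof (rule that[of \<psi>])
    show "\<psi> n \<in> module_homs R (?F n) (?G n)" for n using \<psi> by (simp add: P_def)
    show "\<psi> n x \<in> free_piece R \<A> (b' n) (s' n) j" if "x \<in> free_piece R \<A> (b n) (s n) j" for n j x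
      using \<psi> that by (simp add: P_def)
    show "\<epsilon>' (\<psi> 0 x) = \<epsilon> x" if "x \<in> carrier (?F 0)" for x using \<psi> that by (simp add: P_def)
    show "d' n (\<psi> (Suc n) x) = \<psi> n (d n x)" if "x \<in> carrier (?F (Suc n))" for n x
      using \<psi> that by (simp add: Q_def)
  qed
qed

end

text \<open>If \<open>\<theta>\<close> induces the identity on \<open>N\<close>, the right-hand sides below are cycles of the resolution,
the last one because of the equation in the degree before. Exactness lifts their values on basis
vectors.\<close>

lemma (in cring) null_homotopy:
  fixes N :: "('a, 'c, 's) module_scheme"
  assumes N: "module R N" and res: "free_resolution R N b d \<epsilon>"
    and th: "\<And>n. \<theta> n \<in> module_homs R (free_module R (b n)) (free_module R (b n))"
    and th0: "\<And>x. x \<in> carrier (free_module R (b 0)) \<Longrightarrow> \<epsilon> (\<theta> 0 x) = \<epsilon> x"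
    and thd: "\<And>n x. x \<in> carrier (free_module R (b (Suc n))) \<Longrightarrow> d n (\<theta> (Suc n) x) = \<theta> n (d n x)"
  obtains h where "\<And>n. h n \<in> module_homs R (free_module R (b n)) (free_module R (b (Suc n)))"
    "\<And>x. x \<in> carrier (free_module R (b 0)) \<Longrightarrow> d 0 (h 0 x) = x \<ominus>\<^bsub>free_module R (b 0)\<^esub> \<theta> 0 x"
    "\<And>n x. x \<in> carrier (free_module R (b (Suc n))) \<Longrightarrow> d (Suc n) (h (Suc n) x) =
      x \<ominus>\<^bsub>free_module R (b (Suc n))\<^esub> \<theta> (Suc n) x \<ominus>\<^bsub>free_module R (b (Suc n))\<^esub> h n (d n x)"
proof -
  let ?F = "\<lambda>n. free_module R (b n)"
  note Fm = free_module_module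
  have d: "d n \<in> module_homs R (?F (Suc n)) (?F n)" for n
    using res by (simp add: free_resolution_def chain_complex_def)
  have dd: "d n (d (Suc n) x) = \<zero>\<^bsub>?F n\<^esub>" if "x \<in> carrier (?F (Suc (Suc n)))" for n x
    using res that by (simp add: free_resolution_def chain_complex_def)
  have e: "\<epsilon> \<in> module_homs R (?F 0) N" using res by (simp add: free_resolution_def)
  have ker0: "\<exists>u\<in>carrier (?F 1). d 0 u = y" if "y \<in> carrier (?F 0)" "\<epsilon> y = \<zero>\<^bsub>N\<^esub>" for y
  proof -
    have "y \<in> {x \<in> carrier (?F 0). \<epsilon> x = \<zero>\<^bsub>N\<^esub>}" using that by simp
    moreover have "{x \<in> carrier (?F 0). \<epsilon> x = \<zero>\<^bsub>N\<^esub>} = boundaries ?F d 0"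
      using res by (simp add: free_resolution_def)
    ultimately have "y \<in> boundaries ?F d 0" by (rule rev_subsetD[OF _ equalityD1])
    then show ?thesis by (auto simp: boundaries_def)
  qed
  have ker1: "\<exists>u\<in>carrier (?F (Suc (Suc n))). d (Suc n) u = y" if y: "y \<in> carrier (?F (Suc n))" "d n y = \<zero>\<^bsub>?F n\<^esub>" for n y
    using exact_at[OF res y] by blast
  define P where "P n h \<longleftrightarrow> h \<in> module_homs R (?F n) (?F (Suc n)) \<and>
    (\<forall>x\<in>carrier (?F (Suc n)). d n (h (d n x)) = d n x \<ominus>\<^bsub>?F n\<^esub> \<theta> n (d n x)) \<and>
    (n = 0 \<longrightarrow> (\<forall>x\<in>carrier (?F 0). d 0 (h x) = x \<ominus>\<^bsub>?F 0\<^esub> \<theta> 0 x))" for n h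
  define Q where "Q n h h' \<longleftrightarrow> (\<forall>x\<in>carrier (?F (Suc n)). d (Suc n) (h' x) =
      x \<ominus>\<^bsub>?F (Suc n)\<^esub> \<theta> (Suc n) x \<ominus>\<^bsub>?F (Suc n)\<^esub> h (d n x))" for n h h'
  have idh: "(\<lambda>x. x) \<in> module_homs R (?F n) (?F n)" for n by (auto simp: module_homs_def)
  have self_minus: "x \<ominus>\<^bsub>?F n\<^esub> x = \<zero>\<^bsub>?F n\<^esub>" "x \<ominus>\<^bsub>?F n\<^esub> \<zero>\<^bsub>?F n\<^esub> = x" if "x \<in> carrier (?F n)" for n x
  proof -
    interpret F: module R "?F n" by (rule Fm)
    show "x \<ominus>\<^bsub>?F n\<^esub> x = \<zero>\<^bsub>?F n\<^esub>" using that by (simp add: a_minus_def F.M.r_neg)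
    have "\<ominus>\<^bsub>?F n\<^esub> \<zero>\<^bsub>?F n\<^esub> = \<zero>\<^bsub>?F n\<^esub>" by (rule F.M.minus_equality) auto
    then show "x \<ominus>\<^bsub>?F n\<^esub> \<zero>\<^bsub>?F n\<^esub> = x" using that unfolding a_minus_def by (metis F.M.r_zero)
  qed
  have "\<exists>f. \<forall>n. P n (f n) \<and> Q n (f n) (f (Suc n))"
  proof (rule dependent_nat_choice)
    define f where "f = (\<lambda>x. x \<ominus>\<^bsub>?F 0\<^esub> \<theta> 0 x)"
    have f: "f \<in> module_homs R (?F 0) (?F 0)" unfolding f_def by (rule module_homs_diff[OF Fm Fm idh th])
    interpret N: module R N by (rule N)
    have ker: "\<epsilon> (f x) = \<zero>\<^bsub>N\<^esub>" if "x \<in> carrier (?F 0)" for x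
      unfolding f_def using module_homs_minus[OF Fm N e that module_homsD(1)[OF th that]] th0[OF that]
        module_homsD(1)[OF e that] by (simp add: a_minus_def N.M.r_neg)
    have "\<exists>u\<in>UNIV. u \<in> carrier (?F (Suc 0)) \<and> d 0 u = f (unit_vec (b 0) l)" for l
      using ker0[OF module_homsD(1)[OF f unit_vec_closed] ker[OF unit_vec_closed]] by auto
    from free_lift[OF Fm Fm f d this] obtain x where
      x: "lincomb (?F (Suc 0)) x (b 0) \<in> module_homs R (?F 0) (?F (Suc 0))"
        "\<And>c. c \<in> carrier (?F 0) \<Longrightarrow> d 0 (lincomb (?F (Suc 0)) x (b 0) c) = f c" by metis
    then have "P 0 (lincomb (?F (Suc 0)) x (b 0))"
      unfolding P_def using module_homsD(1)[OF d[of 0]] by (simp add: f_def)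
    then show "\<exists>h. P 0 h" by blast
  next
    fix h n assume "P n h"
    then have h: "h \<in> module_homs R (?F n) (?F (Suc n))"
      "\<And>x. x \<in> carrier (?F (Suc n)) \<Longrightarrow> d n (h (d n x)) = d n x \<ominus>\<^bsub>?F n\<^esub> \<theta> n (d n x)" by (simp_all add: P_def)
    have hd: "(\<lambda>x. h (d n x)) \<in> module_homs R (?F (Suc n)) (?F (Suc n))" using d h(1) by (rule module_homs_comp)
    define f where "f = (\<lambda>x. x \<ominus>\<^bsub>?F (Suc n)\<^esub> \<theta> (Suc n) x \<ominus>\<^bsub>?F (Suc n)\<^esub> h (d n x))"
    have f: "f \<in> module_homs R (?F (Suc n)) (?F (Suc n))"
      unfolding f_def by (intro module_homs_diff[OF Fm Fm] idh th hd)
    have ker: "d n (f x) = \<zero>\<^bsub>?F n\<^esub>" if x: "x \<in> carrier (?F (Suc n))" for x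
    proof -
      have tx: "\<theta> (Suc n) x \<in> carrier (?F (Suc n))" using module_homsD(1)[OF th x] .
      have xt: "x \<ominus>\<^bsub>?F (Suc n)\<^esub> \<theta> (Suc n) x \<in> carrier (?F (Suc n))"
        using module_homsD(1)[OF module_homs_diff[OF Fm Fm idh th] x] .
      have dxt: "d n x \<ominus>\<^bsub>?F n\<^esub> \<theta> n (d n x) \<in> carrier (?F n)"
        using module_homsD(1)[OF module_homs_diff[OF Fm Fm idh th] module_homsD(1)[OF d x]] .
      have "d n (f x) = (d n x \<ominus>\<^bsub>?F n\<^esub> \<theta> n (d n x)) \<ominus>\<^bsub>?F n\<^esub> (d n x \<ominus>\<^bsub>?F n\<^esub> \<theta> n (d n x))"
        unfolding f_def using module_homs_minus[OF Fm Fm d xt module_homsD(1)[OF hd x]]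
          module_homs_minus[OF Fm Fm d x tx] thd[OF x] h(2)[OF x] by simp
      then show ?thesis using self_minus(1)[OF dxt] by simp
    qed
    have "\<exists>u\<in>UNIV. u \<in> carrier (?F (Suc (Suc n))) \<and> d (Suc n) u = f (unit_vec (b (Suc n)) l)" for l
      using ker1[OF module_homsD(1)[OF f unit_vec_closed] ker[OF unit_vec_closed]] by auto
    from free_lift[OF Fm Fm f d this] obtain x where
      x: "lincomb (?F (Suc (Suc n))) x (b (Suc n)) \<in> module_homs R (?F (Suc n)) (?F (Suc (Suc n)))"
        "\<And>c. c \<in> carrier (?F (Suc n)) \<Longrightarrow> d (Suc n) (lincomb (?F (Suc (Suc n))) x (b (Suc n)) c) = f c" by metis
    have hz: "h \<zero>\<^bsub>?F n\<^esub> = \<zero>\<^bsub>?F (Suc n)\<^esub>" using module_homs_zero[OF Fm Fm h(1)] .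
    have "f (d (Suc n) c) = d (Suc n) c \<ominus>\<^bsub>?F (Suc n)\<^esub> \<theta> (Suc n) (d (Suc n) c)"
      if c: "c \<in> carrier (?F (Suc (Suc n)))" for c
    proof -
      have "d (Suc n) c \<ominus>\<^bsub>?F (Suc n)\<^esub> \<theta> (Suc n) (d (Suc n) c) \<in> carrier (?F (Suc n))"
        using module_homsD(1)[OF module_homs_diff[OF Fm Fm idh th] module_homsD(1)[OF d c]] .
      then show ?thesis unfolding f_def dd[OF c] hz by (rule self_minus(2))
    qed
    then have "P (Suc n) (lincomb (?F (Suc (Suc n))) x (b (Suc n)))"
      unfolding P_def using x module_homsD(1)[OF d] by simp
    moreover have "Q n h (lincomb (?F (Suc (Suc n))) x (b (Suc n)))" using x(2) by (simp add: Q_def f_def)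
    ultimately show "\<exists>k. P (Suc n) k \<and> Q n h k" by blast
  qed
  then obtain h where h: "\<forall>n. P n (h n) \<and> Q n (h n) (h (Suc n))" ..
  show ?thesis
  proof (rule that[of h])
    show "h n \<in> module_homs R (?F n) (?F (Suc n))" for n using h by (simp add: P_def)
    show "d 0 (h 0 x) = x \<ominus>\<^bsub>?F 0\<^esub> \<theta> 0 x" if "x \<in> carrier (?F 0)" for x using h that by (simp add: P_def)
    show "d (Suc n) (h (Suc n) x) = x \<ominus>\<^bsub>?F (Suc n)\<^esub> \<theta> (Suc n) x \<ominus>\<^bsub>?F (Suc n)\<^esub> h n (d n x)"
      if "x \<in> carrier (?F (Suc n))" for n x
      using h that by (simp add: Q_def)
  qed
qed

section \<open>Tensor products\<close>

locale tensor = M: module R M + L: module R L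
  for R (structure) and M :: "('a, 'b, 's) module_scheme" and L :: "('a, 'c, 't) module_scheme"
begin

abbreviation "Fr \<equiv> free_Abelian_group (carrier M \<times> carrier L)"
abbreviation "K \<equiv> tensor_rel R M L"
abbreviation "cls \<equiv> tensor_class R M L"
abbreviation "T \<equiv> tensor_product R M L"

sublocale Fr: comm_group Fr by (rule abelian_free_Abelian_group)

lemma of_closed: "\<lbrakk>x \<in> carrier M; y \<in> carrier L\<rbrakk> \<Longrightarrow> frag_of (x, y) \<in> carrier Fr"
  by simp

lemma add_closed: "\<lbrakk>c \<in> carrier Fr; c' \<in> carrier Fr\<rbrakk> \<Longrightarrow> c + c' \<in> carrier Fr"
  using Fr.m_closed by simp

lemma minus_closed: "c \<in> carrier Fr \<Longrightarrow> - c \<in> carrier Fr" by simp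

lemma diff_closed: "\<lbrakk>c \<in> carrier Fr; c' \<in> carrier Fr\<rbrakk> \<Longrightarrow> c - c' \<in> carrier Fr"
  using add_closed[of c "- c'"] minus_closed by simp

lemma K_subgroup: "subgroup K Fr"
  unfolding tensor_rel_def
proof (rule Fr.generate_is_subgroup, intro Un_least subsetI)
qed (auto intro!: diff_closed simp del: carrier_free_Abelian_group_iff intro: of_closed)

lemma K_carrier: "c \<in> K \<Longrightarrow> c \<in> carrier Fr" using subgroup.mem_carrier[OF K_subgroup] .

lemma K_add: "\<lbrakk>c \<in> K; c' \<in> K\<rbrakk> \<Longrightarrow> c + c' \<in> K" using subgroup.m_closed[OF K_subgroup] by simp

lemma K_minus: "c \<in> K \<Longrightarrow> - c \<in> K"
  using subgroup.m_inv_closed[OF K_subgroup, of c] K_carrier[of c] by simp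

lemma K_zero: "0 \<in> K" using subgroup.one_closed[OF K_subgroup] by simp

lemma K_normal: "K \<lhd> Fr" using K_subgroup Fr.normal_iff_subgroup by blast

lemma K_rel_left: "\<lbrakk>x \<in> carrier M; x' \<in> carrier M; y \<in> carrier L\<rbrakk>
    \<Longrightarrow> frag_of (x \<oplus>\<^bsub>M\<^esub> x', y) - frag_of (x, y) - frag_of (x', y) \<in> K"
  unfolding tensor_rel_def by (rule generate.incl) blast

lemma K_rel_right: "\<lbrakk>x \<in> carrier M; y \<in> carrier L; y' \<in> carrier L\<rbrakk>
    \<Longrightarrow> frag_of (x, y \<oplus>\<^bsub>L\<^esub> y') - frag_of (x, y) - frag_of (x, y') \<in> K"
  unfolding tensor_rel_def by (rule generate.incl) blast

lemma K_rel_smult: "\<lbrakk>a \<in> carrier R; x \<in> carrier M; y \<in> carrier L\<rbrakk>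
    \<Longrightarrow> frag_of (a \<odot>\<^bsub>M\<^esub> x, y) - frag_of (x, a \<odot>\<^bsub>L\<^esub> y) \<in> K"
  unfolding tensor_rel_def by (rule generate.incl) blast

lemma cls_eqI:
  assumes "c \<in> carrier Fr" "c' \<in> carrier Fr" "c - c' \<in> K"
  shows "cls c = cls c'"
proof -
  have "c \<in> K #>\<^bsub>Fr\<^esub> c'" unfolding r_coset_def using assms(3) by (auto intro!: bexI[of _ "c - c'"])
  then show ?thesis unfolding tensor_class_def
    using Fr.repr_independence[of c K c'] assms(2) K_subgroup by simp
qed

lemma cls_mem: "c \<in> carrier Fr \<Longrightarrow> c \<in> cls c"
  unfolding tensor_class_def using Fr.rcos_self[OF _ K_subgroup] by blast

lemma cls_memD: "u \<in> cls c \<Longrightarrow> u - c \<in> K"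
  unfolding tensor_class_def r_coset_def by auto

lemma T_simps:
  "carrier T = carrier (Fr Mod K)" "\<zero>\<^bsub>T\<^esub> = \<one>\<^bsub>Fr Mod K\<^esub>" "X \<oplus>\<^bsub>T\<^esub> Y = X \<otimes>\<^bsub>Fr Mod K\<^esub> Y"
  by (simp_all add: tensor_product_def Let_def)

lemma T_carrier: "carrier T = cls ` carrier Fr"
  unfolding T_simps FactGroup_def RCOSETS_def tensor_class_def by auto

lemma T_zero: "\<zero>\<^bsub>T\<^esub> = cls 0"
  unfolding T_simps FactGroup_def tensor_class_def
  using Fr.coset_mult_one[OF subgroup.subset[OF K_subgroup]] by simp

lemma T_add: "\<lbrakk>c \<in> carrier Fr; c' \<in> carrier Fr\<rbrakk> \<Longrightarrow> cls c \<oplus>\<^bsub>T\<^esub> cls c' = cls (c + c')"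
  unfolding T_simps FactGroup_def tensor_class_def
  using normal.rcos_sum[OF K_normal, of c c'] by simp

lemma T_abelian_group: "abelian_group T"
proof -
  interpret Q: comm_group "Fr Mod K" by (rule Fr.abelian_FactGroup[OF K_subgroup])
  show ?thesis
  proof (rule abelian_groupI, unfold T_simps)
    show "\<one>\<^bsub>Fr Mod K\<^esub> \<in> carrier (Fr Mod K)" by (rule Q.one_closed)
  next
    fix x y z assume x: "x \<in> carrier (Fr Mod K)" and y: "y \<in> carrier (Fr Mod K)" and z: "z \<in> carrier (Fr Mod K)"
    show "x \<otimes>\<^bsub>Fr Mod K\<^esub> y \<otimes>\<^bsub>Fr Mod K\<^esub> z = x \<otimes>\<^bsub>Fr Mod K\<^esub> (y \<otimes>\<^bsub>Fr Mod K\<^esub> z)" using x y z by (rule Q.m_assoc)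
  next
    fix x y assume x: "x \<in> carrier (Fr Mod K)" and y: "y \<in> carrier (Fr Mod K)"
    show "x \<otimes>\<^bsub>Fr Mod K\<^esub> y \<in> carrier (Fr Mod K)" using x y by (rule Q.m_closed)
    show "x \<otimes>\<^bsub>Fr Mod K\<^esub> y = y \<otimes>\<^bsub>Fr Mod K\<^esub> x" using x y by (rule Q.m_comm)
  next
    fix x assume x: "x \<in> carrier (Fr Mod K)"
    show "\<one>\<^bsub>Fr Mod K\<^esub> \<otimes>\<^bsub>Fr Mod K\<^esub> x = x" using x by (rule Q.l_one)
    show "\<exists>y\<in>carrier (Fr Mod K). y \<otimes>\<^bsub>Fr Mod K\<^esub> x = \<one>\<^bsub>Fr Mod K\<^esub>"
      using Q.l_inv[OF x] Q.inv_closed[OF x] by (rule bexI)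
  qed
qed

definition pure :: "'b \<Rightarrow> 'c \<Rightarrow> ('b \<times> 'c \<Rightarrow>\<^sub>0 int) set" where
  "pure x y = cls (frag_of (x, y))"

lemma pure_closed: "\<lbrakk>x \<in> carrier M; y \<in> carrier L\<rbrakk> \<Longrightarrow> pure x y \<in> carrier T"
  unfolding pure_def T_carrier by (intro imageI of_closed)

lemma pure_add_left:
  assumes "x \<in> carrier M" "x' \<in> carrier M" "y \<in> carrier L"
  shows "pure (x \<oplus>\<^bsub>M\<^esub> x') y = pure x y \<oplus>\<^bsub>T\<^esub> pure x' y"
proof -
  have "pure x y \<oplus>\<^bsub>T\<^esub> pure x' y = cls (frag_of (x, y) + frag_of (x', y))"
    unfolding pure_def by (intro T_add of_closed assms)
  moreover have "cls (frag_of (x \<oplus>\<^bsub>M\<^esub> x', y)) = cls (frag_of (x, y) + frag_of (x', y))"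
    using K_rel_left[OF assms] assms
    by (intro cls_eqI of_closed add_closed M.M.a_closed) (simp_all add: algebra_simps)
  ultimately show ?thesis by (simp add: pure_def)
qed

lemma pure_add_right:
  assumes "x \<in> carrier M" "y \<in> carrier L" "y' \<in> carrier L"
  shows "pure x (y \<oplus>\<^bsub>L\<^esub> y') = pure x y \<oplus>\<^bsub>T\<^esub> pure x y'"
proof -
  have "pure x y \<oplus>\<^bsub>T\<^esub> pure x y' = cls (frag_of (x, y) + frag_of (x, y'))"
    unfolding pure_def by (intro T_add of_closed assms)
  moreover have "cls (frag_of (x, y \<oplus>\<^bsub>L\<^esub> y')) = cls (frag_of (x, y) + frag_of (x, y'))"
    using K_rel_right[OF assms] assms
    by (intro cls_eqI of_closed add_closed L.M.a_closed) (simp_all add: algebra_simps)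
  ultimately show ?thesis by (simp add: pure_def)
qed

lemma pure_smult:
  assumes "a \<in> carrier R" "x \<in> carrier M" "y \<in> carrier L"
  shows "pure (a \<odot>\<^bsub>M\<^esub> x) y = pure x (a \<odot>\<^bsub>L\<^esub> y)"
  unfolding pure_def using K_rel_smult[OF assms] assms by (intro cls_eqI of_closed) auto

lemma pure_zero_left: "y \<in> carrier L \<Longrightarrow> pure \<zero>\<^bsub>M\<^esub> y = \<zero>\<^bsub>T\<^esub>"
proof -
  assume y: "y \<in> carrier L"
  interpret T: abelian_group T by (rule T_abelian_group)
  have "pure \<zero>\<^bsub>M\<^esub> y \<oplus>\<^bsub>T\<^esub> pure \<zero>\<^bsub>M\<^esub> y = pure \<zero>\<^bsub>M\<^esub> y"
    using pure_add_left[of "\<zero>\<^bsub>M\<^esub>" "\<zero>\<^bsub>M\<^esub>" y] y by simp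
  then show ?thesis using pure_closed[of "\<zero>\<^bsub>M\<^esub>" y] y T.add.l_cancel_one by simp
qed

lemma pure_zero_right: "x \<in> carrier M \<Longrightarrow> pure x \<zero>\<^bsub>L\<^esub> = \<zero>\<^bsub>T\<^esub>"
proof -
  assume x: "x \<in> carrier M"
  interpret T: abelian_group T by (rule T_abelian_group)
  have "pure x \<zero>\<^bsub>L\<^esub> \<oplus>\<^bsub>T\<^esub> pure x \<zero>\<^bsub>L\<^esub> = pure x \<zero>\<^bsub>L\<^esub>"
    using pure_add_right[of x "\<zero>\<^bsub>L\<^esub>" "\<zero>\<^bsub>L\<^esub>"] x by simp
  then show ?thesis using pure_closed[of x "\<zero>\<^bsub>L\<^esub>"] x T.add.l_cancel_one by simp
qed

text \<open>This is how elements of \<open>\<mm> F\<close> vanish in \<open>F \<otimes> k\<close>.\<close>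

lemma pure_lincomb_zero:
  assumes g: "\<And>l. l < s \<Longrightarrow> g l \<in> carrier M" and c: "\<And>l. l < s \<Longrightarrow> c l \<in> carrier R"
    and y: "y \<in> carrier L" and z: "\<And>l. l < s \<Longrightarrow> c l \<odot>\<^bsub>L\<^esub> y = \<zero>\<^bsub>L\<^esub>"
  shows "pure (lincomb M g s c) y = \<zero>\<^bsub>T\<^esub>"
  using g c z
proof (induction s)
  case 0
  then show ?case using pure_zero_left y by simp
next
  case (Suc s)
  interpret T: abelian_group T by (rule T_abelian_group)
  have "pure (c s \<odot>\<^bsub>M\<^esub> g s) y = \<zero>\<^bsub>T\<^esub>"
    using Suc.prems y by (subst pure_smult) (auto simp: pure_zero_right)
  then show ?case using Suc y by (simp add: pure_add_left M.lincomb_closed)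
qed

end

text \<open>The relations of the tensor product are mapped to relations, so that \<open>tensor_map\<close> is
given by the image of any representative.\<close>

lemma tensor_rel_map:
  assumes "tensor R M L" "tensor R M' L" and h: "h \<in> module_homs R M M'" and c: "c \<in> tensor_rel R M L"
  shows "frag_extend (\<lambda>(x, y). frag_of (h x, y)) c \<in> tensor_rel R M' L"
proof -
  interpret A: tensor R M L by fact
  interpret B: tensor R M' L by fact
  note H = module_homsD[OF h]
  let ?e = "frag_extend (\<lambda>(x, y). frag_of (h x, y))"
  have base: "?e c \<in> B.K" if "c \<in> {frag_of (x \<oplus>\<^bsub>M\<^esub> x', y) - frag_of (x, y) - frag_of (x', y) | x x' y.
         x \<in> carrier M \<and> x' \<in> carrier M \<and> y \<in> carrier L}
    \<union> {frag_of (x, y \<oplus>\<^bsub>L\<^esub> y') - frag_of (x, y) - frag_of (x, y') | x y y'.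
         x \<in> carrier M \<and> y \<in> carrier L \<and> y' \<in> carrier L}
    \<union> {frag_of (a \<odot>\<^bsub>M\<^esub> x, y) - frag_of (x, a \<odot>\<^bsub>L\<^esub> y) | a x y.
         a \<in> carrier R \<and> x \<in> carrier M \<and> y \<in> carrier L}" (is "_ \<in> ?S") for c
    using that
  proof (elim UnE)
    assume "c \<in> {frag_of (x \<oplus>\<^bsub>M\<^esub> x', y) - frag_of (x, y) - frag_of (x', y) | x x' y.
         x \<in> carrier M \<and> x' \<in> carrier M \<and> y \<in> carrier L}"
    then obtain x x' y where c: "c = frag_of (x \<oplus>\<^bsub>M\<^esub> x', y) - frag_of (x, y) - frag_of (x', y)"
      "x \<in> carrier M" "x' \<in> carrier M" "y \<in> carrier L" by blast
    show ?thesis unfolding c(1) using B.K_rel_left[OF H(1)[OF c(2)] H(1)[OF c(3)] c(4)] H(2)[OF c(2,3)]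
      by (simp add: frag_extend_diff)
  next
    assume "c \<in> {frag_of (x, y \<oplus>\<^bsub>L\<^esub> y') - frag_of (x, y) - frag_of (x, y') | x y y'.
         x \<in> carrier M \<and> y \<in> carrier L \<and> y' \<in> carrier L}"
    then obtain x y y' where c: "c = frag_of (x, y \<oplus>\<^bsub>L\<^esub> y') - frag_of (x, y) - frag_of (x, y')"
      "x \<in> carrier M" "y \<in> carrier L" "y' \<in> carrier L" by blast
    show ?thesis unfolding c(1) using B.K_rel_right[OF H(1)[OF c(2)] c(3,4)] by (simp add: frag_extend_diff)
  next
    assume "c \<in> {frag_of (a \<odot>\<^bsub>M\<^esub> x, y) - frag_of (x, a \<odot>\<^bsub>L\<^esub> y) | a x y.
         a \<in> carrier R \<and> x \<in> carrier M \<and> y \<in> carrier L}"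
    then obtain a x y where c: "c = frag_of (a \<odot>\<^bsub>M\<^esub> x, y) - frag_of (x, a \<odot>\<^bsub>L\<^esub> y)"
      "a \<in> carrier R" "x \<in> carrier M" "y \<in> carrier L" by blast
    show ?thesis unfolding c(1) using B.K_rel_smult[OF c(2) H(1)[OF c(3)] c(4)] H(3)[OF c(2,3)]
      by (simp add: frag_extend_diff)
  qed
  have S: "c \<in> carrier A.Fr" if "c \<in> ?S" for c
    using that A.K_carrier generate.incl[of c ?S A.Fr] unfolding tensor_rel_def by blast
  show ?thesis using c unfolding tensor_rel_def[of R M L]
  proof induction
    case one
    then show ?case using B.K_zero by simp
  next
    case (incl c)
    then show ?case by (rule base)
  next
    case (inv c)
    then have "inv\<^bsub>A.Fr\<^esub> c = - c" using S[OF inv] by simp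
    then show ?case using base[OF inv] B.K_minus by (simp add: frag_extend_minus)
  next
    case (eng c c')
    then show ?case using B.K_add by (simp add: frag_extend_add)
  qed
qed

lemma tensor_map_cls:
  assumes A: "tensor R M L" and B: "tensor R M' L" and h: "h \<in> module_homs R M M'"
    and c: "c \<in> carrier (free_Abelian_group (carrier M \<times> carrier L))"
  shows "tensor_map R M' L h (tensor_class R M L c) =
      tensor_class R M' L (frag_extend (\<lambda>(x, y). frag_of (h x, y)) c)"
    and "frag_extend (\<lambda>(x, y). frag_of (h x, y)) c \<in> carrier (free_Abelian_group (carrier M' \<times> carrier L))"
proof -
  interpret A: tensor R M L by fact
  interpret B: tensor R M' L by fact
  note H = module_homsD[OF h]
  let ?e = "frag_extend (\<lambda>(x, y). frag_of (h x, y))"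
  have closed: "?e c \<in> carrier B.Fr" if "c \<in> carrier A.Fr" for c
  proof -
    have "(\<Union>x\<in>Poly_Mapping.keys c. Poly_Mapping.keys ((\<lambda>(x, y). frag_of (h x, y)) x)) \<subseteq> carrier M' \<times> carrier L"
    proof (rule UN_least)
      fix p assume "p \<in> Poly_Mapping.keys c"
      then have "p \<in> carrier M \<times> carrier L" using that by auto
      then show "Poly_Mapping.keys ((\<lambda>(x, y). frag_of (h x, y)) p) \<subseteq> carrier M' \<times> carrier L"
        using H(1) by (auto simp: case_prod_beta)
    qed
    then show ?thesis using keys_frag_extend[of "\<lambda>(x, y). frag_of (h x, y)" c] by simp
  qed
  show "?e c \<in> carrier B.Fr" using closed c by blast
  have "tensor_class R M' L (?e u) = tensor_class R M' L (?e c)" if u: "u \<in> A.cls c" for u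
  proof -
    have d: "u - c \<in> A.K" using A.cls_memD[OF u] .
    then have "u - c + c \<in> carrier A.Fr" using A.K_carrier c A.add_closed by blast
    then have uF: "u \<in> carrier A.Fr" by simp
    have "?e u - ?e c \<in> B.K" using tensor_rel_map[OF A B h d] by (simp add: frag_extend_diff)
    then show ?thesis using closed uF c by (intro B.cls_eqI) auto
  qed
  moreover have "c \<in> A.cls c" using A.cls_mem c by blast
  ultimately show "tensor_map R M' L h (A.cls c) = B.cls (?e c)"
    unfolding tensor_map_def by blast
qed

lemma tensor_map_props:
  assumes A: "tensor R M L" and B: "tensor R M' L" and h: "h \<in> module_homs R M M'"
  shows "X \<in> carrier (tensor_product R M L) \<Longrightarrow> tensor_map R M' L h X \<in> carrier (tensor_product R M' L)"
    and "\<lbrakk>X \<in> carrier (tensor_product R M L); Y \<in> carrier (tensor_product R M L)\<rbrakk> \<Longrightarrow>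
      tensor_map R M' L h (X \<oplus>\<^bsub>tensor_product R M L\<^esub> Y) =
      tensor_map R M' L h X \<oplus>\<^bsub>tensor_product R M' L\<^esub> tensor_map R M' L h Y"
    and "tensor_map R M' L h \<zero>\<^bsub>tensor_product R M L\<^esub> = \<zero>\<^bsub>tensor_product R M' L\<^esub>"
    and "\<lbrakk>x \<in> carrier M; y \<in> carrier L\<rbrakk> \<Longrightarrow>
      tensor_map R M' L h (tensor.pure R M L x y) = tensor.pure R M' L (h x) y"
proof -
  interpret A: tensor R M L by fact
  interpret B: tensor R M' L by fact
  note cls = tensor_map_cls[OF A B h]
  show "tensor_map R M' L h X \<in> carrier B.T" if X: "X \<in> carrier A.T"
  proof -
    obtain c where "c \<in> carrier A.Fr" "X = A.cls c" using X unfolding A.T_carrier by blast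
    then show ?thesis unfolding B.T_carrier using cls by simp
  qed
  show "tensor_map R M' L h (X \<oplus>\<^bsub>A.T\<^esub> Y) = tensor_map R M' L h X \<oplus>\<^bsub>B.T\<^esub> tensor_map R M' L h Y"
    if X: "X \<in> carrier A.T" and Y: "Y \<in> carrier A.T"
  proof -
    obtain c where c: "c \<in> carrier A.Fr" "X = A.cls c" using X unfolding A.T_carrier by blast
    obtain c' where c': "c' \<in> carrier A.Fr" "Y = A.cls c'" using Y unfolding A.T_carrier by blast
    have "X \<oplus>\<^bsub>A.T\<^esub> Y = A.cls (c + c')" unfolding c(2) c'(2) by (rule A.T_add[OF c(1) c'(1)])
    then show ?thesis
      using cls(1)[OF c(1)] cls(1)[OF c'(1)] cls(1)[OF A.add_closed[OF c(1) c'(1)]]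
        B.T_add[OF cls(2)[OF c(1)] cls(2)[OF c'(1)]]
      by (simp only: c(2) c'(2) frag_extend_add)
  qed
  show "tensor_map R M' L h \<zero>\<^bsub>A.T\<^esub> = \<zero>\<^bsub>B.T\<^esub>"
    unfolding A.T_zero B.T_zero using cls(1)[of 0] by simp
  show "tensor_map R M' L h (A.pure x y) = B.pure (h x) y" if "x \<in> carrier M" "y \<in> carrier L"
    unfolding A.pure_def B.pure_def using cls(1)[OF A.of_closed[OF that]] by simp
qed

section \<open>Regularity over a graded ring\<close>

text \<open>Here the degree zero part represents the residue field, so that elements of \<open>F \<otimes> k\<close> of
degree \<open>j\<close> are of the form \<open>x \<otimes> 1\<close> with \<open>x\<close> of degree \<open>j\<close>.\<close>

locale graded_short_ring = short_ring \<mm> R gcomp for \<mm> and R (structure) and gcomp +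
  assumes gcomp_one: "gcomp 0 \<one> = \<one>"
    and gcomp_residue: "a \<in> carrier R \<Longrightarrow> a \<ominus> gcomp 0 a \<in> \<mm>"
    and irrelevant: "irrelevant_ideal R (\<lambda>j. {a \<in> carrier R. gcomp j a = a}) = \<mm>"
begin

abbreviation "\<A> \<equiv> \<lambda>j. {a \<in> carrier R. gcomp j a = a}"

sublocale pc: piece_cring R \<A>
proof
  show "a \<otimes> b \<in> \<A> (i + j)" if "a \<in> \<A> i" "b \<in> \<A> j" for a b i j
    using that gcomp_mult[of a b j "i + j"] by simp
qed (auto simp: gcomp_zero gcomp_add gcomp_one)

lemma trivial_pieces: "piece_cring R (\<lambda>_. carrier R)"
  by unfold_locales auto

lemma positive_piece: "a \<in> \<A> j \<Longrightarrow> j > 0 \<Longrightarrow> a \<in> \<mm>"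
proof -
  assume a: "a \<in> \<A> j" "j > 0"
  have "(\<Union>i\<in>{0<..}. \<A> i) \<subseteq> Idl (\<Union>i\<in>{0<..}. \<A> i)" by (rule genideal_self) blast
  then have "a \<in> irrelevant_ideal R \<A>" unfolding irrelevant_ideal_def using a by blast
  then show ?thesis unfolding irrelevant .
qed

lemma free_piece_vcomp:
  "v \<in> free_piece R \<A> b s j \<longleftrightarrow> v \<in> carrier (free_module R b) \<and> vcomp gcomp b s j v = v"
proof -
  have "(\<forall>l<b. gcomp (j - s l) (v l) = v l) \<longleftrightarrow> vcomp gcomp b s j v = v" if "v \<in> carrier (free_module R b)"
  proof
    assume "\<forall>l<b. gcomp (j - s l) (v l) = v l"
    then show "vcomp gcomp b s j v = v"
      using that PiE_arb[of v "{..<b}" "\<lambda>_. carrier R"] by (auto simp: vcomp_def fun_eq_iff free_module_simps)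
  next
    assume eq: "vcomp gcomp b s j v = v"
    show "\<forall>l<b. gcomp (j - s l) (v l) = v l"
    proof (intro allI impI)
      fix l assume "l < b"
      then show "gcomp (j - s l) (v l) = v l" using fun_cong[OF eq, of l] by (simp add: vcomp_def)
    qed
  qed
  moreover have "v l \<in> carrier R" if "v \<in> carrier (free_module R b)" "l < b" for l
    using that PiE_mem[of v "{..<b}" "\<lambda>_. carrier R" l] by (simp add: free_module_simps)
  ultimately show ?thesis unfolding free_piece_def by auto
qed

text \<open>Let \<open>F\<close> be the graded resolution that defines Tor and \<open>G\<close> the one obtained from the good
sequence, whose generators in homological degree \<open>i\<close> have degrees at most \<open>i + 1\<close>. Take a
comparison map \<open>\<psi>\<close> from \<open>F\<close> to \<open>G\<close> that preserves degrees and any comparison map \<open>\<phi>\<close> back. If \<open>x \<in> F\<^sub>i\<close> has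
degree \<open>j > i + 1\<close>, then the coordinates of \<open>\<psi> x\<close> have positive degree, so \<open>\<phi> (\<psi> x) \<in> \<mm> F\<^sub>i\<close> vanishes
in \<open>F\<^sub>i \<otimes> k\<close>. A homotopy between \<open>\<phi> \<circ> \<psi>\<close> and the identity then exhibits a cycle \<open>x \<otimes> 1\<close> as a
boundary.\<close>

theorem graded_reg_le_one:
  fixes N :: "('a, 'c, 's) module_scheme"
  assumes N: "graded_module R gcomp N ncomp" and good: "good_seq R \<mm> N g s0"
    and homog: "\<And>l. l < s0 \<Longrightarrow> ncomp (t0 l) (g l) = g l" and deg: "\<And>l. l < s0 \<Longrightarrow> t0 l \<le> 1"
    and span: "lspan R N g s0 = carrier N"
  shows "graded_reg R \<A> N (\<lambda>j. {x \<in> carrier N. ncomp j x = x}) \<le> 1"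
proof -
  interpret N: graded_module R gcomp N ncomp by fact
  define \<N> where "\<N> = (\<lambda>j. {x \<in> carrier N. ncomp j x = x})"
  note Fm = free_module_module
  have gN: "g l \<in> carrier N" if "l < s0" for l using good that by (auto simp: good_seq_def)
  obtain b' t w where b0: "b' 0 = s0" "t 0 = t0"
    and gw: "\<And>n. good_seq R \<mm> (free_module R (b' n)) (w n) (b' (Suc n))"
    and hw: "\<And>n l. l < b' (Suc n) \<Longrightarrow> vcomp gcomp (b' n) (t n) (t (Suc n) l) (w n l) = w n l"
    and sp0: "lspan R (free_module R (b' 0)) (w 0) (b' 1) = syzygies R N g s0"
    and sp: "\<And>n. lspan R (free_module R (b' (Suc n))) (w (Suc n)) (b' (Suc (Suc n))) =
      syzygies R (free_module R (b' n)) (w n) (b' (Suc n))"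
    and tdeg: "\<And>n l. l < b' (Suc n) \<Longrightarrow> \<exists>i<b' n. t (Suc n) l = t n i + 1"
    using good_resolution[of N ncomp g s0 t0, OF N good homog] by metis
  \<comment> \<open>The primed resolution is the one from the good sequence.\<close>
  define d' where "d' = (\<lambda>n. lincomb (free_module R (b' n)) (w n) (b' (Suc n)))"
  define \<epsilon>' where "\<epsilon>' = lincomb N g (b' 0)"
  let ?G = "\<lambda>n. free_module R (b' n)"
  have wF: "w n l \<in> carrier (?G n)" if "l < b' (Suc n)" for n l
    using gw[of n] that by (auto simp: good_seq_def)
  have resG: "free_resolution R N b' d' \<epsilon>'"
    unfolding d'_def \<epsilon>'_def using resolution_of_syzygies[of N b' g w, OF N.module_axioms] gN wF span sp0 sp b0 by simp
  have tbound: "t n l \<le> int n + 1" if "l < b' n" for n l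
    using that
  proof (induction n arbitrary: l)
    case 0
    then show ?case using deg b0 by simp
  next
    case (Suc n)
    then obtain i where "i < b' n" "t (Suc n) l = t n i + 1" using tdeg by blast
    then show ?case using Suc.IH[of i] by simp
  qed
  have d': "d' n \<in> module_homs R (?G (Suc n)) (?G n)" for n
    using resG by (simp add: free_resolution_def chain_complex_def)
  have e': "\<epsilon>' \<in> module_homs R (?G 0) N" using resG by (simp add: free_resolution_def)
  have coordR: "c l \<in> carrier R" if "c \<in> carrier (free_module R p)" "l < p" for c p l
    using that PiE_mem[of c "{..<p}" "\<lambda>_. carrier R" l] by (simp add: free_module_simps)
  have d'comp: "vcomp gcomp (b' n) (t n) j (d' n c) = d' n (vcomp gcomp (b' (Suc n)) (t (Suc n)) j c)"
    if c: "c \<in> carrier (?G (Suc n))" for n j c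
  proof -
    interpret F: graded_module R gcomp "?G n" "vcomp gcomp (b' n) (t n)" by (rule free_module_graded)
    have "vcomp gcomp (b' n) (t n) j (d' n c) = lincomb (?G n) (w n) (b' (Suc n)) (\<lambda>l. gcomp (j - t (Suc n) l) (c l))"
      unfolding d'_def using wF hw coordR[OF c] by (intro F.ncomp_lincomb)
    also have "\<dots> = d' n (vcomp gcomp (b' (Suc n)) (t (Suc n)) j c)"
      unfolding d'_def by (intro lincomb_cong) (auto simp: vcomp_def)
    finally show ?thesis .
  qed
  have e'comp: "ncomp j (\<epsilon>' c) = \<epsilon>' (vcomp gcomp (b' 0) (t 0) j c)" if c: "c \<in> carrier (?G 0)" for j c
  proof -
    have "ncomp j (\<epsilon>' c) = lincomb N g (b' 0) (\<lambda>l. gcomp (j - t 0 l) (c l))"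
      unfolding \<epsilon>'_def using gN homog coordR[OF c] b0 by (intro N.ncomp_lincomb) auto
    also have "\<dots> = \<epsilon>' (vcomp gcomp (b' 0) (t 0) j c)"
      unfolding \<epsilon>'_def by (intro lincomb_cong) (auto simp: vcomp_def)
    finally show ?thesis .
  qed
  have vpiece: "vcomp gcomp (b' n) (t n) j c \<in> free_piece R \<A> (b' n) (t n) j" if "c \<in> carrier (?G n)" for n j c
  proof -
    interpret F: graded_module R gcomp "?G n" "vcomp gcomp (b' n) (t n)" by (rule free_module_graded)
    show ?thesis unfolding free_piece_vcomp using F.ncomp_closed[OF that] F.ncomp_idem[OF that] by simp
  qed
  have "graded_free_resolution R \<A> N \<N> b' t d' \<epsilon>'"
    unfolding graded_free_resolution_def
  proof (intro conjI allI resG)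
    show "d' n ` free_piece R \<A> (b' (Suc n)) (t (Suc n)) j \<subseteq> free_piece R \<A> (b' n) (t n) j" for n j
      using d'comp module_homsD(1)[OF d'] by (auto simp: free_piece_vcomp)
    show "\<epsilon>' ` free_piece R \<A> (b' 0) (t 0) j \<subseteq> \<N> j" for j
      using e'comp module_homsD(1)[OF e'] by (auto simp: free_piece_vcomp \<N>_def)
  qed
  then have "\<exists>r. case r of (b, s, d) \<Rightarrow> \<exists>\<epsilon>. graded_free_resolution R \<A> N \<N> b s d \<epsilon>"
    by (intro exI[of _ "(b', t, d')"]) auto
  from someI_ex[OF this] obtain b s d \<epsilon> where ch: "chosen_resolution R \<A> N \<N> = (b, s, d)"
    and grF: "graded_free_resolution R \<A> N \<N> b s d \<epsilon>"
    unfolding chosen_resolution_def by (auto split: prod.splits)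
  let ?F = "\<lambda>n. free_module R (b n)"
  have resF: "free_resolution R N b d \<epsilon>" using grF by (simp add: graded_free_resolution_def)
  have d: "d n \<in> module_homs R (?F (Suc n)) (?F n)" for n
    using resF by (simp add: free_resolution_def chain_complex_def)
  have dd: "d n (d (Suc n) x) = \<zero>\<^bsub>?F n\<^esub>" if "x \<in> carrier (?F (Suc (Suc n)))" for n x
    using resF that by (simp add: free_resolution_def chain_complex_def)
  have dd': "d' n (d' (Suc n) x) = \<zero>\<^bsub>?G n\<^esub>" if "x \<in> carrier (?G (Suc (Suc n)))" for n x
    using resG that by (simp add: free_resolution_def chain_complex_def)
  have e: "\<epsilon> \<in> module_homs R (?F 0) N" using resF by (simp add: free_resolution_def)
  have kerF: "{x \<in> carrier (?F 0). \<epsilon> x = \<zero>\<^bsub>N\<^esub>} = d 0 ` carrier (?F 1)"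
    using resF by (simp add: free_resolution_def boundaries_def)
  have kerG: "{x \<in> carrier (?G 0). \<epsilon>' x = \<zero>\<^bsub>N\<^esub>} = d' 0 ` carrier (?G 1)"
    using resG by (simp add: free_resolution_def boundaries_def)
  have surjF: "\<epsilon> ` carrier (?F 0) = carrier N" using resF by (simp add: free_resolution_def)
  have surjG: "\<epsilon>' ` carrier (?G 0) = carrier N" using resG by (simp add: free_resolution_def)
  have ed: "\<epsilon> (d 0 x) = \<zero>\<^bsub>N\<^esub>" if "x \<in> carrier (?F 1)" for x
    using kerF imageI[OF that, of "d 0"] by blast
  have ed': "\<epsilon>' (d' 0 x) = \<zero>\<^bsub>N\<^esub>" if "x \<in> carrier (?G 1)" for x
    using kerG imageI[OF that, of "d' 0"] by blast
  have dp: "d n x \<in> free_piece R \<A> (b n) (s n) j" if "x \<in> free_piece R \<A> (b (Suc n)) (s (Suc n)) j" for n j x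
    by (rule subsetD[OF grF[unfolded graded_free_resolution_def, THEN conjunct2, THEN conjunct1, THEN spec, THEN spec]]) (rule imageI[OF that])
  have ep: "\<epsilon> x \<in> \<N> j" if "x \<in> free_piece R \<A> (b 0) (s 0) j" for j x
    by (rule subsetD[OF grF[unfolded graded_free_resolution_def, THEN conjunct2, THEN conjunct2, THEN spec]]) (rule imageI[OF that])
  have h0: "\<exists>u\<in>free_piece R \<A> (b' 0) (t 0) j. \<epsilon>' u = \<epsilon> x" if x: "x \<in> free_piece R \<A> (b 0) (s 0) j" for j x
  proof -
    have ex: "\<epsilon> x \<in> carrier N" "ncomp j (\<epsilon> x) = \<epsilon> x" using ep[OF x] by (auto simp: \<N>_def)
    then obtain c where c: "c \<in> carrier (?G 0)" "\<epsilon>' c = \<epsilon> x" using surjG by (metis imageE)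
    have "\<epsilon>' (vcomp gcomp (b' 0) (t 0) j c) = \<epsilon> x" using e'comp[OF c(1), of j] c(2) ex by simp
    then show ?thesis using vpiece[OF c(1)] by blast
  qed
  have h1: "\<exists>u\<in>free_piece R \<A> (b' (Suc n)) (t (Suc n)) j. d' n u = y"
    if y: "y \<in> free_piece R \<A> (b' n) (t n) j" and k: "pc.kills b' \<epsilon>' \<zero>\<^bsub>N\<^esub> d' n y" for n j y
  proof -
    have yG: "y \<in> carrier (?G n)" "vcomp gcomp (b' n) (t n) j y = y" using y by (auto simp: free_piece_vcomp)
    have "\<exists>c\<in>carrier (?G (Suc n)). d' n c = y"
    proof (cases n)
      case 0
      then have "y \<in> {x \<in> carrier (?G 0). \<epsilon>' x = \<zero>\<^bsub>N\<^esub>}" using k yG by (simp add: pc.kills_def)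
      then have "y \<in> d' 0 ` carrier (?G 1)" unfolding kerG .
      then show ?thesis using 0 by auto
    next
      case (Suc m)
      then show ?thesis using exact_at[OF resG, of y m] k yG by (simp add: pc.kills_def)
    qed
    then obtain c where c: "c \<in> carrier (?G (Suc n))" "d' n c = y" by blast
    have "d' n (vcomp gcomp (b' (Suc n)) (t (Suc n)) j c) = y" using d'comp[OF c(1), of j] c(2) yG by simp
    then show ?thesis using vpiece[OF c(1)] by blast
  qed
  obtain \<psi> where psi: "\<And>n. \<psi> n \<in> module_homs R (?F n) (?G n)"
    "\<And>n j x. x \<in> free_piece R \<A> (b n) (s n) j \<Longrightarrow> \<psi> n x \<in> free_piece R \<A> (b' n) (t n) j"
    "\<And>x. x \<in> carrier (?F 0) \<Longrightarrow> \<epsilon>' (\<psi> 0 x) = \<epsilon> x"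
    "\<And>n x. x \<in> carrier (?F (Suc n)) \<Longrightarrow> d' n (\<psi> (Suc n) x) = \<psi> n (d n x)"
    by (rule pc.comparison_map[OF N.module_axioms d dd dp e ed d' e' h0 h1]) (assumption+, rule that, blast+)
  interpret tp: piece_cring R "\<lambda>_. carrier R" by (rule trivial_pieces)
  have triv: "x \<in> free_piece R (\<lambda>_. carrier R) c u j \<longleftrightarrow> x \<in> carrier (free_module R c)" for x c u j
    using coordR by (auto simp: free_piece_def)
  \<comment> \<open>The way back is not graded: it comes from the trivial grading on both resolutions.\<close>
  have k0: "\<exists>u\<in>free_piece R (\<lambda>_. carrier R) (b 0) (s 0) j. \<epsilon> u = \<epsilon>' x"
    if "x \<in> free_piece R (\<lambda>_. carrier R) (b' 0) (t 0) j" for j x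
  proof -
    have "\<epsilon>' x \<in> carrier N" using that module_homsD(1)[OF e'] by (simp add: triv)
    then have "\<epsilon>' x \<in> \<epsilon> ` carrier (?F 0)" unfolding surjF .
    then obtain u where "u \<in> carrier (?F 0)" "\<epsilon> u = \<epsilon>' x" by auto
    then show ?thesis by (intro bexI[of _ u]) (simp_all add: triv)
  qed
  have k1: "\<exists>u\<in>free_piece R (\<lambda>_. carrier R) (b (Suc n)) (s (Suc n)) j. d n u = y"
    if y: "y \<in> free_piece R (\<lambda>_. carrier R) (b n) (s n) j" and k: "tp.kills b \<epsilon> \<zero>\<^bsub>N\<^esub> d n y" for n j y
  proof -
    have yF: "y \<in> carrier (?F n)" using y by (simp add: triv)
    have "\<exists>c\<in>carrier (?F (Suc n)). d n c = y"
    proof (cases n)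
      case 0
      then have "y \<in> {x \<in> carrier (?F 0). \<epsilon> x = \<zero>\<^bsub>N\<^esub>}" using k yF by (simp add: tp.kills_def)
      then have "y \<in> d 0 ` carrier (?F 1)" unfolding kerF .
      then show ?thesis using 0 by auto
    next
      case (Suc m)
      then show ?thesis using exact_at[OF resF, of y m] k yF by (simp add: tp.kills_def)
    qed
    then obtain c where "c \<in> carrier (?F (Suc n))" "d n c = y" by blast
    then show ?thesis by (intro bexI[of _ c]) (simp_all add: triv)
  qed
  have dp': "d' n x \<in> free_piece R (\<lambda>_. carrier R) (b' n) (t n) j"
    if "x \<in> free_piece R (\<lambda>_. carrier R) (b' (Suc n)) (t (Suc n)) j" for n j x
    using that module_homsD(1)[OF d'] by (simp add: triv)
  obtain \<phi> where phi: "\<And>n. \<phi> n \<in> module_homs R (?G n) (?F n)"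
    "\<And>x. x \<in> carrier (?G 0) \<Longrightarrow> \<epsilon> (\<phi> 0 x) = \<epsilon>' x"
    "\<And>n x. x \<in> carrier (?G (Suc n)) \<Longrightarrow> d n (\<phi> (Suc n) x) = \<phi> n (d' n x)"
    by (rule tp.comparison_map[OF N.module_axioms d' dd' dp' e' ed' d e k0 k1]) (assumption+, rule that, blast+)
  define \<theta> where "\<theta> = (\<lambda>n x. \<phi> n (\<psi> n x))"
  have th: "\<theta> n \<in> module_homs R (?F n) (?F n)" for n
    unfolding \<theta>_def using psi(1) phi(1) by (rule module_homs_comp)
  have th0: "\<epsilon> (\<theta> 0 x) = \<epsilon> x" if "x \<in> carrier (?F 0)" for x
    unfolding \<theta>_def using phi(2)[OF module_homsD(1)[OF psi(1) that]] psi(3)[OF that] by simp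
  have thd: "d n (\<theta> (Suc n) x) = \<theta> n (d n x)" if "x \<in> carrier (?F (Suc n))" for n x
    unfolding \<theta>_def using phi(3)[OF module_homsD(1)[OF psi(1) that]] psi(4)[OF that] by simp
  obtain h where h: "\<And>n. h n \<in> module_homs R (?F n) (?F (Suc n))"
    "\<And>x. x \<in> carrier (?F 0) \<Longrightarrow> d 0 (h 0 x) = x \<ominus>\<^bsub>?F 0\<^esub> \<theta> 0 x"
    "\<And>n x. x \<in> carrier (?F (Suc n)) \<Longrightarrow> d (Suc n) (h (Suc n) x) =
      x \<ominus>\<^bsub>?F (Suc n)\<^esub> \<theta> (Suc n) x \<ominus>\<^bsub>?F (Suc n)\<^esub> h n (d n x)"
    by (rule null_homotopy[OF N.module_axioms resF th th0 thd]) (assumption+, rule that, blast+)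
  define L where "L = graded_residue_field R \<A>"
  have Lq: "L = module_quot (self_module R) \<mm>" unfolding L_def graded_residue_field_def irrelevant ..
  have msub: "submodule \<mm> R (self_module R)" using is_ideal self_submodule_iff_ideal by blast
  interpret L: module R L unfolding Lq by (rule S.module_quot_module[OF msub])
  define one where "one = \<mm> +>\<^bsub>self_module R\<^esub> \<one>"
  have oneL: "one \<in> carrier L" unfolding Lq S.module_quot_carrier one_def self_simps by blast
  have smult_one: "a \<odot>\<^bsub>L\<^esub> one = \<mm> +>\<^bsub>self_module R\<^esub> a" if "a \<in> carrier R" for a
    using S.module_quot_smult[OF msub, of a \<one>] that by (simp add: Lq one_def self_simps)
  have smult_max: "a \<odot>\<^bsub>L\<^esub> one = \<zero>\<^bsub>L\<^esub>" if "a \<in> \<mm>" for a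
  proof -
    have "a \<odot>\<^bsub>L\<^esub> one = \<mm> +>\<^bsub>self_module R\<^esub> a" using smult_one Icarr[OF that] by blast
    also have "\<dots> = \<mm>" using abelian_subgroup.a_rcos_const[OF S.submodule_abelian_subgroup[OF msub] that] .
    finally show ?thesis by (simp add: Lq module_quot_simps)
  qed
  have Lrep: "\<exists>a\<in>\<A> 0. y = a \<odot>\<^bsub>L\<^esub> one" if y: "y \<in> carrier L" for y
  proof -
    obtain a where a: "a \<in> carrier R" "y = \<mm> +>\<^bsub>self_module R\<^esub> a"
      using y unfolding Lq S.module_quot_carrier self_simps by blast
    have ga: "gcomp 0 a \<in> carrier R" using gcomp_closed[OF a(1)] .
    have "a \<ominus>\<^bsub>self_module R\<^esub> gcomp 0 a \<in> \<mm>"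
      using gcomp_residue[OF a(1)] a ga by (simp add: a_minus_def self_minus self_simps)
    then have "\<mm> +>\<^bsub>self_module R\<^esub> a = \<mm> +>\<^bsub>self_module R\<^esub> gcomp 0 a"
      using a ga by (subst S.coset_eq_iff[OF msub]) (simp_all add: self_simps)
    then have "y = gcomp 0 a \<odot>\<^bsub>L\<^esub> one" using a smult_one[OF ga] by simp
    moreover have "gcomp 0 a \<in> \<A> 0" using ga gcomp_idem[OF a(1)] by simp
    ultimately show ?thesis by blast
  qed
  have tens: "tensor R (?F n) L" for n by (intro tensor.intro Fm L.module_axioms)
  define T where "T = (\<lambda>n. tensor_product R (?F n) L)"
  define \<delta> where "\<delta> = (\<lambda>n. tensor_map R (?F n) L (d n))"
  define pu where "pu = (\<lambda>n x. tensor.pure R (?F n) L x one)"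
  have Tab: "abelian_group (T n)" for n unfolding T_def by (rule tensor.T_abelian_group[OF tens])
  have pu_closed: "pu n x \<in> carrier (T n)" if "x \<in> carrier (?F n)" for n x
    unfolding pu_def T_def using tensor.pure_closed[OF tens that oneL] .
  have pu_add: "pu n (x \<oplus>\<^bsub>?F n\<^esub> y) = pu n x \<oplus>\<^bsub>T n\<^esub> pu n y" if "x \<in> carrier (?F n)" "y \<in> carrier (?F n)" for n x y
    unfolding pu_def T_def using tensor.pure_add_left[OF tens that oneL] .
  have pu_zero: "pu n \<zero>\<^bsub>?F n\<^esub> = \<zero>\<^bsub>T n\<^esub>" for n
    unfolding pu_def T_def using tensor.pure_zero_left[OF tens oneL] .
  have \<delta>_closed: "\<delta> n X \<in> carrier (T n)" if "X \<in> carrier (T (Suc n))" for n X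
    using tensor_map_props(1)[OF tens tens d] that unfolding \<delta>_def T_def .
  have \<delta>_add: "\<delta> n (X \<oplus>\<^bsub>T (Suc n)\<^esub> Y) = \<delta> n X \<oplus>\<^bsub>T n\<^esub> \<delta> n Y"
    if "X \<in> carrier (T (Suc n))" "Y \<in> carrier (T (Suc n))" for n X Y
    using tensor_map_props(2)[OF tens tens d] that unfolding \<delta>_def T_def .
  have \<delta>_pu: "\<delta> n (pu (Suc n) x) = pu n (d n x)" if "x \<in> carrier (?F (Suc n))" for n x
    using tensor_map_props(4)[OF tens tens d that oneL] unfolding \<delta>_def pu_def .
  have \<delta>_zero: "\<delta> n \<zero>\<^bsub>T (Suc n)\<^esub> = \<zero>\<^bsub>T n\<^esub>" for n
    using tensor_map_props(3)[OF tens tens d] unfolding \<delta>_def T_def .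
  have bsub: "additive_subgroup (boundaries T \<delta> n) (T n)" for n
    unfolding boundaries_def using \<delta>_closed \<delta>_add by (intro additive_image_subgroup Tab) auto
  have tensor_piece_pure: "\<exists>x\<in>free_piece R \<A> (b n) (s n) j. z = pu n x"
    if z: "z \<in> tensor_piece R (?F n) (free_piece R \<A> (b n) (s n)) L (residue_field_piece R \<A>) j" for n j z
  proof -
    interpret F: module R "?F n" by (rule Fm)
    interpret TT: tensor R "?F n" L by (rule tens)
    interpret Tn: abelian_group "T n" by (rule Tab)
    define S where "S = pu n ` free_piece R \<A> (b n) (s n) j"
    have pieceF: "x \<in> carrier (?F n)" if "x \<in> free_piece R \<A> (b n) (s n) j" for x j
      using that by (rule pc.free_piece_closed)
    have psub: "\<zero>\<^bsub>?F n\<^esub> \<in> free_piece R \<A> (b n) (s n) j"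
      "\<And>x y. \<lbrakk>x \<in> free_piece R \<A> (b n) (s n) j; y \<in> free_piece R \<A> (b n) (s n) j\<rbrakk> \<Longrightarrow>
        x \<oplus>\<^bsub>?F n\<^esub> y \<in> free_piece R \<A> (b n) (s n) j"
      "\<And>a x p. \<lbrakk>a \<in> \<A> 0; x \<in> free_piece R \<A> (b n) (s n) j\<rbrakk> \<Longrightarrow> a \<odot>\<^bsub>?F n\<^esub> x \<in> free_piece R \<A> (b n) (s n) j" for j
    proof -
      show "\<zero>\<^bsub>?F n\<^esub> \<in> free_piece R \<A> (b n) (s n) j"
        using F.M.zero_closed pc.piece_zero by (simp add: free_piece_def) (simp add: free_module_simps)
      show "x \<oplus>\<^bsub>?F n\<^esub> y \<in> free_piece R \<A> (b n) (s n) j"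
        if "x \<in> free_piece R \<A> (b n) (s n) j" "y \<in> free_piece R \<A> (b n) (s n) j" for x y
        using F.M.a_closed[OF pieceF[OF that(1)] pieceF[OF that(2)]] that pc.piece_add
        by (simp add: free_piece_def) (simp add: free_module_simps)
      show "a \<odot>\<^bsub>?F n\<^esub> x \<in> free_piece R \<A> (b n) (s n) j" if "a \<in> \<A> 0" "x \<in> free_piece R \<A> (b n) (s n) j" for a x
      proof -
        have "a \<otimes> x l \<in> \<A> (j - s n l)" if "l < b n" for l
          using pc.piece_mult[of a 0 "x l" "j - s n l"] \<open>a \<in> \<A> 0\<close> \<open>x \<in> free_piece R \<A> (b n) (s n) j\<close> that
          by (simp add: free_piece_def)
        moreover have "a \<odot>\<^bsub>?F n\<^esub> x \<in> carrier (?F n)" using that pieceF by (intro F.smult_closed) auto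
        ultimately show ?thesis by (simp add: free_piece_def) (simp add: free_module_simps)
      qed
    qed
    have neg: "\<ominus>\<^bsub>?F n\<^esub> x \<in> free_piece R \<A> (b n) (s n) j" if x: "x \<in> free_piece R \<A> (b n) (s n) j" for x
    proof -
      \<comment> \<open>Closure under negation follows from closure under scalars of degree zero.\<close>
      have m1: "\<ominus> \<one> \<in> \<A> 0"
      proof -
        have "gcomp 0 (\<ominus> \<one>) \<oplus> gcomp 0 \<one> = gcomp 0 (\<ominus> \<one> \<oplus> \<one>)" by (rule gcomp_add[symmetric]) simp_all
        also have "\<dots> = \<zero>" by (simp add: l_neg gcomp_zero)
        finally have "gcomp 0 (\<ominus> \<one>) \<oplus> \<one> = \<zero>" by (simp add: gcomp_one)
        then have "\<ominus> \<one> = gcomp 0 (\<ominus> \<one>)" by (rule minus_equality) (simp_all add: gcomp_closed)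
        then show ?thesis by simp
      qed
      have "\<ominus>\<^bsub>?F n\<^esub> x = (\<ominus> \<one>) \<odot>\<^bsub>?F n\<^esub> x" using pieceF[OF x] by (simp add: F.smult_l_minus)
      then show ?thesis using psub(3)[OF m1 x] by simp
    qed
    have inv: "\<ominus>\<^bsub>T n\<^esub> pu n x = pu n (\<ominus>\<^bsub>?F n\<^esub> x)" if "x \<in> carrier (?F n)" for x
    proof -
      have "pu n (\<ominus>\<^bsub>?F n\<^esub> x) \<oplus>\<^bsub>T n\<^esub> pu n x = pu n (\<ominus>\<^bsub>?F n\<^esub> x \<oplus>\<^bsub>?F n\<^esub> x)"
        using that by (intro pu_add[symmetric]) auto
      also have "\<dots> = \<zero>\<^bsub>T n\<^esub>" using that pu_zero by (simp add: F.M.l_neg)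
      finally show ?thesis using that pu_closed by (intro Tn.minus_equality) auto
    qed
    have Ssub: "subgroup S (add_monoid (T n))"
    proof (rule group.subgroupI[OF Tn.a_group])
      show "S \<subseteq> carrier (add_monoid (T n))" using pu_closed pieceF by (auto simp: S_def)
      show "S \<noteq> {}" using psub(1) by (auto simp: S_def)
      show "inv\<^bsub>add_monoid (T n)\<^esub> X \<in> S" if "X \<in> S" for X
        using that inv neg pieceF unfolding S_def a_inv_def[symmetric] by auto
      show "X \<otimes>\<^bsub>add_monoid (T n)\<^esub> Y \<in> S" if "X \<in> S" "Y \<in> S" for X Y
      proof -
        obtain x y where xy: "x \<in> free_piece R \<A> (b n) (s n) j" "X = pu n x"
          "y \<in> free_piece R \<A> (b n) (s n) j" "Y = pu n y" using \<open>X \<in> S\<close> \<open>Y \<in> S\<close> by (auto simp: S_def)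
        have "X \<oplus>\<^bsub>T n\<^esub> Y = pu n (x \<oplus>\<^bsub>?F n\<^esub> y)" unfolding xy(2,4) using pu_add pieceF xy by simp
        then show ?thesis using psub(2)[OF xy(1,3)] by (auto simp: S_def)
      qed
    qed
    have gens: "{tensor_class R (?F n) L (frag_of (x, y)) | x y p q.
        x \<in> free_piece R \<A> (b n) (s n) p \<and> y \<in> residue_field_piece R \<A> q \<and> p + q = j} \<subseteq> S"
    proof clarify
      fix x y p q assume x: "x \<in> free_piece R \<A> (b n) (s n) p" and y: "y \<in> residue_field_piece R \<A> q"
        and j: "j = p + q"
      have xF: "x \<in> carrier (?F n)" using pieceF[OF x] .
      show "tensor_class R (?F n) L (frag_of (x, y)) \<in> S"
      proof (cases "q = 0")
        case True
        then have "y \<in> carrier L" using y by (simp add: residue_field_piece_def L_def)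
        then obtain a where a: "a \<in> \<A> 0" "y = a \<odot>\<^bsub>L\<^esub> one" using Lrep by blast
        have aR: "a \<in> carrier R" using a by simp
        have "tensor_class R (?F n) L (frag_of (x, y)) = pu n (a \<odot>\<^bsub>?F n\<^esub> x)"
          using TT.pure_smult[OF aR xF oneL] by (simp add: pu_def TT.pure_def a(2))
        moreover have "a \<odot>\<^bsub>?F n\<^esub> x \<in> free_piece R \<A> (b n) (s n) j" using psub(3)[OF a(1) x] True j by simp
        ultimately show ?thesis by (auto simp: S_def)
      next
        case False
        then have "y = \<zero>\<^bsub>L\<^esub>" using y by (simp add: residue_field_piece_def L_def)
        then have "tensor_class R (?F n) L (frag_of (x, y)) = pu n \<zero>\<^bsub>?F n\<^esub>"
          using TT.pure_zero_right[OF xF] pu_zero[of n] by (simp add: TT.pure_def T_def)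
        then show ?thesis using psub(1)[of j] by (auto simp: S_def)
      qed
    qed
    have "tensor_piece R (?F n) (free_piece R \<A> (b n) (s n)) L (residue_field_piece R \<A>) j \<subseteq> S"
      unfolding tensor_piece_def
      using group.generate_subgroup_incl[OF Tn.a_group gens Ssub] by (simp add: T_def)
    then show ?thesis using z by (auto simp: S_def)
  qed
  \<comment> \<open>Cycles of degree \<open>j > i + 1\<close> are boundaries.\<close>
  have key: "z \<in> boundaries T \<delta> i"
    if z: "z \<in> cycles T \<delta> i" "z \<in> tensor_piece R (?F i) (free_piece R \<A> (b i) (s i)) L (residue_field_piece R \<A>) j"
      and j: "j > int i + 1" for i j z
  proof -
    interpret Ti: abelian_group "T i" by (rule Tab)
    interpret F: module R "?F i" by (rule Fm)
    interpret B: additive_subgroup "boundaries T \<delta> i" "T i" by (rule bsub)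
    obtain x where x: "x \<in> free_piece R \<A> (b i) (s i) j" "z = pu i x" using tensor_piece_pure[OF z(2)] by blast
    have xF: "x \<in> carrier (?F i)" using pc.free_piece_closed[OF x(1)] .
    have px: "\<psi> i x \<in> free_piece R \<A> (b' i) (t i) j" using psi(2)[OF x(1)] .
    have pxF: "\<psi> i x \<in> carrier (?G i)" using pc.free_piece_closed[OF px] .
    have coord: "\<psi> i x l \<in> \<mm>" if "l < b' i" for l
    proof (rule positive_piece)
      show "\<psi> i x l \<in> \<A> (j - t i l)" using px that by (simp add: free_piece_def)
      show "j - t i l > 0" using tbound[OF that] j by simp
    qed
    have phu: "\<phi> i (unit_vec (b' i) l) \<in> carrier (?F i)" for l using module_homsD(1)[OF phi(1) unit_vec_closed] .
    have "\<theta> i x = \<phi> i (lincomb (?G i) (unit_vec (b' i)) (b' i) (\<psi> i x))"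
      unfolding \<theta>_def using vec_eq_lincomb[OF pxF] by simp
    also have "\<dots> = lincomb (?F i) (\<lambda>l. \<phi> i (unit_vec (b' i) l)) (b' i) (\<psi> i x)"
      using coord Icarr unit_vec_closed by (intro lincomb_hom[OF Fm Fm phi(1)]) auto
    finally have pu_th: "pu i (\<theta> i x) = \<zero>\<^bsub>T i\<^esub>"
      unfolding pu_def T_def using tensor.pure_lincomb_zero[OF tens phu _ oneL] coord Icarr smult_max by simp
    have thF: "\<theta> i x \<in> carrier (?F i)" using module_homsD(1)[OF th xF] .
    have hx: "h i x \<in> carrier (?F (Suc i))" using module_homsD(1)[OF h(1) xF] .
    have dhF: "d i (h i x) \<in> carrier (?F i)" using module_homsD(1)[OF d hx] .
    have dhB: "pu i (d i (h i x)) \<in> boundaries T \<delta> i"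
      unfolding boundaries_def using \<delta>_pu[OF hx] pu_closed[OF hx] by (metis imageI)
    have "pu i (d i (h i x)) = pu i x"
    proof (cases i)
      case 0
      have e: "d i (h i x) = x \<ominus>\<^bsub>?F i\<^esub> \<theta> i x" using h(2)[of x] xF 0 by simp
      have "x = d i (h i x) \<oplus>\<^bsub>?F i\<^esub> \<theta> i x"
        unfolding e using xF thF by (simp add: a_minus_def F.M.a_assoc F.M.l_neg)
      then have "pu i x = pu i (d i (h i x)) \<oplus>\<^bsub>T i\<^esub> pu i (\<theta> i x)" using pu_add[OF dhF thF] by simp
      then show ?thesis using pu_th pu_closed[OF dhF] by simp
    next
      case (Suc k)
      have dx: "d k x \<in> carrier (?F k)" using module_homsD(1)[OF d] xF Suc by simp
      have hdF: "h k (d k x) \<in> carrier (?F i)" using module_homsD(1)[OF h(1) dx] Suc by simp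
      have "\<delta> k z = \<zero>\<^bsub>T k\<^esub>" using z(1) Suc by (simp add: cycles_def)
      then have "pu k (d k x) = \<zero>\<^bsub>T k\<^esub>" using \<delta>_pu[of x k] x(2) xF Suc by simp
      moreover have "tensor_map R (?F (Suc k)) L (h k) (pu k (d k x)) = pu (Suc k) (h k (d k x))"
        unfolding pu_def by (rule tensor_map_props(4)[OF tens tens h(1) dx oneL])
      ultimately have hd0: "pu i (h k (d k x)) = \<zero>\<^bsub>T i\<^esub>"
        using tensor_map_props(3)[OF tens tens h(1), of k] Suc by (simp add: T_def)
      have e: "d i (h i x) = x \<ominus>\<^bsub>?F i\<^esub> \<theta> i x \<ominus>\<^bsub>?F i\<^esub> h k (d k x)" using h(3)[of x k] xF Suc by simp
      have "x = d i (h i x) \<oplus>\<^bsub>?F i\<^esub> h k (d k x) \<oplus>\<^bsub>?F i\<^esub> \<theta> i x"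
        unfolding e using xF thF hdF by (simp add: a_minus_def F.M.a_assoc F.M.l_neg)
      then have "pu i x = pu i (d i (h i x)) \<oplus>\<^bsub>T i\<^esub> pu i (h k (d k x)) \<oplus>\<^bsub>T i\<^esub> pu i (\<theta> i x)"
        using pu_add[OF F.M.a_closed[OF dhF hdF] thF] pu_add[OF dhF hdF] by simp
      then show ?thesis using pu_th hd0 pu_closed[OF dhF] by simp
    qed
    then show ?thesis using dhB x(2) by simp
  qed
  have vanish: "tor_piece R \<A> N \<N> L (residue_field_piece R \<A>) i j = {\<zero>\<^bsub>tor R \<A> N \<N> L i\<^esub>}"
    if j: "j > int i + 1" for i j
  proof -
    interpret Ti: abelian_group "T i" by (rule Tab)
    interpret B: abelian_subgroup "boundaries T \<delta> i" "T i" by (intro abelian_subgroupI3 bsub Tab)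
    let ?Z = "cycles T \<delta> i \<inter> tensor_piece R (?F i) (free_piece R \<A> (b i) (s i)) L (residue_field_piece R \<A>) j"
    have piece: "tor_piece R \<A> N \<N> L (residue_field_piece R \<A>) i j = (\<lambda>z. boundaries T \<delta> i +>\<^bsub>T i\<^esub> z) ` ?Z"
      by (simp add: tor_piece_def ch Let_def T_def \<delta>_def)
    have zero: "\<zero>\<^bsub>tor R \<A> N \<N> L i\<^esub> = boundaries T \<delta> i"
      by (simp add: tor_def ch homology_def module_quot_simps T_def \<delta>_def)
    have "\<zero>\<^bsub>T i\<^esub> \<in> cycles T \<delta> i" using \<delta>_zero Ti.zero_closed by (cases i) (simp_all add: cycles_def)
    moreover have "\<zero>\<^bsub>T i\<^esub> \<in> tensor_piece R (?F i) (free_piece R \<A> (b i) (s i)) L (residue_field_piece R \<A>) j"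
      unfolding tensor_piece_def using generate.one[of "add_monoid (T i)"] by (simp add: T_def)
    ultimately have ne: "\<zero>\<^bsub>T i\<^esub> \<in> ?Z" by blast
    have "boundaries T \<delta> i +>\<^bsub>T i\<^esub> z = boundaries T \<delta> i" if "z \<in> ?Z" for z
      using key[OF _ _ j] that B.a_rcos_const by blast
    then show ?thesis unfolding piece zero using ne by blast
  qed
  show ?thesis unfolding graded_reg_def \<N>_def[symmetric] L_def[symmetric]
  proof (rule Sup_least)
    fix y assume "y \<in> {ereal (of_int (j - int i)) | i j. tor_piece R \<A> N \<N> L (residue_field_piece R \<A>) i j
       \<noteq> {\<zero>\<^bsub>tor R \<A> N \<N> L i\<^esub>}}"
    then obtain i j where y: "y = ereal (of_int (j - int i))"
      "tor_piece R \<A> N \<N> L (residue_field_piece R \<A>) i j \<noteq> {\<zero>\<^bsub>tor R \<A> N \<N> L i\<^esub>}" by blast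
    have "\<not> j > int i + 1" using vanish y(2) by blast
    then have "j - int i \<le> 1" by simp
    then have "(of_int (j - int i) :: real) \<le> 1" by linarith
    then show "y \<le> 1" unfolding y(1) by (simp add: one_ereal_def del: of_int_diff)
  qed
qed

end

section \<open>Regularity of modules over a local ring\<close>

context gr_short
begin

interpretation sr: short_ring \<mm> R "\<lambda>_ a. a"
  by (rule short_ring_if_ann[OF ann])

interpretation A: cring A by (rule G.gr_ring_cring)

lemma gr_comp_E: "r \<in> P k \<Longrightarrow> gr_comp P (int k) (E k r) = E k r"
  unfolding E_def G.S.A.gr_comp_cls by (intro arg_cong[of _ _ cls] ext) (simp add: sr.self_simps)

lemma gr_residue:
  assumes "f \<in> carrier A"
  shows "f \<ominus>\<^bsub>A\<^esub> gr_comp P 0 f \<in> gr_max"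
proof -
  obtain x where x: "\<And>i. x i \<in> P i" "f = cls x" using A_rep[OF assms] by blast
  define u where "u = (\<lambda>i. if i = 0 then \<zero> else x i)"
  define v where "v = (\<lambda>i. if i = 0 then x i else \<zero>)"
  have uP: "u i \<in> P i" and vP: "v i \<in> P i" for i using x(1)[of i] G.P_zero G.P_carrier[OF x(1)[of 0]] by (simp_all add: u_def v_def)
  have uv: "u i \<oplus> v i = x i" for i using G.P_carrier[OF x(1)[of i]] G.P_carrier[OF x(1)[of 0]] by (simp add: u_def v_def)
  have "gr_comp P 0 f = cls v"
    unfolding x(2) G.S.A.gr_comp_cls v_def by (intro arg_cong[of _ _ cls] ext) (simp add: sr.self_simps)
  moreover have "f = cls u \<oplus>\<^bsub>A\<^esub> cls v" unfolding x(2) using cls_add[OF uP vP] uv by simp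
  moreover have "cls u \<in> carrier A" "cls v \<in> carrier A" using cls_closed uP vP by blast+
  ultimately have "f \<ominus>\<^bsub>A\<^esub> gr_comp P 0 f = cls u" by (simp add: a_minus_def A.a_assoc A.r_neg)
  then show ?thesis using gr_max_cls[OF uP] zero_closed by (simp add: u_def)
qed

text \<open>As \<open>\<mm>\<^sup>3 = 0\<close>, an element of positive degree is the sum of its components in degrees one and
two.\<close>

lemma gr_irrelevant: "irrelevant_ideal A (\<lambda>j. {f \<in> carrier A. gr_comp P j f = f}) = gr_max"
proof -
  let ?X = "\<Union>j\<in>{0<..}. {f \<in> carrier A. gr_comp P j f = f}"
  have XA: "?X \<subseteq> carrier A" by blast
  interpret J: ideal "genideal A ?X" A by (rule A.genideal_ideal[OF XA])
  have "?X \<subseteq> gr_max"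
  proof clarify
    fix j :: int and f assume j: "j > 0" and f: "f \<in> carrier A" "gr_comp P j f = f"
    obtain x where x: "\<And>i. x i \<in> P i" "f = cls x" using A_rep[OF f(1)] by blast
    have zero: "\<zero>\<^bsub>self_module R\<^esub> = \<zero>" by (simp add: self_module_def)
    have eq: "f = cls (\<lambda>i. if int i = j then x i else \<zero>)"
      using f(2) G.S.A.gr_comp_cls[of j x] unfolding x(2) zero by simp
    have filt: "(if int i = j then x i else \<zero>) \<in> P i" for i using x(1) G.P_zero by simp
    show "f \<in> gr_max" unfolding eq using j by (subst gr_max_cls[OF filt]) simp
  qed
  then have "genideal A ?X \<subseteq> gr_max" by (rule A.genideal_minimal[OF gr_max_ideal])
  moreover have "gr_max \<subseteq> genideal A ?X"
  proof
    fix f assume "f \<in> gr_max"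
    then obtain x where x: "\<And>i. x i \<in> P i" "x 0 \<in> \<mm>" "f = cls x" using gr_max_rep by blast
    have E: "E (Suc k) (x (Suc k)) \<in> genideal A ?X" for k
    proof -
      have "E (Suc k) (x (Suc k)) \<in> ?X"
        using E_closed[OF x(1), of "Suc k"] gr_comp_E[OF x(1), of "Suc k"]
        by (intro UN_I[of "int (Suc k)"]) simp_all
      then show ?thesis using A.genideal_self[OF XA] by blast
    qed
    have s: "(if i = k then x k else \<zero>) \<in> P i" for i k using single_filt[OF x(1)] .
    have R: "x i \<in> carrier R" for i using G.P_carrier[OF x(1)] .
    have "E (Suc 0) (x (Suc 0)) \<oplus>\<^bsub>A\<^esub> E (Suc (Suc 0)) (x (Suc (Suc 0))) =
        cls (\<lambda>i. (if i = Suc 0 then x (Suc 0) else \<zero>) \<oplus> (if i = Suc (Suc 0) then x (Suc (Suc 0)) else \<zero>))"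
      unfolding E_def by (rule cls_add[OF s s])
    also have "\<dots> = f" unfolding x(3)
    proof (rule cls_cong[OF _ x(1)])
      show "(if i = Suc 0 then x (Suc 0) else \<zero>) \<oplus> (if i = Suc (Suc 0) then x (Suc (Suc 0)) else \<zero>) \<in> P i" for i
        using x(1)[of i] R[of i] G.P_zero by auto
      have "\<ominus> x 0 \<in> \<mm>" using x(2) by (rule a_inv_closed)
      then show "(if 0 = Suc 0 then x (Suc 0) else \<zero>) \<oplus> (if 0 = Suc (Suc 0) then x (Suc (Suc 0)) else \<zero>) \<ominus> x 0 \<in> \<mm>"
        using R[of 0] by (simp add: a_minus_def)
      have "\<zero> \<in> \<mm> \<cdot> \<mm>" using G.P_zero[of "Suc (Suc 0)"] P_simps by simp
      then show "(if Suc 0 = Suc 0 then x (Suc 0) else \<zero>) \<oplus> (if Suc 0 = Suc (Suc 0) then x (Suc (Suc 0)) else \<zero>)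
          \<ominus> x (Suc 0) \<in> \<mm> \<cdot> \<mm>"
        using R[of "Suc 0"] by (simp add: a_minus_def r_neg)
      show "(if Suc (Suc 0) = Suc 0 then x (Suc 0) else \<zero>) \<oplus>
          (if Suc (Suc 0) = Suc (Suc 0) then x (Suc (Suc 0)) else \<zero>) = x (Suc (Suc 0))"
        using R[of "Suc (Suc 0)"] by simp
    qed
    finally have f: "E (Suc 0) (x (Suc 0)) \<oplus>\<^bsub>A\<^esub> E (Suc (Suc 0)) (x (Suc (Suc 0))) = f" .
    show "f \<in> genideal A ?X" unfolding f[symmetric] by (rule J.a_closed[OF E E])
  qed
  ultimately show ?thesis unfolding irrelevant_ideal_def by blast
qed

lemma gr_graded_short_ring: "graded_short_ring gr_max A (gr_comp P)"
proof (intro graded_short_ring.intro graded_short_ring_axioms.intro gr_short_ring gr_residue gr_irrelevant)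
  show "gr_comp P 0 \<one>\<^bsub>A\<^esub> = \<one>\<^bsub>A\<^esub>"
    unfolding G.gr_ring_one G.S.A.gr_comp_cls by (intro arg_cong[of _ _ cls] ext) (simp add: sr.self_simps)
qed

theorem reg_le_one:
  assumes M: "fg_module R M"
  shows "reg R \<mm> M \<le> 1"
proof -
  define \<Phi> where "\<Phi> = (\<lambda>i. ideal_smult M (P i) (carrier M))"
  have mod: "module R M" using M by (simp add: fg_module_def)
  obtain X where X: "finite X" "X \<subseteq> carrier M" "\<And>H. \<lbrakk>submodule H R M; X \<subseteq> H\<rbrakk> \<Longrightarrow> H = carrier M"
    using M unfolding fg_module_def by blast
  define U where "U = (\<lambda>g. gr_class M \<Phi> (\<lambda>i. if i = 0 then g else \<zero>\<^bsub>M\<^esub>)) ` X"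
  note gen = gr_module_degree_zero_generated[OF mod X(2,3), folded \<Phi>_def, folded U_def]
  have pair: "filtered_pair R P M \<Phi>" unfolding \<Phi>_def by (rule G.module_filtered_pair[OF mod])
  interpret N: filtered_pair R P M \<Phi> by (rule pair)
  interpret B: graded_short_ring gr_max A "gr_comp P" by (rule gr_graded_short_ring)
  have gr: "gr_module R \<mm> M = N.N.Gr" by (simp add: gr_module_def \<Phi>_def)
  have NA: "graded_module A (gr_comp P) (gr_module R \<mm> M) (gr_comp \<Phi>)"
    unfolding gr by (rule G.gr_graded_module[OF pair])
  obtain g s t where good: "good_seq A gr_max (gr_module R \<mm> M) g s"
    and hom: "\<And>l. l < s \<Longrightarrow> gr_comp \<Phi> (t l) (g l) = g l"
    and span: "lspan A (gr_module R \<mm> M) g s = carrier (gr_module R \<mm> M)"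
    and deg: "\<And>l. l < s \<Longrightarrow> t l \<le> 1"
    using B.degree_zero_generated_good[OF NA _ gen(1,2,3)] X(1) by (auto simp: U_def)
  have pieceA: "gr_piece A = (\<lambda>j. {f \<in> carrier A. gr_comp P j f = f})"
  proof (rule ext, rule Set.set_eqI)
    show "f \<in> gr_piece A j \<longleftrightarrow> f \<in> {f \<in> carrier A. gr_comp P j f = f}" for j f
      using G.S.A.gr_piece_iff[of f j] by (simp add: gr_piece_def G.gr_ring_simps)
  qed
  have pieceN: "gr_piece (gr_module R \<mm> M) = (\<lambda>j. {x \<in> carrier (gr_module R \<mm> M). gr_comp \<Phi> j x = x})"
    unfolding gr by (rule ext, rule Set.set_eqI) (simp add: N.N.gr_piece_iff)
  show ?thesis unfolding reg_def pieceA pieceN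
    by (rule B.graded_reg_le_one[OF NA good hom deg span])
qed

end

theorem theorem2p15:
  fixes R :: "('a, 'r) ring_scheme" and \<mm> :: "'a set" and M :: "('a, 'b, 's) module_scheme"
  assumes "noetherian_local_ring \<mm> R"
    and "fg_module R M"
    and "\<forall>x \<in> \<mm> - ideal_pow R \<mm> 2. ideal_prod R (annihilator R x) \<mm> = ideal_pow R \<mm> 2"
  shows "((\<exists>x \<in> \<mm> - ideal_pow R \<mm> 2.
              ideal_smult M (annihilator R x) (carrier M) = {\<zero>\<^bsub>M\<^esub>}) \<longrightarrow> koszul_module R \<mm> M)
       \<and> koszul_ring R
       \<and> (\<forall>xs. set xs \<subseteq> \<mm> - ideal_pow R \<mm> 2 \<longrightarrow>
              koszul_module R \<mm> (M\<lparr>carrier := ideal_smult M (genideal R (set xs)) (carrier M)\<rparr>))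
       \<and> reg R \<mm> M \<le> 1
       \<and> (\<forall>I. ideal I R \<and> I \<subseteq> \<mm> \<longrightarrow> koszul_ring (R Quot I))"
proof -
  interpret noetherian_local_ring \<mm> R by (rule assms(1))
  note M = assms(2) and ann = assms(3)
  interpret gr_short \<mm> R by unfold_locales (rule ann)
  show ?thesis
  proof (intro conjI impI allI)
    show "koszul_module R \<mm> M"
      if "\<exists>x\<in>\<mm> - ideal_pow R \<mm> 2. ideal_smult M (annihilator R x) (carrier M) = {\<zero>\<^bsub>M\<^esub>}"
      using that annihilated_koszul[OF ann M] by auto
    show "koszul_ring R" by (rule koszul_ring_if_ann[OF ann])
    show "koszul_module R \<mm> (M\<lparr>carrier := ideal_smult M (genideal R (set xs)) (carrier M)\<rparr>)"
      if "set xs \<subseteq> \<mm> - ideal_pow R \<mm> 2" for xs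
      by (rule linear_ideal_times_module_koszul[OF ann M that])
    show "reg R \<mm> M \<le> 1" by (rule reg_le_one[OF M])
    show "koszul_ring (R Quot I)" if "ideal I R \<and> I \<subseteq> \<mm>" for I
      using quotient_koszul[OF ann] that by simp
  qed
qed

end
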